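(* Let $\left((F,\nu,N),[\,,]_{F,h},(\rho,\eta)\right)$ be a generalized Lie algebroid and let $(E,\pi,M)$ be an interior differential system (IDS) of it, with annihilator subbundle $(E^0,\pi^0,M)$. Then $(E,\pi,M)$ is involutive if and only if the ideal of the exterior algebra $\Lambda(h^*F,h^*\nu,M)$ generated by the $\mathcal F(M)$-submodule $\Gamma(E^0,\pi^0,M)$ is an exterior differential system (EDS) of the same generalized Lie algebroid.
   Context: All manifolds, maps, bundles and sections are smooth; $\mathcal F(N)=C^\infty(N,\mathbb R)$; $\Gamma(F,\nu,N)$ is the $\mathcal F(N)$-module of sections of a vector bundle $(F,\nu,N)$. For a vector bundle morphism $(\varphi,\varphi_0)$ from $(E,\pi,M)$ to $(E',\pi',M')$ with $\varphi_0:M\to M'$ a diffeomorphism, $\Gamma(\varphi,\varphi_0):\Gamma(E,\pi,M)\to\Gamma(E',\pi',M')$ is defined by $(\Gamma(\varphi,\varphi_0)u)(y)=\varphi(u(\varphi_0^{-1}(y)))$. Generalized Lie algebroid: let $h:M\to N$ and $\eta:N\to M$ be diffeomorphisms, $(F,\nu,N)$ a vector bundle, $(\rho,\eta)$ a vector bundle morphism from $(F,\nu,N)$ to $(TM,\tau_M,M)$, and $[\,,]_{F,h}:\Gamma(F,\nu,N)\times\Gamma(F,\nu,N)\to\Gamma(F,\nu,N)$ an operation. Write $a(z)=\Gamma(Th\circ\rho,h\circ\eta)(z)$, a vector field on $N$, for $z\in\Gamma(F,\nu,N)$. The triple $((F,\nu,N),[\,,]_{F,h},(\rho,\eta))$ is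 a generalized Lie algebroid if: (1) $[u,fv]_{F,h}=f[u,v]_{F,h}+(a(u)f)\,v$ for all $u,v\in\Gamma(F,\nu,N)$, $f\in\mathcal F(N)$; (2) $(\Gamma(F,\nu,N),[\,,]_{F,h})$ is a real Lie algebra; (3) $a:\Gamma(F,\nu,N)\to\Gamma(TN,\tau_N,N)$ is a morphism of Lie algebras (for the usual bracket of vector fields). Pull-back Lie algebroid: let $(h^*F,h^*\nu,M)$ be the pull-back of $F$ by $h$. Since $h$ is a diffeomorphism, $z\mapsto z\circ h$ is a bijection $\Gamma(F,\nu,N)\to\Gamma(h^*F,h^*\nu,M)$. The pull-back bundle is a Lie algebroid over $M$ with bracket $[z\circ h,w\circ h]_{h^*F}=[z,w]_{F,h}\circ h$ and anchor $\overset{h^*F}{\rho}$ determined by $\overset{h^*F}{\rho}(z\circ h)=\Gamma(\rho,\eta)(z)$, equivalently the vector field on $M$ that is $h$-related to $a(z)$. (In a local frame $t_\alpha$ of $F$ with $[t_\alpha,t_\beta]_{F,h}=L_{\alpha\beta}^\gamma t_\gamma$, $T_\alpha=t_\alpha\circ h$ and $\Gamma(\rho,\eta)(t_\alpha)=(\rho^i_\alpha\circ h)\partial/\partial x^i$: $[T_\alpha,T_\beta]_{h^*F}=(L^\gamma_{\alpha\beta}\circ h)T_\gamma$, $[T_\alpha,fT_\beta]_{h^*F}=f(L^\gamma_{\alpha\beta}\circ h)T_\gamma+(\rho^i_\alpha\circ h)\frac{\partial f}{\partial x^i}T_\beta$.) $\Lambda^q(h^*F,h^*\nu,M)$ is the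 $\mathcal F(M)$-module of alternating $\mathcal F(M)$-multilinear maps $\Gamma(h^*F,h^*\nu,M)^q\to\mathcal F(M)$ ($\Lambda^0=\mathcal F(M)$), $\Lambda=\bigoplus_q\Lambda^q$ with the usual exterior product (shuffle-sum convention), and $d^{h^*F}$ is the usual Lie algebroid exterior differential, $$d^{h^*F}\omega(Z_0,\dots,Z_q)=\sum_i(-1)^i\overset{h^*F}{\rho}(Z_i)\big(\omega(Z_0,\dots,\hat Z_i,\dots,Z_q)\big)+\sum_{i<j}(-1)^{i+j}\omega\big([Z_i,Z_j]_{h^*F},Z_0,\dots,\hat Z_i,\dots,\hat Z_j,\dots,Z_q\big).$$ An interior differential system (IDS) of the generalized Lie algebroid is a vector subbundle $(E,\pi,M)$ of $(h^*F,h^*\nu,M)$. Its annihilator subbundle $(E^0,\pi^0,M)$ of the dual bundle of $h^*F$ is determined by $\Gamma(E^0,\pi^0,M)=\{\Omega:\Omega(S)=0\ \forall S\in\Gamma(E,\pi,M)\}$. The IDS is involutive if $[S,T]_{h^*F}\in\Gamma(E,\pi,M)$ for all $S,T\in\Gamma(E,\pi,M)$. A differential ideal of the generalized Lie algebroid is an ideal $\mathcal I$ of $\Lambda(h^*F,h^*\nu,M)$ with $d^{h^*F}\mathcal I\subseteq\mathcal I$. A differential ideal $\mathcal I$ is an exterior differential system (EDS) if there exists an IDS $(E',\pi',M)$ such that for every $k\ge1$ and every $\omega\in\mathcal I\cap\Lambda^k(h^*F,h^*\nu,M)$ one has $\omega(u_1,\dots,u_k)=0$ for all $u_1,\dots,u_k\in\Gamma(E',\pi',M)$.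 *)

theory Defs
  imports "HOL-Analysis.Analysis"
begin

section \<open>Smooth functions on subsets of Euclidean space\<close>

text \<open>
  For open \<open>U\<close>, \<open>Ck_on k U f\<close> says that \<open>f\<close> is of class \<open>C^k\<close> on \<open>U\<close>.
\<close>

primrec Ck_on ::
  "nat \<Rightarrow> 'a::euclidean_space set \<Rightarrow> ('a \<Rightarrow> 'b::real_normed_vector) \<Rightarrow> bool" where
  "Ck_on 0 U f \<longleftrightarrow> continuous_on U f"
| "Ck_on (Suc k) U f \<longleftrightarrow> (\<forall>x\<in>U. f differentiable (at x)) \<and>
     (\<forall>v. Ck_on k U (\<lambda>x. frechet_derivative f (at x) v))"

text \<open>
  On an arbitrary set, a function is smooth if locally it extends to a smooth function on an
  open set. This is needed because the model spaces below are linear subspaces of a Euclidean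
  type; in this way all dimensions and ranks, zero included, are covered.
\<close>

definition smooth_on :: "'a::euclidean_space set \<Rightarrow> ('a \<Rightarrow> 'b::real_normed_vector) \<Rightarrow> bool" where
  "smooth_on S f \<longleftrightarrow>
     (\<forall>x\<in>S. \<exists>U g. open U \<and> x \<in> U \<and> (\<forall>k. Ck_on k U g) \<and> (\<forall>y\<in>S \<inter> U. f y = g y))"

definition dir_deriv :: "('a::real_normed_vector \<Rightarrow> 'b::real_normed_vector) \<Rightarrow> 'a \<Rightarrow> 'a \<Rightarrow> 'b" where
  "dir_deriv f x v = vector_derivative (\<lambda>t. f (x + t *\<^sub>R v)) (at 0)"


section \<open>Manifolds\<close>

text \<open>
  The points of a manifold are the elements of a type whose topology is Hausdorff and second
  countable. A chart \<open>(U, \<phi>)\<close> takes the open set \<open>U\<close> to an open subset of the model space, a linear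
  subspace of a Euclidean type. Outside \<open>U\<close> the function \<open>\<phi>\<close> is irrelevant.
\<close>

type_synonym ('m, 'e) chart = "'m set \<times> ('m \<Rightarrow> 'e)"

record ('m, 'e) manifold =
  model_space :: "'e set"
  atlas :: "('m, 'e) chart set"

abbreviation chart_inv :: "('m, 'e) chart \<Rightarrow> 'e \<Rightarrow> 'm" where
  "chart_inv c \<equiv> inv_into (fst c) (snd c)"

definition smooth_manifold ::
  "('m::{t2_space, second_countable_topology}, 'e::euclidean_space) manifold \<Rightarrow> bool" where
  "smooth_manifold M \<longleftrightarrow>
     subspace (model_space M) \<and>
     (\<forall>(U, \<phi>)\<in>atlas M. open U \<and> openin (top_of_set (model_space M)) (\<phi> ` U) \<and>
        homeomorphism U (\<phi> ` U) \<phi> (inv_into U \<phi>)) \<and>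
     (\<forall>p. \<exists>c\<in>atlas M. p \<in> fst c) \<and>
     (\<forall>c\<in>atlas M. \<forall>c'\<in>atlas M. smooth_on (snd c ` (fst c \<inter> fst c')) (snd c' \<circ> chart_inv c))"

text \<open>Smoothness on an open set \<open>A\<close> of a function with values in a vector space.\<close>

definition smooth_fun_on ::
  "('m, 'e::euclidean_space) manifold \<Rightarrow> 'm set \<Rightarrow> ('m \<Rightarrow> 'v::real_normed_vector) \<Rightarrow> bool" where
  "smooth_fun_on M A g \<longleftrightarrow> (\<forall>c\<in>atlas M. smooth_on (snd c ` (fst c \<inter> A)) (g \<circ> chart_inv c))"

text \<open>Smoothness of \<open>(p, w) \<mapsto> g p w\<close> on \<open>A \<times> W\<close>, for \<open>A\<close> open and \<open>W\<close> a linear subspace.\<close>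

definition smooth_fam_on ::
  "('m, 'e::euclidean_space) manifold \<Rightarrow> 'm set \<Rightarrow> 'w::euclidean_space set \<Rightarrow>
   ('m \<Rightarrow> 'w \<Rightarrow> 'v::real_normed_vector) \<Rightarrow> bool" where
  "smooth_fam_on M A W g \<longleftrightarrow>
     (\<forall>c\<in>atlas M. smooth_on ((snd c ` (fst c \<inter> A)) \<times> W) (\<lambda>(x, w). g (chart_inv c x) w))"

definition smooth_functions :: "('m, 'e::euclidean_space) manifold \<Rightarrow> ('m \<Rightarrow> real) set" where
  "smooth_functions M = {f. smooth_fun_on M UNIV f}"

definition smooth_map ::
  "('m::topological_space, 'e::euclidean_space) manifold \<Rightarrow>
   ('n::topological_space, 'd::euclidean_space) manifold \<Rightarrow> ('m \<Rightarrow> 'n) \<Rightarrow> bool" where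
  "smooth_map M N f \<longleftrightarrow> continuous_on UNIV f \<and>
     (\<forall>c\<in>atlas M. \<forall>c'\<in>atlas N.
        smooth_on (snd c ` (fst c \<inter> f -` fst c')) (snd c' \<circ> f \<circ> chart_inv c))"

definition diffeomorphism ::
  "('m::topological_space, 'e::euclidean_space) manifold \<Rightarrow>
   ('n::topological_space, 'd::euclidean_space) manifold \<Rightarrow> ('m \<Rightarrow> 'n) \<Rightarrow> bool" where
  "diffeomorphism M N f \<longleftrightarrow> bij f \<and> smooth_map M N f \<and> smooth_map N M (inv f)"


section \<open>Vector bundles\<close>

text \<open>
  A vector bundle is given by its total set, projection, fibrewise operations and a smooth bundle
  atlas. A trivialization is recorded as \<open>(U, \<Phi>)\<close>, where \<open>\<Phi>\<close> is the vector component of the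
  local trivialization: \<open>e \<mapsto> (proj e, \<Phi> e)\<close> is the bijection of the part over \<open>U\<close> with
  \<open>U \<times> typical\<close>. The smooth structure of the total space is the one for which these bijections are
  diffeomorphisms, so smoothness of sections and morphisms is smoothness of their local
  representatives. Since the fibres are identified with the vector space \<open>typical\<close>, the vector
  space axioms for the fibrewise operations follow.
\<close>

record ('m, 'e, 'f, 'w) vbundle =
  base :: "('m, 'e) manifold"
  total :: "'f set"
  proj :: "'f \<Rightarrow> 'm"
  fadd :: "'f \<Rightarrow> 'f \<Rightarrow> 'f"
  fscale :: "real \<Rightarrow> 'f \<Rightarrow> 'f"
  typical :: "'w set"
  trivs :: "('m set \<times> ('f \<Rightarrow> 'w)) set"

definition fibre :: "('m, 'e, 'f, 'w) vbundle \<Rightarrow> 'm \<Rightarrow> 'f set" where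
  "fibre B p = {e \<in> total B. proj B e = p}"

definition vector_bundle ::
  "('m::{t2_space, second_countable_topology}, 'e::euclidean_space, 'f, 'w::euclidean_space) vbundle
   \<Rightarrow> bool" where
  "vector_bundle B \<longleftrightarrow>
     smooth_manifold (base B) \<and> subspace (typical B) \<and>
     (\<forall>p. \<forall>a\<in>fibre B p. \<forall>b\<in>fibre B p. fadd B a b \<in> fibre B p) \<and>
     (\<forall>p. \<forall>r. \<forall>a\<in>fibre B p. fscale B r a \<in> fibre B p) \<and>
     (\<forall>(U, \<Phi>)\<in>trivs B. open U \<and>
        (\<forall>p\<in>U. bij_betw \<Phi> (fibre B p) (typical B) \<and>
           (\<forall>a\<in>fibre B p. \<forall>b\<in>fibre B p. \<Phi> (fadd B a b) = \<Phi> a + \<Phi> b) \<and>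
           (\<forall>r. \<forall>a\<in>fibre B p. \<Phi> (fscale B r a) = r *\<^sub>R \<Phi> a))) \<and>
     (\<forall>p. \<exists>(U, \<Phi>)\<in>trivs B. p \<in> U) \<and>
     (\<forall>(U, \<Phi>)\<in>trivs B. \<forall>(U', \<Phi>')\<in>trivs B.
        smooth_fam_on (base B) (U \<inter> U') (typical B)
          (\<lambda>p w. \<Phi>' (inv_into (fibre B p) \<Phi> w)))"

definition vb_morphism ::
  "('m::topological_space, 'e::euclidean_space, 'f, 'w::euclidean_space) vbundle \<Rightarrow>
   ('n::topological_space, 'd::euclidean_space, 'g, 'u::euclidean_space) vbundle \<Rightarrow>
   ('f \<Rightarrow> 'g) \<Rightarrow> ('m \<Rightarrow> 'n) \<Rightarrow> bool" where
  "vb_morphism B B' \<phi> \<phi>\<^sub>0 \<longleftrightarrow>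
     smooth_map (base B) (base B') \<phi>\<^sub>0 \<and>
     (\<forall>p. \<forall>a\<in>fibre B p. \<phi> a \<in> fibre B' (\<phi>\<^sub>0 p)) \<and>
     (\<forall>p. \<forall>a\<in>fibre B p. \<forall>b\<in>fibre B p. \<phi> (fadd B a b) = fadd B' (\<phi> a) (\<phi> b)) \<and>
     (\<forall>p. \<forall>r. \<forall>a\<in>fibre B p. \<phi> (fscale B r a) = fscale B' r (\<phi> a)) \<and>
     (\<forall>(U, \<Phi>)\<in>trivs B. \<forall>(U', \<Phi>')\<in>trivs B'.
        smooth_fam_on (base B) (U \<inter> \<phi>\<^sub>0 -` U') (typical B)
          (\<lambda>p w. \<Phi>' (\<phi> (inv_into (fibre B p) \<Phi> w))))"

definition sections ::
  "('m, 'e::euclidean_space, 'f, 'w::euclidean_space) vbundle \<Rightarrow> ('m \<Rightarrow> 'f) set" where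
  "sections B = {s. (\<forall>p. s p \<in> fibre B p) \<and>
     (\<forall>(U, \<Phi>)\<in>trivs B. smooth_fun_on (base B) U (\<Phi> \<circ> s))}"

definition sec_add ::
  "('m, 'e, 'f, 'w) vbundle \<Rightarrow> ('m \<Rightarrow> 'f) \<Rightarrow> ('m \<Rightarrow> 'f) \<Rightarrow> 'm \<Rightarrow> 'f" where
  "sec_add B s t = (\<lambda>p. fadd B (s p) (t p))"

definition sec_mult ::
  "('m, 'e, 'f, 'w) vbundle \<Rightarrow> ('m \<Rightarrow> real) \<Rightarrow> ('m \<Rightarrow> 'f) \<Rightarrow> 'm \<Rightarrow> 'f" where
  "sec_mult B f s = (\<lambda>p. fscale B (f p) (s p))"

definition sec_zero :: "('m, 'e, 'f, 'w) vbundle \<Rightarrow> 'm \<Rightarrow> 'f" where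
  "sec_zero B = (\<lambda>p. THE z. z \<in> fibre B p \<and> (\<forall>a\<in>fibre B p. fadd B z a = a))"

text \<open>The map \<open>\<Gamma>(\<phi>, \<phi>\<^sub>0)\<close> on sections, for bijective \<open>\<phi>\<^sub>0\<close>.\<close>

definition sec_map :: "('f \<Rightarrow> 'g) \<Rightarrow> ('m \<Rightarrow> 'n) \<Rightarrow> ('m \<Rightarrow> 'f) \<Rightarrow> 'n \<Rightarrow> 'g" where
  "sec_map \<phi> \<phi>\<^sub>0 u = (\<lambda>y. \<phi> (u (inv \<phi>\<^sub>0 y)))"

text \<open>
  A vector subbundle of \<open>B\<close> is a vector bundle over the same base whose total set is contained in
  that of \<open>B\<close> and for which the inclusion is a morphism of vector bundles over the identity (in
  particular, projection and fibrewise operations are the restricted ones). As the rank of a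
  subbundle is at most the rank of \<open>B\<close>, the same type can host its typical fibre.
\<close>

definition vector_subbundle ::
  "('m::{t2_space, second_countable_topology}, 'e::euclidean_space, 'f, 'w::euclidean_space) vbundle
   \<Rightarrow> ('m, 'e, 'f, 'w) vbundle \<Rightarrow> bool" where
  "vector_subbundle E B \<longleftrightarrow>
     vector_bundle E \<and> base E = base B \<and> total E \<subseteq> total B \<and> vb_morphism E B (\<lambda>e. e) (\<lambda>p. p)"

definition pullback_bundle ::
  "('m, 'e) manifold \<Rightarrow> ('m \<Rightarrow> 'n) \<Rightarrow> ('n, 'd, 'f, 'w) vbundle \<Rightarrow> ('m, 'e, 'm \<times> 'f, 'w) vbundle" where
  "pullback_bundle M h F =
     \<lparr> base = M,
       total = {(x, a). a \<in> fibre F (h x)},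
       proj = fst,
       fadd = (\<lambda>(x, a) (y, b). (x, fadd F a b)),
       fscale = (\<lambda>r (x, a). (x, fscale F r a)),
       typical = typical F,
       trivs = (\<lambda>(U, \<Phi>). (h -` U, \<Phi> \<circ> snd)) ` trivs F \<rparr>"


section \<open>The tangent bundle\<close>

text \<open>
  A tangent vector at \<open>p\<close> is a family of coordinate vectors, one for each chart around \<open>p\<close>, which
  transforms under changes of charts by their derivatives. The entries at all other indices are
  fixed to be \<open>0\<close>.
\<close>

type_synonym ('m, 'e) tvec = "'m \<times> (('m, 'e) chart \<Rightarrow> 'e)"

definition tangent_space :: "('m, 'e::euclidean_space) manifold \<Rightarrow> 'm \<Rightarrow> (('m, 'e) chart \<Rightarrow> 'e) set" where
  "tangent_space M p = {v.
     (\<forall>c. \<not> (c \<in> atlas M \<and> p \<in> fst c) \<longrightarrow> v c = 0) \<and>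
     (\<forall>c\<in>atlas M. p \<in> fst c \<longrightarrow> v c \<in> model_space M) \<and>
     (\<forall>c\<in>atlas M. \<forall>c'\<in>atlas M. p \<in> fst c \<inter> fst c' \<longrightarrow>
        v c' = dir_deriv (snd c' \<circ> chart_inv c) (snd c p) (v c))}"

definition tangent_bundle ::
  "('m, 'e::euclidean_space) manifold \<Rightarrow> ('m, 'e, ('m, 'e) tvec, 'e) vbundle" where
  "tangent_bundle M =
     \<lparr> base = M,
       total = {(p, v). v \<in> tangent_space M p},
       proj = fst,
       fadd = (\<lambda>(p, v) (q, w). (p, \<lambda>c. v c + w c)),
       fscale = (\<lambda>r (p, v). (p, \<lambda>c. r *\<^sub>R v c)),
       typical = model_space M,
       trivs = (\<lambda>c. (fst c, \<lambda>(p, v). v c)) ` atlas M \<rparr>"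

definition chart_at :: "('m, 'e) manifold \<Rightarrow> 'm \<Rightarrow> ('m, 'e) chart" where
  "chart_at M p = (SOME c. c \<in> atlas M \<and> p \<in> fst c)"

text \<open>The tangent map \<open>Th : TM \<rightarrow> TN\<close>; the result does not depend on the chart around \<open>p\<close>.\<close>

definition tangent_map ::
  "('m, 'e::euclidean_space) manifold \<Rightarrow> ('n, 'd::euclidean_space) manifold \<Rightarrow> ('m \<Rightarrow> 'n) \<Rightarrow>
   ('m, 'e) tvec \<Rightarrow> ('n, 'd) tvec" where
  "tangent_map M N h = (\<lambda>(p, v). (h p, \<lambda>c'.
     if c' \<in> atlas N \<and> h p \<in> fst c'
     then (let c = chart_at M p in dir_deriv (snd c' \<circ> h \<circ> chart_inv c) (snd c p) (v c))
     else 0))"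

text \<open>The derivative \<open>X f\<close> of a function along a vector field, again independent of the chart.\<close>

definition vf_apply ::
  "('m, 'e::euclidean_space) manifold \<Rightarrow> ('m \<Rightarrow> ('m, 'e) tvec) \<Rightarrow> ('m \<Rightarrow> real) \<Rightarrow> 'm \<Rightarrow> real" where
  "vf_apply M X f = (\<lambda>p. let c = chart_at M p in
     dir_deriv (f \<circ> chart_inv c) (snd c p) (snd (X p) c))"

definition vf_bracket ::
  "('m, 'e::euclidean_space) manifold \<Rightarrow> ('m \<Rightarrow> ('m, 'e) tvec) \<Rightarrow> ('m \<Rightarrow> ('m, 'e) tvec) \<Rightarrow>
   'm \<Rightarrow> ('m, 'e) tvec" where
  "vf_bracket M X Y = (THE Z. Z \<in> sections (tangent_bundle M) \<and>
     (\<forall>f\<in>smooth_functions M. vf_apply M Z f =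
        (\<lambda>p. vf_apply M X (vf_apply M Y f) p - vf_apply M Y (vf_apply M X f) p)))"


section \<open>Generalized Lie algebroids\<close>

text \<open>\<open>br\<close> makes the real vector space \<open>\<Gamma>(B)\<close> a Lie algebra.\<close>

definition lie_algebra_of_sections ::
  "('m, 'e::euclidean_space, 'f, 'w::euclidean_space) vbundle \<Rightarrow>
   (('m \<Rightarrow> 'f) \<Rightarrow> ('m \<Rightarrow> 'f) \<Rightarrow> ('m \<Rightarrow> 'f)) \<Rightarrow> bool" where
  "lie_algebra_of_sections B br \<longleftrightarrow>
     (\<forall>u\<in>sections B. \<forall>v\<in>sections B. br u v \<in> sections B) \<and>
     (\<forall>u\<in>sections B. \<forall>v\<in>sections B. \<forall>w\<in>sections B.
        br (sec_add B u v) w = sec_add B (br u w) (br v w) \<and>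
        br w (sec_add B u v) = sec_add B (br w u) (br w v)) \<and>
     (\<forall>r. \<forall>u\<in>sections B. \<forall>v\<in>sections B.
        br (sec_mult B (\<lambda>_. r) u) v = sec_mult B (\<lambda>_. r) (br u v) \<and>
        br u (sec_mult B (\<lambda>_. r) v) = sec_mult B (\<lambda>_. r) (br u v)) \<and>
     (\<forall>u\<in>sections B. br u u = sec_zero B) \<and>
     (\<forall>u\<in>sections B. \<forall>v\<in>sections B. \<forall>w\<in>sections B.
        sec_add B (br u (br v w)) (sec_add B (br v (br w u)) (br w (br u v))) = sec_zero B)"

text \<open>The map \<open>a = \<Gamma>(Th \<circ> \<rho>, h \<circ> \<eta>)\<close>, from sections of \<open>F\<close> to vector fields on its base.\<close>

definition gla_anchor ::
  "('m, 'e::euclidean_space) manifold \<Rightarrow> ('m \<Rightarrow> 'n) \<Rightarrow>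
   ('n, 'd::euclidean_space, 'f, 'w::euclidean_space) vbundle \<Rightarrow>
   ('f \<Rightarrow> ('m, 'e) tvec) \<Rightarrow> ('n \<Rightarrow> 'm) \<Rightarrow> ('n \<Rightarrow> 'f) \<Rightarrow> 'n \<Rightarrow> ('n, 'd) tvec" where
  "gla_anchor M h F \<rho> \<eta> z = sec_map (tangent_map M (base F) h \<circ> \<rho>) (h \<circ> \<eta>) z"

definition generalized_lie_algebroid ::
  "('m::{t2_space, second_countable_topology}, 'e::euclidean_space) manifold \<Rightarrow> ('m \<Rightarrow> 'n) \<Rightarrow>
   ('n::{t2_space, second_countable_topology}, 'd::euclidean_space, 'f, 'w::euclidean_space) vbundle \<Rightarrow>
   (('n \<Rightarrow> 'f) \<Rightarrow> ('n \<Rightarrow> 'f) \<Rightarrow> ('n \<Rightarrow> 'f)) \<Rightarrow>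
   ('f \<Rightarrow> ('m, 'e) tvec) \<Rightarrow> ('n \<Rightarrow> 'm) \<Rightarrow> bool" where
  "generalized_lie_algebroid M h F br \<rho> \<eta> \<longleftrightarrow>
     (let N = base F; TN = tangent_bundle N; a = gla_anchor M h F \<rho> \<eta> in
       smooth_manifold M \<and> smooth_manifold N \<and>
       diffeomorphism M N h \<and> diffeomorphism N M \<eta> \<and>
       vector_bundle F \<and> vb_morphism F (tangent_bundle M) \<rho> \<eta> \<and>
       (\<forall>u\<in>sections F. \<forall>v\<in>sections F. \<forall>f\<in>smooth_functions N.
          br u (sec_mult F f v) =
            sec_add F (sec_mult F f (br u v)) (sec_mult F (vf_apply N (a u) f) v)) \<and>
       lie_algebra_of_sections F br \<and>
       (\<forall>u\<in>sections F. a u \<in> sections TN) \<and>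
       (\<forall>u\<in>sections F. \<forall>v\<in>sections F. a (sec_add F u v) = sec_add TN (a u) (a v)) \<and>
       (\<forall>r. \<forall>u\<in>sections F. a (sec_mult F (\<lambda>_. r) u) = sec_mult TN (\<lambda>_. r) (a u)) \<and>
       (\<forall>u\<in>sections F. \<forall>v\<in>sections F. a (br u v) = vf_bracket N (a u) (a v)))"

text \<open>
  The bijection \<open>z \<mapsto> z \<circ> h\<close> from \<open>\<Gamma>(F)\<close> to the sections of the pull-back bundle (whose elements are
  pairs \<open>(x, a)\<close> with \<open>a\<close> in the fibre over \<open>h x\<close>), and its inverse.
\<close>

definition pb_section :: "('m \<Rightarrow> 'n) \<Rightarrow> ('n \<Rightarrow> 'f) \<Rightarrow> 'm \<Rightarrow> 'm \<times> 'f" where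
  "pb_section h z = (\<lambda>x. (x, z (h x)))"

definition unpb_section :: "('m \<Rightarrow> 'n) \<Rightarrow> ('m \<Rightarrow> 'm \<times> 'f) \<Rightarrow> 'n \<Rightarrow> 'f" where
  "unpb_section h Z = (\<lambda>y. snd (Z (inv h y)))"

definition pb_bracket ::
  "('m \<Rightarrow> 'n) \<Rightarrow> (('n \<Rightarrow> 'f) \<Rightarrow> ('n \<Rightarrow> 'f) \<Rightarrow> ('n \<Rightarrow> 'f)) \<Rightarrow>
   ('m \<Rightarrow> 'm \<times> 'f) \<Rightarrow> ('m \<Rightarrow> 'm \<times> 'f) \<Rightarrow> 'm \<Rightarrow> 'm \<times> 'f" where
  "pb_bracket h br Z W = pb_section h (br (unpb_section h Z) (unpb_section h W))"

definition pb_anchor ::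
  "('m \<Rightarrow> 'n) \<Rightarrow> ('f \<Rightarrow> ('m, 'e) tvec) \<Rightarrow> ('n \<Rightarrow> 'm) \<Rightarrow>
   ('m \<Rightarrow> 'm \<times> 'f) \<Rightarrow> 'm \<Rightarrow> ('m, 'e) tvec" where
  "pb_anchor h \<rho> \<eta> Z = sec_map \<rho> \<eta> (unpb_section h Z)"


section \<open>The exterior algebra\<close>

text \<open>
  An element of the exterior algebra is a function on finite tuples (lists) of sections; its
  component of degree \<open>q\<close> is its restriction to lists of length \<open>q\<close>. Forms are normalized to be \<open>0\<close>
  on lists with entries that are not sections, and \<open>q\<close>-forms are \<open>0\<close> on lists of other lengths.
  A function \<open>f\<close>, as a \<open>0\<close>-form, is the form with value \<open>f\<close> on the empty list.
\<close>

type_synonym ('m, 'f) form = "('m \<Rightarrow> 'f) list \<Rightarrow> 'm \<Rightarrow> real"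

definition Lambda_deg ::
  "('m, 'e::euclidean_space, 'f, 'w::euclidean_space) vbundle \<Rightarrow> nat \<Rightarrow> ('m, 'f) form set" where
  "Lambda_deg B q = {\<omega>.
     (\<forall>Zs. \<not> (length Zs = q \<and> set Zs \<subseteq> sections B) \<longrightarrow> \<omega> Zs = (\<lambda>_. 0)) \<and>
     (\<forall>Zs. length Zs = q \<and> set Zs \<subseteq> sections B \<longrightarrow>
        \<omega> Zs \<in> smooth_functions (base B) \<and>
        (\<forall>i<q. \<forall>X\<in>sections B. \<forall>Y\<in>sections B.
           \<omega> (Zs[i := sec_add B X Y]) = (\<lambda>p. \<omega> (Zs[i := X]) p + \<omega> (Zs[i := Y]) p)) \<and>
        (\<forall>i<q. \<forall>X\<in>sections B. \<forall>f\<in>smooth_functions (base B).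
           \<omega> (Zs[i := sec_mult B f X]) = (\<lambda>p. f p * \<omega> (Zs[i := X]) p)) \<and>
        (\<forall>i<q. \<forall>j<q. i \<noteq> j \<and> Zs ! i = Zs ! j \<longrightarrow> \<omega> Zs = (\<lambda>_. 0)))}"

definition deg_component :: "('m, 'f) form \<Rightarrow> nat \<Rightarrow> ('m, 'f) form" where
  "deg_component \<omega> q = (\<lambda>Zs. if length Zs = q then \<omega> Zs else (\<lambda>_. 0))"

definition Lambda ::
  "('m, 'e::euclidean_space, 'f, 'w::euclidean_space) vbundle \<Rightarrow> ('m, 'f) form set" where
  "Lambda B = {\<omega>. (\<forall>q. deg_component \<omega> q \<in> Lambda_deg B q) \<and>
     finite {q. deg_component \<omega> q \<noteq> (\<lambda>_ _. 0)}}"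

definition form_add :: "('m, 'f) form \<Rightarrow> ('m, 'f) form \<Rightarrow> ('m, 'f) form" where
  "form_add \<omega> \<theta> = (\<lambda>Zs p. \<omega> Zs p + \<theta> Zs p)"

text \<open>
  The exterior product, as a sum over shuffles. A shuffle of \<open>n\<close> arguments into the
  arguments of \<open>\<omega>\<close> and of \<open>\<theta>\<close> is the subset \<open>I\<close> of the positions that go to \<open>\<omega>\<close>; its sign is given by
  the number of its inversions. Letting \<open>I\<close> range over subsets of all sizes sums over all degrees
  of the factors.
\<close>

definition wedge :: "('m, 'f) form \<Rightarrow> ('m, 'f) form \<Rightarrow> ('m, 'f) form" where
  "wedge \<omega> \<theta> = (\<lambda>Zs p. \<Sum>I\<in>Pow {..<length Zs}.
     (-1) ^ card {(i, j). i \<in> I \<and> j \<in> {..<length Zs} - I \<and> j < i} *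
     \<omega> (nths Zs I) p * \<theta> (nths Zs (- I)) p)"

text \<open>The exterior differential of the pull-back Lie algebroid; \<open>nths Zs (- I)\<close> omits the positions in \<open>I\<close>.\<close>

definition ext_diff ::
  "('m, 'e::euclidean_space) manifold \<Rightarrow> ('m \<Rightarrow> 'n) \<Rightarrow>
   ('n, 'd::euclidean_space, 'f, 'w::euclidean_space) vbundle \<Rightarrow>
   (('n \<Rightarrow> 'f) \<Rightarrow> ('n \<Rightarrow> 'f) \<Rightarrow> ('n \<Rightarrow> 'f)) \<Rightarrow>
   ('f \<Rightarrow> ('m, 'e) tvec) \<Rightarrow> ('n \<Rightarrow> 'm) \<Rightarrow> ('m, 'm \<times> 'f) form \<Rightarrow> ('m, 'm \<times> 'f) form" where
  "ext_diff M h F br \<rho> \<eta> \<omega> = (\<lambda>Zs p.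
     if set Zs \<subseteq> sections (pullback_bundle M h F) then
       (\<Sum>i<length Zs. (-1) ^ i * vf_apply M (pb_anchor h \<rho> \<eta> (Zs ! i)) (\<omega> (nths Zs (- {i}))) p) +
       (\<Sum>j<length Zs. \<Sum>i<j. (-1) ^ (i + j) *
          \<omega> (pb_bracket h br (Zs ! i) (Zs ! j) # nths Zs (- {i, j})) p)
     else 0)"

definition is_ideal ::
  "('m, 'e::euclidean_space, 'f, 'w::euclidean_space) vbundle \<Rightarrow> ('m, 'f) form set \<Rightarrow> bool" where
  "is_ideal B I \<longleftrightarrow> I \<subseteq> Lambda B \<and> (\<lambda>_ _. 0) \<in> I \<and>
     (\<forall>\<omega>\<in>I. \<forall>\<theta>\<in>I. form_add \<omega> \<theta> \<in> I) \<and>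
     (\<forall>\<omega>\<in>I. \<forall>\<theta>\<in>Lambda B. wedge \<theta> \<omega> \<in> I \<and> wedge \<omega> \<theta> \<in> I)"

definition ideal_generated ::
  "('m, 'e::euclidean_space, 'f, 'w::euclidean_space) vbundle \<Rightarrow> ('m, 'f) form set \<Rightarrow> ('m, 'f) form set" where
  "ideal_generated B G = \<Inter> {I. is_ideal B I \<and> G \<subseteq> I}"


section \<open>Interior and exterior differential systems\<close>

definition interior_ds ::
  "('m::{t2_space, second_countable_topology}, 'e::euclidean_space) manifold \<Rightarrow> ('m \<Rightarrow> 'n) \<Rightarrow>
   ('n, 'd::euclidean_space, 'f, 'w::euclidean_space) vbundle \<Rightarrow>
   ('m, 'e, 'm \<times> 'f, 'w) vbundle \<Rightarrow> bool" where
  "interior_ds M h F E \<longleftrightarrow> vector_subbundle E (pullback_bundle M h F)"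

definition involutive ::
  "('m \<Rightarrow> 'n) \<Rightarrow> (('n \<Rightarrow> 'f) \<Rightarrow> ('n \<Rightarrow> 'f) \<Rightarrow> ('n \<Rightarrow> 'f)) \<Rightarrow>
   ('m, 'e::euclidean_space, 'm \<times> 'f, 'w::euclidean_space) vbundle \<Rightarrow> bool" where
  "involutive h br E \<longleftrightarrow> (\<forall>S\<in>sections E. \<forall>T\<in>sections E. pb_bracket h br S T \<in> sections E)"

text \<open>
  The sections of the annihilator subbundle \<open>E^0\<close> of the dual of \<open>B\<close>; sections of the dual bundle
  are identified with \<open>1\<close>-forms.
\<close>

definition annihilator_sections ::
  "('m, 'e::euclidean_space, 'f, 'w::euclidean_space) vbundle \<Rightarrow> ('m, 'e, 'f, 'w) vbundle \<Rightarrow>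
   ('m, 'f) form set" where
  "annihilator_sections B E = {\<Omega> \<in> Lambda_deg B 1. \<forall>S\<in>sections E. \<Omega> [S] = (\<lambda>_. 0)}"

definition differential_ideal ::
  "('m, 'e::euclidean_space) manifold \<Rightarrow> ('m \<Rightarrow> 'n) \<Rightarrow>
   ('n, 'd::euclidean_space, 'f, 'w::euclidean_space) vbundle \<Rightarrow>
   (('n \<Rightarrow> 'f) \<Rightarrow> ('n \<Rightarrow> 'f) \<Rightarrow> ('n \<Rightarrow> 'f)) \<Rightarrow>
   ('f \<Rightarrow> ('m, 'e) tvec) \<Rightarrow> ('n \<Rightarrow> 'm) \<Rightarrow> ('m, 'm \<times> 'f) form set \<Rightarrow> bool" where
  "differential_ideal M h F br \<rho> \<eta> I \<longleftrightarrow>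
     is_ideal (pullback_bundle M h F) I \<and> (\<forall>\<omega>\<in>I. ext_diff M h F br \<rho> \<eta> \<omega> \<in> I)"

definition exterior_ds ::
  "('m::{t2_space, second_countable_topology}, 'e::euclidean_space) manifold \<Rightarrow> ('m \<Rightarrow> 'n) \<Rightarrow>
   ('n, 'd::euclidean_space, 'f, 'w::euclidean_space) vbundle \<Rightarrow>
   (('n \<Rightarrow> 'f) \<Rightarrow> ('n \<Rightarrow> 'f) \<Rightarrow> ('n \<Rightarrow> 'f)) \<Rightarrow>
   ('f \<Rightarrow> ('m, 'e) tvec) \<Rightarrow> ('n \<Rightarrow> 'm) \<Rightarrow> ('m, 'm \<times> 'f) form set \<Rightarrow> bool" where
  "exterior_ds M h F br \<rho> \<eta> I \<longleftrightarrow>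
     differential_ideal M h F br \<rho> \<eta> I \<and>
     (\<exists>E'. interior_ds M h F E' \<and>
        (\<forall>k\<ge>1. \<forall>\<omega>\<in>I \<inter> Lambda_deg (pullback_bundle M h F) k.
           \<forall>us. length us = k \<and> set us \<subseteq> sections E' \<longrightarrow> \<omega> us = (\<lambda>_. 0)))"

end

(* The ideal generated by the annihilator of E is the ideal J of all forms that vanish on tuples of
   sections of E. Granting this, both directions follow from the formula for d: if E is involutive,
   every term of d omega vanishes on E whenever omega is in J; and if J is closed under d, then
   0 = (d Omega)(S, T) = - Omega [S, T] for all Omega annihilating E, which puts [S, T] into E because
   the annihilator separates the points of the fibres off E.

   That J is generated by 1-forms needs finitely many forms Omega_a annihilating E and sections c_a
   such that Z - sum_a Omega_a(Z) c_a is in E for every section Z. Without compactness of M,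
   finiteness comes from dimension: a locally finite family of annihilating forms is absorbed one by
   one into a form with values in a space of dimension greater than dim M + rank F, each time
   avoiding a negligible set of coefficient vectors; then the c_a are found locally and glued. The
   sum of the wedge products of Omega_a with the contraction of omega by c_a is a derivation of the
   algebra of forms, and counting how many arguments lie in E shows that J is in the ideal.

   The anchor of the pull-back algebroid is linear over functions only up to the diffeomorphism
   h o eta; the Leibniz rule and antisymmetry force it to vanish wherever the two differ. *)
theory Submission
  imports Defs
begin

text \<open>A point and a vector in the fibre over it have at most \<open>DIM('e) + DIM('w)\<close>
  coordinates between them, so the values of a linear form fill only a null set in any space of
  larger dimension. \<open>'e \<times> 'w \<times> real\<close> has exactly one dimension more, and
  the finitely many generators are indexed by its standard basis. Model spaces and typical fibres
  are subspaces of these types, so the true dimension and rank are only bounded by the two numbers;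
  the count needs no more than the bound.

  Fibres carry no vector space type. Linear algebra in one fibre is therefore done in coordinates,
  and everything global is phrased with modules of sections and of function-linear forms; bump
  functions turn local objects into members of these modules.

  Exact function-linearity of the anchor is required before either direction starts: without it d
  omega need not be multilinear over functions, and so need not lie in the exterior algebra at
  all.\<close>

section \<open>Smooth functions on open sets\<close>

text \<open>\<open>Ck_on\<close> speaks of \<open>frechet_derivative\<close>, which a given
  derivative \<open>f'\<close> matches on \<open>U\<close> only, and passing from one to the other
  needs congruence at level \<open>k\<close>. Congruence is itself proved by an induction that uses
  this lemma; hence it enters as the hypothesis \<open>cong\<close>, discharged in
  \<open>Ck_on_SucI\<close>.\<close>

lemma Ck_on_Suc_intro:
  fixes f :: "'a::euclidean_space \<Rightarrow> 'b::real_normed_vector"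
  assumes "open U" "\<And>x. x \<in> U \<Longrightarrow> (f has_derivative f' x) (at x)"
    and "\<And>v. Ck_on k U (\<lambda>x. f' x v)"
    and cong: "\<And>g h :: 'a \<Rightarrow> 'b. (\<And>x. x \<in> U \<Longrightarrow> g x = h x) \<Longrightarrow> Ck_on k U g = Ck_on k U h"
  shows "Ck_on (Suc k) U f"
proof -
  have *: "f' x = frechet_derivative f (at x)" if "x \<in> U" for x
    using assms(2)[OF that] by (rule frechet_derivative_at)
  have "Ck_on k U (\<lambda>x. frechet_derivative f (at x) v) = Ck_on k U (\<lambda>x. f' x v)" for v
    by (rule cong) (simp add: *)
  then show ?thesis
    using assms(2,3) by (auto simp: differentiable_def)
qed

lemma Ck_on_cong:
  fixes f g :: "'a::euclidean_space \<Rightarrow> 'b::real_normed_vector"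
  assumes "open U" "\<And>x. x \<in> U \<Longrightarrow> f x = g x"
  shows "Ck_on k U f = Ck_on k U g"
  using assms(2)
proof (induction k arbitrary: f g)
  case 0
  then show ?case
    using continuous_on_cong[OF refl, of U f g] by simp
next
  case (Suc k)
  have *: "Ck_on (Suc k) U g" if "Ck_on (Suc k) U f" "\<And>x. x \<in> U \<Longrightarrow> f x = g x" for f g :: "'a \<Rightarrow> 'b"
  proof (rule Ck_on_Suc_intro[OF assms(1)])
    fix x assume "x \<in> U"
    then have "(f has_derivative frechet_derivative f (at x)) (at x)"
      using that(1) by (simp add: frechet_derivative_works)
    then show "(g has_derivative frechet_derivative f (at x)) (at x)"
      by (rule has_derivative_transform_within_open[OF _ assms(1) \<open>x \<in> U\<close>]) (rule that(2))
  next
    show "Ck_on k U (\<lambda>x. frechet_derivative f (at x) v)" for v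
      using that(1) by simp
    show "Ck_on k U u = Ck_on k U w" if "\<And>x. x \<in> U \<Longrightarrow> u x = w x" for u w :: "'a \<Rightarrow> 'b"
      by (rule Suc.IH) (rule that)
  qed
  show ?case
  proof
    show "Ck_on (Suc k) U g" if "Ck_on (Suc k) U f"
      using that Suc.prems by (rule *)
    show "Ck_on (Suc k) U f" if "Ck_on (Suc k) U g"
      using that Suc.prems[symmetric] by (rule *)
  qed
qed

lemma Ck_on_SucI:
  fixes f :: "'a::euclidean_space \<Rightarrow> 'b::real_normed_vector"
  assumes "open U" "\<And>x. x \<in> U \<Longrightarrow> (f has_derivative f' x) (at x)"
    and "\<And>v. Ck_on k U (\<lambda>x. f' x v)"
  shows "Ck_on (Suc k) U f"
proof (rule Ck_on_Suc_intro[OF assms])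
  show "Ck_on k U g = Ck_on k U h" if "\<And>x. x \<in> U \<Longrightarrow> g x = h x" for g h :: "'a \<Rightarrow> 'b"
    using assms(1) that by (rule Ck_on_cong)
qed

lemma Ck_on_SucD:
  assumes "Ck_on (Suc k) U f"
  shows "\<And>x. x \<in> U \<Longrightarrow> (f has_derivative frechet_derivative f (at x)) (at x)"
    and "\<And>v. Ck_on k U (\<lambda>x. frechet_derivative f (at x) v)"
  using assms by (auto simp: frechet_derivative_works)

lemma Ck_on_subset: "Ck_on k U f \<Longrightarrow> V \<subseteq> U \<Longrightarrow> Ck_on k V f"
  by (induction k arbitrary: f) (auto intro: continuous_on_subset)

lemma Ck_on_Suc_imp: "Ck_on (Suc k) U f \<Longrightarrow> Ck_on k U f"
proof (induction k arbitrary: f)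
  case 0
  then show ?case
    by (auto intro!: continuous_at_imp_continuous_on differentiable_imp_continuous_within)
next
  case (Suc k)
  then show ?case by (subst Ck_on.simps) (use Suc.prems in \<open>auto simp del: Ck_on.simps(1)\<close>)
qed

lemma Ck_on_const: "open U \<Longrightarrow> Ck_on k U (\<lambda>x. c)"
proof (induction k arbitrary: c)
  case (Suc k)
  then show ?case by (intro Ck_on_SucI[where f' = "\<lambda>_ _. 0"]) auto
qed auto

lemma Ck_on_bounded_linear:
  assumes "bounded_linear L" "open U" "Ck_on k U f"
  shows "Ck_on k U (\<lambda>x. L (f x))"
  using assms(3)
proof (induction k arbitrary: f)
  case 0
  then show ?case
    using assms(1) by (auto intro: bounded_linear.continuous_on)
next
  case (Suc k)
  note D = Ck_on_SucD[OF Suc.prems]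
  show ?case
    by (rule Ck_on_SucI[OF assms(2) bounded_linear.has_derivative[OF assms(1) D(1)] Suc.IH[OF D(2)]])
qed

lemma Ck_on_add:
  assumes "open U" "Ck_on k U f" "Ck_on k U g"
  shows "Ck_on k U (\<lambda>x. f x + g x)"
  using assms(2,3)
proof (induction k arbitrary: f g)
  case 0
  then show ?case by (auto intro: continuous_on_add)
next
  case (Suc k)
  note D = Ck_on_SucD[OF Suc.prems(1)] Ck_on_SucD[OF Suc.prems(2)]
  show ?case
    by (rule Ck_on_SucI[OF assms(1) has_derivative_add[OF D(1,3)] Suc.IH[OF D(2,4)]])
qed

lemma Ck_on_sum:
  fixes f :: "'i \<Rightarrow> 'a::euclidean_space \<Rightarrow> 'b::real_normed_vector"
  assumes "open U" "\<And>i. i \<in> A \<Longrightarrow> Ck_on k U (f i)"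
  shows "Ck_on k U (\<lambda>x. \<Sum>i\<in>A. f i x)"
proof (cases "finite A")
  case True
  then show ?thesis
    using assms(2) by (induction A) (auto intro: Ck_on_const Ck_on_add assms(1))
qed (auto intro: Ck_on_const assms(1))

lemma Ck_on_bilinear:
  assumes "bounded_bilinear pr" "open U" "Ck_on k U f" "Ck_on k U g"
  shows "Ck_on k U (\<lambda>x. pr (f x) (g x))"
  using assms(3,4)
proof (induction k arbitrary: f g)
  case 0
  then show ?case
    using assms(1) by (auto intro: bounded_bilinear.continuous_on)
next
  case (Suc k)
  note D = Ck_on_SucD[OF Suc.prems(1)] Ck_on_SucD[OF Suc.prems(2)]
  note S = Suc.prems[THEN Ck_on_Suc_imp]
  show ?case
    by (rule Ck_on_SucI[OF assms(2) bounded_bilinear.FDERIV[OF assms(1) D(1,3)]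
          Ck_on_add[OF assms(2) Suc.IH[OF S(1) D(4)] Suc.IH[OF D(2) S(2)]]])
qed

lemma Ck_on_Pair:
  assumes "open U" "Ck_on k U f" "Ck_on k U g"
  shows "Ck_on k U (\<lambda>x. (f x, g x))"
proof -
  have "bounded_linear (\<lambda>a. (a, 0))" "bounded_linear (\<lambda>b. (0, b))"
    by (auto intro!: bounded_linear_Pair bounded_linear_ident bounded_linear_zero)
  from Ck_on_add[OF assms(1) Ck_on_bounded_linear[OF this(1) assms(1,2)]
      Ck_on_bounded_linear[OF this(2) assms(1,3)]]
  show ?thesis by simp
qed

text \<open>The chain rule applies the derivative of \<open>g\<close> to a direction that varies
  with \<open>x\<close>, while \<open>Ck_on\<close> controls derivatives in fixed directions.
  Expanding the direction in the standard basis gives a sum of products of functions covered by the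
  induction hypothesis.\<close>

lemma Ck_on_compose:
  fixes f :: "'a::euclidean_space \<Rightarrow> 'b::euclidean_space" and g :: "'b \<Rightarrow> 'c::real_normed_vector"
  assumes "open U" "open V" "f ` U \<subseteq> V" "Ck_on k U f" "Ck_on k V g"
  shows "Ck_on k U (\<lambda>x. g (f x))"
  using assms(4,5)
proof (induction k arbitrary: g)
  case 0
  then show ?case
    using assms(3) continuous_on_compose2 by auto
next
  case (Suc k)
  note D = Ck_on_SucD[OF Suc.prems(1)] Ck_on_SucD[OF Suc.prems(2)]
  let ?f' = "\<lambda>x. frechet_derivative f (at x)" and ?g' = "\<lambda>y. frechet_derivative g (at y)"
  have der: "((\<lambda>x. g (f x)) has_derivative (\<lambda>v. ?g' (f x) (?f' x v))) (at x)" if "x \<in> U" for x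
    using D(1)[OF that] D(3)[of "f x"] that assms(3) has_derivative_compose by blast
  have eq: "?g' (f x) (?f' x v) = (\<Sum>b\<in>Basis. (?f' x v \<bullet> b) *\<^sub>R ?g' (f x) b)" if "x \<in> U" for x v
  proof -
    have lin: "linear (?g' (f x))"
      using D(3)[of "f x"] that assms(3) has_derivative_linear by blast
    have "?g' (f x) (?f' x v) = ?g' (f x) (\<Sum>b\<in>Basis. (?f' x v \<bullet> b) *\<^sub>R b)"
      by (simp add: euclidean_representation)
    also have "\<dots> = (\<Sum>b\<in>Basis. (?f' x v \<bullet> b) *\<^sub>R ?g' (f x) b)"
      by (simp add: linear_sum[OF lin] linear_scale[OF lin])
    finally show ?thesis .
  qed
  have "Ck_on k U (\<lambda>x. \<Sum>b\<in>Basis. (?f' x v \<bullet> b) *\<^sub>R ?g' (f x) b)" for v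
    by (intro Ck_on_sum Ck_on_bilinear[OF bounded_bilinear_scaleR] assms(1) D(2)
        Ck_on_bounded_linear[OF bounded_linear_inner_left] Suc.IH D(4)
        Suc.prems(1)[THEN Ck_on_Suc_imp])
  then have "Ck_on k U (\<lambda>x. ?g' (f x) (?f' x v))" for v
    by (subst Ck_on_cong[OF assms(1) eq])
  then show ?case
    using der by (intro Ck_on_SucI[OF assms(1)])
qed

lemma Ck_on_ident: "open U \<Longrightarrow> Ck_on k U (\<lambda>x. x)"
proof (induction k)
  case (Suc k)
  then show ?case
    by (intro Ck_on_SucI[where f' = "\<lambda>_ v. v"]) (auto intro: Ck_on_const)
qed auto

lemma Ck_on_inverse: "Ck_on k (- {0}) (inverse :: real \<Rightarrow> real)"
proof (induction k)
  case 0
  then show ?case by (auto intro!: continuous_intros)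
next
  case (Suc k)
  have o: "open (- {0::real})" by auto
  show ?case
  proof (rule Ck_on_SucI[OF o])
    fix x :: real assume "x \<in> - {0}"
    then show "(inverse has_derivative (\<lambda>v. - (inverse x * v * inverse x))) (at x)"
      by (intro has_derivative_inverse') auto
  next
    fix v :: real
    have "Ck_on k (- {0}) (\<lambda>x::real. inverse x * inverse x * (- v))"
      by (intro Ck_on_bilinear[OF bounded_bilinear_mult] o Suc.IH Ck_on_const)
    then show "Ck_on k (- {0}) (\<lambda>x::real. - (inverse x * v * inverse x))"
      by (simp add: mult_ac)
  qed
qed

section \<open>A flat function and a smooth cutoff on the real line\<close>

definition flat :: "nat \<Rightarrow> real \<Rightarrow> real" where
  "flat n x = (if x \<le> 0 then 0 else exp (- inverse x) * inverse x ^ n)"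

lemma flat_tendsto: "((\<lambda>x::real. exp (- inverse x) * inverse x ^ n) \<longlongrightarrow> 0) (at_right 0)"
proof -
  have "((\<lambda>y::real. y ^ n / exp y) \<longlongrightarrow> 0) at_top"
    by (rule tendsto_power_div_exp_0)
  then have "((\<lambda>x::real. inverse x ^ n / exp (inverse x)) \<longlongrightarrow> 0) (at_right 0)"
    by (rule filterlim_compose) (rule filterlim_inverse_at_top_right)
  then show ?thesis
    by (simp add: exp_minus field_simps)
qed

text \<open>The functions exp(-1/x) / x^n, extended by 0, are closed under differentiation up to
  linear combinations. This is why the exponent is a parameter: the induction over the order of
  smoothness never leaves the family.\<close>

lemma flat_deriv: "(flat n has_real_derivative (flat (n + 2) x - real n * flat (n + 1) x)) (at x)"
proof -
  consider "x < 0" | "x = 0" | "x > 0" by linarith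
  then show ?thesis
  proof cases
    case 1
    have "((\<lambda>_. 0) has_real_derivative 0) (at x)" by auto
    then have "(flat n has_real_derivative 0) (at x)"
      by (rule has_field_derivative_transform_within_open[of _ _ _ "{..<0}"])
        (use 1 in \<open>auto simp: flat_def\<close>)
    then show ?thesis using 1 by (simp add: flat_def)
  next
    case 2
    have "((\<lambda>y. flat n y / y) \<longlongrightarrow> 0) (at_right 0)"
      using flat_tendsto[of "Suc n"]
      by (rule Lim_transform_eventually)
        (auto simp: flat_def eventually_at_right_field field_simps intro!: exI[of _ 1])
    moreover have "((\<lambda>y. flat n y / y) \<longlongrightarrow> 0) (at_left 0)"
      by (rule Lim_transform_eventually[OF tendsto_const])
        (auto simp: flat_def eventually_at_left_field intro!: exI[of _ "-1"])
    ultimately have "((\<lambda>y. flat n y / y) \<longlongrightarrow> 0) (at 0)"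
      by (simp add: filterlim_at_split)
    then show ?thesis
      using 2 by (simp add: has_field_derivative_iff flat_def)
  next
    case 3
    have inv: "(inverse has_real_derivative - (inverse x * inverse x)) (at x)"
      using DERIV_inverse[of x UNIV] 3 by (simp add: power2_eq_square)
    have "((\<lambda>x. exp (- inverse x) * inverse x ^ n) has_real_derivative
        exp (- inverse x) * (real n * (- (inverse x * inverse x) * inverse x ^ (n - Suc 0))) +
        exp (- inverse x) * (- (- (inverse x * inverse x))) * inverse x ^ n) (at x)"
      by (intro DERIV_mult' DERIV_power DERIV_minus inv DERIV_chain2[OF DERIV_exp])
    also have "exp (- inverse x) * (real n * (- (inverse x * inverse x) * inverse x ^ (n - Suc 0))) +
        exp (- inverse x) * (- (- (inverse x * inverse x))) * inverse x ^ n
        = flat (n + 2) x - real n * flat (n + 1) x"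
      using 3 by (cases n) (simp_all add: flat_def algebra_simps)
    finally have "((\<lambda>x. exp (- inverse x) * inverse x ^ n) has_real_derivative
        (flat (n + 2) x - real n * flat (n + 1) x)) (at x)" .
    then show ?thesis
      by (rule has_field_derivative_transform_within_open[of _ _ _ "{0<..}"])
        (use 3 in \<open>auto simp: flat_def\<close>)
  qed
qed

lemma Ck_on_flat: "Ck_on k UNIV (flat n)"
proof (induction k arbitrary: n)
  case 0
  then show ?case
    by (auto intro!: continuous_at_imp_continuous_on DERIV_isCont[OF flat_deriv])
next
  case (Suc k)
  show ?case
  proof (rule Ck_on_SucI)
    show "(flat n has_derivative (\<lambda>v. (flat (n + 2) x - real n * flat (n + 1) x) * v)) (at x)" for x
      using flat_deriv by (rule has_field_derivative_imp_has_derivative)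
    have "Ck_on k UNIV (\<lambda>x. (flat (n + 2) x + (- real n) * flat (n + 1) x) * v)" for v
      by (intro Ck_on_bilinear[OF bounded_bilinear_mult] Ck_on_add Ck_on_const Suc.IH open_UNIV)
    then show "Ck_on k UNIV (\<lambda>x. (flat (n + 2) x - real n * flat (n + 1) x) * v)" for v
      by simp
  qed auto
qed

text \<open>The quotient F(b - s) / (F(b - s) + F(s - a)) for F = \<open>flat 0\<close>. As a < b,
  at least one of the two arguments is positive, so the denominator never vanishes.\<close>

lemma smooth_cutoff:
  fixes a b :: real
  assumes "a < b"
  obtains \<beta> :: "real \<Rightarrow> real" where "\<And>k. Ck_on k UNIV \<beta>" "\<And>s. s \<le> a \<Longrightarrow> \<beta> s = 1" "\<And>s. s \<ge> b \<Longrightarrow> \<beta> s = 0"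
proof -
  have pos: "flat 0 (b - s) + flat 0 (s - a) > 0" for s
    using assms by (auto simp: flat_def add_pos_pos)
  define \<beta> where "\<beta> s = flat 0 (b - s) * inverse (flat 0 (b - s) + flat 0 (s - a))" for s
  have *: "Ck_on k UNIV (\<lambda>s. flat 0 (c * s + d))" for k c d
  proof (rule Ck_on_compose[where V = UNIV and g = "flat 0"])
    show "Ck_on k UNIV (\<lambda>s. c * s + d)"
      by (intro Ck_on_bilinear[OF bounded_bilinear_mult] Ck_on_add Ck_on_const Ck_on_ident open_UNIV)
  qed (auto intro: Ck_on_flat)
  have **: "Ck_on k UNIV (\<lambda>s. flat 0 (b - s))" "Ck_on k UNIV (\<lambda>s. flat 0 (s - a))" for k
    using *[of k "-1" b] *[of k 1 "- a"] by (simp_all add: algebra_simps)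
  have sum: "Ck_on k UNIV (\<lambda>s. flat 0 (b - s) + flat 0 (s - a))" for k
    by (rule Ck_on_add[OF open_UNIV **])
  have "flat 0 (b - s) + flat 0 (s - a) \<noteq> 0" for s
    using pos[of s] by linarith
  then have "range (\<lambda>s. flat 0 (b - s) + flat 0 (s - a)) \<subseteq> - {0}"
    by auto
  from Ck_on_compose[OF open_UNIV _ this sum Ck_on_inverse]
  have "Ck_on k UNIV (\<lambda>s. inverse (flat 0 (b - s) + flat 0 (s - a)))" for k
    by (simp add: open_Compl)
  then have "Ck_on k UNIV \<beta>" for k
    unfolding \<beta>_def by (rule Ck_on_bilinear[OF bounded_bilinear_mult open_UNIV **(1)])
  then show ?thesis
  proof (rule that)
    show "\<beta> s = 1" if "s \<le> a" for s
      using that assms by (simp add: \<beta>_def flat_def)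
    show "\<beta> s = 0" if "s \<ge> b" for s
      using that by (simp add: \<beta>_def flat_def)
  qed
qed

section \<open>Smooth functions on manifolds\<close>

text \<open>Chart images are only relatively open in the model subspace, so smoothness is witnessed
  by an ambient extension \<open>G\<close>. Avoiding the chart inverse lets local representatives be
  composed directly. The identity is required for all points of the chart landing in
  \<open>W\<close>: this is smoothness near \<open>p\<close>, not a condition at \<open>p\<close>
  alone.\<close>

definition smooth_in :: "('m, 'e::euclidean_space) chart \<Rightarrow> 'm \<Rightarrow> ('m \<Rightarrow> 'v::real_normed_vector) \<Rightarrow> bool" where
  "smooth_in c p g \<longleftrightarrow> (\<exists>W G. open W \<and> snd c p \<in> W \<and> (\<forall>k. Ck_on k W G) \<and>
     (\<forall>q\<in>fst c. snd c q \<in> W \<longrightarrow> g q = G (snd c q)))"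

definition smooth_at :: "('m, 'e::euclidean_space) manifold \<Rightarrow> 'm \<Rightarrow> ('m \<Rightarrow> 'v::real_normed_vector) \<Rightarrow> bool" where
  "smooth_at M p g \<longleftrightarrow> (\<exists>c\<in>atlas M. p \<in> fst c \<and> smooth_in c p g)"

lemma smooth_inI:
  assumes "open W" "snd c p \<in> W" "\<And>k. Ck_on k W G"
    and "\<And>q. q \<in> fst c \<Longrightarrow> snd c q \<in> W \<Longrightarrow> g q = G (snd c q)"
  shows "smooth_in c p g"
  using assms unfolding smooth_in_def by blast

lemma smooth_inE:
  assumes "smooth_in c p g"
  obtains W G where "open W" "snd c p \<in> W" "\<And>k. Ck_on k W G"
    "\<And>q. q \<in> fst c \<Longrightarrow> snd c q \<in> W \<Longrightarrow> g q = G (snd c q)"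
  using assms unfolding smooth_in_def by meson

lemma smooth_onE:
  assumes "smooth_on S f" "x \<in> S"
  obtains U g where "open U" "x \<in> U" "\<And>k. Ck_on k U g" "\<And>y. y \<in> S \<Longrightarrow> y \<in> U \<Longrightarrow> f y = g y"
  using assms unfolding smooth_on_def by (meson IntI)

lemma manifold_chart:
  assumes "smooth_manifold M" "c \<in> atlas M"
  shows "open (fst c)" "openin (top_of_set (model_space M)) (snd c ` fst c)"
    and "homeomorphism (fst c) (snd c ` fst c) (snd c) (chart_inv c)"
proof -
  have "\<forall>(U, \<phi>)\<in>atlas M. open U \<and> openin (top_of_set (model_space M)) (\<phi> ` U) \<and>
        homeomorphism U (\<phi> ` U) \<phi> (inv_into U \<phi>)"
    using assms(1) unfolding smooth_manifold_def by blast
  from this[rule_format, OF assms(2)]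
  show "open (fst c)" "openin (top_of_set (model_space M)) (snd c ` fst c)"
    "homeomorphism (fst c) (snd c ` fst c) (snd c) (chart_inv c)"
    by (auto split: prod.splits)
qed

lemma manifold_subspace: "smooth_manifold M \<Longrightarrow> subspace (model_space M)"
  unfolding smooth_manifold_def by blast

lemma manifold_chart_ex:
  assumes "smooth_manifold M"
  obtains c where "c \<in> atlas M" "p \<in> fst c"
  using assms unfolding smooth_manifold_def by blast

lemma chart_inv_chart:
  assumes "smooth_manifold M" "c \<in> atlas M" "q \<in> fst c"
  shows "chart_inv c (snd c q) = q"
  using manifold_chart(3)[OF assms(1,2)] assms(3) by (rule homeomorphism_apply1)

lemma chart_in_model:
  assumes "smooth_manifold M" "c \<in> atlas M" "q \<in> fst c"
  shows "snd c q \<in> model_space M"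
  using openin_subset[OF manifold_chart(2)[OF assms(1,2)]] assms(3) by auto

text \<open>The image of an open set is open in the model subspace, hence the trace of an ambient
  open \<open>W\<close>. The last conclusion, that every model point in \<open>W\<close> is hit, is
  what later allows straight lines and balls of the model subspace to be pulled back to the
  manifold.\<close>

lemma chart_nhd:
  assumes "smooth_manifold M" "c \<in> atlas M" "open A" "p \<in> fst c" "p \<in> A"
  obtains W where "open W" "snd c p \<in> W"
    "\<And>q. q \<in> fst c \<Longrightarrow> snd c q \<in> W \<Longrightarrow> q \<in> A"
    "\<And>y. y \<in> model_space M \<Longrightarrow> y \<in> W \<Longrightarrow> \<exists>q\<in>fst c. q \<in> A \<and> snd c q = y"
proof -
  note hom = manifold_chart[OF assms(1,2)]
  have "openin (top_of_set (fst c)) (fst c \<inter> A)"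
    using assms(3) by (simp add: openin_open_Int)
  then have "openin (top_of_set (snd c ` fst c)) (snd c ` (fst c \<inter> A))"
    by (rule homeomorphism_imp_open_map[OF hom(3)])
  then have "openin (top_of_set (model_space M)) (snd c ` (fst c \<inter> A))"
    using hom(2) openin_trans by blast
  then obtain W where W: "open W" "snd c ` (fst c \<inter> A) = model_space M \<inter> W"
    unfolding openin_open by blast
  show thesis
  proof (rule that[OF W(1)])
    show "snd c p \<in> W" using W(2) assms by blast
    show "q \<in> A" if q: "q \<in> fst c" "snd c q \<in> W" for q
    proof -
      have "snd c q \<in> snd c ` (fst c \<inter> A)"
        unfolding W(2) using chart_in_model[OF assms(1,2) q(1)] q(2) by blast
      then obtain q' where "q' \<in> fst c" "q' \<in> A" "snd c q = snd c q'" by blast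
      then show ?thesis
        using chart_inv_chart[OF assms(1,2)] q(1) by metis
    qed
    show "\<exists>q\<in>fst c. q \<in> A \<and> snd c q = y" if "y \<in> model_space M" "y \<in> W" for y
    proof -
      have "y \<in> snd c ` (fst c \<inter> A)" unfolding W(2) using that by blast
      then show ?thesis by blast
    qed
  qed
qed

lemma chart_nhd_inside:
  assumes "smooth_manifold M" "c \<in> atlas M" "open A" "p \<in> fst c" "p \<in> A"
  obtains W where "open W" "snd c p \<in> W" "\<And>q. q \<in> fst c \<Longrightarrow> snd c q \<in> W \<Longrightarrow> q \<in> A"
  by (rule chart_nhd[OF assms]) (rule that)

lemma smooth_map_local:
  assumes M: "smooth_manifold M" and "smooth_map M N f"
    and c: "c \<in> atlas M" "p \<in> fst c" and c': "c' \<in> atlas N" "f p \<in> fst c'" "open (fst c')"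
  obtains W T where "open W" "snd c p \<in> W" "\<And>k. Ck_on k W T"
    "\<And>q. q \<in> fst c \<Longrightarrow> snd c q \<in> W \<Longrightarrow> f q \<in> fst c' \<and> snd c' (f q) = T (snd c q)"
proof -
  have "open (f -` fst c')"
    using assms(2) c'(3) unfolding smooth_map_def by (blast intro: open_vimage)
  then obtain W where W: "open W" "snd c p \<in> W" "\<And>q. q \<in> fst c \<Longrightarrow> snd c q \<in> W \<Longrightarrow> q \<in> f -` fst c'"
    using chart_nhd[OF M c(1), of "f -` fst c'" p] c(2) c'(2) by (metis vimageI2)
  let ?S = "snd c ` (fst c \<inter> f -` fst c')"
  have "smooth_on ?S (snd c' \<circ> f \<circ> chart_inv c)"
    using assms(2) c c' unfolding smooth_map_def by blast
  moreover have "snd c p \<in> ?S" using c c' by blast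
  ultimately obtain V T where T: "open V" "snd c p \<in> V" "\<And>k. Ck_on k V T"
    "\<And>y. y \<in> ?S \<Longrightarrow> y \<in> V \<Longrightarrow> (snd c' \<circ> f \<circ> chart_inv c) y = T y"
    by (rule smooth_onE) (rule that)
  show thesis
  proof (rule that[of "W \<inter> V" T])
    show "open (W \<inter> V)" "snd c p \<in> W \<inter> V" using W T by auto
    show "Ck_on k (W \<inter> V) T" for k using T(3) by (rule Ck_on_subset) auto
    show "f q \<in> fst c' \<and> snd c' (f q) = T (snd c q)" if "q \<in> fst c" "snd c q \<in> W \<inter> V" for q
      using T(4)[of "snd c q"] W(3)[of q] that chart_inv_chart[OF M c(1) that(1)] by auto
  qed
qed

text \<open>Compatibility of charts, read as smoothness of the identity: every change of chart
  becomes a special case of composing with a smooth map.\<close>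

lemma smooth_map_ident:
  assumes "smooth_manifold M" shows "smooth_map M M (\<lambda>x. x)"
  using assms unfolding smooth_map_def smooth_manifold_def by (auto simp: comp_def)

lemma smooth_in_map:
  assumes M: "smooth_manifold M" and N: "smooth_manifold N" and f: "smooth_map M N f"
    and c: "c \<in> atlas M" "p \<in> fst c" and c': "c' \<in> atlas N" "f p \<in> fst c'" and g: "smooth_in c' (f p) g"
  shows "smooth_in c p (\<lambda>q. g (f q))"
proof -
  obtain W T where T: "open W" "snd c p \<in> W" "\<And>k. Ck_on k W T"
    "\<And>q. q \<in> fst c \<Longrightarrow> snd c q \<in> W \<Longrightarrow> f q \<in> fst c' \<and> snd c' (f q) = T (snd c q)"
    using smooth_map_local[OF M f c c' manifold_chart(1)[OF N c'(1)]] by blast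
  obtain V G where G: "open V" "snd c' (f p) \<in> V" "\<And>k. Ck_on k V G"
     "\<And>q. q \<in> fst c' \<Longrightarrow> snd c' q \<in> V \<Longrightarrow> g q = G (snd c' q)"
    by (rule smooth_inE[OF g]) (rule that)
  have "continuous_on W T" using T(3)[of 0] by simp
  then have op: "open (W \<inter> T -` V)"
    using T(1) G(1) by (simp add: continuous_open_preimage)
  show ?thesis
  proof (rule smooth_inI[OF op])
    show "snd c p \<in> W \<inter> T -` V" using T(2,4) c G(2) by auto
    show "Ck_on k (W \<inter> T -` V) (\<lambda>x. G (T x))" for k
      by (rule Ck_on_compose[OF op G(1) _ Ck_on_subset[OF T(3)] G(3)]) auto
    show "g (f q) = G (T (snd c q))" if "q \<in> fst c" "snd c q \<in> W \<inter> T -` V" for q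
      using T(4)[of q] G(4)[of "f q"] that by auto
  qed
qed

lemma smooth_at_chart:
  assumes "smooth_manifold M" "smooth_at M p g" "c \<in> atlas M" "p \<in> fst c"
  shows "smooth_in c p g"
  using assms smooth_in_map[OF assms(1,1) smooth_map_ident[OF assms(1)] assms(3,4), of _ g]
  unfolding smooth_at_def by blast

lemma smooth_atI: "c \<in> atlas M \<Longrightarrow> p \<in> fst c \<Longrightarrow> smooth_in c p g \<Longrightarrow> smooth_at M p g"
  unfolding smooth_at_def by blast

lemma smooth_at_map:
  assumes "smooth_manifold M" "smooth_manifold N" "smooth_map M N f" "smooth_at N (f p) g"
  shows "smooth_at M p (\<lambda>q. g (f q))"
proof -
  obtain c where "c \<in> atlas M" "p \<in> fst c" using manifold_chart_ex[OF assms(1)] .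
  then show ?thesis
    using assms(4) smooth_in_map[OF assms(1-3)] unfolding smooth_at_def by blast
qed

text \<open>The bridge from the chartwise notion on an open set to smoothness at points, in which
  all later arguments are phrased.\<close>

lemma smooth_fun_on_iff:
  assumes M: "smooth_manifold M" and A: "open A"
  shows "smooth_fun_on M A g \<longleftrightarrow> (\<forall>p\<in>A. smooth_at M p g)"
proof
  assume L: "smooth_fun_on M A g"
  show "\<forall>p\<in>A. smooth_at M p g"
  proof
    fix p assume "p \<in> A"
    obtain c where c: "c \<in> atlas M" "p \<in> fst c" using manifold_chart_ex[OF M] .
    have "smooth_on (snd c ` (fst c \<inter> A)) (g \<circ> chart_inv c)"
      using L c unfolding smooth_fun_on_def by blast
    moreover have "snd c p \<in> snd c ` (fst c \<inter> A)" using c \<open>p \<in> A\<close> by blast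
    ultimately obtain V T where T: "open V" "snd c p \<in> V" "\<And>k. Ck_on k V T"
      "\<And>y. y \<in> snd c ` (fst c \<inter> A) \<Longrightarrow> y \<in> V \<Longrightarrow> (g \<circ> chart_inv c) y = T y"
      by (rule smooth_onE) (rule that)
    obtain W where W: "open W" "snd c p \<in> W" "\<And>q. q \<in> fst c \<Longrightarrow> snd c q \<in> W \<Longrightarrow> q \<in> A"
      by (rule chart_nhd_inside[OF M c(1) A c(2) \<open>p \<in> A\<close>]) (rule that)
    have "smooth_in c p g"
    proof (rule smooth_inI[of "W \<inter> V" _ _ T])
      show "open (W \<inter> V)" "snd c p \<in> W \<inter> V" using W T by auto
      show "Ck_on k (W \<inter> V) T" for k using T(3) by (rule Ck_on_subset) auto
      show "g q = T (snd c q)" if "q \<in> fst c" "snd c q \<in> W \<inter> V" for q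
        using T(4)[of "snd c q"] W(3)[of q] that chart_inv_chart[OF M c(1) that(1)] by auto
    qed
    then show "smooth_at M p g" by (rule smooth_atI[OF c(1,2)])
  qed
next
  assume R: "\<forall>p\<in>A. smooth_at M p g"
  show "smooth_fun_on M A g"
    unfolding smooth_fun_on_def smooth_on_def
  proof (intro ballI)
    fix c x assume c: "c \<in> atlas M" and "x \<in> snd c ` (fst c \<inter> A)"
    then obtain p where p: "p \<in> fst c" "p \<in> A" "x = snd c p" by blast
    have sm: "smooth_in c p g" using R p c smooth_at_chart[OF M] by blast
    obtain V G where G: "open V" "snd c p \<in> V" "\<And>k. Ck_on k V G"
     "\<And>q. q \<in> fst c \<Longrightarrow> snd c q \<in> V \<Longrightarrow> g q = G (snd c q)"
      by (rule smooth_inE[OF sm]) (rule that)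
    have "(g \<circ> chart_inv c) y = G y" if "y \<in> snd c ` (fst c \<inter> A) \<inter> V" for y
      using that G(4) chart_inv_chart[OF M c] by auto
    then show "\<exists>U h. open U \<and> x \<in> U \<and> (\<forall>k. Ck_on k U h) \<and>
        (\<forall>y\<in>snd c ` (fst c \<inter> A) \<inter> U. (g \<circ> chart_inv c) y = h y)"
      using G(1-3) p(3) by (intro exI[of _ V] exI[of _ G]) simp
  qed
qed

lemma smooth_functions_iff:
  "smooth_manifold M \<Longrightarrow> f \<in> smooth_functions M \<longleftrightarrow> (\<forall>p. smooth_at M p f)"
  unfolding smooth_functions_def by (simp add: smooth_fun_on_iff)

lemma smooth_at_cong:
  assumes M: "smooth_manifold M" and "smooth_at M p f" "open V" "p \<in> V" "\<And>q. q \<in> V \<Longrightarrow> f q = g q"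
  shows "smooth_at M p g"
proof -
  obtain c where c: "c \<in> atlas M" "p \<in> fst c" "smooth_in c p f"
    using assms(2) unfolding smooth_at_def by blast
  obtain W G where G: "open W" "snd c p \<in> W" "\<And>k. Ck_on k W G"
     "\<And>q. q \<in> fst c \<Longrightarrow> snd c q \<in> W \<Longrightarrow> f q = G (snd c q)"
    by (rule smooth_inE[OF c(3)]) (rule that)
  obtain W' where W': "open W'" "snd c p \<in> W'" "\<And>q. q \<in> fst c \<Longrightarrow> snd c q \<in> W' \<Longrightarrow> q \<in> V"
    by (rule chart_nhd_inside[OF M c(1) assms(3) c(2) assms(4)]) (rule that)
  have "smooth_in c p g"
  proof (rule smooth_inI[of "W \<inter> W'" _ _ G])
    show "open (W \<inter> W')" "snd c p \<in> W \<inter> W'" using W' G by auto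
    show "Ck_on k (W \<inter> W') G" for k using G(3) by (rule Ck_on_subset) auto
    show "g q = G (snd c q)" if "q \<in> fst c" "snd c q \<in> W \<inter> W'" for q
      using G(4)[of q] W'(3)[of q] assms(5)[of q] that by auto
  qed
  then show ?thesis by (rule smooth_atI[OF c(1,2)])
qed

lemma smooth_at_const:
  assumes "smooth_manifold M" shows "smooth_at M p (\<lambda>q. a)"
proof -
  obtain c where "c \<in> atlas M" "p \<in> fst c" using manifold_chart_ex[OF assms(1)] .
  moreover have "smooth_in c p (\<lambda>q. a)"
    by (rule smooth_inI[of UNIV _ _ "\<lambda>_. a"]) (auto intro: Ck_on_const)
  ultimately show ?thesis by (rule smooth_atI)
qed

lemma smooth_at_chart_self:
  assumes "c \<in> atlas M" "p \<in> fst c" shows "smooth_at M p (snd c)"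
  by (rule smooth_atI[OF assms], rule smooth_inI[of UNIV _ _ "\<lambda>x. x"]) (auto intro: Ck_on_ident)

lemma smooth_at_Pair:
  assumes M: "smooth_manifold M" and "smooth_at M p f" "smooth_at M p g"
  shows "smooth_at M p (\<lambda>q. (f q, g q))"
proof -
  obtain c where c: "c \<in> atlas M" "p \<in> fst c" using manifold_chart_ex[OF M] .
  obtain W F where F: "open W" "snd c p \<in> W" "\<And>k. Ck_on k W F"
     "\<And>q. q \<in> fst c \<Longrightarrow> snd c q \<in> W \<Longrightarrow> f q = F (snd c q)"
    by (rule smooth_inE[OF smooth_at_chart[OF M assms(2) c]]) (rule that)
  obtain V G where G: "open V" "snd c p \<in> V" "\<And>k. Ck_on k V G"
     "\<And>q. q \<in> fst c \<Longrightarrow> snd c q \<in> V \<Longrightarrow> g q = G (snd c q)"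
    by (rule smooth_inE[OF smooth_at_chart[OF M assms(3) c]]) (rule that)
  have "smooth_in c p (\<lambda>q. (f q, g q))"
  proof (rule smooth_inI[of "W \<inter> V" _ _ "\<lambda>x. (F x, G x)"])
    show "open (W \<inter> V)" "snd c p \<in> W \<inter> V" using F G by auto
    then show "Ck_on k (W \<inter> V) (\<lambda>x. (F x, G x))" for k
      by (intro Ck_on_Pair Ck_on_subset[OF F(3)] Ck_on_subset[OF G(3)]) auto
  qed (use F G in auto)
  then show ?thesis by (rule smooth_atI[OF c(1,2)])
qed

lemma smooth_at_comp:
  fixes f :: "'m::topological_space \<Rightarrow> 'b::euclidean_space"
  assumes "smooth_at M p f" "open V" "f p \<in> V" "\<And>k. Ck_on k V g"
  shows "smooth_at M p (\<lambda>q. g (f q))"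
proof -
  obtain c where c: "c \<in> atlas M" "p \<in> fst c" "smooth_in c p f"
    using assms(1) unfolding smooth_at_def by blast
  obtain W F where F: "open W" "snd c p \<in> W" "\<And>k. Ck_on k W F"
     "\<And>q. q \<in> fst c \<Longrightarrow> snd c q \<in> W \<Longrightarrow> f q = F (snd c q)"
    by (rule smooth_inE[OF c(3)]) (rule that)
  have "continuous_on W F" using F(3)[of 0] by simp
  then have op: "open (W \<inter> F -` V)"
    using F(1) assms(2) by (simp add: continuous_open_preimage)
  have "smooth_in c p (\<lambda>q. g (f q))"
  proof (rule smooth_inI[OF op])
    show "snd c p \<in> W \<inter> F -` V" using F(2,4) c assms(3) by auto
    show "Ck_on k (W \<inter> F -` V) (\<lambda>x. g (F x))" for k
      by (rule Ck_on_compose[OF op assms(2) _ Ck_on_subset[OF F(3)] assms(4)]) auto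
  qed (use F in auto)
  then show ?thesis by (rule smooth_atI[OF c(1,2)])
qed

lemma smooth_at_linear:
  fixes f :: "'m::topological_space \<Rightarrow> 'b::euclidean_space"
  assumes "smooth_at M p f" "bounded_linear L"
  shows "smooth_at M p (\<lambda>q. L (f q))"
  by (rule smooth_at_comp[OF assms(1) open_UNIV UNIV_I]) (intro Ck_on_bounded_linear[OF assms(2)] Ck_on_ident open_UNIV)

lemma smooth_at_bilinear:
  fixes f :: "'m::{t2_space, second_countable_topology} \<Rightarrow> 'b::euclidean_space" and g :: "'m \<Rightarrow> 'c::euclidean_space"
  assumes "smooth_manifold M" "smooth_at M p f" "smooth_at M p g" "bounded_bilinear pr"
  shows "smooth_at M p (\<lambda>q. pr (f q) (g q))"
proof -
  have "Ck_on k UNIV (\<lambda>z. pr (fst z) (snd z))" for k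
    by (intro Ck_on_bilinear[OF assms(4)] Ck_on_bounded_linear[OF bounded_linear_fst]
        Ck_on_bounded_linear[OF bounded_linear_snd] Ck_on_ident open_UNIV)
  from smooth_at_comp[OF smooth_at_Pair[OF assms(1-3)] open_UNIV UNIV_I this] show ?thesis by simp
qed

lemma smooth_at_add:
  fixes f g :: "'m::{t2_space, second_countable_topology} \<Rightarrow> 'b::euclidean_space"
  assumes "smooth_manifold M" "smooth_at M p f" "smooth_at M p g"
  shows "smooth_at M p (\<lambda>q. f q + g q)"
proof -
  have "Ck_on k UNIV (\<lambda>z::'b \<times> 'b. fst z + snd z)" for k
    by (intro Ck_on_add Ck_on_bounded_linear[OF bounded_linear_fst]
        Ck_on_bounded_linear[OF bounded_linear_snd] Ck_on_ident open_UNIV)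
  from smooth_at_comp[OF smooth_at_Pair[OF assms(1-3)] open_UNIV UNIV_I this] show ?thesis by simp
qed

lemma smooth_at_sum:
  fixes f :: "'i \<Rightarrow> 'm::{t2_space, second_countable_topology} \<Rightarrow> 'b::euclidean_space"
  assumes "smooth_manifold M" "\<And>i. i \<in> A \<Longrightarrow> smooth_at M p (f i)"
  shows "smooth_at M p (\<lambda>q. \<Sum>i\<in>A. f i q)"
proof (cases "finite A")
  case True
  then show ?thesis using assms(2)
    by (induction A) (auto intro: smooth_at_add smooth_at_const assms(1))
qed (auto intro: smooth_at_const assms(1))

lemmas smooth_at_scaleR = smooth_at_bilinear[OF _ _ _ bounded_bilinear_scaleR]
lemmas smooth_at_mult = smooth_at_bilinear[OF _ _ _ bounded_bilinear_mult]
lemmas smooth_at_inner = smooth_at_bilinear[OF _ _ _ bounded_bilinear_inner]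

lemma smooth_at_prod:
  fixes f :: "'i \<Rightarrow> 'm::{t2_space, second_countable_topology} \<Rightarrow> real"
  assumes "smooth_manifold M" "\<And>i. i \<in> A \<Longrightarrow> smooth_at M p (f i)"
  shows "smooth_at M p (\<lambda>q. \<Prod>i\<in>A. f i q)"
proof (cases "finite A")
  case True
  then show ?thesis using assms(2)
    by (induction A) (auto intro: smooth_at_mult smooth_at_const assms(1))
qed (auto intro: smooth_at_const assms(1))

lemma smooth_at_minus:
  fixes f :: "'m::topological_space \<Rightarrow> 'b::euclidean_space"
  assumes "smooth_at M p f"
  shows "smooth_at M p (\<lambda>q. - f q)"
  by (rule smooth_at_linear[OF assms]) (simp add: bounded_linear_minus bounded_linear_ident)

lemma smooth_at_diff:
  fixes f g :: "'m::{t2_space, second_countable_topology} \<Rightarrow> 'b::euclidean_space"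
  assumes "smooth_manifold M" "smooth_at M p f" "smooth_at M p g"
  shows "smooth_at M p (\<lambda>q. f q - g q)"
  using smooth_at_add[OF assms(1,2) smooth_at_minus[OF assms(3)]] by simp

lemma smooth_at_inverse:
  fixes f :: "'m::topological_space \<Rightarrow> real"
  assumes "smooth_at M p f" "f p \<noteq> 0"
  shows "smooth_at M p (\<lambda>q. inverse (f q))"
  by (rule smooth_at_comp[OF assms(1), of "- {0}"]) (use assms in \<open>auto intro: Ck_on_inverse\<close>)

lemma smooth_at_imp_nonzero_nhd:
  fixes f :: "'m::{t2_space, second_countable_topology} \<Rightarrow> real"
  assumes M: "smooth_manifold M" and "smooth_at M p f" "f p \<noteq> 0"
  obtains V where "open V" "p \<in> V" "\<And>q. q \<in> V \<Longrightarrow> f q \<noteq> 0"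
proof -
  obtain c where c: "c \<in> atlas M" "p \<in> fst c" "smooth_in c p f"
    using assms(2) unfolding smooth_at_def by blast
  obtain W F where F: "open W" "snd c p \<in> W" "\<And>k. Ck_on k W F"
     "\<And>q. q \<in> fst c \<Longrightarrow> snd c q \<in> W \<Longrightarrow> f q = F (snd c q)"
    by (rule smooth_inE[OF c(3)]) (rule that)
  have "continuous_on W F" using F(3)[of 0] by simp
  then have op: "open (W \<inter> F -` (- {0}))"
    using F(1) by (intro continuous_open_preimage) auto
  have "continuous_on (fst c) (snd c)"
    using homeomorphism_cont1[OF manifold_chart(3)[OF M c(1)]] .
  then have "open (fst c \<inter> snd c -` (W \<inter> F -` (- {0})))"
    by (rule continuous_open_preimage[OF _ manifold_chart(1)[OF M c(1)] op])
  then show thesis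
    by (rule that) (use c F assms in auto)
qed

text \<open>Transition maps of bundles are given as families. Substituting a representative of a
  section into such a family yields its representative in another trivialization.\<close>

lemma smooth_at_fam:
  fixes u :: "'m::{t2_space, second_countable_topology} \<Rightarrow> 'w::euclidean_space"
  assumes M: "smooth_manifold M" and A: "open A" "p \<in> A"
    and g: "smooth_fam_on M A W g" and u: "smooth_at M p u" "\<And>q. q \<in> A \<Longrightarrow> u q \<in> W"
  shows "smooth_at M p (\<lambda>q. g q (u q))"
proof -
  obtain c where c: "c \<in> atlas M" "p \<in> fst c" using manifold_chart_ex[OF M] .
  let ?S = "(snd c ` (fst c \<inter> A)) \<times> W"
  have "smooth_on ?S (\<lambda>(x, w). g (chart_inv c x) w)"
    using g c unfolding smooth_fam_on_def by blast
  moreover have "(snd c p, u p) \<in> ?S" using c A u by blast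
  ultimately obtain V T where T: "open V" "(snd c p, u p) \<in> V" "\<And>k. Ck_on k V T"
      "\<And>y. y \<in> ?S \<Longrightarrow> y \<in> V \<Longrightarrow> (case y of (x, w) \<Rightarrow> g (chart_inv c x) w) = T y"
    by (rule smooth_onE) (rule that)
  have "smooth_at M p (\<lambda>q. T (snd c q, u q))"
    by (rule smooth_at_comp[OF smooth_at_Pair[OF M smooth_at_chart_self[OF c] u(1)] T(1,2,3)])
  moreover
  \<comment> \<open>Continuity of the pair of the chart and \<open>u\<close> is read off from a
    local representative of the pair. It provides the open set on which the extension
    \<open>T\<close> of the family may be used.\<close>
  obtain Q U where U: "open Q" "snd c p \<in> Q" "\<And>k. Ck_on k Q U"
     "\<And>q. q \<in> fst c \<Longrightarrow> snd c q \<in> Q \<Longrightarrow> (snd c q, u q) = U (snd c q)"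
    by (rule smooth_inE[OF smooth_at_chart[OF M smooth_at_Pair[OF M smooth_at_chart_self[OF c] u(1)] c]]) (rule that)
  have "continuous_on Q U" using U(3)[of 0] by simp
  then have op: "open (Q \<inter> U -` V)"
    using U(1) T(1) by (intro continuous_open_preimage) auto
  have "continuous_on (fst c) (snd c)"
    using homeomorphism_cont1[OF manifold_chart(3)[OF M c(1)]] .
  then have "open (A \<inter> (fst c \<inter> snd c -` (Q \<inter> U -` V)))"
    by (intro open_Int A(1) continuous_open_preimage[OF _ manifold_chart(1)[OF M c(1)] op])
  moreover have "p \<in> A \<inter> (fst c \<inter> snd c -` (Q \<inter> U -` V))"
    using A c U(2,4) T(2) by auto
  moreover have "T (snd c q, u q) = g q (u q)" if "q \<in> A \<inter> (fst c \<inter> snd c -` (Q \<inter> U -` V))" for q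
  proof -
    have "(snd c q, u q) \<in> V" using that U(4)[of q] by auto
    moreover have "(snd c q, u q) \<in> ?S" using that u(2) by auto
    ultimately show ?thesis
      using T(4)[of "(snd c q, u q)"] that chart_inv_chart[OF M c(1)] by auto
  qed
  ultimately show ?thesis
    by (rule smooth_at_cong[OF M])
qed

text \<open>For the extension by 0 to be smooth, the support must be closed in the whole manifold.
  It is the image under the inverse chart of the compact trace of a ball on the model subspace,
  hence compact, hence closed because the manifold is Hausdorff.\<close>

lemma smooth_bump:
  fixes M :: "('m::{t2_space, second_countable_topology}, 'e::euclidean_space) manifold"
  assumes M: "smooth_manifold M" and U: "open U" "p \<in> U"
  obtains \<kappa> :: "'m \<Rightarrow> real" and V K where "\<And>q. smooth_at M q \<kappa>" "open V" "p \<in> V"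
    "\<And>q. q \<in> V \<Longrightarrow> \<kappa> q = 1" "V \<subseteq> K" "closed K" "K \<subseteq> U" "\<And>q. q \<notin> K \<Longrightarrow> \<kappa> q = 0"
proof -
  obtain c where c: "c \<in> atlas M" "p \<in> fst c" using manifold_chart_ex[OF M] .
  note hom = manifold_chart[OF M c(1)]
  have "open (fst c \<inter> U)" using hom U by auto
  then obtain W where W: "open W" "snd c p \<in> W"
    "\<And>y. y \<in> model_space M \<Longrightarrow> y \<in> W \<Longrightarrow> \<exists>q\<in>fst c. q \<in> fst c \<inter> U \<and> snd c q = y"
    by (rule chart_nhd[OF M c(1) _ c(2), of "fst c \<inter> U"]) (use c U that in auto)
  obtain r where r: "r > 0" "cball (snd c p) r \<subseteq> W"
    using W open_contains_cball by blast
  define C where "C = model_space M \<inter> cball (snd c p) r"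
  have "compact C"
    unfolding C_def using closed_subspace[OF manifold_subspace[OF M]]
    by (simp add: closed_Int_compact)
  have CS: "C \<subseteq> snd c ` (fst c \<inter> U)"
    using W(3) r unfolding C_def by blast
  define K where "K = chart_inv c ` C"
  have "continuous_on C (chart_inv c)"
    using homeomorphism_cont2[OF hom(3)] by (rule continuous_on_subset) (use CS in blast)
  then have "compact K" unfolding K_def using \<open>compact C\<close> by (rule compact_continuous_image)
  then have K: "closed K" by (rule compact_imp_closed)
  have KU: "K \<subseteq> fst c \<inter> U"
    unfolding K_def using CS chart_inv_chart[OF M c(1)] by force
  obtain \<beta> :: "real \<Rightarrow> real" where \<beta>: "\<And>k. Ck_on k UNIV \<beta>" "\<And>s. s \<le> (r/2)\<^sup>2 \<Longrightarrow> \<beta> s = 1" "\<And>s. s \<ge> r\<^sup>2 \<Longrightarrow> \<beta> s = 0"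
    using smooth_cutoff[of "(r/2)\<^sup>2" "r\<^sup>2"] r by (auto simp: power2_eq_square)
  \<comment> \<open>The squared distance is used since it is smooth at the centre as well; the radii
    r/2 and r appear squared in \<beta> for the same reason.\<close>
  define b where "b x = \<beta> ((x - snd c p) \<bullet> (x - snd c p))" for x
  define \<kappa> where "\<kappa> q = (if q \<in> fst c then b (snd c q) else 0)" for q
  have diff: "Ck_on k UNIV (\<lambda>x. x - snd c p)" for k
    using Ck_on_add[OF open_UNIV Ck_on_ident[OF open_UNIV] Ck_on_const[OF open_UNIV], of k "- snd c p"] by simp
  have b: "Ck_on k UNIV b" for k
    unfolding b_def
    by (rule Ck_on_compose[OF open_UNIV open_UNIV subset_UNIV
          Ck_on_bilinear[OF bounded_bilinear_inner open_UNIV diff diff] \<beta>(1)])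
  have out: "\<kappa> q = 0" if "q \<notin> K" for q
  proof (cases "q \<in> fst c")
    case True
    have "snd c q \<notin> cball (snd c p) r"
    proof
      assume "snd c q \<in> cball (snd c p) r"
      then have "snd c q \<in> C" unfolding C_def using chart_in_model[OF M c(1) True] by blast
      then have "q \<in> K" unfolding K_def using chart_inv_chart[OF M c(1) True] by force
      then show False using that by blast
    qed
    then have "r \<le> norm (snd c q - snd c p)" by (simp add: dist_norm norm_minus_commute)
    then have "r\<^sup>2 \<le> (norm (snd c q - snd c p))\<^sup>2" using r by (intro power_mono) auto
    then show ?thesis
      using True \<beta>(3) by (simp add: \<kappa>_def b_def power2_norm_eq_inner)
  qed (simp add: \<kappa>_def)
  have sm: "smooth_at M q \<kappa>" for q
  proof (cases "q \<in> fst c")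
    case True
    show ?thesis
      by (rule smooth_atI[OF c(1) True], rule smooth_inI[of UNIV _ _ b]) (auto simp: \<kappa>_def b)
  next
    case False
    show ?thesis
      by (rule smooth_at_cong[OF M smooth_at_const[OF M, of q 0], of "- K"])
        (use False K KU out in auto)
  qed
  define V where "V = fst c \<inter> snd c -` ball (snd c p) (r/2)"
  have "open V"
    unfolding V_def
    by (rule continuous_open_preimage[OF homeomorphism_cont1[OF hom(3)] hom(1) open_ball])
  moreover have one: "\<kappa> q = 1" if "q \<in> V" for q
  proof -
    have "norm (snd c q - snd c p) \<le> r/2" using that by (simp add: V_def dist_norm norm_minus_commute)
    then have "(norm (snd c q - snd c p))\<^sup>2 \<le> (r/2)\<^sup>2" by (intro power_mono) auto
    then show ?thesis
      using that \<beta>(2) by (simp add: \<kappa>_def b_def V_def power2_norm_eq_inner)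
  qed
  moreover have "V \<subseteq> K" using one out by force
  ultimately show thesis
    by (intro that[OF sm _ _ _ _ K _ out]) (use c r KU in \<open>auto simp: V_def\<close>)
qed

lemma smooth_at_extend:
  fixes f :: "'m::{t2_space, second_countable_topology} \<Rightarrow> 'v::euclidean_space"
  assumes M: "smooth_manifold M" and "open U" "\<And>q. smooth_at M q \<kappa>" "closed K" "K \<subseteq> U" "\<And>q. q \<notin> K \<Longrightarrow> \<kappa> q = 0"
    and "\<And>q. q \<in> U \<Longrightarrow> smooth_at M q f"
  shows "smooth_at M q (\<lambda>q. \<kappa> q *\<^sub>R f q)"
proof (cases "q \<in> U")
  case True
  then show ?thesis using assms by (intro smooth_at_scaleR)
next
  case False
  show ?thesis
    by (rule smooth_at_cong[OF M smooth_at_const[OF M, of q 0], of "- K"])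
      (use False assms(4-6) in auto)
qed

section \<open>Derivatives along vector fields\<close>

text \<open>For \<open>v\<close> in the model subspace the line through the image of
  \<open>p\<close> stays in the chart image for small parameters, so the chart inverse is evaluated
  only where it is meaningful. In particular the value does not depend on the extension
  \<open>G\<close>.\<close>

lemma dir_deriv_chart:
  fixes G :: "'e::euclidean_space \<Rightarrow> 'v::real_normed_vector"
    and M :: "('m::{t2_space, second_countable_topology}, 'e) manifold"
  assumes M: "smooth_manifold M" and c: "c \<in> atlas M" "p \<in> fst c" and v: "v \<in> model_space M"
    and W: "open W" "snd c p \<in> W" and G: "(G has_derivative D) (at (snd c p))"
    and eq: "\<And>q. q \<in> fst c \<Longrightarrow> snd c q \<in> W \<Longrightarrow> g q = G (snd c q)"
  shows "dir_deriv (g \<circ> chart_inv c) (snd c p) v = D v"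
proof -
  obtain W' where W': "open W'" "snd c p \<in> W'"
    "\<And>y. y \<in> model_space M \<Longrightarrow> y \<in> W' \<Longrightarrow> \<exists>q\<in>fst c. q \<in> UNIV \<and> snd c q = y"
    by (rule chart_nhd[OF M c(1) open_UNIV c(2) UNIV_I]) (rule that)
  let ?\<gamma> = "\<lambda>t. snd c p + t *\<^sub>R v"
  let ?S = "?\<gamma> -` (W \<inter> W')"
  have S: "open ?S" "0 \<in> ?S"
    using W W' by (auto intro!: open_vimage continuous_intros)
  have \<gamma>: "(?\<gamma> has_derivative (\<lambda>t. t *\<^sub>R v)) (at 0)"
    by (auto intro!: derivative_eq_intros)
  have "((\<lambda>t. G (?\<gamma> t)) has_derivative (\<lambda>t. D (t *\<^sub>R v))) (at 0)"
    by (rule has_derivative_compose[OF \<gamma>]) (use G in simp)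
  moreover have "D (t *\<^sub>R v) = t *\<^sub>R D v" for t
    using has_derivative_linear[OF G] linear_scale by blast
  ultimately have "((\<lambda>t. G (?\<gamma> t)) has_vector_derivative D v) (at 0)"
    by (simp add: has_vector_derivative_def)
  then have "((\<lambda>t. (g \<circ> chart_inv c) (?\<gamma> t)) has_vector_derivative D v) (at 0)"
  proof (rule has_vector_derivative_transform_within_open[OF _ S])
    fix t assume t: "t \<in> ?S"
    have "?\<gamma> t \<in> model_space M"
      using manifold_subspace[OF M] chart_in_model[OF M c] v by (intro subspace_add subspace_scale)
    then obtain q where "q \<in> fst c" "snd c q = ?\<gamma> t"
      using W'(3)[of "?\<gamma> t"] t by auto
    then show "G (?\<gamma> t) = (g \<circ> chart_inv c) (?\<gamma> t)"
      using eq[of q] t chart_inv_chart[OF M c(1), of q] by (metis Int_iff comp_apply vimageE)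
  qed
  then show ?thesis
    unfolding dir_deriv_def by (rule vector_derivative_at)
qed

text \<open>The transported vector has to lie in the model subspace of \<open>N\<close>, since in
  other directions the composite with the chart inverse carries no information. The hypothesis
  \<open>w\<close> ensures this; it holds when the vector is an entry of a tangent vector.\<close>

lemma dir_deriv_chain:
  fixes M :: "('m::{t2_space, second_countable_topology}, 'e::euclidean_space) manifold"
    and N :: "('n::{t2_space, second_countable_topology}, 'd::euclidean_space) manifold"
  assumes M: "smooth_manifold M" and N: "smooth_manifold N" and f: "smooth_map M N f"
    and c: "c \<in> atlas M" "p \<in> fst c" and c': "c' \<in> atlas N" "f p \<in> fst c'"
    and v: "v \<in> model_space M" and w: "dir_deriv (snd c' \<circ> f \<circ> chart_inv c) (snd c p) v \<in> model_space N"
    and g: "smooth_at N (f p) g"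
  shows "dir_deriv ((\<lambda>q. g (f q)) \<circ> chart_inv c) (snd c p) v =
    dir_deriv (g \<circ> chart_inv c') (snd c' (f p)) (dir_deriv (snd c' \<circ> f \<circ> chart_inv c) (snd c p) v)"
proof -
  obtain W T where T: "open W" "snd c p \<in> W" "\<And>k. Ck_on k W T"
    "\<And>q. q \<in> fst c \<Longrightarrow> snd c q \<in> W \<Longrightarrow> f q \<in> fst c' \<and> snd c' (f q) = T (snd c q)"
    by (rule smooth_map_local[OF M f c c' manifold_chart(1)[OF N c'(1)]]) (rule that)
  obtain V G where G: "open V" "snd c' (f p) \<in> V" "\<And>k. Ck_on k V G"
     "\<And>q. q \<in> fst c' \<Longrightarrow> snd c' q \<in> V \<Longrightarrow> g q = G (snd c' q)"
    by (rule smooth_inE[OF smooth_at_chart[OF N g c']]) (rule that)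
  have "continuous_on W T" using T(3)[of 0] by simp
  then have op: "open (W \<inter> T -` V)"
    using T(1) G(1) by (simp add: continuous_open_preimage)
  have Tp: "snd c' (f p) = T (snd c p)" using T(2,4) c by blast
  let ?DT = "frechet_derivative T (at (snd c p))"
  let ?DG = "frechet_derivative G (at (snd c' (f p)))"
  have DT: "(T has_derivative ?DT) (at (snd c p))"
    by (rule Ck_on_SucD(1)[OF T(3,2)])
  have DG: "(G has_derivative ?DG) (at (snd c' (f p)))"
    by (rule Ck_on_SucD(1)[OF G(3,2)])
  have 1: "dir_deriv (snd c' \<circ> f \<circ> chart_inv c) (snd c p) v = ?DT v"
    by (rule dir_deriv_chart[OF M c v T(1,2) DT]) (use T(4) in auto)
  have "((\<lambda>x. G (T x)) has_derivative (\<lambda>x. ?DG (?DT x))) (at (snd c p))"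
    by (rule has_derivative_compose[OF DT]) (use DG Tp in simp)
  then have 2: "dir_deriv ((\<lambda>q. g (f q)) \<circ> chart_inv c) (snd c p) v = ?DG (?DT v)"
    by (rule dir_deriv_chart[OF M c v op, rotated]) (use T(2,4) G(2,4) Tp in auto)
  show ?thesis
    unfolding 2 1 by (rule dir_deriv_chart[OF N c' _ G(1,2) DG G(4), symmetric]) (use w 1 in simp_all)
qed

lemma chart_at:
  assumes "smooth_manifold M"
  shows "chart_at M p \<in> atlas M" "p \<in> fst (chart_at M p)"
proof -
  have "\<exists>c. c \<in> atlas M \<and> p \<in> fst c" using manifold_chart_ex[OF assms] by blast
  from someI_ex[OF this] show "chart_at M p \<in> atlas M" "p \<in> fst (chart_at M p)"
    unfolding chart_at_def by blast+
qed

lemma fibre_tangent_bundle: "x \<in> fibre (tangent_bundle M) p \<longleftrightarrow> fst x = p \<and> snd x \<in> tangent_space M p"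
  unfolding fibre_def tangent_bundle_def by auto

lemma tangent_space_model:
  "v \<in> tangent_space M p \<Longrightarrow> c \<in> atlas M \<Longrightarrow> p \<in> fst c \<Longrightarrow> v c \<in> model_space M"
  unfolding tangent_space_def by blast

text \<open>The transformation law of tangent vectors is the chain rule for the identity between two
  charts, so the chart chosen in \<open>vf_apply\<close> may be exchanged for any other around
  \<open>p\<close>.\<close>

lemma vf_apply_chart:
  assumes M: "smooth_manifold M" and X: "X p \<in> fibre (tangent_bundle M) p"
    and f: "smooth_at M p f" and c: "c \<in> atlas M" "p \<in> fst c"
  shows "vf_apply M X f p = dir_deriv (f \<circ> chart_inv c) (snd c p) (snd (X p) c)"
proof -
  let ?a = "chart_at M p"
  note a = chart_at[OF M, of p]
  have T: "snd (X p) \<in> tangent_space M p" using X by (simp add: fibre_tangent_bundle)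
  have tr: "snd (X p) c = dir_deriv (snd c \<circ> (\<lambda>x. x) \<circ> chart_inv ?a) (snd ?a p) (snd (X p) ?a)"
  proof -
    have "\<forall>c\<in>atlas M. \<forall>c'\<in>atlas M. p \<in> fst c \<inter> fst c' \<longrightarrow>
        snd (X p) c' = dir_deriv (snd c' \<circ> chart_inv c) (snd c p) (snd (X p) c)"
      using T unfolding tangent_space_def mem_Collect_eq by (elim conjE)
    from this[rule_format, OF a(1) c(1)] a(2) c(2) show ?thesis
      by (simp add: comp_def)
  qed
  have "vf_apply M X f p = dir_deriv ((\<lambda>q. f q) \<circ> chart_inv ?a) (snd ?a p) (snd (X p) ?a)"
    by (simp add: vf_apply_def Let_def)
  also have "\<dots> = dir_deriv (f \<circ> chart_inv c) (snd c p)
      (dir_deriv (snd c \<circ> (\<lambda>x. x) \<circ> chart_inv ?a) (snd ?a p) (snd (X p) ?a))"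
    by (rule dir_deriv_chain[OF M M smooth_map_ident[OF M] a c])
      (use tangent_space_model[OF T a] tangent_space_model[OF T c] tr f in auto)
  finally show ?thesis unfolding tr .
qed

lemma vf_apply_deriv:
  fixes M :: "('m::{t2_space, second_countable_topology}, 'e::euclidean_space) manifold"
  assumes M: "smooth_manifold M" and X: "X p \<in> fibre (tangent_bundle M) p"
    and f: "smooth_at M p f" and c: "c \<in> atlas M" "p \<in> fst c"
    and W: "open W" "snd c p \<in> W" and G: "(G has_derivative D) (at (snd c p))"
    and eq: "\<And>q. q \<in> fst c \<Longrightarrow> snd c q \<in> W \<Longrightarrow> f q = G (snd c q)"
  shows "vf_apply M X f p = D (snd (X p) c)"
proof -
  have "snd (X p) c \<in> model_space M"
    using X tangent_space_model[OF _ c] by (simp add: fibre_tangent_bundle)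
  from dir_deriv_chart[OF M c this W G eq] show ?thesis
    unfolding vf_apply_chart[where X = X and p = p, OF M X f c] .
qed

text \<open>\<open>tangent_map\<close> and \<open>vf_apply\<close> use the same chosen chart at
  \<open>p\<close>, so with the chosen charts on both sides relatedness is literally the chain
  rule.\<close>

lemma vf_apply_map:
  fixes M :: "('m::{t2_space, second_countable_topology}, 'e::euclidean_space) manifold"
    and N :: "('n::{t2_space, second_countable_topology}, 'd::euclidean_space) manifold"
  assumes M: "smooth_manifold M" and N: "smooth_manifold N" and f: "smooth_map M N f"
    and X: "X p \<in> fibre (tangent_bundle M) p" and Y: "Y (f p) \<in> fibre (tangent_bundle N) (f p)"
    and XY: "Y (f p) = tangent_map M N f (X p)" and g: "smooth_at N (f p) g"
  shows "vf_apply N Y g (f p) = vf_apply M X (\<lambda>q. g (f q)) p"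
proof -
  let ?c = "chart_at M p" and ?c' = "chart_at N (f p)"
  note c = chart_at[OF M, of p] and c' = chart_at[OF N, of "f p"]
  have X': "fst (X p) = p" "snd (X p) \<in> tangent_space M p"
    and Y': "snd (Y (f p)) \<in> tangent_space N (f p)"
    using X Y by (auto simp: fibre_tangent_bundle)
  have w: "snd (Y (f p)) ?c' = dir_deriv (snd ?c' \<circ> f \<circ> chart_inv ?c) (snd ?c p) (snd (X p) ?c)"
    using X' c' unfolding XY tangent_map_def by (simp add: split_beta Let_def)
  show ?thesis
    unfolding vf_apply_def Let_def w
    by (rule dir_deriv_chain[OF M N f c c' tangent_space_model[OF X'(2) c] _ g, symmetric])
      (use tangent_space_model[OF Y' c'] w in simp)
qed

lemma vf_apply_add:
  fixes M :: "('m::{t2_space, second_countable_topology}, 'e::euclidean_space) manifold"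
  assumes M: "smooth_manifold M" and X: "X p \<in> fibre (tangent_bundle M) p"
    and f: "smooth_at M p f" and g: "smooth_at M p g"
  shows "vf_apply M X (\<lambda>q. f q + g q) p = vf_apply M X f p + vf_apply M X g p"
    and "vf_apply M X (\<lambda>q. f q * g q) p = f p * vf_apply M X g p + vf_apply M X f p * g p"
proof -
  obtain c where c: "c \<in> atlas M" "p \<in> fst c" using manifold_chart_ex[OF M] .
  obtain W F where F: "open W" "snd c p \<in> W" "\<And>k. Ck_on k W F"
     "\<And>q. q \<in> fst c \<Longrightarrow> snd c q \<in> W \<Longrightarrow> f q = F (snd c q)"
    by (rule smooth_inE[OF smooth_at_chart[OF M f c]]) (rule that)
  obtain V G where G: "open V" "snd c p \<in> V" "\<And>k. Ck_on k V G"
     "\<And>q. q \<in> fst c \<Longrightarrow> snd c q \<in> V \<Longrightarrow> g q = G (snd c q)"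
    by (rule smooth_inE[OF smooth_at_chart[OF M g c]]) (rule that)
  note DF = Ck_on_SucD(1)[OF F(3,2)] and DG = Ck_on_SucD(1)[OF G(3,2)]
  have VW: "open (V \<inter> W)" "snd c p \<in> V \<inter> W" using F G by auto
  have rf: "vf_apply M X f p = frechet_derivative F (at (snd c p)) (snd (X p) c)"
    by (rule vf_apply_deriv[where X = X and p = p, OF M X f c F(1,2) DF F(4)])
  have rg: "vf_apply M X g p = frechet_derivative G (at (snd c p)) (snd (X p) c)"
    by (rule vf_apply_deriv[where X = X and p = p, OF M X g c G(1,2) DG G(4)])
  show "vf_apply M X (\<lambda>q. f q + g q) p = vf_apply M X f p + vf_apply M X g p"
    unfolding rf rg
    by (rule vf_apply_deriv[where X = X and p = p, OF M X smooth_at_add[OF M f g] c VW has_derivative_add[OF DF DG]])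
      (use F(4) G(4) in auto)
  have "f p = F (snd c p)" "g p = G (snd c p)" using F G c by auto
  then show "vf_apply M X (\<lambda>q. f q * g q) p = f p * vf_apply M X g p + vf_apply M X f p * g p"
    unfolding rf rg
    using vf_apply_deriv[where X = X and p = p, OF M X smooth_at_mult[OF M f g] c VW has_derivative_mult[OF DF DG]]
      F(4) G(4) by auto
qed

lemma vf_apply_const:
  fixes M :: "('m::{t2_space, second_countable_topology}, 'e::euclidean_space) manifold"
  assumes M: "smooth_manifold M" and X: "X p \<in> fibre (tangent_bundle M) p"
  shows "vf_apply M X (\<lambda>q. a) p = 0"
proof -
  obtain c where c: "c \<in> atlas M" "p \<in> fst c" using manifold_chart_ex[OF M] .
  show ?thesis
    by (rule vf_apply_deriv[where X = X and p = p, OF M X smooth_at_const[OF M] c open_UNIV UNIV_I has_derivative_const]) auto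
qed

lemma vf_apply_field_add:
  fixes M :: "('m::{t2_space, second_countable_topology}, 'e::euclidean_space) manifold"
  assumes M: "smooth_manifold M" and X: "X p \<in> fibre (tangent_bundle M) p"
    and Y: "Y p \<in> fibre (tangent_bundle M) p" and Z: "Z p \<in> fibre (tangent_bundle M) p"
    and f: "smooth_at M p f"
  shows "Z p = fadd (tangent_bundle M) (X p) (Y p) \<Longrightarrow> vf_apply M Z f p = vf_apply M X f p + vf_apply M Y f p"
    and "Z p = fscale (tangent_bundle M) r (X p) \<Longrightarrow> vf_apply M Z f p = r * vf_apply M X f p"
proof -
  obtain c where c: "c \<in> atlas M" "p \<in> fst c" using manifold_chart_ex[OF M] .
  obtain W F where F: "open W" "snd c p \<in> W" "\<And>k. Ck_on k W F"
     "\<And>q. q \<in> fst c \<Longrightarrow> snd c q \<in> W \<Longrightarrow> f q = F (snd c q)"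
    by (rule smooth_inE[OF smooth_at_chart[OF M f c]]) (rule that)
  note DF = Ck_on_SucD(1)[OF F(3,2)]
  note lin = has_derivative_linear[OF DF]
  note r = vf_apply_deriv[where p = p, OF M _ f c F(1,2) DF F(4)]
  have rX: "vf_apply M X f p = frechet_derivative F (at (snd c p)) (snd (X p) c)" by (rule r[where X = X, OF X])
  have rY: "vf_apply M Y f p = frechet_derivative F (at (snd c p)) (snd (Y p) c)" by (rule r[where X = Y, OF Y])
  have rZ: "vf_apply M Z f p = frechet_derivative F (at (snd c p)) (snd (Z p) c)" by (rule r[where X = Z, OF Z])
  show "vf_apply M Z f p = vf_apply M X f p + vf_apply M Y f p" if "Z p = fadd (tangent_bundle M) (X p) (Y p)"
    unfolding rX rY rZ that linear_add[OF lin, symmetric]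
    by (simp add: tangent_bundle_def split_beta)
  show "vf_apply M Z f p = r * vf_apply M X f p" if "Z p = fscale (tangent_bundle M) r (X p)"
    unfolding rX rY rZ that using linear_scale[OF lin, of r "snd (X p) c"]
    by (simp add: tangent_bundle_def split_beta)
qed

text \<open>In a chart, X f is the sum of the components of X times the partial derivatives of an
  extension of f. The extension has derivatives in all ambient directions, so the standard basis of
  the Euclidean type serves although X is tangent to the model subspace.\<close>

lemma vf_apply_smooth:
  fixes M :: "('m::{t2_space, second_countable_topology}, 'e::euclidean_space) manifold"
  assumes M: "smooth_manifold M" and X: "X \<in> sections (tangent_bundle M)"
    and f: "\<And>q. smooth_at M q f"
  shows "smooth_at M p (vf_apply M X f)"
proof -
  obtain c where c: "c \<in> atlas M" "p \<in> fst c" using manifold_chart_ex[OF M] .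
  note oc = manifold_chart(1)[OF M c(1)]
  have X1: "X q \<in> fibre (tangent_bundle M) q" for q
    using X unfolding sections_def by blast
  have "smooth_fun_on M (fst c) ((\<lambda>(p, v). v c) \<circ> X)"
    using X c unfolding sections_def tangent_bundle_def by auto
  then have X2: "smooth_at M p (\<lambda>q. snd (X q) c)"
    using smooth_fun_on_iff[OF M oc, of "\<lambda>q. snd (X q) c"] c by (simp add: comp_def split_beta)
  obtain W F where F: "open W" "snd c p \<in> W" "\<And>k. Ck_on k W F"
     "\<And>q. q \<in> fst c \<Longrightarrow> snd c q \<in> W \<Longrightarrow> f q = F (snd c q)"
    by (rule smooth_inE[OF smooth_at_chart[OF M f c]]) (rule that)
  let ?D = "\<lambda>x. frechet_derivative F (at x)"
  have D: "(F has_derivative ?D x) (at x)" if "x \<in> W" for x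
    by (rule Ck_on_SucD(1)[OF F(3) that])
  have "smooth_at M p (\<lambda>q. ?D (snd c q) b)" for b
    by (rule smooth_at_comp[OF smooth_at_chart_self[OF c] F(1,2) Ck_on_SucD(2)[OF F(3)]])
  then have "smooth_at M p (\<lambda>q. \<Sum>b\<in>Basis. (snd (X q) c \<bullet> b) *\<^sub>R ?D (snd c q) b)"
    by (intro smooth_at_sum smooth_at_scaleR smooth_at_inner smooth_at_const M X2)
  moreover have "continuous_on (fst c) (snd c)"
    using homeomorphism_cont1[OF manifold_chart(3)[OF M c(1)]] .
  then have "open (fst c \<inter> snd c -` W)"
    by (rule continuous_open_preimage[OF _ oc F(1)])
  moreover have "p \<in> fst c \<inter> snd c -` W" using c F by auto
  moreover have "(\<Sum>b\<in>Basis. (snd (X q) c \<bullet> b) *\<^sub>R ?D (snd c q) b) = vf_apply M X f q"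
    if q: "q \<in> fst c \<inter> snd c -` W" for q
  proof -
    have q': "q \<in> fst c" "snd c q \<in> W" using q by auto
    note lin = has_derivative_linear[OF D[OF q'(2)]]
    have "vf_apply M X f q = ?D (snd c q) (snd (X q) c)"
      by (rule vf_apply_deriv[where X = X and p = q, OF M X1 f c(1) q'(1) F(1) q'(2) D[OF q'(2)] F(4)])
    also have "\<dots> = ?D (snd c q) (\<Sum>b\<in>Basis. (snd (X q) c \<bullet> b) *\<^sub>R b)"
      by (simp add: euclidean_representation)
    also have "\<dots> = (\<Sum>b\<in>Basis. (snd (X q) c \<bullet> b) *\<^sub>R ?D (snd c q) b)"
      by (simp add: linear_sum[OF lin] linear_scale[OF lin])
    finally show ?thesis by simp
  qed
  ultimately show ?thesis
    by (rule smooth_at_cong[OF M])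
qed

section \<open>Sections of vector bundles\<close>

text \<open>A linear coordinate on the single fibre over \<open>p\<close>, taken from a
  trivialization chosen for each point separately. It has no smoothness in \<open>p\<close>: it
  serves linear algebra in one fibre, while smoothness is tested in a fixed trivialization.\<close>

definition frep :: "('m, 'e, 'f, 'w) vbundle \<Rightarrow> 'm \<Rightarrow> 'f \<Rightarrow> 'w" where
  "frep B p = snd (SOME t. t \<in> trivs B \<and> p \<in> fst t)"

text \<open>Fibres belong to no algebraic type class, so finite sums of sections are formed in fibre
  coordinates and carried back.\<close>

definition sec_sum ::
  "('m, 'e, 'f, 'w::real_vector) vbundle \<Rightarrow> 'i set \<Rightarrow> ('i \<Rightarrow> 'm \<Rightarrow> 'f) \<Rightarrow> 'm \<Rightarrow> 'f" where
  "sec_sum B A s = (\<lambda>p. inv_into (fibre B p) (frep B p) (\<Sum>i\<in>A. frep B p (s i p)))"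

text \<open>The sections of Hom(B, V), encoded as function-linear maps. For V = \<open>real\<close>
  these are the sections of the dual bundle; other V serve to bundle many scalar forms into
  one.\<close>

definition lin_forms ::
  "('m, 'e::euclidean_space, 'f, 'w::euclidean_space) vbundle \<Rightarrow>
   (('m \<Rightarrow> 'f) \<Rightarrow> 'm \<Rightarrow> 'v::euclidean_space) set" where
  "lin_forms B = {\<tau>. (\<forall>Z\<in>sections B. \<forall>p. smooth_at (base B) p (\<tau> Z)) \<and>
     (\<forall>Z\<in>sections B. \<forall>Y\<in>sections B. \<tau> (sec_add B Z Y) = (\<lambda>p. \<tau> Z p + \<tau> Y p)) \<and>
     (\<forall>Z\<in>sections B. \<forall>f. (\<forall>p. smooth_at (base B) p f) \<longrightarrow> \<tau> (sec_mult B f Z) = (\<lambda>p. f p *\<^sub>R \<tau> Z p))}"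

lemma lin_formsD:
  assumes "\<tau> \<in> lin_forms B" "Z \<in> sections B"
  shows "smooth_at (base B) p (\<tau> Z)"
    and "Y \<in> sections B \<Longrightarrow> \<tau> (sec_add B Z Y) p = \<tau> Z p + \<tau> Y p"
    and "(\<And>p. smooth_at (base B) p f) \<Longrightarrow> \<tau> (sec_mult B f Z) p = f p *\<^sub>R \<tau> Z p"
proof -
  note A = assms(1)[unfolded lin_forms_def mem_Collect_eq]
  show "smooth_at (base B) p (\<tau> Z)" using A assms(2) by (elim conjE) simp
  show "\<tau> (sec_add B Z Y) p = \<tau> Z p + \<tau> Y p" if "Y \<in> sections B"
    using A assms(2) that by (elim conjE) simp
  show "\<tau> (sec_mult B f Z) p = f p *\<^sub>R \<tau> Z p" if "\<And>p. smooth_at (base B) p f"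
    using A assms(2) that by (elim conjE) simp
qed

locale vb =
  fixes B :: "('m::{t2_space, second_countable_topology}, 'e::euclidean_space, 'f, 'w::euclidean_space) vbundle"
  assumes vb_B: "vector_bundle B"
begin

lemma base_manifold: "smooth_manifold (base B)" and typical_subspace: "subspace (typical B)"
  using vb_B unfolding vector_bundle_def by blast+

lemma fadd_fibre: "a \<in> fibre B p \<Longrightarrow> b \<in> fibre B p \<Longrightarrow> fadd B a b \<in> fibre B p"
  and fscale_fibre: "a \<in> fibre B p \<Longrightarrow> fscale B r a \<in> fibre B p"
proof -
  have "\<forall>p. \<forall>a\<in>fibre B p. \<forall>b\<in>fibre B p. fadd B a b \<in> fibre B p"
    using vb_B unfolding vector_bundle_def by (elim conjE)
  moreover have "\<forall>p. \<forall>r. \<forall>a\<in>fibre B p. fscale B r a \<in> fibre B p"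
    using vb_B unfolding vector_bundle_def by (elim conjE)
  ultimately show "a \<in> fibre B p \<Longrightarrow> b \<in> fibre B p \<Longrightarrow> fadd B a b \<in> fibre B p"
    "a \<in> fibre B p \<Longrightarrow> fscale B r a \<in> fibre B p" by simp_all
qed

lemma triv:
  assumes "t \<in> trivs B"
  shows "open (fst t)"
    and "p \<in> fst t \<Longrightarrow> bij_betw (snd t) (fibre B p) (typical B)"
    and "p \<in> fst t \<Longrightarrow> a \<in> fibre B p \<Longrightarrow> b \<in> fibre B p \<Longrightarrow> snd t (fadd B a b) = snd t a + snd t b"
    and "p \<in> fst t \<Longrightarrow> a \<in> fibre B p \<Longrightarrow> snd t (fscale B r a) = r *\<^sub>R snd t a"
proof -
  have "\<forall>(U, \<Phi>)\<in>trivs B. open U \<and>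
        (\<forall>p\<in>U. bij_betw \<Phi> (fibre B p) (typical B) \<and>
           (\<forall>a\<in>fibre B p. \<forall>b\<in>fibre B p. \<Phi> (fadd B a b) = \<Phi> a + \<Phi> b) \<and>
           (\<forall>r. \<forall>a\<in>fibre B p. \<Phi> (fscale B r a) = r *\<^sub>R \<Phi> a))"
    using vb_B unfolding vector_bundle_def by (elim conjE)
  from this[rule_format, OF assms]
  have *: "open (fst t) \<and> (\<forall>p\<in>fst t. bij_betw (snd t) (fibre B p) (typical B) \<and>
           (\<forall>a\<in>fibre B p. \<forall>b\<in>fibre B p. snd t (fadd B a b) = snd t a + snd t b) \<and>
           (\<forall>r. \<forall>a\<in>fibre B p. snd t (fscale B r a) = r *\<^sub>R snd t a))"
    by (simp add: split_beta)
  show "open (fst t)"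
    "p \<in> fst t \<Longrightarrow> bij_betw (snd t) (fibre B p) (typical B)"
    "p \<in> fst t \<Longrightarrow> a \<in> fibre B p \<Longrightarrow> b \<in> fibre B p \<Longrightarrow> snd t (fadd B a b) = snd t a + snd t b"
    "p \<in> fst t \<Longrightarrow> a \<in> fibre B p \<Longrightarrow> snd t (fscale B r a) = r *\<^sub>R snd t a"
    using * by simp_all
qed

lemma triv_ex: obtains t where "t \<in> trivs B" "p \<in> fst t"
proof -
  have "\<forall>p. \<exists>(U, \<Phi>)\<in>trivs B. p \<in> U"
    using vb_B unfolding vector_bundle_def by (elim conjE)
  from this[rule_format, of p] show thesis using that by (auto split: prod.splits)
qed

lemma triv_trans:
  assumes "t \<in> trivs B" "t' \<in> trivs B"
  shows "smooth_fam_on (base B) (fst t \<inter> fst t') (typical B)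
    (\<lambda>p w. snd t' (inv_into (fibre B p) (snd t) w))"
proof -
  have "\<forall>(U, \<Phi>)\<in>trivs B. \<forall>(U', \<Phi>')\<in>trivs B.
        smooth_fam_on (base B) (U \<inter> U') (typical B) (\<lambda>p w. \<Phi>' (inv_into (fibre B p) \<Phi> w))"
    using vb_B unfolding vector_bundle_def by (elim conjE)
  from this[rule_format, OF assms(1)] assms(2) show ?thesis
    by (auto simp: split_beta)
qed

lemma triv_mem: "t \<in> trivs B \<Longrightarrow> p \<in> fst t \<Longrightarrow> a \<in> fibre B p \<Longrightarrow> snd t a \<in> typical B"
  using bij_betwE[OF triv(2)] by blast

lemma triv_inj: "t \<in> trivs B \<Longrightarrow> p \<in> fst t \<Longrightarrow> a \<in> fibre B p \<Longrightarrow> b \<in> fibre B p \<Longrightarrow> snd t a = snd t b \<longleftrightarrow> a = b"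
  using inj_on_eq_iff[OF bij_betw_imp_inj_on[OF triv(2)]] by blast

lemma triv_inv:
  assumes "t \<in> trivs B" "p \<in> fst t"
  shows "w \<in> typical B \<Longrightarrow> inv_into (fibre B p) (snd t) w \<in> fibre B p"
    and "w \<in> typical B \<Longrightarrow> snd t (inv_into (fibre B p) (snd t) w) = w"
    and "a \<in> fibre B p \<Longrightarrow> inv_into (fibre B p) (snd t) (snd t a) = a"
  using triv(2)[OF assms] bij_betw_imp_surj_on bij_betw_inv_into_right bij_betw_inv_into_left inv_into_into
  by metis+

lemma frep_triv: obtains t where "t \<in> trivs B" "p \<in> fst t" "frep B p = snd t"
proof -
  have "\<exists>t. t \<in> trivs B \<and> p \<in> fst t" using triv_ex[of p] by metis
  from someI_ex[OF this] show thesis using that unfolding frep_def by blast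
qed

lemma frep_add: "a \<in> fibre B p \<Longrightarrow> b \<in> fibre B p \<Longrightarrow> frep B p (fadd B a b) = frep B p a + frep B p b"
  and frep_scale: "a \<in> fibre B p \<Longrightarrow> frep B p (fscale B r a) = r *\<^sub>R frep B p a"
  and frep_mem: "a \<in> fibre B p \<Longrightarrow> frep B p a \<in> typical B"
  and frep_inj: "a \<in> fibre B p \<Longrightarrow> b \<in> fibre B p \<Longrightarrow> frep B p a = frep B p b \<longleftrightarrow> a = b"
  and frep_inv: "w \<in> typical B \<Longrightarrow> inv_into (fibre B p) (frep B p) w \<in> fibre B p"
    "w \<in> typical B \<Longrightarrow> frep B p (inv_into (fibre B p) (frep B p) w) = w"
    "a \<in> fibre B p \<Longrightarrow> inv_into (fibre B p) (frep B p) (frep B p a) = a"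
  using frep_triv[of p] triv(3,4) triv_mem triv_inj triv_inv by metis+

lemma section_fibre: "s \<in> sections B \<Longrightarrow> s p \<in> fibre B p"
  unfolding sections_def by blast

lemma section_smooth:
  assumes "s \<in> sections B" "t \<in> trivs B" "p \<in> fst t"
  shows "smooth_at (base B) p (\<lambda>q. snd t (s q))"
proof -
  have "\<forall>(U, \<Phi>)\<in>trivs B. smooth_fun_on (base B) U (\<Phi> \<circ> s)"
    using assms(1) unfolding sections_def by blast
  from this[rule_format, OF assms(2)] have "smooth_fun_on (base B) (fst t) (snd t \<circ> s)"
    by (simp add: split_beta)
  then show ?thesis
    using smooth_fun_on_iff[OF base_manifold triv(1)[OF assms(2)], of "snd t \<circ> s"] assms(3) by (simp add: comp_def)
qed

lemma triv_change:
  assumes t: "t \<in> trivs B" "p \<in> fst t" and t': "t' \<in> trivs B" "p \<in> fst t'"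
    and s: "\<And>q. s q \<in> fibre B q" and sm: "smooth_at (base B) p (\<lambda>q. snd t (s q))"
  shows "smooth_at (base B) p (\<lambda>q. snd t' (s q))"
proof -
  let ?A = "fst t \<inter> fst t'"
  have A: "open ?A" "p \<in> ?A" using open_Int[OF triv(1)[OF t(1)] triv(1)[OF t'(1)]] t t' by auto
  have "smooth_at (base B) p (\<lambda>q. snd t' (inv_into (fibre B q) (snd t) (snd t (s q))))"
    by (rule smooth_at_fam[OF base_manifold A triv_trans[OF t(1) t'(1)] sm])
      (use triv_mem[OF t(1) _ s] in auto)
  then show ?thesis
    by (rule smooth_at_cong[OF base_manifold _ A]) (use triv_inv(3)[OF t(1) _ s] in auto)
qed

lemma sectionI:
  assumes s: "\<And>q. s q \<in> fibre B q"
    and sm: "\<And>p. \<exists>t\<in>trivs B. p \<in> fst t \<and> smooth_at (base B) p (\<lambda>q. snd t (s q))"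
  shows "s \<in> sections B"
proof -
  have "smooth_fun_on (base B) (fst t) (snd t \<circ> s)" if t: "t \<in> trivs B" for t
    unfolding smooth_fun_on_iff[OF base_manifold triv(1)[OF t]] comp_def
  proof
    fix p assume "p \<in> fst t"
    moreover obtain t' where "t' \<in> trivs B" "p \<in> fst t'" "smooth_at (base B) p (\<lambda>q. snd t' (s q))"
      using sm[of p] by blast
    ultimately show "smooth_at (base B) p (\<lambda>q. snd t (s q))"
      using triv_change[OF _ _ t _ s] by simp
  qed
  then show ?thesis
    unfolding sections_def using s by (auto simp: split_beta)
qed

lemma section_eqI:
  assumes "s \<in> sections B" "s' \<in> sections B" "\<And>p. frep B p (s p) = frep B p (s' p)"
  shows "s = s'"
  using assms frep_inj section_fibre by (auto simp: fun_eq_iff)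

lemma sec_add_mem:
  assumes "s \<in> sections B" "s' \<in> sections B" shows "sec_add B s s' \<in> sections B"
proof (rule sectionI)
  show "sec_add B s s' q \<in> fibre B q" for q
    unfolding sec_add_def using assms by (intro fadd_fibre section_fibre)
  fix p
  obtain t where t: "t \<in> trivs B" "p \<in> fst t" using triv_ex[of p] .
  have "smooth_at (base B) p (\<lambda>q. snd t (s q) + snd t (s' q))"
    by (intro smooth_at_add base_manifold section_smooth assms t)
  then have "smooth_at (base B) p (\<lambda>q. snd t (sec_add B s s' q))"
    by (rule smooth_at_cong[OF base_manifold _ triv(1)[OF t(1)] t(2)])
      (use triv(3)[OF t(1)] section_fibre assms in \<open>auto simp: sec_add_def\<close>)
  then show "\<exists>t\<in>trivs B. p \<in> fst t \<and> smooth_at (base B) p (\<lambda>q. snd t (sec_add B s s' q))"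
    using t by blast
qed

lemma sec_mult_mem:
  assumes "s \<in> sections B" "\<And>p. smooth_at (base B) p f" shows "sec_mult B f s \<in> sections B"
proof (rule sectionI)
  show "sec_mult B f s q \<in> fibre B q" for q
    unfolding sec_mult_def using assms by (intro fscale_fibre section_fibre)
  fix p
  obtain t where t: "t \<in> trivs B" "p \<in> fst t" using triv_ex[of p] .
  have "smooth_at (base B) p (\<lambda>q. f q *\<^sub>R snd t (s q))"
    by (intro smooth_at_scaleR base_manifold section_smooth assms t)
  then have "smooth_at (base B) p (\<lambda>q. snd t (sec_mult B f s q))"
    by (rule smooth_at_cong[OF base_manifold _ triv(1)[OF t(1)] t(2)])
      (use triv(4)[OF t(1)] section_fibre assms in \<open>auto simp: sec_mult_def\<close>)
  then show "\<exists>t\<in>trivs B. p \<in> fst t \<and> smooth_at (base B) p (\<lambda>q. snd t (sec_mult B f s q))"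
    using t by blast
qed

lemma triv_sec_add: "t \<in> trivs B \<Longrightarrow> p \<in> fst t \<Longrightarrow> s p \<in> fibre B p \<Longrightarrow> s' p \<in> fibre B p \<Longrightarrow>
    snd t (sec_add B s s' p) = snd t (s p) + snd t (s' p)"
  and triv_sec_mult: "t \<in> trivs B \<Longrightarrow> p \<in> fst t \<Longrightarrow> s p \<in> fibre B p \<Longrightarrow>
    snd t (sec_mult B f s p) = f p *\<^sub>R snd t (s p)"
  unfolding sec_add_def sec_mult_def by (auto intro: triv(3,4))

lemma frep_sec_add: "s \<in> sections B \<Longrightarrow> s' \<in> sections B \<Longrightarrow>
    frep B p (sec_add B s s' p) = frep B p (s p) + frep B p (s' p)"
  and frep_sec_mult: "s \<in> sections B \<Longrightarrow> frep B p (sec_mult B f s p) = f p *\<^sub>R frep B p (s p)"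
  unfolding sec_add_def sec_mult_def by (auto intro: frep_add frep_scale section_fibre)

lemma sec_zero_eq: "sec_zero B p = inv_into (fibre B p) (frep B p) 0"
  unfolding sec_zero_def
proof (rule the_equality)
  let ?z = "inv_into (fibre B p) (frep B p) 0"
  have z: "?z \<in> fibre B p" "frep B p ?z = 0" using frep_inv subspace_0[OF typical_subspace] by auto
  show "?z \<in> fibre B p \<and> (\<forall>a\<in>fibre B p. fadd B ?z a = a)"
    using z frep_add[OF z(1)] frep_inj[OF fadd_fibre[OF z(1)]] by auto
  show "y = ?z" if "y \<in> fibre B p \<and> (\<forall>a\<in>fibre B p. fadd B y a = a)" for y
  proof -
    have "frep B p (fadd B y ?z) = frep B p ?z" using that z by auto
    then show ?thesis using that z frep_add[of y p ?z] frep_inj[of y p ?z] by auto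
  qed
qed

lemma sec_zero_fibre: "sec_zero B p \<in> fibre B p" and frep_zero: "frep B p (sec_zero B p) = 0"
  unfolding sec_zero_eq using frep_inv subspace_0[OF typical_subspace] by auto

lemma triv_zero:
  assumes t: "t \<in> trivs B" "p \<in> fst t" shows "snd t (sec_zero B p) = 0"
proof -
  note z = sec_zero_fibre[of p]
  have "fadd B (sec_zero B p) (sec_zero B p) = sec_zero B p"
    using frep_inj[OF fadd_fibre[OF z z] z] frep_add[OF z z] frep_zero by simp
  then show ?thesis using triv(3)[OF t z z] by simp
qed

lemma sec_zero_mem: "sec_zero B \<in> sections B"
proof (rule sectionI)
  fix p
  obtain t where t: "t \<in> trivs B" "p \<in> fst t" using triv_ex[of p] .
  have "smooth_at (base B) p (\<lambda>q. snd t (sec_zero B q))"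
    by (rule smooth_at_cong[OF base_manifold smooth_at_const[OF base_manifold, of p 0] triv(1)[OF t(1)] t(2)])
      (use triv_zero[OF t(1)] in auto)
  then show "\<exists>t\<in>trivs B. p \<in> fst t \<and> smooth_at (base B) p (\<lambda>q. snd t (sec_zero B q))"
    using t by blast
qed (rule sec_zero_fibre)

lemma fibre_zero_iff: "a \<in> fibre B p \<Longrightarrow> a = sec_zero B p \<longleftrightarrow> frep B p a = 0"
  using frep_inj[OF _ sec_zero_fibre, of a p] frep_zero by simp

lemma frep_sec_sum:
  assumes "\<And>i. i \<in> A \<Longrightarrow> s i p \<in> fibre B p"
  shows "frep B p (sec_sum B A s p) = (\<Sum>i\<in>A. frep B p (s i p))" "sec_sum B A s p \<in> fibre B p"
proof -
  have "(\<Sum>i\<in>A. frep B p (s i p)) \<in> typical B"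
    using assms by (intro subspace_sum[OF typical_subspace] frep_mem)
  then show "frep B p (sec_sum B A s p) = (\<Sum>i\<in>A. frep B p (s i p))" "sec_sum B A s p \<in> fibre B p"
    unfolding sec_sum_def by (auto intro: frep_inv)
qed

lemma sec_sum_empty: "sec_sum B {} s = sec_zero B"
  by (simp add: sec_sum_def sec_zero_eq fun_eq_iff)

lemma sec_sum_insert_at:
  assumes "finite A" "i \<notin> A" "\<And>j. j \<in> insert i A \<Longrightarrow> s j p \<in> fibre B p"
  shows "sec_sum B (insert i A) s p = sec_add B (s i) (sec_sum B A s) p"
proof -
  have 1: "s i p \<in> fibre B p" "sec_sum B A s p \<in> fibre B p"
    using assms(3) by (auto intro!: frep_sec_sum(2))
  have "frep B p (sec_sum B (insert i A) s p) = (\<Sum>j\<in>insert i A. frep B p (s j p))"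
    "frep B p (sec_sum B A s p) = (\<Sum>j\<in>A. frep B p (s j p))"
    by (rule frep_sec_sum(1), use assms(3) in blast)+
  then have "frep B p (sec_sum B (insert i A) s p) = frep B p (sec_add B (s i) (sec_sum B A s) p)"
    using assms(1,2) 1 by (simp add: sec_add_def frep_add)
  then show ?thesis
    using frep_inj frep_sec_sum(2)[of "insert i A" s p] assms 1 fadd_fibre unfolding sec_add_def by metis
qed

lemma sec_sum_insert:
  assumes "finite A" "i \<notin> A" "\<And>j. j \<in> insert i A \<Longrightarrow> s j \<in> sections B"
  shows "sec_sum B (insert i A) s = sec_add B (s i) (sec_sum B A s)"
  using sec_sum_insert_at[OF assms(1,2)] assms(3) section_fibre by (auto simp: fun_eq_iff)

lemma triv_sec_sum:
  assumes t: "t \<in> trivs B" "p \<in> fst t" and "finite A" "\<And>i. i \<in> A \<Longrightarrow> s i p \<in> fibre B p"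
  shows "snd t (sec_sum B A s p) = (\<Sum>i\<in>A. snd t (s i p))"
  using assms(3,4)
proof (induction A)
  case empty
  then show ?case using triv_zero[OF t] by (simp add: sec_sum_empty)
next
  case (insert i A)
  then show ?case
    using sec_sum_insert_at[of A i s p] triv_sec_add[OF t, of "s i" "sec_sum B A s"] frep_sec_sum(2)[of A s p]
    by simp
qed

lemma sec_sum_mem:
  assumes "finite A" "\<And>i. i \<in> A \<Longrightarrow> s i \<in> sections B"
  shows "sec_sum B A s \<in> sections B"
  using assms
proof (induction A)
  case (insert i A)
  then show ?case using sec_sum_insert[OF insert(1,2,4)] by (simp add: sec_add_mem)
qed (simp add: sec_sum_empty sec_zero_mem)

lemma lin_form_zero:
  assumes "\<tau> \<in> lin_forms B" shows "\<tau> (sec_zero B) p = 0"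
proof -
  note z = sec_zero_mem
  have "sec_add B (sec_zero B) (sec_zero B) = sec_zero B"
    by (rule section_eqI[OF sec_add_mem[OF z z] z]) (simp add: frep_sec_add z frep_zero)
  then show ?thesis using lin_formsD(2)[OF assms z z, of p] by simp
qed

lemma lin_form_sum:
  assumes "\<tau> \<in> lin_forms B" "finite A" "\<And>i. i \<in> A \<Longrightarrow> s i \<in> sections B"
  shows "\<tau> (sec_sum B A s) p = (\<Sum>i\<in>A. \<tau> (s i) p)"
  using assms(2,3)
proof (induction A)
  case empty
  then show ?case using lin_form_zero[OF assms(1)] by (simp add: sec_sum_empty)
next
  case (insert i A)
  then show ?case
    using lin_formsD(2)[OF assms(1), of "s i" "sec_sum B A s"] sec_sum_insert[OF insert(1,2,4)]
    by (simp add: sec_sum_mem)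
qed

lemma local_section:
  assumes t: "t \<in> trivs B" and \<kappa>: "\<And>q. smooth_at (base B) q \<kappa>"
    and K: "closed K" "K \<subseteq> fst t" "\<And>q. q \<notin> K \<Longrightarrow> \<kappa> q = 0" and w: "w \<in> typical B"
  obtains s where "s \<in> sections B" "\<And>q. q \<in> fst t \<Longrightarrow> snd t (s q) = \<kappa> q *\<^sub>R w"
proof -
  define s where "s q = (if q \<in> fst t then inv_into (fibre B q) (snd t) (\<kappa> q *\<^sub>R w) else sec_zero B q)" for q
  have w': "\<kappa> q *\<^sub>R w \<in> typical B" for q using w typical_subspace by (rule subspace_scale[rotated])
  have s1: "snd t (s q) = \<kappa> q *\<^sub>R w" if "q \<in> fst t" for q
    using that triv_inv(2)[OF t that w'] by (simp add: s_def)
  have s2: "s q \<in> fibre B q" for q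
    using triv_inv(1)[OF t _ w'] sec_zero_fibre by (simp add: s_def)
  have s3: "s q = sec_zero B q" if "q \<notin> K" for q
  proof (cases "q \<in> fst t")
    case True
    have "snd t (s q) = snd t (sec_zero B q)" using s1[OF True] K(3)[OF that] triv_zero[OF t True] by simp
    then show ?thesis using triv_inj[OF t True s2 sec_zero_fibre] by simp
  qed (simp add: s_def)
  have "s \<in> sections B"
  proof (rule sectionI[OF s2])
    fix p
    show "\<exists>t\<in>trivs B. p \<in> fst t \<and> smooth_at (base B) p (\<lambda>q. snd t (s q))"
    proof (cases "p \<in> fst t")
      case True
      have "smooth_at (base B) p (\<lambda>q. \<kappa> q *\<^sub>R w)"
        by (intro smooth_at_scaleR smooth_at_const base_manifold \<kappa>)
      then have "smooth_at (base B) p (\<lambda>q. snd t (s q))"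
        by (rule smooth_at_cong[OF base_manifold _ triv(1)[OF t] True]) (use s1 in auto)
      then show ?thesis using t True by blast
    next
      case False
      obtain t' where t': "t' \<in> trivs B" "p \<in> fst t'" using triv_ex[of p] .
      have "smooth_at (base B) p (\<lambda>q. snd t' (sec_zero B q))"
        by (rule section_smooth[OF sec_zero_mem t'])
      then have "smooth_at (base B) p (\<lambda>q. snd t' (s q))"
        by (rule smooth_at_cong[where V = "- K", OF base_manifold]) (use s3 K False in auto)
      then show ?thesis using t' by blast
    qed
  qed
  then show thesis using s1 that by blast
qed

section \<open>Local frames of global sections, and tensoriality of linear forms\<close>

lemma typical_basis:
  obtains D where "finite D" "D \<subseteq> typical B" "\<And>w. w \<in> typical B \<Longrightarrow> (\<Sum>b\<in>D. (w \<bullet> b) *\<^sub>R b) = w"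
proof -
  obtain D where D: "D \<subseteq> typical B" "pairwise orthogonal D" "\<And>x. x \<in> D \<Longrightarrow> norm x = 1"
    "independent D" "span D = typical B"
    using orthonormal_basis_subspace[OF typical_subspace] by metis
  then have "finite D" using independent_imp_finite by blast
  then show thesis
    using that D orthonormal_basis_expand[OF D(2,3)] by metis
qed

text \<open>The frame \<open>f\<close> and the coordinate forms \<open>\<beta>\<close> are both
  globalized by the same bump function \<kappa>, so that the expansion of \<kappa>^2 Z holds on the
  whole manifold and any function-linear \<tau> may be applied to it. On \<open>U\<close>, where
  \<kappa> = 1, it becomes the expansion of \<tau> Z. Locality of \<tau> is thus a consequence of
  linearity.\<close>

lemma local_frame:
  fixes p :: 'm
  obtains t U D f \<beta> where "t \<in> trivs B" "frep B p = snd t" "U \<subseteq> fst t" "open U" "p \<in> U" "finite D"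
    "\<And>b. b \<in> D \<Longrightarrow> f b \<in> sections B" "\<And>b. b \<in> D \<Longrightarrow> \<beta> b \<in> lin_forms B"
    "\<And>b Z q. q \<in> U \<Longrightarrow> \<beta> b Z q = snd t (Z q) \<bullet> b"
    "\<And>w. w \<in> typical B \<Longrightarrow> (\<Sum>b\<in>D. (w \<bullet> b) *\<^sub>R b) = w"
    "\<And>(\<tau> :: ('m \<Rightarrow> 'f) \<Rightarrow> 'm \<Rightarrow> 'v::euclidean_space) Z q. \<tau> \<in> lin_forms B \<Longrightarrow> Z \<in> sections B \<Longrightarrow>
       q \<in> U \<Longrightarrow> \<tau> Z q = (\<Sum>b\<in>D. \<beta> b Z q *\<^sub>R \<tau> (f b) q)"
proof -
  obtain t where t: "t \<in> trivs B" "p \<in> fst t" "frep B p = snd t" using frep_triv[of p] .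
  obtain \<kappa> :: "'m \<Rightarrow> real" and U K where \<kappa>: "\<And>q. smooth_at (base B) q \<kappa>" "open U" "p \<in> U"
    "\<And>q. q \<in> U \<Longrightarrow> \<kappa> q = 1" "U \<subseteq> K" "closed K" "K \<subseteq> fst t" "\<And>q. q \<notin> K \<Longrightarrow> \<kappa> q = 0"
    by (rule smooth_bump[OF base_manifold triv(1)[OF t(1)] t(2)]) (rule that)
  obtain D where D: "finite D" "D \<subseteq> typical B" "\<And>w. w \<in> typical B \<Longrightarrow> (\<Sum>b\<in>D. (w \<bullet> b) *\<^sub>R b) = w"
    by (rule typical_basis) (rule that)
  have "\<exists>s. s \<in> sections B \<and> (\<forall>q\<in>fst t. snd t (s q) = \<kappa> q *\<^sub>R b)" if b: "b \<in> D" for b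
  proof -
    have "b \<in> typical B" using b D by blast
    show ?thesis
      by (rule local_section[OF t(1) \<kappa>(1,6,7) _ \<open>b \<in> typical B\<close>]) (use \<kappa>(8) in auto)
  qed
  then obtain f where f: "\<And>b. b \<in> D \<Longrightarrow> f b \<in> sections B"
    "\<And>b q. b \<in> D \<Longrightarrow> q \<in> fst t \<Longrightarrow> snd t (f b q) = \<kappa> q *\<^sub>R b"
    by metis
  define \<beta> where "\<beta> b Z q = \<kappa> q *\<^sub>R (snd t (Z q) \<bullet> b)" for b Z q
  have sm: "smooth_at (base B) q (\<beta> b Z)" if Z: "Z \<in> sections B" for b Z q
  proof -
    have "smooth_at (base B) q (\<lambda>q. \<kappa> q *\<^sub>R (snd t (Z q) \<bullet> b))"
      by (rule smooth_at_extend[OF base_manifold triv(1)[OF t(1)] \<kappa>(1,6,7,8)])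
        (assumption, rule smooth_at_inner[OF base_manifold section_smooth[OF Z t(1)] smooth_at_const[OF base_manifold]])
    then show ?thesis by (simp add: \<beta>_def[abs_def])
  qed
  have k0: "\<kappa> q = 0" if "q \<notin> fst t" for q using that \<kappa>(7,8) by blast
  have \<beta>: "\<beta> b \<in> lin_forms B" for b
    unfolding lin_forms_def mem_Collect_eq
  proof (intro conjI ballI allI impI)
    show "smooth_at (base B) q (\<beta> b Z)" if "Z \<in> sections B" for Z q using sm[OF that] .
    show "\<beta> b (sec_add B Z Y) = (\<lambda>p. \<beta> b Z p + \<beta> b Y p)" if "Z \<in> sections B" "Y \<in> sections B" for Z Y
    proof
      fix q show "\<beta> b (sec_add B Z Y) q = \<beta> b Z q + \<beta> b Y q"
        using k0[of q] triv_sec_add[OF t(1), of q Z Y] that section_fibre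
        by (cases "q \<in> fst t") (auto simp: \<beta>_def inner_add_left algebra_simps)
    qed
    show "\<beta> b (sec_mult B f Z) = (\<lambda>p. f p *\<^sub>R \<beta> b Z p)" if "Z \<in> sections B" for Z f
    proof
      fix q show "\<beta> b (sec_mult B f Z) q = f q *\<^sub>R \<beta> b Z q"
        using k0[of q] triv_sec_mult[OF t(1), of q Z f] that section_fibre
        by (cases "q \<in> fst t") (auto simp: \<beta>_def)
    qed
  qed
  have exp: "\<tau> Z q = (\<Sum>b\<in>D. \<beta> b Z q *\<^sub>R \<tau> (f b) q)"
    if \<tau>: "\<tau> \<in> lin_forms B" and Z: "Z \<in> sections B" and q: "q \<in> U"
    for \<tau> :: "('m \<Rightarrow> 'f) \<Rightarrow> 'm \<Rightarrow> 'v" and Z q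
  proof -
    have \<kappa>2: "smooth_at (base B) q (\<lambda>q. \<kappa> q * \<kappa> q)" for q
      by (intro smooth_at_mult base_manifold \<kappa>(1))
    have m: "sec_mult B (\<beta> b Z) (f b) \<in> sections B" if "b \<in> D" for b
      by (intro sec_mult_mem f that sm Z)
    \<comment> \<open>One factor \<kappa> comes from the coefficients and one from the frame; off
      the domain of the trivialization both sides are 0.\<close>
    have "sec_mult B (\<lambda>q. \<kappa> q * \<kappa> q) Z = sec_sum B D (\<lambda>b. sec_mult B (\<beta> b Z) (f b))"
    proof (rule section_eqI[OF sec_mult_mem[OF Z \<kappa>2] sec_sum_mem[OF D(1) m]])
      fix x
      show "frep B x (sec_mult B (\<lambda>q. \<kappa> q * \<kappa> q) Z x) = frep B x (sec_sum B D (\<lambda>b. sec_mult B (\<beta> b Z) (f b)) x)"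
      proof (cases "x \<in> fst t")
        case True
        have fb: "snd t (sec_mult B (\<beta> b Z) (f b) x) = \<beta> b Z x *\<^sub>R snd t (f b x)" if "b \<in> D" for b
          by (rule triv_sec_mult[OF t(1) True]) (rule section_fibre[OF f(1)[OF that]])
        have "snd t (sec_mult B (\<lambda>q. \<kappa> q * \<kappa> q) Z x) = (\<kappa> x * \<kappa> x) *\<^sub>R (\<Sum>b\<in>D. (snd t (Z x) \<bullet> b) *\<^sub>R b)"
          using triv_sec_mult[where s = Z and p = x, OF t(1) True section_fibre[OF Z]] D(3) triv_mem[OF t(1) True section_fibre[OF Z]]
          by simp
        also have "\<dots> = (\<Sum>b\<in>D. snd t (sec_mult B (\<beta> b Z) (f b) x))"
          unfolding scaleR_sum_right
          by (rule sum.cong[OF refl])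
            (use fb f(2)[OF _ True] in \<open>auto simp: \<beta>_def\<close>)
        also have "\<dots> = snd t (sec_sum B D (\<lambda>b. sec_mult B (\<beta> b Z) (f b)) x)"
          by (rule triv_sec_sum[symmetric, OF t(1) True D(1)]) (rule section_fibre[OF m])
        finally have "snd t (sec_mult B (\<lambda>q. \<kappa> q * \<kappa> q) Z x) = snd t (sec_sum B D (\<lambda>b. sec_mult B (\<beta> b Z) (f b)) x)" .
        moreover have "sec_mult B (\<lambda>q. \<kappa> q * \<kappa> q) Z x \<in> fibre B x"
          by (rule section_fibre[OF sec_mult_mem[OF Z \<kappa>2]])
        moreover have "sec_sum B D (\<lambda>b. sec_mult B (\<beta> b Z) (f b)) x \<in> fibre B x"
          by (rule section_fibre, rule sec_sum_mem[OF D(1)], rule m)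
        ultimately show ?thesis
          using triv_inj[OF t(1) True] by simp
      next
        case False
        have "frep B x (sec_sum B D (\<lambda>b. sec_mult B (\<beta> b Z) (f b)) x) = (\<Sum>b\<in>D. frep B x (sec_mult B (\<beta> b Z) (f b) x))"
          by (rule frep_sec_sum) (rule section_fibre[OF m])
        also have "\<dots> = 0"
          by (rule sum.neutral) (use frep_sec_mult[OF f(1)] k0[OF False] in \<open>auto simp: \<beta>_def\<close>)
        finally show ?thesis
          using k0[OF False] frep_sec_mult[OF Z] by simp
      qed
    qed
    then have "\<tau> (sec_mult B (\<lambda>q. \<kappa> q * \<kappa> q) Z) q = (\<Sum>b\<in>D. \<tau> (sec_mult B (\<beta> b Z) (f b)) q)"
      using lin_form_sum[OF \<tau> D(1) m] by simp
    also have "\<dots> = (\<Sum>b\<in>D. \<beta> b Z q *\<^sub>R \<tau> (f b) q)"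
      by (rule sum.cong[OF refl]) (rule lin_formsD(3)[OF \<tau> f(1) sm[OF Z]])
    finally show ?thesis
      using lin_formsD(3)[OF \<tau> Z \<kappa>2] \<kappa>(4)[OF q] by simp
  qed
  show thesis
  proof (rule that[of t U D f \<beta>])
    show "\<beta> b Z q = snd t (Z q) \<bullet> b" if "q \<in> U" for b Z q
      using \<kappa>(4)[OF that] by (simp add: \<beta>_def)
    show "U \<subseteq> fst t" using \<kappa>(5,7) by blast
    show "\<beta> b \<in> lin_forms B" for b by (rule \<beta>)
    show "(\<Sum>b\<in>D. (w \<bullet> b) *\<^sub>R b) = w" if "w \<in> typical B" for w using that by (rule D(3))
    show "\<tau> Z q = (\<Sum>b\<in>D. \<beta> b Z q *\<^sub>R \<tau> (f b) q)" if "\<tau> \<in> lin_forms B" "Z \<in> sections B" "q \<in> U"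
      for \<tau> :: "('m \<Rightarrow> 'f) \<Rightarrow> 'm \<Rightarrow> 'v" and Z q
      using that by (rule exp)
  qed (fact t \<kappa>(2,3) D(1) f(1))+
qed

lemma section_through:
  assumes "a \<in> fibre B p" obtains s where "s \<in> sections B" "s p = a"
proof -
  obtain t where t: "t \<in> trivs B" "p \<in> fst t" using triv_ex[of p] .
  obtain \<kappa> :: "'m \<Rightarrow> real" and U K where \<kappa>: "\<And>q. smooth_at (base B) q \<kappa>" "open U" "p \<in> U"
    "\<And>q. q \<in> U \<Longrightarrow> \<kappa> q = 1" "U \<subseteq> K" "closed K" "K \<subseteq> fst t" "\<And>q. q \<notin> K \<Longrightarrow> \<kappa> q = 0"
    by (rule smooth_bump[OF base_manifold triv(1)[OF t(1)] t(2)]) (rule that)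
  obtain s where s: "s \<in> sections B" "\<And>q. q \<in> fst t \<Longrightarrow> snd t (s q) = \<kappa> q *\<^sub>R snd t a"
    by (rule local_section[OF t(1) \<kappa>(1,6,7) _ triv_mem[OF t assms]]) (use \<kappa>(8) that in auto)
  have "s p = a"
    using s(2)[OF t(2)] \<kappa>(3,4) triv_inj[OF t section_fibre[OF s(1)] assms] by simp
  then show thesis using that s(1) by blast
qed

text \<open>Tensoriality: in a local frame the value at \<open>p\<close> is a combination of the
  coordinates of Z at \<open>p\<close>. Writing these as inner products makes \<theta> linear on the
  whole type, not just on the typical fibre.\<close>

lemma lin_form_at:
  fixes \<tau> :: "('m \<Rightarrow> 'f) \<Rightarrow> 'm \<Rightarrow> 'v::euclidean_space"
  assumes "\<tau> \<in> lin_forms B"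
  obtains \<theta> where "linear \<theta>" "\<And>Z. Z \<in> sections B \<Longrightarrow> \<tau> Z p = \<theta> (frep B p (Z p))"
proof -
  obtain t U D f \<beta> where *: "t \<in> trivs B" "frep B p = snd t" "U \<subseteq> fst t" "open U" "p \<in> U" "finite D"
    "\<And>b. b \<in> D \<Longrightarrow> f b \<in> sections B" "\<And>b. b \<in> D \<Longrightarrow> \<beta> b \<in> lin_forms B"
    "\<And>b Z q. q \<in> U \<Longrightarrow> \<beta> b Z q = snd t (Z q) \<bullet> b"
    "\<And>w. w \<in> typical B \<Longrightarrow> (\<Sum>b\<in>D. (w \<bullet> b) *\<^sub>R b) = w"
    "\<And>\<tau> Z q. \<tau> \<in> lin_forms B \<Longrightarrow> Z \<in> sections B \<Longrightarrow> q \<in> U \<Longrightarrow>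
      (\<tau> Z q :: 'v) = (\<Sum>b\<in>D. \<beta> b Z q *\<^sub>R \<tau> (f b) q)"
    by (rule local_frame[of p, where ?'v = 'v]) (rule that)
  define \<theta> where "\<theta> w = (\<Sum>b\<in>D. (w \<bullet> b) *\<^sub>R \<tau> (f b) p)" for w
  have "linear \<theta>"
    by (rule linearI) (auto simp: \<theta>_def inner_add_left scaleR_add_left sum.distrib scaleR_sum_right)
  then show thesis
    by (rule that) (use *(11)[OF assms _ *(5)] *(9)[OF *(5)] *(2) in \<open>auto simp: \<theta>_def\<close>)
qed

lemma lin_form_cong:
  assumes "\<tau> \<in> lin_forms B" "Z \<in> sections B" "Z' \<in> sections B" "Z p = Z' p"
  shows "\<tau> Z p = \<tau> Z' p"
  using lin_form_at[OF assms(1), of p] assms(2-4) by metis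

text \<open>The coordinate forms of a local frame already detect every component of Z at
  \<open>p\<close>.\<close>

lemma lin_forms_separate:
  assumes Z: "Z \<in> sections B" and 0: "\<And>\<tau> :: ('m \<Rightarrow> 'f) \<Rightarrow> 'm \<Rightarrow> real. \<tau> \<in> lin_forms B \<Longrightarrow> \<tau> Z p = 0"
  shows "frep B p (Z p) = 0"
proof -
  obtain t U D f \<beta> where *: "t \<in> trivs B" "frep B p = snd t" "U \<subseteq> fst t" "open U" "p \<in> U" "finite D"
    "\<And>b. b \<in> D \<Longrightarrow> f b \<in> sections B" "\<And>b. b \<in> D \<Longrightarrow> \<beta> b \<in> lin_forms B"
    "\<And>b Z q. q \<in> U \<Longrightarrow> \<beta> b Z q = snd t (Z q) \<bullet> b"
    "\<And>w. w \<in> typical B \<Longrightarrow> (\<Sum>b\<in>D. (w \<bullet> b) *\<^sub>R b) = w"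
    "\<And>\<tau> Z q. \<tau> \<in> lin_forms B \<Longrightarrow> Z \<in> sections B \<Longrightarrow> q \<in> U \<Longrightarrow>
      (\<tau> Z q :: real) = (\<Sum>b\<in>D. \<beta> b Z q *\<^sub>R \<tau> (f b) q)"
    by (rule local_frame[of p, where ?'v = real]) (rule that)
  have "(\<Sum>b\<in>D. (frep B p (Z p) \<bullet> b) *\<^sub>R b) = 0"
    by (rule sum.neutral) (use 0[OF *(8)] *(9)[OF *(5), of _ Z] *(2) in auto)
  then show ?thesis using *(10)[OF frep_mem[OF section_fibre[OF Z]]] by simp
qed

end

section \<open>Dual systems and subbundles\<close>

text \<open>Let K be the common kernel of the \<theta> i in V. Duality makes the v i independent and
  splits V into K and their span, so dim V = dim K + k. As S lies in K, the three claims compare S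
  with K: an inequality in general, equality of dimensions if K is in S, and S = K if the dimensions
  match. The last one carries a count made at one point over to its neighbours.\<close>

lemma dim_dual_functionals:
  fixes V S :: "'w::euclidean_space set" and \<theta> :: "nat \<Rightarrow> 'w \<Rightarrow> real"
  assumes V: "subspace V" and S: "subspace S" "S \<subseteq> V"
    and lin: "\<And>i. i < k \<Longrightarrow> linear (\<theta> i)" and v: "\<And>i. i < k \<Longrightarrow> v i \<in> V"
    and dual: "\<And>i j. i < k \<Longrightarrow> j < k \<Longrightarrow> \<theta> i (v j) = (if i = j then 1 else 0)"
    and 0: "\<And>i s. i < k \<Longrightarrow> s \<in> S \<Longrightarrow> \<theta> i s = 0"
  shows "dim S + k \<le> dim V"
    and "(\<And>x. x \<in> V \<Longrightarrow> (\<And>i. i < k \<Longrightarrow> \<theta> i x = 0) \<Longrightarrow> x \<in> S) \<Longrightarrow> dim S + k = dim V"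
    and "dim S + k = dim V \<Longrightarrow> x \<in> V \<Longrightarrow> (\<And>i. i < k \<Longrightarrow> \<theta> i x = 0) \<Longrightarrow> x \<in> S"
proof -
  define K where "K = {x \<in> V. \<forall>i<k. \<theta> i x = 0}"
  define L where "L = span (v ` {..<k})"
  have K: "subspace K"
    unfolding K_def subspace_def using V
    by (auto simp: subspace_0 subspace_add subspace_scale linear_0[OF lin] linear_add[OF lin] linear_scale[OF lin])
  have inj: "inj_on v {..<k}"
    by (rule inj_onI) (use dual in \<open>metis lessThan_iff zero_neq_one\<close>)
  have ind: "independent (v ` {..<k})"
  proof (rule independent_if_scalars_zero)
    fix f x assume eq: "(\<Sum>x\<in>v ` {..<k}. f x *\<^sub>R x) = 0" and "x \<in> v ` {..<k}"
    then obtain i where i: "i < k" "x = v i" by blast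
    have "0 = \<theta> i (\<Sum>j<k. f (v j) *\<^sub>R v j)"
      using eq by (simp add: sum.reindex[OF inj] linear_0[OF lin[OF i(1)]])
    also have "\<dots> = (\<Sum>j<k. f (v j) * \<theta> i (v j))"
      by (simp add: linear_sum[OF lin[OF i(1)]] linear_scale[OF lin[OF i(1)]])
    also have "\<dots> = (\<Sum>j<k. if i = j then f (v j) else 0)"
      by (rule sum.cong) (use dual i in auto)
    finally show "f x = 0" using i by simp
  qed auto
  have dimL: "dim L = k"
    unfolding L_def using dim_span_eq_card_independent[OF ind] card_image[OF inj] by simp
  have LV: "L \<subseteq> V" unfolding L_def using v V by (intro span_minimal) auto
  have "x \<in> K \<inter> L \<Longrightarrow> x = 0" for x
  proof -
    assume x: "x \<in> K \<inter> L"
    then obtain u where "x = (\<Sum>a\<in>v ` {..<k}. u a *\<^sub>R a)"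
      unfolding L_def span_finite[OF finite_imageI[OF finite_lessThan]] by blast
    then have xs: "x = (\<Sum>j<k. u (v j) *\<^sub>R v j)" by (simp add: sum.reindex[OF inj])
    have "u (v i) = 0" if i: "i < k" for i
    proof -
      have "0 = \<theta> i x" using x i by (simp add: K_def)
      also have "\<dots> = (\<Sum>j<k. u (v j) * \<theta> i (v j))"
        unfolding xs by (simp add: linear_sum[OF lin[OF i]] linear_scale[OF lin[OF i]])
      also have "\<dots> = (\<Sum>j<k. if i = j then u (v j) else 0)"
        by (rule sum.cong) (use dual i in auto)
      finally show ?thesis using i by simp
    qed
    then show "x = 0" unfolding xs by simp
  qed
  then have KL: "K \<inter> L = {0}"
    using subspace_0[OF K] subspace_0[OF subspace_span] unfolding L_def by blast
  have sum: "{x + y |x y. x \<in> K \<and> y \<in> L} = V"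
  proof
    show "{x + y |x y. x \<in> K \<and> y \<in> L} \<subseteq> V"
      using LV subspace_add[OF V] by (auto simp: K_def)
    show "V \<subseteq> {x + y |x y. x \<in> K \<and> y \<in> L}"
    proof
      fix x assume x: "x \<in> V"
      let ?y = "\<Sum>j<k. \<theta> j x *\<^sub>R v j"
      have y: "?y \<in> L"
        unfolding L_def by (intro span_sum span_scale span_base) auto
      have "\<theta> i (x - ?y) = 0" if i: "i < k" for i
      proof -
        have "\<theta> i ?y = (\<Sum>j<k. \<theta> j x * \<theta> i (v j))"
          by (simp add: linear_sum[OF lin[OF i]] linear_scale[OF lin[OF i]])
        also have "\<dots> = (\<Sum>j<k. if i = j then \<theta> j x else 0)"
          by (rule sum.cong) (use dual i in auto)
        finally show ?thesis using i by (simp add: linear_diff[OF lin[OF i]])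
      qed
      then have "x - ?y \<in> K"
        unfolding K_def using x y LV subspace_diff[OF V] by auto
      then show "x \<in> {x + y |x y. x \<in> K \<and> y \<in> L}"
        using y by (intro CollectI exI[of _ "x - ?y"] exI[of _ ?y]) simp
    qed
  qed
  have "dim V = dim K + k"
    using dim_sums_Int[OF K, of L] unfolding sum KL dimL using subspace_span unfolding L_def by simp
  moreover have SK: "S \<subseteq> K" using S 0 by (auto simp: K_def)
  ultimately show "dim S + k \<le> dim V"
    using dim_subset[OF SK] by simp
  show "dim S + k = dim V" if "\<And>x. x \<in> V \<Longrightarrow> (\<And>i. i < k \<Longrightarrow> \<theta> i x = 0) \<Longrightarrow> x \<in> S"
  proof -
    have "S = K" using SK that by (auto simp: K_def)
    then show ?thesis using \<open>dim V = dim K + k\<close> by simp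
  qed
  show "x \<in> S" if "dim S + k = dim V" "x \<in> V" "\<And>i. i < k \<Longrightarrow> \<theta> i x = 0"
  proof -
    have "S = K"
      by (rule subspace_dim_equal[OF S(1) K SK]) (use that \<open>dim V = dim K + k\<close> in simp)
    then show ?thesis using that by (auto simp: K_def)
  qed
qed

section \<open>Biorthogonal systems of sections and forms near a point\<close>

definition form_module :: "('m, 'e::euclidean_space, 'f, 'w::euclidean_space) vbundle \<Rightarrow>
    (('m \<Rightarrow> 'f) \<Rightarrow> 'm \<Rightarrow> real) set \<Rightarrow> bool" where
  "form_module B P \<longleftrightarrow> P \<subseteq> lin_forms B \<and> (\<lambda>_ _. 0) \<in> P \<and>
     (\<forall>\<tau>\<in>P. \<forall>\<sigma>\<in>P. (\<lambda>Z p. \<tau> Z p + \<sigma> Z p) \<in> P) \<and>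
     (\<forall>\<tau>\<in>P. \<forall>f. (\<forall>p. smooth_at (base B) p f) \<longrightarrow> (\<lambda>Z p. f p * \<tau> Z p) \<in> P)"

definition sec_module :: "('m, 'e::euclidean_space, 'f, 'w::euclidean_space) vbundle \<Rightarrow> ('m \<Rightarrow> 'f) set \<Rightarrow> bool" where
  "sec_module B Q \<longleftrightarrow> Q \<subseteq> sections B \<and> sec_zero B \<in> Q \<and>
     (\<forall>s\<in>Q. \<forall>s'\<in>Q. sec_add B s s' \<in> Q) \<and>
     (\<forall>s\<in>Q. \<forall>f. (\<forall>p. smooth_at (base B) p f) \<longrightarrow> sec_mult B f s \<in> Q)"

text \<open>Duality is demanded on a whole neighbourhood of \<open>p\<close>, with members from
  prescribed modules of sections and of forms. Spanning is not built in; it comes out of the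
  maximality of \<open>k\<close>.\<close>

definition dual_system :: "('m::topological_space \<Rightarrow> 'f) set \<Rightarrow> (('m \<Rightarrow> 'f) \<Rightarrow> 'm \<Rightarrow> real) set \<Rightarrow>
    'm \<Rightarrow> nat \<Rightarrow> (nat \<Rightarrow> 'm \<Rightarrow> 'f) \<Rightarrow> (nat \<Rightarrow> ('m \<Rightarrow> 'f) \<Rightarrow> 'm \<Rightarrow> real) \<Rightarrow> bool" where
  "dual_system Q P p k e \<Theta> \<longleftrightarrow> (\<forall>j<k. e j \<in> Q \<and> \<Theta> j \<in> P) \<and>
     (\<exists>U. open U \<and> p \<in> U \<and> (\<forall>x\<in>U. \<forall>i<k. \<forall>j<k. \<Theta> i (e j) x = (if i = j then 1 else 0)))"

context vb
begin

lemma form_moduleD: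
  assumes "form_module B P"
  shows "\<tau> \<in> P \<Longrightarrow> \<tau> \<in> lin_forms B" "(\<lambda>_ _. 0) \<in> P"
    "\<tau> \<in> P \<Longrightarrow> \<sigma> \<in> P \<Longrightarrow> (\<lambda>Z p. \<tau> Z p + \<sigma> Z p) \<in> P"
    "\<tau> \<in> P \<Longrightarrow> (\<And>p. smooth_at (base B) p f) \<Longrightarrow> (\<lambda>Z p. f p * \<tau> Z p) \<in> P"
  using assms unfolding form_module_def by blast+

lemma form_module_sum:
  assumes P: "form_module B P" and "finite A" "\<And>i. i \<in> A \<Longrightarrow> \<tau> i \<in> P"
  shows "(\<lambda>Z p. \<Sum>i\<in>A. \<tau> i Z p) \<in> P"
  using assms(2,3)
proof (induction A)
  case empty
  then show ?case using form_moduleD(2)[OF P] by simp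
next
  case (insert i A)
  then show ?case
    using form_moduleD(3)[OF P, of "\<tau> i" "\<lambda>Z p. \<Sum>i\<in>A. \<tau> i Z p"] by simp
qed

lemma lin_form_neg_smooth:
  assumes "\<Theta> \<in> lin_forms B" "Z \<in> sections B"
  shows "smooth_at (base B) q (\<lambda>p. - \<Theta> Z p)"
  by (rule smooth_at_minus[OF lin_formsD(1)[OF assms]])

lemma form_module_lin_forms: "form_module B (lin_forms B)"
  unfolding form_module_def
proof (intro conjI ballI allI impI subset_refl)
  show "(\<lambda>_ _. 0 :: real) \<in> lin_forms B"
    unfolding lin_forms_def by (simp add: smooth_at_const[OF base_manifold])
  fix \<tau> :: "('m \<Rightarrow> 'f) \<Rightarrow> 'm \<Rightarrow> real" assume \<tau>: "\<tau> \<in> lin_forms B"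
  show "(\<lambda>Z p. \<tau> Z p + \<sigma> Z p) \<in> lin_forms B" if \<sigma>: "\<sigma> \<in> lin_forms B" for \<sigma>
    unfolding lin_forms_def
    using lin_formsD[OF \<tau>] lin_formsD[OF \<sigma>]
    by (simp add: fun_eq_iff algebra_simps smooth_at_add[OF base_manifold])
  show "(\<lambda>Z p. f p * \<tau> Z p) \<in> lin_forms B" if f: "\<forall>p. smooth_at (base B) p f" for f
    unfolding lin_forms_def
    using lin_formsD[OF \<tau>] f
    by (simp add: fun_eq_iff algebra_simps smooth_at_mult[OF base_manifold])
qed

text \<open>Z minus the sum of \<Theta> j (Z) e j. Where the system is dual, this is the projection
  to the common kernel of the \<Theta> j along the e j.\<close>

definition sec_reduce :: "nat \<Rightarrow> (nat \<Rightarrow> 'm \<Rightarrow> 'f) \<Rightarrow> (nat \<Rightarrow> ('m \<Rightarrow> 'f) \<Rightarrow> 'm \<Rightarrow> real) \<Rightarrow> ('m \<Rightarrow> 'f) \<Rightarrow> 'm \<Rightarrow> 'f" where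
  "sec_reduce k e \<Theta> Z = sec_add B Z (sec_sum B {..<k} (\<lambda>j. sec_mult B (\<lambda>p. - \<Theta> j Z p) (e j)))"

lemma sec_reduce:
  assumes e: "\<And>j. j < k \<Longrightarrow> e j \<in> sections B" and \<Theta>: "\<And>j. j < k \<Longrightarrow> \<Theta> j \<in> lin_forms B"
    and Z: "Z \<in> sections B"
  shows "sec_reduce k e \<Theta> Z \<in> sections B"
    and "\<tau> \<in> lin_forms B \<Longrightarrow> \<tau> (sec_reduce k e \<Theta> Z) x = \<tau> Z x - (\<Sum>j<k. \<Theta> j Z x *\<^sub>R \<tau> (e j) x)"
    and "frep B x (sec_reduce k e \<Theta> Z x) = frep B x (Z x) - (\<Sum>j<k. \<Theta> j Z x *\<^sub>R frep B x (e j x))"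
    and "sec_module B Q \<Longrightarrow> Z \<in> Q \<Longrightarrow> (\<And>j. j < k \<Longrightarrow> e j \<in> Q) \<Longrightarrow> sec_reduce k e \<Theta> Z \<in> Q"
proof -
  have m: "sec_mult B (\<lambda>p. - \<Theta> j Z p) (e j) \<in> sections B" if "j \<in> {..<k}" for j
    using that by (intro sec_mult_mem e lin_form_neg_smooth \<Theta> Z) auto
  have S: "sec_sum B {..<k} (\<lambda>j. sec_mult B (\<lambda>p. - \<Theta> j Z p) (e j)) \<in> sections B"
    by (rule sec_sum_mem[OF _ m]) auto
  show "sec_reduce k e \<Theta> Z \<in> sections B"
    unfolding sec_reduce_def by (rule sec_add_mem[OF Z S])
  show "\<tau> (sec_reduce k e \<Theta> Z) x = \<tau> Z x - (\<Sum>j<k. \<Theta> j Z x *\<^sub>R \<tau> (e j) x)" if \<tau>: "\<tau> \<in> lin_forms B"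
  proof -
    have "\<tau> (sec_mult B (\<lambda>p. - \<Theta> j Z p) (e j)) x = - (\<Theta> j Z x *\<^sub>R \<tau> (e j) x)" if "j \<in> {..<k}" for j
      using lin_formsD(3)[OF \<tau> e lin_form_neg_smooth[OF \<Theta> Z]] that by simp
    then have "(\<Sum>j<k. \<tau> (sec_mult B (\<lambda>p. - \<Theta> j Z p) (e j)) x) = - (\<Sum>j<k. \<Theta> j Z x *\<^sub>R \<tau> (e j) x)"
      by (simp add: sum_negf)
    moreover have "\<tau> (sec_reduce k e \<Theta> Z) x = \<tau> Z x + (\<Sum>j<k. \<tau> (sec_mult B (\<lambda>p. - \<Theta> j Z p) (e j)) x)"
      unfolding sec_reduce_def lin_formsD(2)[OF \<tau> Z S]
      by (rule arg_cong[where f = "(+) (\<tau> Z x)"], rule lin_form_sum[OF \<tau> finite_lessThan m])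
    ultimately show ?thesis by simp
  qed
  show "frep B x (sec_reduce k e \<Theta> Z x) = frep B x (Z x) - (\<Sum>j<k. \<Theta> j Z x *\<^sub>R frep B x (e j x))"
  proof -
    have "frep B x (sec_mult B (\<lambda>p. - \<Theta> j Z p) (e j) x) = - (\<Theta> j Z x *\<^sub>R frep B x (e j x))" if "j \<in> {..<k}" for j
      using frep_sec_mult[OF e] that by simp
    then have "(\<Sum>j<k. frep B x (sec_mult B (\<lambda>p. - \<Theta> j Z p) (e j) x)) = - (\<Sum>j<k. \<Theta> j Z x *\<^sub>R frep B x (e j x))"
      by (simp add: sum_negf)
    moreover have "frep B x (sec_sum B {..<k} (\<lambda>j. sec_mult B (\<lambda>p. - \<Theta> j Z p) (e j)) x) =
        (\<Sum>j<k. frep B x (sec_mult B (\<lambda>p. - \<Theta> j Z p) (e j) x))"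
      by (rule frep_sec_sum(1)) (rule section_fibre[OF m])
    ultimately show ?thesis
      unfolding sec_reduce_def frep_sec_add[OF Z S] by simp
  qed
  show "sec_reduce k e \<Theta> Z \<in> Q" if Q: "sec_module B Q" "Z \<in> Q" "\<And>j. j < k \<Longrightarrow> e j \<in> Q"
  proof -
    have mQ: "sec_mult B (\<lambda>p. - \<Theta> j Z p) (e j) \<in> Q" if "j \<in> {..<k}" for j
      using Q(1) Q(3)[of j] that lin_form_neg_smooth[OF \<Theta> Z] unfolding sec_module_def by simp
    have "sec_sum B A (\<lambda>j. sec_mult B (\<lambda>p. - \<Theta> j Z p) (e j)) \<in> Q" if "finite A" "A \<subseteq> {..<k}" for A
      using that
    proof (induction A)
      case empty
      then show ?case using Q(1) by (simp add: sec_sum_empty sec_module_def)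
    next
      case (insert i A)
      have "sec_sum B (insert i A) (\<lambda>j. sec_mult B (\<lambda>p. - \<Theta> j Z p) (e j)) =
          sec_add B (sec_mult B (\<lambda>p. - \<Theta> i Z p) (e i)) (sec_sum B A (\<lambda>j. sec_mult B (\<lambda>p. - \<Theta> j Z p) (e j)))"
        by (rule sec_sum_insert[OF insert(1,2)]) (use m insert(4) in blast)
      then show ?case using insert mQ[of i] Q(1) unfolding sec_module_def by simp
    qed
    then show ?thesis
      using Q unfolding sec_reduce_def sec_module_def by simp
  qed
qed

lemma local_inverse:
  fixes f :: "'m \<Rightarrow> real"
  assumes "\<And>q. smooth_at (base B) q f" "f p \<noteq> 0"
  obtains g U where "\<And>q. smooth_at (base B) q g" "open U" "p \<in> U" "\<And>q. q \<in> U \<Longrightarrow> g q * f q = (1::real)"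
proof -
  obtain V where V: "open V" "p \<in> V" "\<And>q. q \<in> V \<Longrightarrow> f q \<noteq> 0"
    by (rule smooth_at_imp_nonzero_nhd[OF base_manifold assms]) (rule that)
  obtain \<kappa> :: "'m \<Rightarrow> real" and U K where \<kappa>: "\<And>q. smooth_at (base B) q \<kappa>" "open U" "p \<in> U"
    "\<And>q. q \<in> U \<Longrightarrow> \<kappa> q = 1" "U \<subseteq> K" "closed K" "K \<subseteq> V" "\<And>q. q \<notin> K \<Longrightarrow> \<kappa> q = 0"
    by (rule smooth_bump[OF base_manifold V(1,2)]) (rule that)
  have "smooth_at (base B) q (\<lambda>q. \<kappa> q *\<^sub>R inverse (f q))" for q
    by (rule smooth_at_extend[OF base_manifold V(1) \<kappa>(1,6,7)])
      (use \<kappa>(8) smooth_at_inverse[OF assms(1) V(3)] in auto)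
  then show thesis
    by (rule that[OF _ \<kappa>(2,3)]) (use \<kappa>(4,5,7) V(3) in auto)
qed

text \<open>A Gram-Schmidt step on both sides: Z is replaced by its reduction Y, killed by all
  \<Theta> i near \<open>p\<close>, and \<Omega> by \<Omega>', which kills all e i there. Since
  \<Theta> j (Z) vanishes at \<open>p\<close>, the new pairing at \<open>p\<close> is still \<Omega>
  Z p. It is nonzero, so \<Omega>' can be rescaled to take the value 1 on Y near
  \<open>p\<close>.\<close>

lemma dual_extend:
  assumes Q: "sec_module B Q" and P: "form_module B P" and d: "dual_system Q P p k e \<Theta>"
    and Z: "Z \<in> Q" "\<And>j. j < k \<Longrightarrow> \<Theta> j Z p = 0" and \<Omega>: "\<Omega> \<in> P" "\<Omega> Z p \<noteq> 0"
  shows "\<exists>e \<Theta>. dual_system Q P p (Suc k) e \<Theta>"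
proof -
  note PL = form_moduleD(1)[OF P]
  have QB: "Q \<subseteq> sections B" using Q unfolding sec_module_def by blast
  obtain U where U: "open U" "p \<in> U"
    "\<And>x i j. x \<in> U \<Longrightarrow> i < k \<Longrightarrow> j < k \<Longrightarrow> \<Theta> i (e j) x = (if i = j then 1 else 0)"
    using d unfolding dual_system_def by blast
  have eQ: "\<And>j. j < k \<Longrightarrow> e j \<in> Q" and \<Theta>P: "\<And>j. j < k \<Longrightarrow> \<Theta> j \<in> P"
    using d unfolding dual_system_def by blast+
  have e: "\<And>j. j < k \<Longrightarrow> e j \<in> sections B" and \<Theta>: "\<And>j. j < k \<Longrightarrow> \<Theta> j \<in> lin_forms B"
    and ZB: "Z \<in> sections B" using eQ \<Theta>P QB PL Z by blast+
  define Y where "Y = sec_reduce k e \<Theta> Z"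
  note red = sec_reduce[where e = e and \<Theta> = \<Theta> and k = k, OF e \<Theta> ZB]
  have Y: "Y \<in> Q" "Y \<in> sections B"
    unfolding Y_def using red(4)[OF _ _ Q Z(1) eQ] red(1) by auto
  have YF: "\<tau> Y x = \<tau> Z x - (\<Sum>j<k. \<Theta> j Z x * \<tau> (e j) x)" if "\<tau> \<in> lin_forms B" for \<tau> :: "('m \<Rightarrow> 'f) \<Rightarrow> 'm \<Rightarrow> real" and x
    unfolding Y_def using red(2)[OF _ _ that] by simp
  have \<Theta>Y: "\<Theta> i Y x = 0" if "x \<in> U" "i < k" for i x
  proof -
    have "(\<Sum>j<k. \<Theta> j Z x * \<Theta> i (e j) x) = (\<Sum>j<k. if i = j then \<Theta> j Z x else 0)"
      by (rule sum.cong) (use U(3)[OF that(1)] that in auto)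
    then show ?thesis using YF[OF \<Theta>[OF that(2)]] that by simp
  qed
  define \<Omega>' where "\<Omega>' X x = \<Omega> X x + (\<Sum>j<k. (- \<Omega> (e j) x) * \<Theta> j X x)" for X x
  have \<Omega>L: "\<Omega> \<in> lin_forms B" using PL \<Omega> by blast
  have \<Omega>': "\<Omega>' \<in> P"
  proof -
    have "(\<lambda>X x. (- \<Omega> (e j) x) * \<Theta> j X x) \<in> P" if "j \<in> {..<k}" for j
      using that by (intro form_moduleD(4)[OF P \<Theta>P] lin_form_neg_smooth[OF \<Omega>L e]) auto
    then have "(\<lambda>X x. \<Sum>j<k. (- \<Omega> (e j) x) * \<Theta> j X x) \<in> P"
      by (intro form_module_sum[OF P finite_lessThan])
    from form_moduleD(3)[OF P \<Omega>(1) this] show ?thesis by (simp add: \<Omega>'_def[abs_def])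
  qed
  have \<Omega>e: "\<Omega>' (e i) x = 0" if "x \<in> U" "i < k" for i x
  proof -
    have "(\<Sum>j<k. (- \<Omega> (e j) x) * \<Theta> j (e i) x) = (\<Sum>j<k. if j = i then - \<Omega> (e j) x else 0)"
      by (rule sum.cong) (use U(3)[OF that(1)] that in auto)
    then show ?thesis using that by (simp add: \<Omega>'_def)
  qed
  have "\<Omega>' Y p = \<Omega> Y p" using \<Theta>Y[OF U(2)] by (simp add: \<Omega>'_def)
  also have "\<dots> = \<Omega> Z p" using YF[OF \<Omega>L] Z(2) by simp
  finally have nz: "\<Omega>' Y p \<noteq> 0" using \<Omega>(2) by simp
  have "smooth_at (base B) q (\<Omega>' Y)" for q
    by (rule lin_formsD(1)[OF PL[OF \<Omega>'] Y(2)])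
  from local_inverse[OF this nz]
  obtain g W where g: "\<And>q. smooth_at (base B) q g" "open W" "p \<in> W" "\<And>q. q \<in> W \<Longrightarrow> g q * \<Omega>' Y q = 1"
    by metis
  define e' where "e' = e(k := Y)"
  define \<Theta>' where "\<Theta>' = fun_upd \<Theta> k (\<lambda>X x. g x * \<Omega>' X x)"
  have "dual_system Q P p (Suc k) e' \<Theta>'"
    unfolding dual_system_def
  proof (intro conjI exI[of _ "U \<inter> W"] allI impI ballI)
    fix j assume "j < Suc k"
    then show "e' j \<in> Q" "\<Theta>' j \<in> P"
      using eQ \<Theta>P Y(1) form_moduleD(4)[OF P \<Omega>' g(1)] by (auto simp: e'_def \<Theta>'_def less_Suc_eq)
  next
    fix x i j assume *: "x \<in> U \<inter> W" "i < Suc k" "j < Suc k"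
    then consider "i < k" "j < k" | "i < k" "j = k" | "i = k" "j < k" | "i = k" "j = k" by linarith
    then show "\<Theta>' i (e' j) x = (if i = j then 1 else 0)"
      by cases (use * U(3)[of x i j] \<Theta>Y[of x i] \<Omega>e[of x j] g(4)[of x] in \<open>auto simp: e'_def \<Theta>'_def\<close>)
  qed (use U g in auto)
  then show ?thesis by blast
qed

lemma form_functionals:
  fixes \<Theta> :: "nat \<Rightarrow> ('m \<Rightarrow> 'f) \<Rightarrow> 'm \<Rightarrow> real"
  assumes "\<And>j. j < k \<Longrightarrow> \<Theta> j \<in> lin_forms B"
  obtains \<theta> where "\<And>j. j < k \<Longrightarrow> linear (\<theta> j)"
    "\<And>j Z. j < k \<Longrightarrow> Z \<in> sections B \<Longrightarrow> \<Theta> j Z x = \<theta> j (frep B x (Z x))"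
proof -
  have "\<exists>\<theta>. linear \<theta> \<and> (\<forall>Z\<in>sections B. \<Theta> j Z x = \<theta> (frep B x (Z x)))" if "j < k" for j
    using lin_form_at[OF assms[OF that], of x] by metis
  then obtain \<theta> where "\<forall>j. j < k \<longrightarrow> linear (\<theta> j) \<and> (\<forall>Z\<in>sections B. \<Theta> j Z x = \<theta> j (frep B x (Z x)))"
    by metis
  then show thesis using that by blast
qed

lemma dual_bound:
  assumes Q: "Q \<subseteq> sections B" and P: "P \<subseteq> lin_forms B" and d: "dual_system Q P p k e \<Theta>"
  shows "k \<le> DIM('w)"
proof -
  have e: "\<And>j. j < k \<Longrightarrow> e j \<in> sections B" and \<Theta>: "\<And>j. j < k \<Longrightarrow> \<Theta> j \<in> lin_forms B"
    using d Q P unfolding dual_system_def by blast+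
  have dual: "\<Theta> i (e j) p = (if i = j then 1 else 0)" if "i < k" "j < k" for i j
    using d that unfolding dual_system_def by blast
  obtain \<theta> where \<theta>: "\<And>j. j < k \<Longrightarrow> linear (\<theta> j)"
    "\<And>j Z. j < k \<Longrightarrow> Z \<in> sections B \<Longrightarrow> \<Theta> j Z p = \<theta> j (frep B p (Z p))"
    by (rule form_functionals[where x = p and \<Theta> = \<Theta> and k = k, OF \<Theta>]) (use that in blast)+
  have "dim {0::'w} + k \<le> dim (UNIV :: 'w set)"
    by (rule dim_dual_functionals(1)[where \<theta> = \<theta> and v = "\<lambda>j. frep B p (e j p)"])
      (use \<theta>(1) \<theta>(2)[OF _ e, symmetric] dual in \<open>auto simp: linear_0\<close>)
  then show ?thesis by simp
qed

text \<open>In the fibre over \<open>p\<close> the members of a dual system are linearly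
  independent, which bounds \<open>k\<close> by \<open>DIM('w)\<close>; a pair violating the
  conclusion would extend a system of greatest size.\<close>

lemma dual_maximal:
  assumes Q: "sec_module B Q" and P: "form_module B P"
  obtains k e \<Theta> where "dual_system Q P p k e \<Theta>"
    "\<And>Z \<Omega>. Z \<in> Q \<Longrightarrow> \<forall>j<k. \<Theta> j Z p = 0 \<Longrightarrow> \<Omega> \<in> P \<Longrightarrow> \<Omega> Z p = 0"
proof -
  define R where "R k \<longleftrightarrow> (\<exists>e \<Theta>. dual_system Q P p k e \<Theta>)" for k
  have "R 0" unfolding R_def dual_system_def by (auto intro: exI[of _ UNIV])
  moreover have "\<forall>k. R k \<longrightarrow> k < Suc DIM('w)"
  proof (intro allI impI)
    fix k assume "R k"
    then obtain e \<Theta> where "dual_system Q P p k e \<Theta>" unfolding R_def by blast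
    then have "k \<le> DIM('w)"
      by (rule dual_bound[rotated 2]) (use Q P in \<open>auto simp: sec_module_def form_module_def\<close>)
    then show "k < Suc DIM('w)" by simp
  qed
  ultimately obtain k where k: "R k" "\<And>j. R j \<Longrightarrow> j \<le> k"
    using ex_has_greatest_nat[of R 0 "\<lambda>k. k" "Suc DIM('w)"] by blast
  then obtain e \<Theta> where d: "dual_system Q P p k e \<Theta>" unfolding R_def by blast
  show thesis
  proof (rule that[OF d])
    fix Z \<Omega> assume *: "Z \<in> Q" "\<forall>j<k. \<Theta> j Z p = 0" "\<Omega> \<in> P"
    show "\<Omega> Z p = 0"
    proof (rule ccontr)
      assume "\<Omega> Z p \<noteq> 0"
      from dual_extend[OF Q P d *(1) *(2)[rule_format] *(3) this] have "R (Suc k)" unfolding R_def by blast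
      then show False using k(2) by fastforce
    qed
  qed
qed

end

section \<open>Subbundles and their fibres in coordinates\<close>

locale subvb = vb B for B :: "('m::{t2_space, second_countable_topology}, 'e::euclidean_space, 'f, 'w::euclidean_space) vbundle" +
  fixes E :: "('m, 'e, 'f, 'w) vbundle"
  assumes sub: "vector_subbundle E B"
begin

sublocale E: vb E
  using sub unfolding vector_subbundle_def by unfold_locales blast

lemma base_E: "base E = base B"
  using sub unfolding vector_subbundle_def by blast

lemma inclusion: "vb_morphism E B (\<lambda>e. e) (\<lambda>p. p)"
  using sub unfolding vector_subbundle_def by blast

lemma fibre_E: "a \<in> fibre E p \<Longrightarrow> a \<in> fibre B p"
  and fadd_E: "a \<in> fibre E p \<Longrightarrow> b \<in> fibre E p \<Longrightarrow> fadd E a b = fadd B a b"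
  and fscale_E: "a \<in> fibre E p \<Longrightarrow> fscale E r a = fscale B r a"
  using inclusion unfolding vb_morphism_def by simp_all

lemma sections_E: assumes s: "s \<in> sections E" shows "s \<in> sections B"
proof (rule sectionI)
  show "s q \<in> fibre B q" for q by (rule fibre_E[OF E.section_fibre[OF s]])
  fix p
  obtain t where t: "t \<in> trivs E" "p \<in> fst t" using E.triv_ex[of p] .
  obtain t' where t': "t' \<in> trivs B" "p \<in> fst t'" using triv_ex[of p] .
  have "\<forall>(U, \<Phi>)\<in>trivs E. \<forall>(U', \<Phi>')\<in>trivs B.
        smooth_fam_on (base E) (U \<inter> (\<lambda>p. p) -` U') (typical E) (\<lambda>p w. \<Phi>' (inv_into (fibre E p) \<Phi> w))"
    using inclusion unfolding vb_morphism_def by blast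
  from this[rule_format, OF t(1)] t'(1)
  have fam: "smooth_fam_on (base B) (fst t \<inter> fst t') (typical E) (\<lambda>p w. snd t' (inv_into (fibre E p) (snd t) w))"
    by (auto simp: split_beta base_E)
  have A: "open (fst t \<inter> fst t')" "p \<in> fst t \<inter> fst t'"
    using open_Int[OF E.triv(1)[OF t(1)] triv(1)[OF t'(1)]] t t' by auto
  have "smooth_at (base B) p (\<lambda>q. snd t (s q))"
    using E.section_smooth[OF s t] by (simp add: base_E)
  then have "smooth_at (base B) p (\<lambda>q. snd t' (inv_into (fibre E q) (snd t) (snd t (s q))))"
    by (rule smooth_at_fam[OF base_manifold A fam]) (use E.triv_mem[OF t(1) _ E.section_fibre[OF s]] in auto)
  then have "smooth_at (base B) p (\<lambda>q. snd t' (s q))"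
    by (rule smooth_at_cong[OF base_manifold _ A]) (use E.triv_inv(3)[OF t(1) _ E.section_fibre[OF s]] in auto)
  then show "\<exists>t\<in>trivs B. p \<in> fst t \<and> smooth_at (base B) p (\<lambda>q. snd t (s q))"
    using t' by blast
qed

lemma sec_add_E: "s \<in> sections E \<Longrightarrow> s' \<in> sections E \<Longrightarrow> sec_add E s s' = sec_add B s s'"
  and sec_mult_E: "s \<in> sections E \<Longrightarrow> sec_mult E f s = sec_mult B f s"
proof -
  show "sec_add E s s' = sec_add B s s'" if "s \<in> sections E" "s' \<in> sections E"
    unfolding sec_add_def
    by (rule ext, rule fadd_E[OF E.section_fibre[OF that(1)] E.section_fibre[OF that(2)]])
  show "sec_mult E f s = sec_mult B f s" if "s \<in> sections E"
    unfolding sec_mult_def by (rule ext, rule fscale_E[OF E.section_fibre[OF that]])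
qed

text \<open>The zero of a fibre is its only idempotent for addition, and E restricts the addition of
  B.\<close>

lemma sec_zero_E: "sec_zero E = sec_zero B"
proof
  fix p
  note z = E.sec_zero_fibre[of p]
  have "fadd E (sec_zero E p) (sec_zero E p) = sec_zero E p"
    using E.frep_inj[OF E.fadd_fibre[OF z z] z] E.frep_add[OF z z] E.frep_zero by simp
  then have "frep B p (sec_zero E p) = 0"
    using fadd_E[OF z z] frep_add[OF fibre_E[OF z] fibre_E[OF z]] by simp
  then show "sec_zero E p = sec_zero B p"
    using fibre_zero_iff[OF fibre_E[OF z]] by simp
qed

lemma sec_module_E: "sec_module B (sections E)"
  unfolding sec_module_def
  using sections_E E.sec_zero_mem E.sec_add_mem E.sec_mult_mem sec_add_E sec_mult_E base_E sec_zero_E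
  by (metis subsetI)

lemma sec_module_B: "sec_module B (sections B)"
  unfolding sec_module_def using sec_zero_mem sec_add_mem sec_mult_mem by blast

text \<open>Coordinates of B are used for the fibres of E too: the typical fibre of E is an
  unrelated subspace of \<open>'w\<close>, so its own coordinates cannot be compared with those of
  B.\<close>

definition eimg :: "'m \<Rightarrow> 'w set" where
  "eimg x = frep B x ` fibre E x"

lemma eimg_mem: "a \<in> fibre B x \<Longrightarrow> frep B x a \<in> eimg x \<longleftrightarrow> a \<in> fibre E x"
  unfolding eimg_def using frep_inj[of a x] fibre_E[of _ x] by auto

lemma eimg_typical: "eimg x \<subseteq> typical B"
  unfolding eimg_def using frep_mem fibre_E by blast

lemma eimg_subspace: "subspace (eimg x)"
  unfolding subspace_def
proof (intro conjI ballI allI)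
  show "0 \<in> eimg x" unfolding eimg_def
    by (rule image_eqI[OF _ E.sec_zero_fibre]) (simp add: sec_zero_E frep_zero)
  show "u + v \<in> eimg x" if uv: "u \<in> eimg x" "v \<in> eimg x" for u v
  proof -
    obtain a b where ab: "a \<in> fibre E x" "b \<in> fibre E x" "u = frep B x a" "v = frep B x b"
      using uv unfolding eimg_def by blast
    then have "u + v = frep B x (fadd E a b)" by (simp add: frep_add fibre_E fadd_E)
    then show ?thesis unfolding eimg_def using E.fadd_fibre ab by blast
  qed
  show "r *\<^sub>R u \<in> eimg x" if u: "u \<in> eimg x" for r u
  proof -
    obtain a where a: "a \<in> fibre E x" "u = frep B x a" using u unfolding eimg_def by blast
    then have "r *\<^sub>R u = frep B x (fscale E r a)" by (simp add: frep_scale fibre_E fscale_E)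
    then show ?thesis unfolding eimg_def using E.fscale_fibre a by blast
  qed
qed

text \<open>Constancy of the rank: in coordinates, the inclusion of E in B is a linear injection of
  \<open>typical E\<close>.\<close>

lemma eimg_dim: "dim (eimg x) = dim (typical E)"
proof -
  obtain D where D: "finite D" "D \<subseteq> typical E" "\<And>w. w \<in> typical E \<Longrightarrow> (\<Sum>b\<in>D. (w \<bullet> b) *\<^sub>R b) = w"
    by (rule E.typical_basis) (rule that)
  define l where "l w = inv_into (fibre E x) (frep E x) w" for w
  have l: "l w \<in> fibre E x" "frep E x (l w) = w" if "w \<in> typical E" for w
    unfolding l_def using E.frep_inv that by blast+
  have l_add: "frep B x (l (w + w')) = frep B x (l w) + frep B x (l w')"
    if w: "w \<in> typical E" "w' \<in> typical E" for w w'
  proof -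
    have "l (w + w') = fadd E (l w) (l w')"
      using E.frep_inj[OF l(1)[OF subspace_add[OF E.typical_subspace w]] E.fadd_fibre[OF l(1)[OF w(1)] l(1)[OF w(2)]]]
        E.frep_add[OF l(1)[OF w(1)] l(1)[OF w(2)]] l(2) w subspace_add[OF E.typical_subspace w] by simp
    then show ?thesis
      using fadd_E[OF l(1)[OF w(1)] l(1)[OF w(2)]] frep_add[OF fibre_E[OF l(1)[OF w(1)]] fibre_E[OF l(1)[OF w(2)]]] by simp
  qed
  have l_scale: "frep B x (l (r *\<^sub>R w)) = r *\<^sub>R frep B x (l w)" if w: "w \<in> typical E" for r w
  proof -
    have "l (r *\<^sub>R w) = fscale E r (l w)"
      using E.frep_inj[OF l(1)[OF subspace_scale[OF E.typical_subspace w, of r]] E.fscale_fibre[OF l(1)[OF w], of r]]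
        E.frep_scale[OF l(1)[OF w]] l(2) w subspace_scale[OF E.typical_subspace w] by simp
    then show ?thesis
      using fscale_E[OF l(1)[OF w]] frep_scale[OF fibre_E[OF l(1)[OF w]]] by simp
  qed
  have l_sum: "(\<Sum>b\<in>A. u b *\<^sub>R b) \<in> typical E \<and>
      frep B x (l (\<Sum>b\<in>A. u b *\<^sub>R b)) = (\<Sum>b\<in>A. u b *\<^sub>R frep B x (l b))" if "A \<subseteq> D" for A u
  proof -
    have "finite A" using that D(1) finite_subset by blast
    then show ?thesis using that
    proof (induction A)
      case empty
      have "frep B x (l 0) = 0" using l_scale[OF subspace_0[OF E.typical_subspace], of 0] by simp
      then show ?case using subspace_0[OF E.typical_subspace] by simp
    next
      case (insert b A)
      then have "b \<in> typical E" using D(2) by blast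
      then show ?case
        using insert l_add[OF subspace_scale[OF E.typical_subspace \<open>b \<in> typical E\<close>]] l_scale subspace_scale[OF E.typical_subspace]
          subspace_add[OF E.typical_subspace] by simp
    qed
  qed
  \<comment> \<open>\<open>l\<close> is additive and homogeneous on \<open>typical E\<close> only;
    inner products with a basis extend the coordinate inclusion to a linear map on the whole
    type.\<close>
  define L where "L w = (\<Sum>b\<in>D. (w \<bullet> b) *\<^sub>R frep B x (l b))" for w
  have "linear L"
    by (rule linearI) (auto simp: L_def inner_add_left scaleR_add_left sum.distrib scaleR_sum_right)
  have L: "L w = frep B x (l w)" if "w \<in> typical E" for w
    using l_sum[of D "\<lambda>b. w \<bullet> b"] D(3)[OF that] by (simp add: L_def)
  have "inj_on L (typical E)"
    by (rule inj_onI) (metis L l frep_inj fibre_E)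
  moreover have "span (typical E) = typical E" using E.typical_subspace span_eq_iff by blast
  ultimately have "dim (L ` typical E) = dim (typical E)"
    using dim_image_eq[OF \<open>linear L\<close>] by metis
  moreover have "L ` typical E = eimg x"
  proof
    show "L ` typical E \<subseteq> eimg x" using L l(1) unfolding eimg_def by auto
    show "eimg x \<subseteq> L ` typical E"
    proof
      fix u assume "u \<in> eimg x"
      then obtain a where a: "a \<in> fibre E x" "u = frep B x a" unfolding eimg_def by blast
      have "l (frep E x a) = a" unfolding l_def using E.frep_inv(3)[OF a(1)] .
      then show "u \<in> L ` typical E" using L[OF E.frep_mem[OF a(1)]] a E.frep_mem[OF a(1)] by (metis image_eqI)
    qed
  qed
  ultimately show ?thesis by simp
qed

end

section \<open>Annihilators are finitely generated\<close>

context vb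
begin

text \<open>With bump functions along a countable subcover, \<psi> k = \<kappa> k (1 - \<kappa> 0)
  ... (1 - \<kappa> (k - 1)) sums to 1 minus a product. A factor of this product vanishes wherever
  some \<kappa> j equals 1, so local finiteness and total 1 both follow, without a locally finite
  refinement or a division. The cut-off index in the last claim replaces an infinite sum.\<close>

lemma partition_of_unity:
  fixes \<Phi> :: "'m set \<Rightarrow> bool"
  assumes "\<And>p. \<exists>U. open U \<and> p \<in> U \<and> \<Phi> U"
  obtains U :: "nat \<Rightarrow> 'm set" and \<psi> :: "nat \<Rightarrow> 'm \<Rightarrow> real"
  where "\<And>k. \<Phi> (U k)" "\<And>k q. smooth_at (base B) q (\<psi> k)" "\<And>k q. \<psi> k q \<noteq> 0 \<Longrightarrow> q \<in> U k"
    "\<And>q. \<exists>W J. open W \<and> q \<in> W \<and> (\<forall>k\<ge>J. \<forall>x\<in>W. \<psi> k x = 0)"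
    "\<And>q J. \<forall>k\<ge>J. \<psi> k q = 0 \<Longrightarrow> (\<Sum>k<J. \<psi> k q) = 1"
proof -
  have "\<exists>U V. open V \<and> p \<in> V \<and> \<Phi> U \<and> (\<exists>\<kappa> :: 'm \<Rightarrow> real. (\<forall>q. smooth_at (base B) q \<kappa>) \<and>
      (\<forall>q\<in>V. \<kappa> q = 1) \<and> (\<forall>q. \<kappa> q \<noteq> 0 \<longrightarrow> q \<in> U))" for p
  proof -
    obtain U where U: "open U" "p \<in> U" "\<Phi> U" using assms by blast
    obtain \<kappa> :: "'m \<Rightarrow> real" and V K where \<kappa>: "\<And>q. smooth_at (base B) q \<kappa>" "open V" "p \<in> V"
      "\<And>q. q \<in> V \<Longrightarrow> \<kappa> q = 1" "V \<subseteq> K" "closed K" "K \<subseteq> U" "\<And>q. q \<notin> K \<Longrightarrow> \<kappa> q = 0"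
      by (rule smooth_bump[OF base_manifold U(1,2)]) (rule that)
    have "\<forall>q. \<kappa> q \<noteq> 0 \<longrightarrow> q \<in> U" using \<kappa>(7,8) by blast
    then show ?thesis using U \<kappa>(1-4) by (intro exI[of _ U] exI[of _ V]) auto
  qed
  then obtain U V where UV: "\<And>p. open (V p)" "\<And>p. p \<in> V p" "\<And>p. \<Phi> (U p)"
    "\<And>p. \<exists>\<kappa> :: 'm \<Rightarrow> real. (\<forall>q. smooth_at (base B) q \<kappa>) \<and> (\<forall>q\<in>V p. \<kappa> q = 1) \<and> (\<forall>q. \<kappa> q \<noteq> 0 \<longrightarrow> q \<in> U p)"
    by metis
  then obtain \<kappa> :: "'m \<Rightarrow> 'm \<Rightarrow> real" where \<kappa>: "\<And>p q. smooth_at (base B) q (\<kappa> p)"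
    "\<And>p q. q \<in> V p \<Longrightarrow> \<kappa> p q = 1" "\<And>p q. \<kappa> p q \<noteq> 0 \<Longrightarrow> q \<in> U p"
    by metis
  obtain F where F: "F \<subseteq> range V" "countable F" "\<Union>F = \<Union>(range V)"
    using Lindelof[of "range V"] UV(1) by auto
  have "\<Union>F = UNIV" using F(3) UV(2) by blast
  then have ne: "F \<noteq> {}" by auto
  have "\<exists>p. from_nat_into F n = V p" for n
    using from_nat_into[OF ne] F(1) by blast
  then obtain pt where pt: "\<And>n. from_nat_into F n = V (pt n)" by metis
  have cover: "\<exists>n. q \<in> V (pt n)" for q
  proof -
    have "q \<in> \<Union>F" unfolding \<open>\<Union>F = UNIV\<close> by simp
    then obtain A where A: "A \<in> F" "q \<in> A" by (rule UnionE)
    then have "A \<in> range (from_nat_into F)" using range_from_nat_into[OF ne F(2)] by simp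
    then obtain n where "A = from_nat_into F n" by (rule rangeE)
    then show ?thesis using A(2) pt[of n] by (intro exI[of _ n]) simp
  qed
  define \<psi> where "\<psi> k q = \<kappa> (pt k) q * (\<Prod>j<k. 1 - \<kappa> (pt j) q)" for k q
  have sm: "smooth_at (base B) q (\<psi> k)" for k q
    unfolding \<psi>_def[abs_def]
    by (intro smooth_at_mult smooth_at_prod smooth_at_diff smooth_at_const base_manifold \<kappa>)
  have vanish: "\<psi> k x = 0" if "x \<in> V (pt n)" "k \<ge> Suc n" for k x n
  proof -
    have "(\<Prod>j<k. 1 - \<kappa> (pt j) x) = 0"
      by (rule prod_zero) (use that \<kappa>(2) in \<open>auto intro!: bexI[of _ n]\<close>)
    then show ?thesis by (simp add: \<psi>_def)
  qed
  have tel: "(\<Sum>k<J. \<psi> k q) = 1 - (\<Prod>j<J. 1 - \<kappa> (pt j) q)" for J q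
    by (induction J) (simp_all add: \<psi>_def algebra_simps)
  show thesis
  proof (rule that[of "\<lambda>k. U (pt k)" \<psi>])
    show "\<exists>W J. open W \<and> q \<in> W \<and> (\<forall>k\<ge>J. \<forall>x\<in>W. \<psi> k x = 0)" for q
    proof -
      obtain n where "q \<in> V (pt n)" using cover by blast
      then show ?thesis using UV(1) vanish by (intro exI[of _ "V (pt n)"] exI[of _ "Suc n"]) auto
    qed
    show "(\<Sum>k<J. \<psi> k q) = 1" if z: "\<forall>k\<ge>J. \<psi> k q = 0" for q J
    proof -
      obtain n where n: "q \<in> V (pt n)" using cover by blast
      \<comment> \<open>The range is enlarged by zero terms until it contains an index whose bump
        function is 1 at q; then the telescoped product is 0.\<close>
      have "(\<Sum>k<J. \<psi> k q) = (\<Sum>k<max J (Suc n). \<psi> k q)"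
        by (rule sum.mono_neutral_left) (use z in auto)
      also have "(\<Prod>j<max J (Suc n). 1 - \<kappa> (pt j) q) = 0"
        by (rule prod_zero) (use n \<kappa>(2) in \<open>auto intro!: bexI[of _ n]\<close>)
      then have "(\<Sum>k<max J (Suc n). \<psi> k q) = 1" by (simp add: tel)
      finally show ?thesis .
    qed
    show "q \<in> U (pt k)" if "\<psi> k q \<noteq> 0" for k q
      using that \<kappa>(3) by (auto simp: \<psi>_def)
  qed (use UV(3) sm in auto)
qed

text \<open>Near a point, \<tau> Z q is a continuously differentiable function of the chart
  coordinates of q and the fibre coordinates of Z q, so these values form a null set in a space of
  larger dimension. Countably many such neighbourhoods cover the manifold.\<close>

lemma lin_form_avoids:
  fixes \<tau> :: "('m \<Rightarrow> 'f) \<Rightarrow> 'm \<Rightarrow> 'v::euclidean_space"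
  assumes \<tau>: "\<tau> \<in> lin_forms B" and dim: "DIM('e) + DIM('w) < DIM('v)"
  obtains c where "\<And>Z p. Z \<in> sections B \<Longrightarrow> \<tau> Z p \<noteq> c"
proof -
  have "\<exists>O'. open O' \<and> p \<in> O' \<and> negligible {\<tau> Z q |Z q. Z \<in> sections B \<and> q \<in> O'}" for p
  proof -
    obtain t U D f \<beta> where fr: "t \<in> trivs B" "frep B p = snd t" "U \<subseteq> fst t" "open U" "p \<in> U" "finite D"
      "\<And>b. b \<in> D \<Longrightarrow> f b \<in> sections B" "\<And>b. b \<in> D \<Longrightarrow> \<beta> b \<in> lin_forms B"
      "\<And>b Z q. q \<in> U \<Longrightarrow> \<beta> b Z q = snd t (Z q) \<bullet> b"
      "\<And>w. w \<in> typical B \<Longrightarrow> (\<Sum>b\<in>D. (w \<bullet> b) *\<^sub>R b) = w"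
      "\<And>\<tau> Z q. \<tau> \<in> lin_forms B \<Longrightarrow> Z \<in> sections B \<Longrightarrow> q \<in> U \<Longrightarrow>
        (\<tau> Z q :: 'v) = (\<Sum>b\<in>D. \<beta> b Z q *\<^sub>R \<tau> (f b) q)"
      by (rule local_frame[of p, where ?'v = 'v]) (rule that)
    obtain c where c: "c \<in> atlas (base B)" "p \<in> fst c" using manifold_chart_ex[OF base_manifold] .
    have "\<exists>W G. open W \<and> snd c p \<in> W \<and> (\<forall>k. Ck_on k W G) \<and>
        (\<forall>q\<in>fst c. snd c q \<in> W \<longrightarrow> \<tau> (f b) q = G (snd c q))" if "b \<in> D" for b
      using smooth_at_chart[OF base_manifold lin_formsD(1)[OF \<tau> fr(7)[OF that]] c] unfolding smooth_in_def .
    then obtain W G where WG: "\<And>b. b \<in> D \<Longrightarrow> open (W b)" "\<And>b. b \<in> D \<Longrightarrow> snd c p \<in> W b"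
      "\<And>b k. b \<in> D \<Longrightarrow> Ck_on k (W b) (G b)"
      "\<And>b q. b \<in> D \<Longrightarrow> q \<in> fst c \<Longrightarrow> snd c q \<in> W b \<Longrightarrow> \<tau> (f b) q = G b (snd c q)"
      by metis
    define W' where "W' = (\<Inter>b\<in>D. W b)"
    have W': "open W'" "snd c p \<in> W'" unfolding W'_def using WG(1,2) fr(6) by auto
    define g where "g z = (\<Sum>b\<in>D. (snd z \<bullet> b) *\<^sub>R G b (fst z))" for z :: "'e \<times> 'w"
    have op: "open (W' \<times> (UNIV :: 'w set))" using W' by (simp add: open_Times)
    have "Ck_on (Suc 0) (W' \<times> UNIV) g"
      unfolding g_def[abs_def]
    proof (rule Ck_on_sum[OF op])
      fix b assume b: "b \<in> D"
      have fst: "Ck_on (Suc 0) (W' \<times> (UNIV :: 'w set)) (\<lambda>z. fst z)"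
        by (rule Ck_on_bounded_linear[OF bounded_linear_fst op Ck_on_ident[OF op]])
      have "(\<lambda>z. fst z) ` (W' \<times> (UNIV :: 'w set)) \<subseteq> W b" using b unfolding W'_def by auto
      from Ck_on_compose[OF op WG(1)[OF b] this fst WG(3)[OF b]]
      have 1: "Ck_on (Suc 0) (W' \<times> (UNIV :: 'w set)) (\<lambda>z. G b (fst z))" .
      have 2: "Ck_on (Suc 0) (W' \<times> (UNIV :: 'w set)) (\<lambda>z. snd z \<bullet> b)"
        by (rule Ck_on_bounded_linear[OF bounded_linear_compose[OF bounded_linear_inner_left bounded_linear_snd] op Ck_on_ident[OF op]])
      show "Ck_on (Suc 0) (W' \<times> UNIV) (\<lambda>z. (snd z \<bullet> b) *\<^sub>R G b (fst z))"
        by (rule Ck_on_bilinear[OF bounded_bilinear_scaleR op 2 1])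
    qed
    then have "g differentiable_on (W' \<times> UNIV)"
      unfolding Ck_on.simps by (auto intro!: differentiable_at_imp_differentiable_on)
    then have neg: "negligible (g ` (W' \<times> UNIV))"
      by (rule negligible_differentiable_image_lowdim[rotated]) (use dim in simp)
    have "continuous_on (fst c) (snd c)"
      using homeomorphism_cont1[OF manifold_chart(3)[OF base_manifold c(1)]] .
    then have "open (U \<inter> (fst c \<inter> snd c -` W'))"
      by (intro open_Int fr(4) continuous_open_preimage[OF _ manifold_chart(1)[OF base_manifold c(1)] W'(1)])
    moreover have "p \<in> U \<inter> (fst c \<inter> snd c -` W')" using fr(5) c W' by auto
    moreover have "{\<tau> Z q |Z q. Z \<in> sections B \<and> q \<in> U \<inter> (fst c \<inter> snd c -` W')} \<subseteq> g ` (W' \<times> UNIV)"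
    proof safe
      fix Z q assume *: "Z \<in> sections B" "q \<in> U" "q \<in> fst c" "snd c q \<in> W'"
      have "\<tau> Z q = g (snd c q, snd t (Z q))"
        unfolding g_def fr(11)[OF \<tau> *(1,2)]
        by (rule sum.cong) (use * fr(9)[OF *(2)] WG(4) in \<open>auto simp: W'_def\<close>)
      then show "\<tau> Z q \<in> g ` (W' \<times> UNIV)" using * by auto
    qed
    then have "negligible {\<tau> Z q |Z q. Z \<in> sections B \<and> q \<in> U \<inter> (fst c \<inter> snd c -` W')}"
      by (rule negligible_subset[OF neg])
    ultimately show ?thesis by blast
  qed
  then have "\<exists>O'. \<forall>p. open (O' p) \<and> p \<in> O' p \<and> negligible {\<tau> Z q |Z q. Z \<in> sections B \<and> q \<in> O' p}"
    by (intro choice allI)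
  then obtain O' where "\<forall>p. open (O' p) \<and> p \<in> O' p \<and> negligible {\<tau> Z q |Z q. Z \<in> sections B \<and> q \<in> O' p}"
    by (rule exE)
  then have O': "\<And>p. open (O' p)" "\<And>p. p \<in> O' p"
    "\<And>p. negligible {\<tau> Z q |Z q. Z \<in> sections B \<and> q \<in> O' p}" by simp_all
  obtain F where F: "F \<subseteq> range O'" "countable F" "\<Union>F = \<Union>(range O')"
    using Lindelof[of "range O'"] O'(1) by auto
  have "negligible (\<Union>A\<in>F. {\<tau> Z q |Z q. Z \<in> sections B \<and> q \<in> A})"
    by (rule negligible_countable_Union) (use F O'(3) in auto)
  moreover have "{\<tau> Z q |Z q. Z \<in> sections B} \<subseteq> (\<Union>A\<in>F. {\<tau> Z q |Z q. Z \<in> sections B \<and> q \<in> A})"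
  proof
    fix y assume "y \<in> {\<tau> Z q |Z q. Z \<in> sections B}"
    then obtain Z q where Z: "y = \<tau> Z q" "Z \<in> sections B" by blast
    have "q \<in> \<Union>(range O')" using O'(2)[of q] by (intro UnionI[of "O' q"]) auto
    then obtain A where "A \<in> F" "q \<in> A" unfolding F(3)[symmetric] by (rule UnionE)
    then show "y \<in> (\<Union>A\<in>F. {\<tau> Z q |Z q. Z \<in> sections B \<and> q \<in> A})"
      using Z by (intro UN_I[of A]) auto
  qed
  ultimately have "negligible {\<tau> Z q |Z q. Z \<in> sections B}" by (rule negligible_subset)
  then have "{\<tau> Z q |Z q. Z \<in> sections B} \<noteq> UNIV" using non_negligible_UNIV by metis
  then obtain c where "c \<notin> {\<tau> Z q |Z q. Z \<in> sections B}" by blast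
  then show thesis by (intro that[of c]) auto
qed

text \<open>If \<tau> Z = s(Z) c at a point where s(Z) is not 0, dividing Z by that number gives a
  section on which \<tau> takes the value c. So the negative of any vector off the range of \<tau>
  will do.\<close>

lemma lin_form_mixing:
  fixes \<tau> :: "('m \<Rightarrow> 'f) \<Rightarrow> 'm \<Rightarrow> 'v::euclidean_space"
  assumes \<tau>: "\<tau> \<in> lin_forms B" and s: "s \<in> lin_forms B" and dim: "DIM('e) + DIM('w) < DIM('v)"
  obtains c where "\<And>Z p. Z \<in> sections B \<Longrightarrow> \<tau> Z p + s Z p *\<^sub>R c = 0 \<Longrightarrow> \<tau> Z p = 0 \<and> s Z p = (0::real)"
proof -
  obtain c where c: "\<And>Z p. Z \<in> sections B \<Longrightarrow> \<tau> Z p \<noteq> c"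
    by (rule lin_form_avoids[OF \<tau> dim]) (rule that)
  show thesis
  proof (rule that[of "- c"])
    fix Z p assume Z: "Z \<in> sections B" and eq: "\<tau> Z p + s Z p *\<^sub>R (- c) = 0"
    have "s Z p = 0"
    proof (rule ccontr)
      assume nz: "s Z p \<noteq> 0"
      have k: "smooth_at (base B) q (\<lambda>_. 1 / s Z p)" for q by (rule smooth_at_const[OF base_manifold])
      have "\<tau> (sec_mult B (\<lambda>_. 1 / s Z p) Z) p = (1 / s Z p) *\<^sub>R (s Z p *\<^sub>R c)"
        using lin_formsD(3)[OF \<tau> Z k] eq by simp
      then have "\<tau> (sec_mult B (\<lambda>_. 1 / s Z p) Z) p = c" using nz by simp
      then show False using c[OF sec_mult_mem[OF Z k]] by blast
    qed
    then show "\<tau> Z p = 0 \<and> s Z p = 0" using eq by simp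
  qed
qed

lemma lin_forms_scaleR:
  assumes "s \<in> lin_forms B"
  shows "(\<lambda>Z p. s Z p *\<^sub>R (c :: 'v::euclidean_space)) \<in> lin_forms B"
  unfolding lin_forms_def using lin_formsD[OF assms]
  by (simp add: fun_eq_iff scaleR_add_left smooth_at_scaleR[OF base_manifold] smooth_at_const[OF base_manifold])

lemma lin_forms_add:
  fixes \<tau> \<sigma> :: "('m \<Rightarrow> 'f) \<Rightarrow> 'm \<Rightarrow> 'v::euclidean_space"
  assumes "\<tau> \<in> lin_forms B" "\<sigma> \<in> lin_forms B"
  shows "(\<lambda>Z p. \<tau> Z p + \<sigma> Z p) \<in> lin_forms B"
  unfolding lin_forms_def using lin_formsD[OF assms(1)] lin_formsD[OF assms(2)]
  by (simp add: fun_eq_iff scaleR_add_right algebra_simps smooth_at_add[OF base_manifold])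

lemma lin_forms_local:
  fixes \<tau> :: "('m \<Rightarrow> 'f) \<Rightarrow> 'm \<Rightarrow> 'v::euclidean_space"
  assumes "\<And>p. \<exists>\<sigma>\<in>lin_forms B. \<exists>W. open W \<and> p \<in> W \<and> (\<forall>Z\<in>sections B. \<forall>x\<in>W. \<tau> Z x = \<sigma> Z x)"
  shows "\<tau> \<in> lin_forms B"
  unfolding lin_forms_def mem_Collect_eq
proof (intro conjI ballI allI impI)
  fix Z p assume Z: "Z \<in> sections B"
  obtain \<sigma> W where \<sigma>: "\<sigma> \<in> lin_forms B" "open W" "p \<in> W" "\<And>Z x. Z \<in> sections B \<Longrightarrow> x \<in> W \<Longrightarrow> \<tau> Z x = \<sigma> Z x"
    using assms[of p] by metis
  show "smooth_at (base B) p (\<tau> Z)"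
    by (rule smooth_at_cong[OF base_manifold lin_formsD(1)[OF \<sigma>(1) Z] \<sigma>(2,3)]) (use \<sigma>(4) Z in auto)
next
  fix Z Y assume Z: "Z \<in> sections B" and Y: "Y \<in> sections B"
  show "\<tau> (sec_add B Z Y) = (\<lambda>p. \<tau> Z p + \<tau> Y p)"
  proof
    fix p
    obtain \<sigma> W where "\<sigma> \<in> lin_forms B" "open W" "p \<in> W" "\<And>Z x. Z \<in> sections B \<Longrightarrow> x \<in> W \<Longrightarrow> \<tau> Z x = \<sigma> Z x"
      using assms[of p] by metis
    then show "\<tau> (sec_add B Z Y) p = \<tau> Z p + \<tau> Y p"
      using Z Y lin_formsD(2) sec_add_mem by metis
  qed
next
  fix Z f assume Z: "Z \<in> sections B" and f: "\<forall>p. smooth_at (base B) p (f :: 'm \<Rightarrow> real)"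
  show "\<tau> (sec_mult B f Z) = (\<lambda>p. f p *\<^sub>R \<tau> Z p)"
  proof
    fix p
    obtain \<sigma> W where "\<sigma> \<in> lin_forms B" "open W" "p \<in> W" "\<And>Z x. Z \<in> sections B \<Longrightarrow> x \<in> W \<Longrightarrow> \<tau> Z x = \<sigma> Z x"
      using assms[of p] by metis
    then show "\<tau> (sec_mult B f Z) p = f p *\<^sub>R \<tau> Z p"
      using Z f lin_formsD(3) sec_mult_mem by metis
  qed
qed

text \<open>The sum of the \<psi> k (c k) is cut off at an index depending on the point. Near each
  point one common index gives the same values, and this makes the result smooth.\<close>

lemma glue_sections:
  fixes \<psi> :: "nat \<Rightarrow> 'm \<Rightarrow> real"
  assumes \<psi>: "\<And>k q. smooth_at (base B) q (\<psi> k)"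
      "\<And>q. \<exists>W J. open W \<and> q \<in> W \<and> (\<forall>k\<ge>J. \<forall>x\<in>W. \<psi> k x = 0)"
    and c: "\<And>k. c k \<in> sections B"
  obtains s where "s \<in> sections B"
    "\<And>x J. \<forall>k\<ge>J. \<psi> k x = 0 \<Longrightarrow> frep B x (s x) = (\<Sum>k<J. \<psi> k x *\<^sub>R frep B x (c k x))"
proof -
  define J where "J x = (SOME J. \<forall>k\<ge>J. \<psi> k x = 0)" for x
  have J: "\<psi> k x = 0" if "k \<ge> J x" for k x
  proof -
    have "\<exists>J. \<forall>k\<ge>J. \<psi> k x = 0" using \<psi>(2)[of x] by blast
    from someI_ex[OF this] show ?thesis using that unfolding J_def by blast
  qed
  define S where "S j = sec_sum B {..<j} (\<lambda>k. sec_mult B (\<psi> k) (c k))" for j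
  have m: "sec_mult B (\<psi> k) (c k) \<in> sections B" for k by (rule sec_mult_mem[OF c \<psi>(1)])
  have S: "S j \<in> sections B" for j unfolding S_def by (rule sec_sum_mem[OF _ m]) simp
  have Sf: "frep B x (S j x) = (\<Sum>k<j. \<psi> k x *\<^sub>R frep B x (c k x))" for x j
    unfolding S_def by (subst frep_sec_sum(1)[OF section_fibre[OF m]]) (simp add: frep_sec_mult[OF c])
  have tail: "(\<Sum>k<j. \<psi> k x *\<^sub>R frep B x (c k x)) = (\<Sum>k<J x. \<psi> k x *\<^sub>R frep B x (c k x))"
    if "\<And>k. k \<ge> j \<Longrightarrow> \<psi> k x = 0" for x j
  proof -
    have "(\<Sum>k<j. \<psi> k x *\<^sub>R frep B x (c k x)) = (\<Sum>k<max j (J x). \<psi> k x *\<^sub>R frep B x (c k x))"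
      by (rule sum.mono_neutral_left) (use that in auto)
    also have "\<dots> = (\<Sum>k<J x. \<psi> k x *\<^sub>R frep B x (c k x))"
      by (rule sum.mono_neutral_right) (use J in auto)
    finally show ?thesis .
  qed
  define s where "s x = S (J x) x" for x
  have sf: "s x \<in> fibre B x" for x unfolding s_def by (rule section_fibre[OF S])
  have eq: "s x = S j x" if "\<And>k. k \<ge> j \<Longrightarrow> \<psi> k x = 0" for x j
    using frep_inj[OF sf section_fibre[OF S, of j x]] tail[OF that] Sf unfolding s_def by simp
  have "s \<in> sections B"
  proof (rule sectionI[OF sf])
    fix p
    obtain W j where W: "open W" "p \<in> W" "\<And>k x. k \<ge> j \<Longrightarrow> x \<in> W \<Longrightarrow> \<psi> k x = 0"
      using \<psi>(2)[of p] by blast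
    obtain t where t: "t \<in> trivs B" "p \<in> fst t" using triv_ex[of p] .
    have "smooth_at (base B) p (\<lambda>q. snd t (s q))"
      by (rule smooth_at_cong[OF base_manifold section_smooth[OF S t, of j] W(1,2)])
        (rule arg_cong[where f = "snd t"], rule eq[symmetric], rule W(3))
    then show "\<exists>t\<in>trivs B. p \<in> fst t \<and> smooth_at (base B) p (\<lambda>q. snd t (s q))" using t by blast
  qed
  then show thesis
    by (rule that) (use tail Sf in \<open>auto simp: s_def\<close>)
qed

text \<open>Each form \<open>s k\<close> is absorbed into a single vector-valued form: by dimension, the vector
  \<open>c\<close> in \<open>\<tau> + s k c\<close> can be chosen outside of the values of \<open>- \<tau>\<close>, so that no kernel is lost.\<close>

lemma finite_joint_kernel:
  fixes s :: "nat \<Rightarrow> ('m \<Rightarrow> 'f) \<Rightarrow> 'm \<Rightarrow> real"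
  assumes P: "form_module B P" and s: "\<And>k. s k \<in> P"
    and fin: "\<And>q. \<exists>W J. open W \<and> q \<in> W \<and> (\<forall>k\<ge>J. \<forall>x\<in>W. \<forall>Z\<in>sections B. s k Z x = 0)"
    and dim: "DIM('e) + DIM('w) < DIM('v::euclidean_space)"
  obtains \<tau> :: "('m \<Rightarrow> 'f) \<Rightarrow> 'm \<Rightarrow> 'v::euclidean_space" where "\<tau> \<in> lin_forms B"
    "\<And>k Z p. Z \<in> sections B \<Longrightarrow> \<tau> Z p = 0 \<Longrightarrow> s k Z p = 0"
    "\<And>Z p. Z \<in> sections B \<Longrightarrow> \<forall>k. s k Z p = 0 \<Longrightarrow> \<tau> Z p = 0"
proof -
  have sL: "s k \<in> lin_forms B" for k using form_moduleD(1)[OF P s] .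
  have "\<exists>f. \<forall>n. f n \<in> lin_forms B \<and> (\<forall>Z\<in>sections B. \<forall>p. (\<forall>k. s k Z p = 0) \<longrightarrow> f n Z p = (0::'v)) \<and>
     (\<exists>c. f (Suc n) = (\<lambda>Z p. f n Z p + s n Z p *\<^sub>R c) \<and>
       (\<forall>Z\<in>sections B. \<forall>p. f (Suc n) Z p = 0 \<longrightarrow> f n Z p = 0 \<and> s n Z p = 0))"
  proof -
    \<comment> \<open>The same statement, bracketed into an invariant of each \<open>f n\<close> and
      a relation between \<open>f n\<close> and its successor, the shape required by recursive
      choice.\<close>
    have "\<exists>f. \<forall>n. (f n \<in> lin_forms B \<and> (\<forall>Z\<in>sections B. \<forall>p. (\<forall>k. s k Z p = 0) \<longrightarrow> f n Z p = (0::'v))) \<and>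
     (\<exists>c. f (Suc n) = (\<lambda>Z p. f n Z p + s n Z p *\<^sub>R c) \<and>
       (\<forall>Z\<in>sections B. \<forall>p. f (Suc n) Z p = 0 \<longrightarrow> f n Z p = 0 \<and> s n Z p = 0))"
    proof (rule dependent_nat_choice)
      have "(\<lambda>_ _. 0 :: 'v) \<in> lin_forms B" unfolding lin_forms_def by (simp add: smooth_at_const[OF base_manifold])
      then show "\<exists>x. x \<in> lin_forms B \<and> (\<forall>Z\<in>sections B. \<forall>p. (\<forall>k. s k Z p = 0) \<longrightarrow> x Z p = (0::'v))"
        by (intro exI[of _ "\<lambda>_ _. 0"]) simp
      fix x :: "('m \<Rightarrow> 'f) \<Rightarrow> 'm \<Rightarrow> 'v" and n
      assume x: "x \<in> lin_forms B \<and> (\<forall>Z\<in>sections B. \<forall>p. (\<forall>k. s k Z p = 0) \<longrightarrow> x Z p = 0)"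
      obtain c where c: "\<And>Z p. Z \<in> sections B \<Longrightarrow> x Z p + s n Z p *\<^sub>R c = 0 \<Longrightarrow> x Z p = 0 \<and> s n Z p = 0"
        by (rule lin_form_mixing[OF conjunct1[OF x] sL dim]) (rule that)
      show "\<exists>y. (y \<in> lin_forms B \<and> (\<forall>Z\<in>sections B. \<forall>p. (\<forall>k. s k Z p = 0) \<longrightarrow> y Z p = 0)) \<and>
          (\<exists>c. y = (\<lambda>Z p. x Z p + s n Z p *\<^sub>R c) \<and>
            (\<forall>Z\<in>sections B. \<forall>p. y Z p = 0 \<longrightarrow> x Z p = 0 \<and> s n Z p = 0))"
      proof (intro exI[of _ "\<lambda>Z p. x Z p + s n Z p *\<^sub>R c"] conjI exI[of _ c])
        show "(\<lambda>Z p. x Z p + s n Z p *\<^sub>R c) \<in> lin_forms B"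
          by (rule lin_forms_add[OF conjunct1[OF x] lin_forms_scaleR[OF sL]])
      qed (use x c in auto)
    qed
    then show ?thesis by simp
  qed
  then obtain f where F: "\<forall>n. f n \<in> lin_forms B \<and>
     (\<forall>Z\<in>sections B. \<forall>p. (\<forall>k. s k Z p = 0) \<longrightarrow> f n Z p = (0::'v)) \<and>
     (\<exists>c. f (Suc n) = (\<lambda>Z p. f n Z p + s n Z p *\<^sub>R c) \<and>
       (\<forall>Z\<in>sections B. \<forall>p. f (Suc n) Z p = 0 \<longrightarrow> f n Z p = 0 \<and> s n Z p = 0))"
    by (rule exE)
  have f1: "f n \<in> lin_forms B" for n using spec[OF F, of n] by (elim conjE)
  have f2: "f n Z p = 0" if "Z \<in> sections B" "\<forall>k. s k Z p = 0" for n Z p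
    using conjunct1[OF conjunct2[OF spec[OF F, of n]], rule_format, OF that(1), of p] that(2) by simp
  have f3: "\<exists>c. f (Suc n) = (\<lambda>Z p. f n Z p + s n Z p *\<^sub>R c)"
    and f4: "Z \<in> sections B \<Longrightarrow> f (Suc n) Z p = 0 \<Longrightarrow> f n Z p = 0 \<and> s n Z p = 0" for n Z p
  proof -
    obtain c where c: "f (Suc n) = (\<lambda>Z p. f n Z p + s n Z p *\<^sub>R c)"
      "\<forall>Z\<in>sections B. \<forall>p. f (Suc n) Z p = 0 \<longrightarrow> f n Z p = 0 \<and> s n Z p = 0"
      using conjunct2[OF conjunct2[OF spec[OF F, of n]]] by (elim exE conjE) (rule that)
    show "\<exists>c. f (Suc n) = (\<lambda>Z p. f n Z p + s n Z p *\<^sub>R c)" using c(1) by (rule exI)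
    show "f n Z p = 0 \<and> s n Z p = 0" if "Z \<in> sections B" "f (Suc n) Z p = 0"
      using c(2)[rule_format, OF that] .
  qed
  note f = f1 f2 f3 f4
  have f_Suc: "f (Suc n) Z x = f n Z x" if "s n Z x = 0" for n Z x
    using f(3)[of n] that by auto
  have stable: "f (j + i) Z x = f j Z x" if "\<And>k. k \<ge> j \<Longrightarrow> s k Z x = 0" for i j Z x
    using that f_Suc by (induction i) auto
  have down: "\<forall>k<n. s k Z p = 0" if "Z \<in> sections B" "f n Z p = 0" for n Z p
    using that(2)
  proof (induction n)
    case (Suc n)
    then show ?case using f(4)[OF that(1) Suc.prems] by (auto simp: less_Suc_eq)
  qed simp
  \<comment> \<open>At x the forms \<open>s k\<close> vanish from \<open>J x\<close> on, so the
    sequence \<open>f n\<close> is stationary there, and \<tau> is its final value. The index can be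
    chosen uniformly near each point, so locally \<tau> is one of the \<open>f n\<close>.\<close>
  define J where "J x = (SOME J. \<forall>k\<ge>J. \<forall>Z\<in>sections B. s k Z x = 0)" for x
  have J: "s k Z x = 0" if "k \<ge> J x" "Z \<in> sections B" for k Z x
  proof -
    have "\<exists>J. \<forall>k\<ge>J. \<forall>Z\<in>sections B. s k Z x = 0" using fin[of x] by blast
    from someI_ex[OF this] show ?thesis using that unfolding J_def by blast
  qed
  define \<tau> where "\<tau> Z x = f (J x) Z x" for Z x
  have \<tau>f: "\<tau> Z x = f j Z x" if "\<And>k. k \<ge> j \<Longrightarrow> s k Z x = 0" "Z \<in> sections B" for j Z x
    using stable[of "J x" Z x j] stable[of j Z x "J x"] J[OF _ that(2)] that(1)
    by (simp add: \<tau>_def add.commute)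
  have "\<tau> \<in> lin_forms B"
  proof (rule lin_forms_local)
    fix p
    obtain W j where W: "open W" "p \<in> W" "\<And>k x Z. k \<ge> j \<Longrightarrow> x \<in> W \<Longrightarrow> Z \<in> sections B \<Longrightarrow> s k Z x = 0"
      using fin[of p] by blast
    show "\<exists>\<sigma>\<in>lin_forms B. \<exists>W. open W \<and> p \<in> W \<and> (\<forall>Z\<in>sections B. \<forall>x\<in>W. \<tau> Z x = \<sigma> Z x)"
      using \<tau>f W by (intro bexI[OF _ f(1)[of j]] exI[of _ W]) auto
  qed
  moreover have "s k Z p = 0" if Z: "Z \<in> sections B" "\<tau> Z p = 0" for k Z p
  proof (cases "k < J p")
    case True
    then show ?thesis using down[OF Z(1) Z(2)[unfolded \<tau>_def]] by blast
  next
    case False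
    then show ?thesis using J[OF _ Z(1)] by simp
  qed
  moreover have "\<tau> Z p = 0" if "Z \<in> sections B" "\<forall>k. s k Z p = 0" for Z p
    unfolding \<tau>_def by (rule f(2)[OF that])
  ultimately show thesis by (rule that)
qed

end

section \<open>Local frames of a subbundle and of a complement, and the annihilator\<close>

context subvb
begin

definition ann :: "(('m \<Rightarrow> 'f) \<Rightarrow> 'm \<Rightarrow> real) set" where
  "ann = {\<Omega> \<in> lin_forms B. \<forall>S\<in>sections E. \<forall>p. \<Omega> S p = 0}"

lemma form_module_ann: "form_module B ann"
  using form_module_lin_forms unfolding form_module_def ann_def by auto

text \<open>A maximal dual system between sections of E and all forms on B has as many members as
  the rank of E, because forms separate the vectors of the fibre over \<open>p\<close>. The rank
  being constant and duality valid on all of \<open>U\<close>, the same sections span the fibres of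
  E over \<open>U\<close>.\<close>

lemma E_local_frame:
  obtains U and k :: nat and e \<Theta> where "open U" "p \<in> U" "\<And>j. j < k \<Longrightarrow> e j \<in> sections E" "\<And>j. j < k \<Longrightarrow> \<Theta> j \<in> lin_forms B"
    "\<And>x i j. x \<in> U \<Longrightarrow> i < k \<Longrightarrow> j < k \<Longrightarrow> \<Theta> i (e j) x = (if i = j then 1 else (0::real))"
    "\<And>x Z. x \<in> U \<Longrightarrow> Z \<in> sections E \<Longrightarrow> frep B x (Z x) = (\<Sum>j<k. \<Theta> j Z x *\<^sub>R frep B x (e j x))"
proof -
  obtain k e \<Theta> where d: "dual_system (sections E) (lin_forms B) p k e \<Theta>"
    and max: "\<And>Z \<Omega>. Z \<in> sections E \<Longrightarrow> \<forall>j<k. \<Theta> j Z p = 0 \<Longrightarrow> \<Omega> \<in> lin_forms B \<Longrightarrow> \<Omega> Z p = (0::real)"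
    by (rule dual_maximal[OF sec_module_E form_module_lin_forms, of p]) (rule that)
  obtain U where U: "open U" "p \<in> U"
    "\<And>x i j. x \<in> U \<Longrightarrow> i < k \<Longrightarrow> j < k \<Longrightarrow> \<Theta> i (e j) x = (if i = j then 1 else 0)"
    using d unfolding dual_system_def by blast
  have e: "\<And>j. j < k \<Longrightarrow> e j \<in> sections E" and \<Theta>: "\<And>j. j < k \<Longrightarrow> \<Theta> j \<in> lin_forms B"
    using d unfolding dual_system_def by blast+
  have eB: "\<And>j. j < k \<Longrightarrow> e j \<in> sections B" using sections_E e by blast
  have ev: "frep B x (e j x) \<in> eimg x" if "j < k" for j x
    unfolding eimg_def using E.section_fibre[OF e[OF that]] by blast
  have fr: "frep B x (Z x) \<in> eimg x" if "Z \<in> sections E" for Z x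
    unfolding eimg_def using E.section_fibre[OF that] by blast
  have k: "k = dim (typical E)"
  proof -
    obtain \<theta> where \<theta>: "\<And>j. j < k \<Longrightarrow> linear (\<theta> j)"
      "\<And>j Z. j < k \<Longrightarrow> Z \<in> sections B \<Longrightarrow> \<Theta> j Z p = \<theta> j (frep B p (Z p))"
      by (rule form_functionals[where x = p and \<Theta> = \<Theta> and k = k, OF \<Theta>]) (use that in blast)+
    have "dim {0::'w} + k = dim (eimg p)"
    proof (rule dim_dual_functionals(2)[where \<theta> = \<theta> and v = "\<lambda>j. frep B p (e j p)"])
      fix v assume v: "v \<in> eimg p" "\<And>i. i < k \<Longrightarrow> \<theta> i v = 0"
      then obtain a where a: "a \<in> fibre E p" "v = frep B p a" unfolding eimg_def by blast
      obtain Z where Z: "Z \<in> sections E" "Z p = a" using E.section_through[OF a(1)] .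
      have "frep B p (Z p) = 0"
        by (rule lin_forms_separate[OF sections_E[OF Z(1)]])
          (rule max[OF Z(1)], use \<theta>(2)[OF _ sections_E[OF Z(1)]] v a Z in auto)
      then show "v \<in> {0}" using a Z by simp
    next
      show "{0} \<subseteq> eimg p" using subspace_0[OF eimg_subspace] by simp
      show "\<theta> i (frep B p (e j p)) = (if i = j then 1 else 0)" if "i < k" "j < k" for i j
        using \<theta>(2)[OF that(1) eB[OF that(2)]] U(3)[OF U(2) that] by simp
      show "\<theta> i s = 0" if "i < k" "s \<in> {0}" for i s
        using linear_0[OF \<theta>(1)[OF that(1)]] that(2) by simp
    qed (fact eimg_subspace subspace_single_0 \<theta>(1) ev)+
    then show ?thesis using eimg_dim by simp
  qed
  have exp: "frep B x (Z x) = (\<Sum>j<k. \<Theta> j Z x *\<^sub>R frep B x (e j x))" if x: "x \<in> U" and Z: "Z \<in> sections E" for x Z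
  proof -
    obtain \<theta> where \<theta>: "\<And>j. j < k \<Longrightarrow> linear (\<theta> j)"
      "\<And>j Z. j < k \<Longrightarrow> Z \<in> sections B \<Longrightarrow> \<Theta> j Z x = \<theta> j (frep B x (Z x))"
      by (rule form_functionals[where x = x and \<Theta> = \<Theta> and k = k, OF \<Theta>]) (use that in blast)+
    note red = sec_reduce[where e = e and \<Theta> = \<Theta> and k = k, OF eB \<Theta> sections_E[OF Z]]
    define Y where "Y = sec_reduce k e \<Theta> Z"
    have Y: "Y \<in> sections E" "Y \<in> sections B"
      unfolding Y_def using red(4)[OF _ _ sec_module_E Z e] red(1) by auto
    have "\<Theta> i Y x = 0" if i: "i < k" for i
    proof -
      have "(\<Sum>j<k. \<Theta> j Z x * \<Theta> i (e j) x) = (\<Sum>j<k. if i = j then \<Theta> j Z x else 0)"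
        by (rule sum.cong) (use U(3)[OF x] i in auto)
      then show ?thesis unfolding Y_def using red(2)[OF _ _ \<Theta>[OF i]] i by simp
    qed
    then have \<theta>Y: "\<theta> i (frep B x (Y x)) = 0" if "i < k" for i
      using \<theta>(2)[OF that Y(2)] that by simp
    have "frep B x (Y x) \<in> {0}"
    proof (rule dim_dual_functionals(3)[where \<theta> = \<theta> and v = "\<lambda>j. frep B x (e j x)" and k = k and S = "{0}"])
      show "{0} \<subseteq> eimg x" using subspace_0[OF eimg_subspace] by simp
      show "\<theta> i (frep B x (e j x)) = (if i = j then 1 else 0)" if "i < k" "j < k" for i j
        using \<theta>(2)[OF that(1) eB[OF that(2)]] U(3)[OF x that] by simp
      show "\<theta> i s = 0" if "i < k" "s \<in> {0}" for i s
        using linear_0[OF \<theta>(1)[OF that(1)]] that(2) by simp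
      show "dim {0::'w} + k = dim (eimg x)" using k eimg_dim by simp
    qed (fact eimg_subspace subspace_single_0 \<theta>(1) ev fr[OF Y(1)] \<theta>Y)+
    then show ?thesis unfolding Y_def using red(3) by simp
  qed
  show thesis by (rule that[OF U(1,2) e \<Theta> U(3) exp])
qed

text \<open>Smoothness in trivializations of B says nothing directly about those of E. Near
  \<open>p\<close>, however, Z coincides with the combination of frame sections of E with
  coefficients \<Theta> j (Z), and these are smooth because the \<Theta> j are forms on all of
  B.\<close>

lemma section_E_I:
  assumes Z: "Z \<in> sections B" and ZE: "\<And>x. Z x \<in> fibre E x"
  shows "Z \<in> sections E"
proof (rule E.sectionI[OF ZE])
  fix p
  obtain U and k :: nat and e \<Theta> where F: "open U" "p \<in> U" "\<And>j. j < k \<Longrightarrow> e j \<in> sections E" "\<And>j. j < k \<Longrightarrow> \<Theta> j \<in> lin_forms B"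
    "\<And>x i j. x \<in> U \<Longrightarrow> i < k \<Longrightarrow> j < k \<Longrightarrow> \<Theta> i (e j) x = (if i = j then 1 else (0::real))"
    "\<And>x Z. x \<in> U \<Longrightarrow> Z \<in> sections E \<Longrightarrow> frep B x (Z x) = (\<Sum>j<k. \<Theta> j Z x *\<^sub>R frep B x (e j x))"
    by (rule E_local_frame[of p]) (rule that)
  define Y where "Y = sec_sum E {..<k} (\<lambda>j. sec_mult E (\<Theta> j Z) (e j))"
  have m: "sec_mult E (\<Theta> j Z) (e j) \<in> sections E" if "j \<in> {..<k}" for j
    using that by (intro E.sec_mult_mem F(3)) (auto simp: base_E intro: lin_formsD(1)[OF F(4) Z])
  have Y: "Y \<in> sections E" unfolding Y_def by (rule E.sec_sum_mem[OF finite_lessThan m])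
  have "sec_sum E A (\<lambda>j. sec_mult E (\<Theta> j Z) (e j)) x \<in> fibre E x \<and>
      frep B x (sec_sum E A (\<lambda>j. sec_mult E (\<Theta> j Z) (e j)) x) = (\<Sum>j\<in>A. \<Theta> j Z x *\<^sub>R frep B x (e j x))"
    if "finite A" "A \<subseteq> {..<k}" for A x
    using that
  proof (induction A)
    case empty
    then show ?case using E.sec_zero_fibre frep_zero by (simp add: E.sec_sum_empty sec_zero_E)
  next
    case (insert i A)
    let ?s = "\<lambda>j. sec_mult E (\<Theta> j Z) (e j)"
    have i: "i < k" and A: "A \<subseteq> {..<k}" using insert by auto
    have eq: "sec_sum E (insert i A) ?s = sec_add E (?s i) (sec_sum E A ?s)"
      by (rule E.sec_sum_insert[OF insert(1,2)]) (use m insert(4) in blast)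
    have SA: "sec_sum E A ?s \<in> sections E"
      by (rule E.sec_sum_mem[OF insert(1)]) (use m A in blast)
    have "?s i \<in> sections E" using m i by simp
    then have "frep B x (sec_add E (?s i) (sec_sum E A ?s) x) = frep B x (?s i x) + frep B x (sec_sum E A ?s x)"
      unfolding sec_add_E[OF \<open>?s i \<in> sections E\<close> SA] by (intro frep_sec_add sections_E SA)
    moreover have "frep B x (?s i x) = \<Theta> i Z x *\<^sub>R frep B x (e i x)"
      unfolding sec_mult_E[OF F(3)[OF i]] by (rule frep_sec_mult[OF sections_E[OF F(3)[OF i]]])
    ultimately show ?case
      using insert A E.section_fibre[OF E.sec_add_mem[OF \<open>?s i \<in> sections E\<close> SA]] by (simp add: eq)
  qed
  then have Yf: "frep B x (Y x) = (\<Sum>j<k. \<Theta> j Z x *\<^sub>R frep B x (e j x))" for x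
    unfolding Y_def by simp
  have eq: "Y x = Z x" if x: "x \<in> U" for x
  proof -
    \<comment> \<open>The frame expansion is available for sections of E only. It is applied to a
      section of E through the vector Z x; the forms \<Theta> j depend on that vector alone.\<close>
    obtain S where S: "S \<in> sections E" "S x = Z x" using E.section_through[OF ZE] .
    have "\<Theta> j Z x = \<Theta> j S x" if "j < k" for j
      by (rule lin_form_cong[OF F(4)[OF that] Z sections_E[OF S(1)]]) (simp add: S)
    then have "frep B x (Y x) = frep B x (S x)"
      unfolding F(6)[OF x S(1)] Yf by simp
    then show ?thesis
      using frep_inj[OF section_fibre[OF sections_E[OF Y]] section_fibre[OF Z]] S(2) by simp
  qed
  obtain t where t: "t \<in> trivs E" "p \<in> fst t" using E.triv_ex[of p] .
  have "smooth_at (base E) p (\<lambda>q. snd t (Z q))"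
    by (rule smooth_at_cong[OF E.base_manifold E.section_smooth[OF Y t] F(1,2)]) (use eq in auto)
  then show "\<exists>t\<in>trivs E. p \<in> fst t \<and> smooth_at (base E) p (\<lambda>q. snd t (Z q))" using t by blast
qed

text \<open>If Z is outside E at \<open>p\<close>, its reduction Y by a frame of E is not 0 there,
  and some form \<Omega> sees it. \<Omega> applied after the reduction annihilates E near
  \<open>p\<close>, since the reduction kills sections of E there; a bump function makes it global,
  and at \<open>p\<close> it takes the nonzero value \<Omega>(Y) on Z.\<close>

lemma ann_separates:
  assumes Z: "Z \<in> sections B" and 0: "\<forall>\<Omega>\<in>ann. \<Omega> Z p = 0"
  shows "Z p \<in> fibre E p"
proof (rule ccontr)
  assume notE: "Z p \<notin> fibre E p"
  obtain U and k :: nat and e \<Theta> where F: "open U" "p \<in> U" "\<And>j. j < k \<Longrightarrow> e j \<in> sections E" "\<And>j. j < k \<Longrightarrow> \<Theta> j \<in> lin_forms B"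
    "\<And>x i j. x \<in> U \<Longrightarrow> i < k \<Longrightarrow> j < k \<Longrightarrow> \<Theta> i (e j) x = (if i = j then 1 else (0::real))"
    "\<And>x Z. x \<in> U \<Longrightarrow> Z \<in> sections E \<Longrightarrow> frep B x (Z x) = (\<Sum>j<k. \<Theta> j Z x *\<^sub>R frep B x (e j x))"
    by (rule E_local_frame[of p]) (rule that)
  have eB: "\<And>j. j < k \<Longrightarrow> e j \<in> sections B" using sections_E F(3) by blast
  note red = sec_reduce[where e = e and \<Theta> = \<Theta> and k = k, OF eB F(4) Z]
  define Y where "Y = sec_reduce k e \<Theta> Z"
  have Y: "Y \<in> sections B" unfolding Y_def using red(1) by simp
  have "(\<Sum>j<k. \<Theta> j Z p *\<^sub>R frep B p (e j p)) \<in> eimg p"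
    by (intro subspace_sum subspace_scale eimg_subspace)
      (use E.section_fibre[OF F(3)] in \<open>auto simp: eimg_def\<close>)
  moreover have "frep B p (Z p) \<notin> eimg p" using eimg_mem[OF section_fibre[OF Z]] notE by simp
  ultimately have "frep B p (Y p) \<noteq> 0" unfolding Y_def using red(3) by auto
  then obtain \<Omega> where \<Omega>: "\<Omega> \<in> lin_forms B" "\<Omega> Y p \<noteq> (0::real)"
    using lin_forms_separate[OF Y] by blast
  obtain \<kappa> :: "'m \<Rightarrow> real" and V K where \<kappa>: "\<And>q. smooth_at (base B) q \<kappa>" "open V" "p \<in> V"
    "\<And>q. q \<in> V \<Longrightarrow> \<kappa> q = 1" "V \<subseteq> K" "closed K" "K \<subseteq> U" "\<And>q. q \<notin> K \<Longrightarrow> \<kappa> q = 0"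
    by (rule smooth_bump[OF base_manifold F(1,2)]) (rule that)
  define \<Omega>' where "\<Omega>' X x = \<kappa> x * (\<Omega> X x + (\<Sum>j<k. (- \<Omega> (e j) x) * \<Theta> j X x))" for X x
  note PL = form_module_lin_forms
  have "(\<lambda>X x. (- \<Omega> (e j) x) * \<Theta> j X x) \<in> lin_forms B" if "j \<in> {..<k}" for j
    using that by (intro form_moduleD(4)[OF PL F(4)] lin_form_neg_smooth[OF \<Omega>(1) eB]) auto
  then have "(\<lambda>X x. \<Sum>j<k. (- \<Omega> (e j) x) * \<Theta> j X x) \<in> lin_forms B"
    by (intro form_module_sum[OF PL finite_lessThan])
  from form_moduleD(4)[OF PL form_moduleD(3)[OF PL \<Omega>(1) this] \<kappa>(1)]
  have "\<Omega>' \<in> lin_forms B" by (simp add: \<Omega>'_def[abs_def])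
  moreover have "\<Omega>' S x = 0" if S: "S \<in> sections E" for S x
  proof (cases "x \<in> U")
    case True
    obtain \<theta> where \<theta>: "linear \<theta>" "\<And>Z. Z \<in> sections B \<Longrightarrow> \<Omega> Z x = \<theta> (frep B x (Z x))"
      using lin_form_at[OF \<Omega>(1)] by metis
    have "\<Omega> S x = (\<Sum>j<k. \<Theta> j S x * \<theta> (frep B x (e j x)))"
      unfolding \<theta>(2)[OF sections_E[OF S]] F(6)[OF True S]
      by (simp add: linear_sum[OF \<theta>(1)] linear_scale[OF \<theta>(1)])
    also have "\<dots> = (\<Sum>j<k. \<Theta> j S x * \<Omega> (e j) x)"
      by (rule sum.cong) (use \<theta>(2)[OF eB] in auto)
    finally show ?thesis by (simp add: \<Omega>'_def sum_negf mult.commute)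
  next
    case False
    then show ?thesis using \<kappa>(7,8) by (auto simp: \<Omega>'_def)
  qed
  ultimately have "\<Omega>' \<in> ann" by (simp add: ann_def)
  then have "\<Omega>' Z p = 0" using 0 by blast
  moreover have "\<Omega>' Z p = \<Omega> Y p"
    unfolding Y_def using red(2)[OF _ _ \<Omega>(1)] \<kappa>(3,4) by (simp add: \<Omega>'_def sum_negf mult.commute)
  ultimately show False using \<Omega>(2) by simp
qed

text \<open>A maximal dual system between all sections of B and P has rank B - rank E members: by
  \<open>sep\<close> its common kernel at \<open>p\<close> is the fibre of E. The count persists on
  \<open>U\<close>, so there too the common kernel is the fibre of E and reduced sections land in
  it. The lemma is stated for a submodule P of the annihilator because it serves twice, for the
  whole annihilator and for the module spanned by finitely many forms.\<close>

lemma complement_frame: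
  assumes P: "form_module B P" "P \<subseteq> ann"
    and sep: "\<And>Z. Z \<in> sections B \<Longrightarrow> \<forall>\<Omega>\<in>P. \<Omega> Z p = 0 \<Longrightarrow> Z p \<in> fibre E p"
  obtains U and k :: nat and e \<Theta> where "open U" "p \<in> U" "k \<le> DIM('w)" "\<And>j. j < k \<Longrightarrow> e j \<in> sections B" "\<And>j. j < k \<Longrightarrow> \<Theta> j \<in> P"
    "\<And>x Z. x \<in> U \<Longrightarrow> Z \<in> sections B \<Longrightarrow>
      frep B x (Z x) - (\<Sum>j<k. \<Theta> j Z x *\<^sub>R frep B x (e j x)) \<in> eimg x"
proof -
  have PL: "P \<subseteq> lin_forms B" using P(1) unfolding form_module_def by blast
  obtain k e \<Theta> where d: "dual_system (sections B) P p k e \<Theta>"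
    and max: "\<And>Z \<Omega>. Z \<in> sections B \<Longrightarrow> \<forall>j<k. \<Theta> j Z p = 0 \<Longrightarrow> \<Omega> \<in> P \<Longrightarrow> \<Omega> Z p = 0"
    by (rule dual_maximal[OF sec_module_B P(1), of p]) (rule that)
  have kb: "k \<le> DIM('w)" by (rule dual_bound[OF subset_refl PL d])
  obtain U where U: "open U" "p \<in> U"
    "\<And>x i j. x \<in> U \<Longrightarrow> i < k \<Longrightarrow> j < k \<Longrightarrow> \<Theta> i (e j) x = (if i = j then 1 else 0)"
    using d unfolding dual_system_def by blast
  have e: "\<And>j. j < k \<Longrightarrow> e j \<in> sections B" and \<Theta>P: "\<And>j. j < k \<Longrightarrow> \<Theta> j \<in> P"
    using d unfolding dual_system_def by blast+
  have \<Theta>: "\<And>j. j < k \<Longrightarrow> \<Theta> j \<in> lin_forms B" using \<Theta>P PL by blast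
  have ev: "frep B x (e j x) \<in> typical B" if "j < k" for j x
    by (rule frep_mem[OF section_fibre[OF e[OF that]]])
  have \<theta>E: "\<theta> j v = 0" if "v \<in> eimg x" "j < k"
    and "\<And>j Z. j < k \<Longrightarrow> Z \<in> sections B \<Longrightarrow> \<Theta> j Z x = \<theta> j (frep B x (Z x))" for x \<theta> j v
  proof -
    obtain a where a: "a \<in> fibre E x" "v = frep B x a" using \<open>v \<in> eimg x\<close> unfolding eimg_def by blast
    obtain Z where Z: "Z \<in> sections E" "Z x = a" using E.section_through[OF a(1)] .
    have "\<Theta> j \<in> ann" using \<Theta>P that(2) P(2) by blast
    then have "\<Theta> j Z x = 0" using Z(1) unfolding ann_def by blast
    then show ?thesis using that(3)[OF that(2) sections_E[OF Z(1)]] a Z by simp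
  qed
  have k: "dim (typical E) + k = dim (typical B)"
  proof -
    obtain \<theta> where \<theta>: "\<And>j. j < k \<Longrightarrow> linear (\<theta> j)"
      "\<And>j Z. j < k \<Longrightarrow> Z \<in> sections B \<Longrightarrow> \<Theta> j Z p = \<theta> j (frep B p (Z p))"
      by (rule form_functionals[where x = p and \<Theta> = \<Theta> and k = k, OF \<Theta>]) (use that in blast)+
    have "dim (eimg p) + k = dim (typical B)"
    proof (rule dim_dual_functionals(2)[where \<theta> = \<theta> and v = "\<lambda>j. frep B p (e j p)"])
      fix v assume v: "v \<in> typical B" "\<And>i. i < k \<Longrightarrow> \<theta> i v = 0"
      define a where "a = inv_into (fibre B p) (frep B p) v"
      have a: "a \<in> fibre B p" "frep B p a = v" unfolding a_def using frep_inv v(1) by blast+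
      obtain Z where Z: "Z \<in> sections B" "Z p = a" using section_through[OF a(1)] .
      have "Z p \<in> fibre E p"
        by (rule sep[OF Z(1)], rule ballI, rule max[OF Z(1)]) (use \<theta>(2)[OF _ Z(1)] v a Z in auto)
      then show "v \<in> eimg p" using a Z eimg_mem by auto
    next
      show "\<theta> i s = 0" if "i < k" "s \<in> eimg p" for i s
        by (rule \<theta>E[OF that(2,1) \<theta>(2)])
      show "\<theta> i (frep B p (e j p)) = (if i = j then 1 else 0)" if "i < k" "j < k" for i j
        using \<theta>(2)[OF that(1) e[OF that(2)]] U(3)[OF U(2) that] by simp
    qed (fact eimg_subspace eimg_typical typical_subspace \<theta>(1) ev)+
    then show ?thesis using eimg_dim by simp
  qed
  have exp: "frep B x (Z x) - (\<Sum>j<k. \<Theta> j Z x *\<^sub>R frep B x (e j x)) \<in> eimg x"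
    if x: "x \<in> U" and Z: "Z \<in> sections B" for x Z
  proof -
    obtain \<theta> where \<theta>: "\<And>j. j < k \<Longrightarrow> linear (\<theta> j)"
      "\<And>j Z. j < k \<Longrightarrow> Z \<in> sections B \<Longrightarrow> \<Theta> j Z x = \<theta> j (frep B x (Z x))"
      by (rule form_functionals[where x = x and \<Theta> = \<Theta> and k = k, OF \<Theta>]) (use that in blast)+
    note red = sec_reduce[where e = e and \<Theta> = \<Theta> and k = k, OF e \<Theta> Z]
    define Y where "Y = sec_reduce k e \<Theta> Z"
    have Y: "Y \<in> sections B" unfolding Y_def using red(1) by auto
    have 0: "\<Theta> i Y x = 0" if i: "i < k" for i
    proof -
      have "(\<Sum>j<k. \<Theta> j Z x * \<Theta> i (e j) x) = (\<Sum>j<k. if i = j then \<Theta> j Z x else 0)"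
        by (rule sum.cong) (use U(3)[OF x] i in auto)
      then show ?thesis unfolding Y_def using red(2)[OF _ _ \<Theta>[OF i]] i by simp
    qed
    have "frep B x (Y x) \<in> eimg x"
    proof (rule dim_dual_functionals(3)[where \<theta> = \<theta> and v = "\<lambda>j. frep B x (e j x)" and k = k, OF typical_subspace eimg_subspace eimg_typical])
      show "\<theta> i s = 0" if "i < k" "s \<in> eimg x" for i s
        by (rule \<theta>E[OF that(2,1) \<theta>(2)])
      show "\<theta> i (frep B x (e j x)) = (if i = j then 1 else 0)" if "i < k" "j < k" for i j
        using \<theta>(2)[OF that(1) e[OF that(2)]] U(3)[OF x that] by simp
      show "\<theta> i (frep B x (Y x)) = 0" if "i < k" for i
        using \<theta>(2)[OF that Y] 0[OF that] by simp
      show "dim (eimg x) + k = dim (typical B)" using k eimg_dim by simp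
    qed (fact \<theta>(1) ev frep_mem[OF section_fibre[OF Y]])+
    then show ?thesis unfolding Y_def using red(3) by simp
  qed
  show thesis by (rule that[OF U(1,2) kb e \<Theta>P exp])
qed

text \<open>Local coframes of the annihilator, multiplied by a partition of unity, form a countable,
  locally finite family whose common zeros are exactly E. The dimension argument compresses it into
  a single vector-valued form with the same kernel.\<close>

lemma ann_joint_kernel:
  obtains \<tau> :: "('m \<Rightarrow> 'f) \<Rightarrow> 'm \<Rightarrow> 'e \<times> 'w \<times> real" where "\<tau> \<in> lin_forms B"
    "\<And>S p. S \<in> sections E \<Longrightarrow> \<tau> S p = 0"
    "\<And>Z p. Z \<in> sections B \<Longrightarrow> \<tau> Z p = 0 \<Longrightarrow> Z p \<in> fibre E p"
proof -
  define R where "R U k \<Theta> \<longleftrightarrow> k \<le> DIM('w) \<and> (\<forall>j<k. \<Theta> j \<in> ann) \<and>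
    (\<forall>x\<in>U. \<forall>Z\<in>sections B. (\<forall>j<k. \<Theta> j Z x = 0) \<longrightarrow> Z x \<in> fibre E x)" for U k \<Theta>
  have "\<exists>U. open U \<and> p \<in> U \<and> (\<exists>k \<Theta>. R U k \<Theta>)" for p
  proof -
    obtain U and k :: nat and e \<Theta> where C: "open U" "p \<in> U" "k \<le> DIM('w)" "\<And>j. j < k \<Longrightarrow> e j \<in> sections B" "\<And>j. j < k \<Longrightarrow> \<Theta> j \<in> ann"
      "\<And>x Z. x \<in> U \<Longrightarrow> Z \<in> sections B \<Longrightarrow> frep B x (Z x) - (\<Sum>j<k. \<Theta> j Z x *\<^sub>R frep B x (e j x)) \<in> eimg x"
      by (rule complement_frame[where p = p and P = ann, OF form_module_ann subset_refl], erule (1) ann_separates, rule that)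
    have "R U k \<Theta>"
      unfolding R_def
    proof (intro conjI allI impI ballI)
      fix x Z assume x: "x \<in> U" and Z: "Z \<in> sections B" and 0: "\<forall>j<k. \<Theta> j Z x = 0"
      have "frep B x (Z x) \<in> eimg x" using C(6)[OF x Z] 0 by simp
      then show "Z x \<in> fibre E x" using eimg_mem[OF section_fibre[OF Z]] by simp
    qed (fact C)+
    then show ?thesis using C(1,2) by (intro exI[of _ U]) auto
  qed
  from this obtain U and \<psi> :: "nat \<Rightarrow> 'm \<Rightarrow> real" where \<psi>: "\<And>n. \<exists>k \<Theta>. R (U n) k \<Theta>" "\<And>k q. smooth_at (base B) q (\<psi> k)" "\<And>k q. \<psi> k q \<noteq> 0 \<Longrightarrow> q \<in> U k"
    "\<And>q. \<exists>W J. open W \<and> q \<in> W \<and> (\<forall>k\<ge>J. \<forall>x\<in>W. \<psi> k x = 0)"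
    "\<And>q J. \<forall>k\<ge>J. \<psi> k q = 0 \<Longrightarrow> (\<Sum>k<J. \<psi> k q) = (1::real)"
    by (rule partition_of_unity[where \<Phi> = "\<lambda>U. \<exists>k \<Theta>. R U k \<Theta>"]) (rule that)
  obtain K \<Theta> where R: "\<And>n. R (U n) (K n) (\<Theta> n)" using \<psi>(1) by metis
  \<comment> \<open>The pair (n, j) gets the number n * \<open>DIM('w)\<close> + j, a faithful
    coding because a local coframe has at most \<open>DIM('w)\<close> members; numbers without a
    form carry 0.\<close>
  define s where "s i Z x = (let n = i div DIM('w); j = i mod DIM('w) in
      if j < K n then \<psi> n x * \<Theta> n j Z x else 0)" for i Z x
  have s: "s i \<in> ann" for i
  proof (cases "i mod DIM('w) < K (i div DIM('w))")
    case True
    then have "\<Theta> (i div DIM('w)) (i mod DIM('w)) \<in> ann" using R unfolding R_def by blast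
    from form_moduleD(4)[OF form_module_ann this \<psi>(2)] True show ?thesis
      by (simp add: s_def[abs_def] Let_def)
  next
    case False
    then show ?thesis using form_moduleD(2)[OF form_module_ann] by (simp add: s_def[abs_def] Let_def)
  qed
  have fin: "\<exists>W J. open W \<and> q \<in> W \<and> (\<forall>i\<ge>J. \<forall>x\<in>W. \<forall>Z\<in>sections B. s i Z x = 0)" for q
  proof -
    obtain W J where W: "open W" "q \<in> W" "\<forall>k\<ge>J. \<forall>x\<in>W. \<psi> k x = 0" using \<psi>(4)[of q] by blast
    have "s i Z x = 0" if "i \<ge> J * DIM('w)" "x \<in> W" for i Z x
    proof -
      have "J \<le> i div DIM('w)" using div_le_mono[OF that(1), of "DIM('w)"] by simp
      then show ?thesis using W(3) that(2) by (simp add: s_def Let_def)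
    qed
    then show ?thesis using W(1,2) by blast
  qed
  obtain \<tau> :: "('m \<Rightarrow> 'f) \<Rightarrow> 'm \<Rightarrow> 'e \<times> 'w \<times> real" where \<tau>: "\<tau> \<in> lin_forms B"
    "\<And>k Z p. Z \<in> sections B \<Longrightarrow> \<tau> Z p = 0 \<Longrightarrow> s k Z p = 0"
    "\<And>Z p. Z \<in> sections B \<Longrightarrow> \<forall>k. s k Z p = 0 \<Longrightarrow> \<tau> Z p = 0"
    by (rule finite_joint_kernel[where ?'v = "'e \<times> 'w \<times> real", OF form_module_ann s fin]) (simp, rule that)
  show thesis
  proof (rule that[OF \<tau>(1)])
    show "\<tau> S p = 0" if "S \<in> sections E" for S p
      using s that unfolding ann_def by (intro \<tau>(3) sections_E) blast+
    fix Z p assume Z: "Z \<in> sections B" "\<tau> Z p = 0"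
    obtain W J where W: "p \<in> W" "\<forall>k\<ge>J. \<forall>x\<in>W. \<psi> k x = 0" using \<psi>(4)[of p] by blast
    then have "(\<Sum>k<J. \<psi> k p) = 1" by (intro \<psi>(5)) auto
    then have "\<exists>n. \<psi> n p \<noteq> 0" by (metis sum.neutral zero_neq_one)
    then obtain n where n: "\<psi> n p \<noteq> 0" by blast
    have "\<Theta> n j Z p = 0" if "j < K n" for j
    proof -
      have "K n \<le> DIM('w)" using R[of n] unfolding R_def by blast
      then have "j < DIM('w)" using that by simp
      then have "s (n * DIM('w) + j) Z p = \<psi> n p * \<Theta> n j Z p" using that by (simp add: s_def Let_def)
      then show ?thesis using \<tau>(2)[OF Z] n by simp
    qed
    then show "Z p \<in> fibre E p"
      using R[of n] \<psi>(3)[OF n] Z(1) unfolding R_def by blast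
  qed
qed

text \<open>The components \<Omega> a of the joint form cut out E at every point, so a complement
  frame can be taken from the module they generate, and this yields sections c a locally. The
  condition that Z minus the sum of \<Omega> a (Z) c a lies in E is preserved under affine
  combinations of the families c, so local solutions can be averaged by a partition of
  unity.\<close>

lemma finite_resolution:
  obtains A :: "('e \<times> 'w \<times> real) set" and \<Omega> c where "finite A" "\<And>a. a \<in> A \<Longrightarrow> \<Omega> a \<in> ann" "\<And>a. a \<in> A \<Longrightarrow> c a \<in> sections B"
    "\<And>Z. Z \<in> sections B \<Longrightarrow> \<exists>R\<in>sections E. Z = sec_add B R (sec_sum B A (\<lambda>a. sec_mult B (\<Omega> a Z) (c a)))"
proof -
  obtain \<tau> :: "('m \<Rightarrow> 'f) \<Rightarrow> 'm \<Rightarrow> 'e \<times> 'w \<times> real" where \<tau>: "\<tau> \<in> lin_forms B"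
    "\<And>S p. S \<in> sections E \<Longrightarrow> \<tau> S p = 0"
    "\<And>Z p. Z \<in> sections B \<Longrightarrow> \<tau> Z p = 0 \<Longrightarrow> Z p \<in> fibre E p"
    by (rule ann_joint_kernel) (rule that)
  let ?A = "Basis :: ('e \<times> 'w \<times> real) set"
  define \<Omega> where "\<Omega> a Z p = \<tau> Z p \<bullet> a" for a Z p
  have \<Omega>: "\<Omega> a \<in> ann" for a
    unfolding ann_def lin_forms_def using lin_formsD[OF \<tau>(1)] \<tau>(2)
    by (simp add: \<Omega>_def[abs_def] fun_eq_iff inner_add_left smooth_at_inner[OF base_manifold] smooth_at_const[OF base_manifold])
  have \<Omega>L: "\<Omega> a \<in> lin_forms B" for a using \<Omega> unfolding ann_def by blast
  \<comment> \<open>The module generated by the components. Its members come with smooth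
    coefficients g, which convert a complement frame of local length into sections indexed by the
    fixed basis.\<close>
  define P where "P = {(\<lambda>Z p. \<Sum>a\<in>?A. g a p * \<Omega> a Z p) |g. \<forall>a p. smooth_at (base B) p (g a)}"
  have Pann: "P \<subseteq> ann"
  proof
    fix \<Theta> assume "\<Theta> \<in> P"
    then obtain g where g: "\<And>a p. smooth_at (base B) p (g a)" "\<Theta> = (\<lambda>Z p. \<Sum>a\<in>?A. g a p * \<Omega> a Z p)"
      unfolding P_def by blast
    show "\<Theta> \<in> ann"
      unfolding g(2) by (rule form_module_sum[OF form_module_ann finite_Basis])
        (rule form_moduleD(4)[OF form_module_ann \<Omega> g(1)])
  qed
  have P: "form_module B P"
    unfolding form_module_def
  proof (intro conjI ballI allI impI)
    show "P \<subseteq> lin_forms B" using Pann unfolding ann_def by blast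
    show "(\<lambda>_ _. 0) \<in> P"
      unfolding P_def by (intro CollectI exI[of _ "\<lambda>_ _. 0"]) (simp add: smooth_at_const[OF base_manifold])
    fix \<sigma> assume "\<sigma> \<in> P"
    then obtain g where g: "\<And>a p. smooth_at (base B) p (g a)" "\<sigma> = (\<lambda>Z p. \<Sum>a\<in>?A. g a p * \<Omega> a Z p)"
      unfolding P_def by blast
    show "(\<lambda>Z p. \<sigma> Z p + \<sigma>' Z p) \<in> P" if \<sigma>': "\<sigma>' \<in> P" for \<sigma>'
    proof -
      obtain g' where g': "\<And>a p. smooth_at (base B) p (g' a)" "\<sigma>' = (\<lambda>Z p. \<Sum>a\<in>?A. g' a p * \<Omega> a Z p)"
        using \<sigma>' unfolding P_def by blast
      show ?thesis
        unfolding P_def g(2) g'(2)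
        by (intro CollectI exI[of _ "\<lambda>a p. g a p + g' a p"])
          (simp add: fun_eq_iff sum.distrib distrib_right smooth_at_add[OF base_manifold] g(1) g'(1))
    qed
    show "(\<lambda>Z p. f p * \<sigma> Z p) \<in> P" if "\<forall>p. smooth_at (base B) p f" for f
      unfolding P_def g(2)
      by (intro CollectI exI[of _ "\<lambda>a p. f p * g a p"])
        (use that in \<open>simp add: fun_eq_iff sum_distrib_left mult.assoc smooth_at_mult[OF base_manifold] g(1)\<close>)
  qed
  have \<Omega>P: "\<Omega> a \<in> P" if "a \<in> ?A" for a
  proof -
    have "(\<Sum>b\<in>?A. (if b = a then 1 else 0) * \<Omega> b Z p) = \<Omega> a Z p" for Z p
    proof -
      have "(\<Sum>b\<in>?A. (if b = a then 1 else 0) * \<Omega> b Z p) = (\<Sum>b\<in>?A. if b = a then \<Omega> b Z p else 0)"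
        by (rule sum.cong) auto
      then show ?thesis using that by simp
    qed
    then show ?thesis
      unfolding P_def
      by (intro CollectI exI[of _ "\<lambda>b _. if b = a then 1 else 0"]) (simp add: smooth_at_const[OF base_manifold])
  qed
  have sep: "Z p \<in> fibre E p" if Z: "Z \<in> sections B" "\<forall>\<Theta>\<in>P. \<Theta> Z p = 0" for Z p
  proof -
    have "\<tau> Z p \<bullet> a = 0" if "a \<in> ?A" for a using bspec[OF Z(2) \<Omega>P[OF that]] by (simp add: \<Omega>_def)
    then have "\<tau> Z p = 0" using euclidean_all_zero_iff by blast
    then show ?thesis by (rule \<tau>(3)[OF Z(1)])
  qed
  define R where "R U c \<longleftrightarrow> (\<forall>a. c a \<in> sections B) \<and> (\<forall>x\<in>U. \<forall>Z\<in>sections B.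
    frep B x (Z x) - (\<Sum>a\<in>?A. \<Omega> a Z x *\<^sub>R frep B x (c a x)) \<in> eimg x)" for U c
  have "\<exists>U. open U \<and> p \<in> U \<and> (\<exists>c. R U c)" for p
  proof -
    obtain U and k :: nat and e \<Theta> where C: "open U" "p \<in> U" "k \<le> DIM('w)" "\<And>j. j < k \<Longrightarrow> e j \<in> sections B" "\<And>j. j < k \<Longrightarrow> \<Theta> j \<in> P"
      "\<And>x Z. x \<in> U \<Longrightarrow> Z \<in> sections B \<Longrightarrow> frep B x (Z x) - (\<Sum>j<k. \<Theta> j Z x *\<^sub>R frep B x (e j x)) \<in> eimg x"
      by (rule complement_frame[where p = p and P = P, OF P Pann], erule (1) sep, rule that)
    have ex: "\<exists>g. (\<forall>a p. smooth_at (base B) p (g a)) \<and> \<Theta> j = (\<lambda>Z p. \<Sum>a\<in>?A. g a p * \<Omega> a Z p)" if "j < k" for j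
      using C(5)[OF that] unfolding P_def by blast
    define g where "g j = (SOME g. (\<forall>a p. smooth_at (base B) p (g a)) \<and>
        \<Theta> j = (\<lambda>Z p. \<Sum>a\<in>?A. g a p * \<Omega> a Z p))" for j
    have g': "(\<forall>a p. smooth_at (base B) p (g j a)) \<and> \<Theta> j = (\<lambda>Z p. \<Sum>a\<in>?A. g j a p * \<Omega> a Z p)" if "j < k" for j
      unfolding g_def by (rule someI_ex[OF ex[OF that]])
    note g = conjunct1[OF g', rule_format] conjunct2[OF g']
    \<comment> \<open>Inserting \<Theta> j = \<Sum>a g j a \<Omega> a into the sum of \<Theta> j (Z)
      e j and exchanging the sums leaves this as the coefficient of \<Omega> a (Z).\<close>
    define c where "c a = sec_sum B {..<k} (\<lambda>j. sec_mult B (g j a) (e j))" for a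
    have m: "sec_mult B (g j a) (e j) \<in> sections B" if "j \<in> {..<k}" for j a
      using that by (intro sec_mult_mem C(4) g(1)) auto
    have c: "c a \<in> sections B" for a unfolding c_def by (rule sec_sum_mem[OF finite_lessThan m])
    have cf: "frep B x (c a x) = (\<Sum>j<k. g j a x *\<^sub>R frep B x (e j x))" for a x
    proof -
      have "frep B x (c a x) = (\<Sum>j<k. frep B x (sec_mult B (g j a) (e j) x))"
        unfolding c_def by (rule frep_sec_sum(1)) (rule section_fibre[OF m])
      also have "\<dots> = (\<Sum>j<k. g j a x *\<^sub>R frep B x (e j x))"
        by (rule sum.cong) (use frep_sec_mult[OF C(4)] in auto)
      finally show ?thesis .
    qed
    have "(\<Sum>j<k. \<Theta> j Z x *\<^sub>R frep B x (e j x)) = (\<Sum>a\<in>?A. \<Omega> a Z x *\<^sub>R frep B x (c a x))" for x Z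
    proof -
      have "(\<Sum>j<k. \<Theta> j Z x *\<^sub>R frep B x (e j x)) = (\<Sum>j<k. \<Sum>a\<in>?A. (g j a x * \<Omega> a Z x) *\<^sub>R frep B x (e j x))"
        by (rule sum.cong) (use g(2) in \<open>auto simp: scaleR_sum_left\<close>)
      also have "\<dots> = (\<Sum>a\<in>?A. \<Sum>j<k. (g j a x * \<Omega> a Z x) *\<^sub>R frep B x (e j x))"
        by (rule sum.swap)
      also have "\<dots> = (\<Sum>a\<in>?A. \<Omega> a Z x *\<^sub>R frep B x (c a x))"
        by (simp add: cf scaleR_sum_right mult.commute)
      finally show ?thesis .
    qed
    then have "R U c" unfolding R_def using C(6) c by simp
    then show ?thesis using C(1,2) by (intro exI[of _ U]) auto
  qed
  then obtain U and \<psi> :: "nat \<Rightarrow> 'm \<Rightarrow> real" where \<psi>: "\<And>n. \<exists>c. R (U n) c" "\<And>k q. smooth_at (base B) q (\<psi> k)" "\<And>k q. \<psi> k q \<noteq> 0 \<Longrightarrow> q \<in> U k"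
    "\<And>q. \<exists>W J. open W \<and> q \<in> W \<and> (\<forall>k\<ge>J. \<forall>x\<in>W. \<psi> k x = 0)"
    "\<And>q J. \<forall>k\<ge>J. \<psi> k q = 0 \<Longrightarrow> (\<Sum>k<J. \<psi> k q) = (1::real)"
    by (rule partition_of_unity[where \<Phi> = "\<lambda>U. \<exists>c. R U c"]) (rule that)
  obtain C where C: "\<And>n. R (U n) (C n)" using \<psi>(1) by metis
  have CB: "C n a \<in> sections B" for n a using C[of n] unfolding R_def by blast
  have ex: "\<exists>s. s \<in> sections B \<and> (\<forall>x J. (\<forall>k\<ge>J. \<psi> k x = 0) \<longrightarrow>
      frep B x (s x) = (\<Sum>k<J. \<psi> k x *\<^sub>R frep B x (C k a x)))" for a
    by (rule glue_sections[where \<psi> = \<psi> and c = "\<lambda>n. C n a", OF \<psi>(2,4) CB]) auto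
  define c where "c a = (SOME s. s \<in> sections B \<and> (\<forall>x J. (\<forall>k\<ge>J. \<psi> k x = 0) \<longrightarrow>
      frep B x (s x) = (\<Sum>k<J. \<psi> k x *\<^sub>R frep B x (C k a x))))" for a
  have c: "c a \<in> sections B"
    "\<forall>k\<ge>J. \<psi> k x = 0 \<Longrightarrow> frep B x (c a x) = (\<Sum>k<J. \<psi> k x *\<^sub>R frep B x (C k a x))" for a x J
    using someI_ex[OF ex[of a]] unfolding c_def by simp_all
  have key: "frep B x (Z x) - (\<Sum>a\<in>?A. \<Omega> a Z x *\<^sub>R frep B x (c a x)) \<in> eimg x" if Z: "Z \<in> sections B" for Z x
  proof -
    obtain J where J: "\<forall>k\<ge>J. \<psi> k x = 0" using \<psi>(4)[of x] by blast
    have one: "(\<Sum>k<J. \<psi> k x) = 1" using \<psi>(5) J by blast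
    have "(\<Sum>a\<in>?A. \<Omega> a Z x *\<^sub>R frep B x (c a x)) = (\<Sum>a\<in>?A. \<Sum>k<J. \<psi> k x *\<^sub>R (\<Omega> a Z x *\<^sub>R frep B x (C k a x)))"
      unfolding c(2)[OF J] by (simp add: scaleR_sum_right mult.commute)
    also have "\<dots> = (\<Sum>k<J. \<psi> k x *\<^sub>R (\<Sum>a\<in>?A. \<Omega> a Z x *\<^sub>R frep B x (C k a x)))"
      unfolding scaleR_sum_right by (rule sum.swap)
    finally have "frep B x (Z x) - (\<Sum>a\<in>?A. \<Omega> a Z x *\<^sub>R frep B x (c a x)) =
        (\<Sum>k<J. \<psi> k x) *\<^sub>R frep B x (Z x) - (\<Sum>k<J. \<psi> k x *\<^sub>R (\<Sum>a\<in>?A. \<Omega> a Z x *\<^sub>R frep B x (C k a x)))"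
      using one by simp
    also have "\<dots> = (\<Sum>k<J. \<psi> k x *\<^sub>R (frep B x (Z x) - (\<Sum>a\<in>?A. \<Omega> a Z x *\<^sub>R frep B x (C k a x))))"
      by (simp add: scaleR_sum_left sum_subtractf scaleR_diff_right)
    also have "\<dots> \<in> eimg x"
    proof (rule subspace_sum[OF eimg_subspace])
      fix k
      show "\<psi> k x *\<^sub>R (frep B x (Z x) - (\<Sum>a\<in>?A. \<Omega> a Z x *\<^sub>R frep B x (C k a x))) \<in> eimg x"
      proof (cases "\<psi> k x = 0")
        case True
        then show ?thesis using subspace_0[OF eimg_subspace] by simp
      next
        case False
        then show ?thesis
          using C[of k] Z \<psi>(3)[OF False] unfolding R_def by (intro subspace_scale eimg_subspace) blast
      qed
    qed
    finally show ?thesis .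
  qed
  show thesis
  proof (rule that[of ?A \<Omega> c])
    fix Z assume Z: "Z \<in> sections B"
    let ?S = "sec_sum B ?A (\<lambda>a. sec_mult B (\<Omega> a Z) (c a))"
    have m: "sec_mult B (\<Omega> a Z) (c a) \<in> sections B" for a
      by (rule sec_mult_mem[OF c(1) lin_formsD(1)[OF \<Omega>L Z]])
    have S: "?S \<in> sections B" by (rule sec_sum_mem[OF finite_Basis m])
    have Sf: "frep B x (?S x) = (\<Sum>a\<in>?A. \<Omega> a Z x *\<^sub>R frep B x (c a x))" for x
      by (subst frep_sec_sum(1)[OF section_fibre[OF m]]) (simp add: frep_sec_mult[OF c(1)])
    define R where "R = sec_add B Z (sec_mult B (\<lambda>_. -1) ?S)"
    have mS: "sec_mult B (\<lambda>_. -1) ?S \<in> sections B"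
      by (rule sec_mult_mem[OF S smooth_at_const[OF base_manifold]])
    have RB: "R \<in> sections B" unfolding R_def by (rule sec_add_mem[OF Z mS])
    have Rf: "frep B x (R x) = frep B x (Z x) - frep B x (?S x)" for x
      unfolding R_def frep_sec_add[OF Z mS] frep_sec_mult[OF S] by simp
    have "R \<in> sections E"
      by (rule section_E_I[OF RB])
        (use eimg_mem[OF section_fibre[OF RB]] key[OF Z] Rf Sf in simp)
    moreover have "Z = sec_add B R ?S"
      by (rule section_eqI[OF Z sec_add_mem[OF RB S]]) (simp add: frep_sec_add[OF RB S] Rf)
    ultimately show "\<exists>R\<in>sections E. Z = sec_add B R ?S" by blast
  qed (use \<Omega> c in auto)
qed

end

section \<open>Alternating forms\<close>

text \<open>A working description of \<open>Lambda\<close> for inhomogeneous forms. Linearity is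
  asked in the first slot and antisymmetry for adjacent arguments, because these can be checked for
  products and differentials and imply linearity in every slot and alternation. The equivalence is
  \<open>alt_form_Lambda\<close> together with \<open>Lambda_alt_form\<close>.\<close>

definition alt_form :: "('m::topological_space, 'e::euclidean_space, 'f, 'w::euclidean_space) vbundle \<Rightarrow> ('m, 'f) form \<Rightarrow> bool" where
  "alt_form B \<omega> \<longleftrightarrow>
     (\<exists>q. \<forall>Zs. length Zs > q \<longrightarrow> \<omega> Zs = (\<lambda>_. 0)) \<and>
     (\<forall>Zs. \<not> set Zs \<subseteq> sections B \<longrightarrow> \<omega> Zs = (\<lambda>_. 0)) \<and>
     (\<forall>Zs p. set Zs \<subseteq> sections B \<longrightarrow> smooth_at (base B) p (\<omega> Zs)) \<and>
     (\<forall>X Y Zs p. X \<in> sections B \<longrightarrow> Y \<in> sections B \<longrightarrow> set Zs \<subseteq> sections B \<longrightarrow>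
        \<omega> (sec_add B X Y # Zs) p = \<omega> (X # Zs) p + \<omega> (Y # Zs) p) \<and>
     (\<forall>f X Zs p. X \<in> sections B \<longrightarrow> (\<forall>q. smooth_at (base B) q f) \<longrightarrow> set Zs \<subseteq> sections B \<longrightarrow>
        \<omega> (sec_mult B f X # Zs) p = f p * \<omega> (X # Zs) p) \<and>
     (\<forall>X Y us vs p. X \<in> sections B \<longrightarrow> Y \<in> sections B \<longrightarrow> set us \<subseteq> sections B \<longrightarrow> set vs \<subseteq> sections B \<longrightarrow>
        \<omega> (us @ Y # X # vs) p = - \<omega> (us @ X # Y # vs) p)"

lemma alt_formI:
  assumes "\<And>Zs. length Zs > q \<Longrightarrow> \<omega> Zs = (\<lambda>_. 0)"
    and "\<And>Zs. \<not> set Zs \<subseteq> sections B \<Longrightarrow> \<omega> Zs = (\<lambda>_. 0)"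
    and "\<And>Zs p. set Zs \<subseteq> sections B \<Longrightarrow> smooth_at (base B) p (\<omega> Zs)"
    and "\<And>X Y Zs p. X \<in> sections B \<Longrightarrow> Y \<in> sections B \<Longrightarrow> set Zs \<subseteq> sections B \<Longrightarrow>
        \<omega> (sec_add B X Y # Zs) p = \<omega> (X # Zs) p + \<omega> (Y # Zs) p"
    and "\<And>f X Zs p. X \<in> sections B \<Longrightarrow> (\<And>q. smooth_at (base B) q f) \<Longrightarrow> set Zs \<subseteq> sections B \<Longrightarrow>
        \<omega> (sec_mult B f X # Zs) p = f p * \<omega> (X # Zs) p"
    and "\<And>X Y us vs p. X \<in> sections B \<Longrightarrow> Y \<in> sections B \<Longrightarrow> set us \<subseteq> sections B \<Longrightarrow> set vs \<subseteq> sections B \<Longrightarrow>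
        \<omega> (us @ Y # X # vs) p = - \<omega> (us @ X # Y # vs) p"
  shows "alt_form B \<omega>"
  unfolding alt_form_def
proof (intro conjI)
  show "\<exists>q. \<forall>Zs. length Zs > q \<longrightarrow> \<omega> Zs = (\<lambda>_. 0)" using assms(1) by (intro exI[of _ q]) simp
qed ((intro allI impI, rule assms(2), assumption), (intro allI impI, rule assms(3), assumption),
  (intro allI impI, rule assms(4); assumption), (intro allI impI, rule assms(5); (assumption | erule spec)),
  (intro allI impI, rule assms(6); assumption))

lemma alt_formD:
  assumes "alt_form B \<omega>"
  shows "\<exists>q. \<forall>Zs. length Zs > q \<longrightarrow> \<omega> Zs = (\<lambda>_. 0)"
    and "\<not> set Zs \<subseteq> sections B \<Longrightarrow> \<omega> Zs = (\<lambda>_. 0)"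
    and "set Zs \<subseteq> sections B \<Longrightarrow> smooth_at (base B) p (\<omega> Zs)"
    and "X \<in> sections B \<Longrightarrow> Y \<in> sections B \<Longrightarrow> set Zs \<subseteq> sections B \<Longrightarrow>
        \<omega> (sec_add B X Y # Zs) p = \<omega> (X # Zs) p + \<omega> (Y # Zs) p"
    and "X \<in> sections B \<Longrightarrow> (\<And>q. smooth_at (base B) q f) \<Longrightarrow> set Zs \<subseteq> sections B \<Longrightarrow>
        \<omega> (sec_mult B f X # Zs) p = f p * \<omega> (X # Zs) p"
    and "X \<in> sections B \<Longrightarrow> Y \<in> sections B \<Longrightarrow> set us \<subseteq> sections B \<Longrightarrow> set vs \<subseteq> sections B \<Longrightarrow>
        \<omega> (us @ Y # X # vs) p = - \<omega> (us @ X # Y # vs) p"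
proof -
  note A = assms[unfolded alt_form_def]
  show "\<exists>q. \<forall>Zs. length Zs > q \<longrightarrow> \<omega> Zs = (\<lambda>_. 0)" using A by (elim conjE)
  show "\<not> set Zs \<subseteq> sections B \<Longrightarrow> \<omega> Zs = (\<lambda>_. 0)" using A by (elim conjE) simp
  show "set Zs \<subseteq> sections B \<Longrightarrow> smooth_at (base B) p (\<omega> Zs)" using A by (elim conjE) simp
  show "X \<in> sections B \<Longrightarrow> Y \<in> sections B \<Longrightarrow> set Zs \<subseteq> sections B \<Longrightarrow>
        \<omega> (sec_add B X Y # Zs) p = \<omega> (X # Zs) p + \<omega> (Y # Zs) p" using A by (elim conjE) simp
  show "X \<in> sections B \<Longrightarrow> (\<And>q. smooth_at (base B) q f) \<Longrightarrow> set Zs \<subseteq> sections B \<Longrightarrow>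
        \<omega> (sec_mult B f X # Zs) p = f p * \<omega> (X # Zs) p" using A by (elim conjE) simp
  show "X \<in> sections B \<Longrightarrow> Y \<in> sections B \<Longrightarrow> set us \<subseteq> sections B \<Longrightarrow> set vs \<subseteq> sections B \<Longrightarrow>
        \<omega> (us @ Y # X # vs) p = - \<omega> (us @ X # Y # vs) p" using A by (elim conjE) blast
qed

lemma alt_form_move_front:
  assumes \<omega>: "alt_form B \<omega>" and "X \<in> sections B" "set us \<subseteq> sections B" "set vs \<subseteq> sections B"
  shows "\<omega> (us @ X # vs) p = (-1) ^ length us * \<omega> (X # us @ vs) p"
  using assms(3,4)
proof (induction us arbitrary: vs rule: rev_induct)
  case (snoc u us)
  have "\<omega> ((us @ [u]) @ X # vs) p = - \<omega> (us @ X # u # vs) p"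
    using alt_formD(6)[OF \<omega> assms(2), of u us vs p] snoc.prems by simp
  also have "\<omega> (us @ X # u # vs) p = (-1) ^ length us * \<omega> (X # us @ u # vs) p"
    using snoc.IH[of "u # vs"] snoc.prems by simp
  finally show ?case by simp
qed simp

context vb
begin

text \<open>Moving the slot to the front costs a sign that does not depend on the entry.\<close>

lemma alt_form_slot:
  assumes \<omega>: "alt_form B \<omega>" and Zs: "set us \<subseteq> sections B" "set vs \<subseteq> sections B"
  shows "(\<lambda>X. \<omega> (us @ X # vs)) \<in> lin_forms B"
  unfolding lin_forms_def mem_Collect_eq
proof (intro conjI ballI allI impI)
  show "smooth_at (base B) p (\<omega> (us @ Z # vs))" if "Z \<in> sections B" for Z p
    using Zs that by (intro alt_formD(3)[OF \<omega>]) auto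
  have uv: "set (us @ vs) \<subseteq> sections B" using Zs by simp
  show "\<omega> (us @ sec_add B Z Y # vs) = (\<lambda>p. \<omega> (us @ Z # vs) p + \<omega> (us @ Y # vs) p)"
    if "Z \<in> sections B" "Y \<in> sections B" for Z Y
  proof
    fix p
    show "\<omega> (us @ sec_add B Z Y # vs) p = \<omega> (us @ Z # vs) p + \<omega> (us @ Y # vs) p"
      using alt_form_move_front[OF \<omega> _ Zs, of _ p] alt_formD(4)[OF \<omega> that uv, of p] that sec_add_mem[OF that]
      by (simp add: distrib_left)
  qed
  show "\<omega> (us @ sec_mult B f Z # vs) = (\<lambda>p. f p *\<^sub>R \<omega> (us @ Z # vs) p)"
    if Z: "Z \<in> sections B" and f: "\<forall>p. smooth_at (base B) p f" for Z and f :: "'m \<Rightarrow> real"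
  proof
    fix p
    show "\<omega> (us @ sec_mult B f Z # vs) p = f p *\<^sub>R \<omega> (us @ Z # vs) p"
      using alt_form_move_front[OF \<omega> _ Zs, of _ p] alt_formD(5)[OF \<omega> Z _ uv, of f p] f Z sec_mult_mem[OF Z, of f]
      by simp
  qed
qed

lemma alt_form_repeat:
  assumes \<omega>: "alt_form B \<omega>" and X: "X \<in> sections B"
    and S: "set us \<subseteq> sections B" "set vs \<subseteq> sections B" "set ws \<subseteq> sections B"
  shows "\<omega> (us @ X # vs @ X # ws) p = 0"
proof -
  have "\<omega> (us @ X # vs @ X # ws) p = (-1) ^ length us * \<omega> (X # us @ vs @ X # ws) p"
    using alt_form_move_front[OF \<omega> X S(1), of "vs @ X # ws"] S X by simp
  also have "\<omega> (X # us @ vs @ X # ws) p = (-1) ^ Suc (length us + length vs) * \<omega> (X # X # us @ vs @ ws) p"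
    using alt_form_move_front[OF \<omega> X, of "X # us @ vs" ws] S X by simp
  also have "\<omega> (X # X # us @ vs @ ws) p = 0"
    using alt_formD(6)[OF \<omega> X X, of "[]" "us @ vs @ ws" p] S by simp
  finally show ?thesis by simp
qed

lemma alt_form_Lambda:
  assumes \<omega>: "alt_form B \<omega>" shows "\<omega> \<in> Lambda B"
proof -
  have deg: "deg_component \<omega> q \<in> Lambda_deg B q" for q
    unfolding Lambda_deg_def mem_Collect_eq
  proof (intro conjI allI impI ballI)
    show "deg_component \<omega> q Zs = (\<lambda>_. 0)" if "\<not> (length Zs = q \<and> set Zs \<subseteq> sections B)" for Zs
      using that alt_formD(2)[OF \<omega>, of Zs] by (auto simp: deg_component_def)
  next
    fix Zs assume Zs: "length Zs = q \<and> set Zs \<subseteq> sections B"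
    show "deg_component \<omega> q Zs \<in> smooth_functions (base B)"
      using Zs alt_formD(3)[OF \<omega>] by (simp add: deg_component_def smooth_functions_iff[OF base_manifold])
    have upd: "deg_component \<omega> q (Zs[i := Z]) = \<omega> (take i Zs @ Z # drop (Suc i) Zs)" if "i < q" for i Z
      using Zs that by (simp add: deg_component_def upd_conv_take_nth_drop)
    have slot: "(\<lambda>X. \<omega> (take i Zs @ X # drop (Suc i) Zs)) \<in> lin_forms B" for i
      by (rule alt_form_slot[OF \<omega> subset_trans[OF set_take_subset conjunct2[OF Zs]] subset_trans[OF set_drop_subset conjunct2[OF Zs]]])
    show "deg_component \<omega> q (Zs[i := sec_add B X Y]) =
        (\<lambda>p. deg_component \<omega> q (Zs[i := X]) p + deg_component \<omega> q (Zs[i := Y]) p)"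
      if "i < q" "X \<in> sections B" "Y \<in> sections B" for i X Y
      unfolding upd[OF that(1)] using lin_formsD(2)[OF slot that(2,3)] by (simp add: fun_eq_iff)
    show "deg_component \<omega> q (Zs[i := sec_mult B f X]) = (\<lambda>p. f p * deg_component \<omega> q (Zs[i := X]) p)"
      if "i < q" "X \<in> sections B" "f \<in> smooth_functions (base B)" for i X f
      unfolding upd[OF that(1)] using lin_formsD(3)[OF slot that(2), of f] that(3)
      by (simp add: fun_eq_iff smooth_functions_iff[OF base_manifold])
    have rep: "\<omega> Zs = (\<lambda>_. 0)" if "i < j" "j < q" "Zs ! i = Zs ! j" for i j
    proof -
      let ?us = "take i Zs" and ?vs = "take (j - Suc i) (drop (Suc i) Zs)" and ?ws = "drop (Suc j) Zs"
      have jj: "drop (Suc i) Zs ! (j - Suc i) = Zs ! j" using that Zs by simp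
      have "Zs = ?us @ Zs ! i # drop (Suc i) Zs"
        by (rule id_take_nth_drop) (use that Zs in simp)
      also have "drop (Suc i) Zs = ?vs @ Zs ! j # ?ws"
        using id_take_nth_drop[of "j - Suc i" "drop (Suc i) Zs"] that Zs jj by simp
      finally have eq: "Zs = ?us @ Zs ! i # ?vs @ Zs ! i # ?ws" using that(3) by simp
      have "Zs ! i \<in> sections B" using Zs that nth_mem[of i Zs] by auto
      moreover have "set ?us \<subseteq> sections B" "set ?vs \<subseteq> sections B" "set ?ws \<subseteq> sections B"
        using Zs by (meson set_take_subset set_drop_subset subset_trans)+
      ultimately have "\<omega> (?us @ Zs ! i # ?vs @ Zs ! i # ?ws) p = 0" for p by (rule alt_form_repeat[OF \<omega>])
      then show ?thesis unfolding eq[symmetric] by blast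
    qed
    show "deg_component \<omega> q Zs = (\<lambda>_. 0)" if "i < q" "j < q" "i \<noteq> j \<and> Zs ! i = Zs ! j" for i j
    proof -
      have "\<omega> Zs = (\<lambda>_. 0)"
        using rep[of i j] rep[of j i] that by (cases "i < j") auto
      then show ?thesis by (simp add: deg_component_def)
    qed
  qed
  obtain q where q: "\<And>Zs. length Zs > q \<Longrightarrow> \<omega> Zs = (\<lambda>_. 0)" using alt_formD(1)[OF \<omega>] by blast
  have "{n. deg_component \<omega> n \<noteq> (\<lambda>_ _. 0)} \<subseteq> {..q}"
  proof
    fix n assume "n \<in> {n. deg_component \<omega> n \<noteq> (\<lambda>_ _. 0)}"
    then obtain Zs where "deg_component \<omega> n Zs \<noteq> (\<lambda>_. 0)" by auto
    then have "length Zs = n" "\<omega> Zs \<noteq> (\<lambda>_. 0)" unfolding deg_component_def by (auto split: if_splits)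
    then show "n \<in> {..q}" using q[of Zs] by (cases "q < n") auto
  qed
  then have "finite {n. deg_component \<omega> n \<noteq> (\<lambda>_ _. 0)}" by (rule finite_subset) simp
  then show ?thesis unfolding Lambda_def using deg by simp
qed

text \<open>Antisymmetry follows from alternation by polarization: the form vanishes with X + Y in
  two adjacent slots.\<close>

lemma Lambda_alt_form:
  assumes \<omega>: "\<omega> \<in> Lambda B" shows "alt_form B \<omega>"
proof -
  have deg: "deg_component \<omega> q \<in> Lambda_deg B q" for q
    using \<omega> unfolding Lambda_def by simp
  have fin: "finite {q. deg_component \<omega> q \<noteq> (\<lambda>_ _. 0)}"
    using \<omega> unfolding Lambda_def by simp
  have eq: "\<omega> Zs = deg_component \<omega> (length Zs) Zs" for Zs by (simp add: deg_component_def)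
  note D = deg[unfolded Lambda_deg_def mem_Collect_eq]
  obtain q where q: "\<And>n. n \<in> {q. deg_component \<omega> q \<noteq> (\<lambda>_ _. 0)} \<Longrightarrow> n \<le> q"
    using fin unfolding finite_nat_set_iff_bounded_le by blast
  have add: "\<omega> (us @ sec_add B X Y # vs) p = \<omega> (us @ X # vs) p + \<omega> (us @ Y # vs) p"
    if "X \<in> sections B" "Y \<in> sections B" "set us \<subseteq> sections B" "set vs \<subseteq> sections B" for us vs X Y p
  proof -
    let ?Zs = "us @ X # vs"
    have "length ?Zs = length ?Zs \<and> set ?Zs \<subseteq> sections B" "length us < length ?Zs" using that by auto
    from conjunct2[OF D[of "length ?Zs"], rule_format, OF this(1), THEN conjunct2, THEN conjunct1, rule_format, OF this(2) that(1,2)]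
    show ?thesis by (simp add: deg_component_def)
  qed
  have mult: "\<omega> (us @ sec_mult B f X # vs) p = f p * \<omega> (us @ X # vs) p"
    if "X \<in> sections B" "f \<in> smooth_functions (base B)" "set us \<subseteq> sections B" "set vs \<subseteq> sections B" for us vs X f p
  proof -
    let ?Zs = "us @ X # vs"
    have "length ?Zs = length ?Zs \<and> set ?Zs \<subseteq> sections B" "length us < length ?Zs" using that by auto
    from conjunct2[OF D[of "length ?Zs"], rule_format, OF this(1), THEN conjunct2, THEN conjunct2, THEN conjunct1,
        rule_format, OF this(2) that(1,2)]
    show ?thesis by (simp add: deg_component_def)
  qed
  have alt: "\<omega> (us @ X # X # vs) p = 0"
    if "X \<in> sections B" "set us \<subseteq> sections B" "set vs \<subseteq> sections B" for us vs X p
  proof -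
    let ?Zs = "us @ X # X # vs"
    have 1: "length ?Zs = length ?Zs \<and> set ?Zs \<subseteq> sections B" "length us < length ?Zs" "Suc (length us) < length ?Zs" using that by auto
    have "length us \<noteq> Suc (length us) \<and> ?Zs ! length us = ?Zs ! Suc (length us)" by (simp add: nth_append)
    from conjunct2[OF D[of "length ?Zs"], rule_format, OF 1(1), THEN conjunct2, THEN conjunct2, THEN conjunct2,
        rule_format, OF 1(2,3) this]
    show ?thesis by (simp add: deg_component_def)
  qed
  show ?thesis
  proof (rule alt_formI[of q])
    show "\<omega> Zs = (\<lambda>_. 0)" if "length Zs > q" for Zs
      using q[of "length Zs"] that unfolding eq[of Zs] by force
    show "\<omega> Zs = (\<lambda>_. 0)" if "\<not> set Zs \<subseteq> sections B" for Zs
      using conjunct1[OF D[of "length Zs"]] that unfolding eq[of Zs] by simp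
    show "smooth_at (base B) p (\<omega> Zs)" if "set Zs \<subseteq> sections B" for Zs p
    proof -
      have "deg_component \<omega> (length Zs) Zs \<in> smooth_functions (base B)"
        using conjunct2[OF D[of "length Zs"], rule_format, of Zs] that by simp
      then show ?thesis unfolding eq[symmetric] by (simp add: smooth_functions_iff[OF base_manifold])
    qed
    show "\<omega> (sec_add B X Y # Zs) p = \<omega> (X # Zs) p + \<omega> (Y # Zs) p"
      if "X \<in> sections B" "Y \<in> sections B" "set Zs \<subseteq> sections B" for X Y Zs p
      using add[OF that(1,2), of "[]" Zs] that by simp
    show "\<omega> (sec_mult B f X # Zs) p = f p * \<omega> (X # Zs) p"
      if "X \<in> sections B" "\<And>q. smooth_at (base B) q f" "set Zs \<subseteq> sections B" for f :: "'m \<Rightarrow> real" and X Zs p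
      using mult[OF that(1), of f "[]" Zs] that by (simp add: smooth_functions_iff[OF base_manifold])
    show "\<omega> (us @ Y # X # vs) p = - \<omega> (us @ X # Y # vs) p"
      if X: "X \<in> sections B" and Y: "Y \<in> sections B" and S: "set us \<subseteq> sections B" "set vs \<subseteq> sections B" for X Y us vs p
    proof -
      have XY: "sec_add B X Y \<in> sections B" by (rule sec_add_mem[OF X Y])
      have "0 = \<omega> (us @ sec_add B X Y # sec_add B X Y # vs) p" by (simp add: alt[OF XY S])
      also have "\<dots> = \<omega> (us @ X # sec_add B X Y # vs) p + \<omega> (us @ Y # sec_add B X Y # vs) p"
        using add[OF X Y S(1), of "sec_add B X Y # vs"] XY S by simp
      also have "\<omega> (us @ X # sec_add B X Y # vs) p = \<omega> (us @ X # X # vs) p + \<omega> (us @ X # Y # vs) p"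
        using add[OF X Y, of "us @ [X]" vs] X S by simp
      also have "\<omega> (us @ Y # sec_add B X Y # vs) p = \<omega> (us @ Y # X # vs) p + \<omega> (us @ Y # Y # vs) p"
        using add[OF X Y, of "us @ [Y]" vs] Y S by simp
      finally show ?thesis using alt[OF X S] alt[OF Y S] by simp
    qed
  qed
qed

lemma alt_form_comb:
  assumes \<omega>: "alt_form B \<omega>" and \<theta>: "alt_form B \<theta>"
  shows "alt_form B (\<lambda>Zs p. \<omega> Zs p + r * \<theta> Zs p)"
proof -
  obtain q where q: "\<And>Zs. length Zs > q \<Longrightarrow> \<omega> Zs = (\<lambda>_. 0)" using alt_formD(1)[OF \<omega>] by blast
  obtain q' where q': "\<And>Zs. length Zs > q' \<Longrightarrow> \<theta> Zs = (\<lambda>_. 0)" using alt_formD(1)[OF \<theta>] by blast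
  show ?thesis
  proof (rule alt_formI[of "max q q'"])
    show "smooth_at (base B) p (\<lambda>p. \<omega> Zs p + r * \<theta> Zs p)" if "set Zs \<subseteq> sections B" for Zs p
      by (intro smooth_at_add smooth_at_mult smooth_at_const base_manifold alt_formD(3)[OF \<omega> that] alt_formD(3)[OF \<theta> that])
  next
    fix X Y Zs p assume *: "X \<in> sections B" "Y \<in> sections B" "set Zs \<subseteq> sections B"
    show "\<omega> (sec_add B X Y # Zs) p + r * \<theta> (sec_add B X Y # Zs) p =
        \<omega> (X # Zs) p + r * \<theta> (X # Zs) p + (\<omega> (Y # Zs) p + r * \<theta> (Y # Zs) p)"
      using alt_formD(4)[OF \<omega> *, of p] alt_formD(4)[OF \<theta> *, of p] by (simp add: algebra_simps)
  next
    fix f :: "'m \<Rightarrow> real" and X Zs p assume *: "X \<in> sections B" "\<And>q. smooth_at (base B) q f" "set Zs \<subseteq> sections B"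
    show "\<omega> (sec_mult B f X # Zs) p + r * \<theta> (sec_mult B f X # Zs) p = f p * (\<omega> (X # Zs) p + r * \<theta> (X # Zs) p)"
      using alt_formD(5)[OF \<omega> *, of p] alt_formD(5)[OF \<theta> *, of p] by (simp add: algebra_simps)
  next
    fix X Y us vs p assume *: "X \<in> sections B" "Y \<in> sections B" "set us \<subseteq> sections B" "set vs \<subseteq> sections B"
    show "\<omega> (us @ Y # X # vs) p + r * \<theta> (us @ Y # X # vs) p = - (\<omega> (us @ X # Y # vs) p + r * \<theta> (us @ X # Y # vs) p)"
      using alt_formD(6)[OF \<omega> *, of p] alt_formD(6)[OF \<theta> *, of p] by (simp add: algebra_simps)
  qed (use q q' alt_formD(2)[OF \<omega>] alt_formD(2)[OF \<theta>] in auto)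
qed

lemma alt_form_zero: "alt_form B (\<lambda>_ _. 0)"
  by (rule alt_formI) (auto intro: smooth_at_const base_manifold)

lemma alt_form_deg:
  assumes \<omega>: "alt_form B \<omega>" shows "alt_form B (deg_component \<omega> q)"
proof (rule alt_formI[of q])
  show "smooth_at (base B) p (deg_component \<omega> q Zs)" if "set Zs \<subseteq> sections B" for Zs p
    using alt_formD(3)[OF \<omega> that] by (simp add: deg_component_def smooth_at_const[OF base_manifold])
  show "deg_component \<omega> q Zs = (\<lambda>_. 0)" if "\<not> set Zs \<subseteq> sections B" for Zs
    using alt_formD(2)[OF \<omega> that] by (simp add: deg_component_def)
  show "deg_component \<omega> q (sec_add B X Y # Zs) p = deg_component \<omega> q (X # Zs) p + deg_component \<omega> q (Y # Zs) p"
    if "X \<in> sections B" "Y \<in> sections B" "set Zs \<subseteq> sections B" for X Y Zs p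
    using alt_formD(4)[OF \<omega> that] by (simp add: deg_component_def)
  show "deg_component \<omega> q (sec_mult B f X # Zs) p = f p * deg_component \<omega> q (X # Zs) p"
    if "X \<in> sections B" "\<And>q. smooth_at (base B) q f" "set Zs \<subseteq> sections B" for f :: "'m \<Rightarrow> real" and X Zs p
    using alt_formD(5)[OF \<omega> that] by (simp add: deg_component_def)
  show "deg_component \<omega> q (us @ Y # X # vs) p = - deg_component \<omega> q (us @ X # Y # vs) p"
    if "X \<in> sections B" "Y \<in> sections B" "set us \<subseteq> sections B" "set vs \<subseteq> sections B" for X Y us vs p
    using alt_formD(6)[OF \<omega> that] by (simp add: deg_component_def)
qed (simp add: deg_component_def)

text \<open>The interior product with \<open>c\<close>. The scalar is built in because forms
  otherwise have only sums and exterior products here.\<close>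

definition contract :: "real \<Rightarrow> ('m \<Rightarrow> 'f) \<Rightarrow> ('m, 'f) form \<Rightarrow> ('m, 'f) form" where
  "contract r c \<omega> = (\<lambda>Zs p. r * \<omega> (c # Zs) p)"

lemma alt_form_contract:
  assumes \<omega>: "alt_form B \<omega>" and c: "c \<in> sections B"
  shows "alt_form B (contract r c \<omega>)"
proof -
  obtain q where q: "\<And>Zs. length Zs > q \<Longrightarrow> \<omega> Zs = (\<lambda>_. 0)" using alt_formD(1)[OF \<omega>] by blast
  have swap: "\<omega> (c # X # Zs) p = - \<omega> (X # c # Zs) p" if "X \<in> sections B" "set Zs \<subseteq> sections B" for X Zs p
    using alt_formD(6)[OF \<omega> that(1) c, of "[]" Zs p] that by simp
  show ?thesis
    unfolding contract_def
  proof (rule alt_formI[of q])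
    show "smooth_at (base B) p (\<lambda>p. r * \<omega> (c # Zs) p)" if "set Zs \<subseteq> sections B" for Zs p
      using that c by (intro smooth_at_mult smooth_at_const base_manifold alt_formD(3)[OF \<omega>]) simp
    show "(\<lambda>p. r * \<omega> (c # Zs) p) = (\<lambda>_. 0)" if "\<not> set Zs \<subseteq> sections B" for Zs
      using alt_formD(2)[OF \<omega>, of "c # Zs"] that by simp
    show "r * \<omega> (c # sec_add B X Y # Zs) p = r * \<omega> (c # X # Zs) p + r * \<omega> (c # Y # Zs) p"
      if "X \<in> sections B" "Y \<in> sections B" "set Zs \<subseteq> sections B" for X Y Zs p
      using that alt_formD(4)[OF \<omega> that(1,2), of "c # Zs" p] c sec_add_mem[OF that(1,2)]
      by (simp add: swap algebra_simps)
    show "r * \<omega> (c # sec_mult B f X # Zs) p = f p * (r * \<omega> (c # X # Zs) p)"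
      if "X \<in> sections B" "\<And>q. smooth_at (base B) q f" "set Zs \<subseteq> sections B" for f :: "'m \<Rightarrow> real" and X Zs p
      using that alt_formD(5)[OF \<omega> that(1,2), of "c # Zs" p] c sec_mult_mem[OF that(1,2)]
      by (simp add: swap algebra_simps)
    show "r * \<omega> (c # us @ Y # X # vs) p = - (r * \<omega> (c # us @ X # Y # vs) p)"
      if "X \<in> sections B" "Y \<in> sections B" "set us \<subseteq> sections B" "set vs \<subseteq> sections B" for X Y us vs p
      using alt_formD(6)[OF \<omega> that(1,2), of "c # us" vs p] c that by simp
  qed (use q in auto)
qed

end

section \<open>Shuffles under an adjacent transposition, and the exterior product\<close>

definition adj_swap :: "nat \<Rightarrow> nat \<Rightarrow> nat" where
  "adj_swap a i = (if i = a then Suc a else if i = Suc a then a else i)"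

lemma adj_swap_invol [simp]: "adj_swap a (adj_swap a i) = i"
  by (simp add: adj_swap_def)

lemma adj_swap_less: "Suc a < n \<Longrightarrow> adj_swap a i < n \<longleftrightarrow> i < n"
  by (auto simp: adj_swap_def)

lemma nths_cong: "(\<And>i. i < length xs \<Longrightarrow> i \<in> A \<longleftrightarrow> i \<in> B) \<Longrightarrow> nths xs A = nths xs B"
proof (induction xs arbitrary: A B)
  case (Cons x xs)
  have "nths xs {j. Suc j \<in> A} = nths xs {j. Suc j \<in> B}"
    by (rule Cons.IH) (use Cons.prems in auto)
  then show ?case using Cons.prems[of 0] by (simp add: nths_Cons)
qed simp

lemma nths_adjacent:
  "nths (us @ x # y # vs) A = nths us A @ (if length us \<in> A then [x] else []) @
     (if Suc (length us) \<in> A then [y] else []) @ nths vs {j. Suc (Suc (j + length us)) \<in> A}"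
  by (simp add: nths_append nths_Cons)

text \<open>If at most one of the two neighbours is selected, their order cannot be seen in the
  selection, provided the index set is transposed along with the list. The transposition is an
  involution, so the preimage written here is also the image.\<close>

lemma nths_swap:
  assumes "\<not> (length us \<in> A \<and> Suc (length us) \<in> A)"
  shows "nths (us @ y # x # vs) {i. adj_swap (length us) i \<in> A} = nths (us @ x # y # vs) A"
proof -
  have "nths us {i. adj_swap (length us) i \<in> A} = nths us A"
    by (rule nths_cong) (auto simp: adj_swap_def)
  moreover have "nths vs {j. Suc (Suc (j + length us)) \<in> {i. adj_swap (length us) i \<in> A}} =
      nths vs {j. Suc (Suc (j + length us)) \<in> A}"
    by (rule nths_cong) (auto simp: adj_swap_def)
  ultimately show ?thesis
    unfolding nths_adjacent using assms by (auto simp: adj_swap_def)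
qed

lemma nths_swap_both:
  assumes "length us \<in> A" "Suc (length us) \<in> A"
  obtains us' vs' where "nths (us @ x # y # vs) A = us' @ x # y # vs'" "nths (us @ y # x # vs) A = us' @ y # x # vs'"
    "set us' \<subseteq> set us" "set vs' \<subseteq> set vs"
  by (rule that[of "nths us A" "nths vs {j. Suc (Suc (j + length us)) \<in> A}"])
    (use assms set_nths_subset in \<open>auto simp: nths_adjacent dest: in_set_nthsD\<close>)

definition inversions :: "nat \<Rightarrow> nat set \<Rightarrow> (nat \<times> nat) set" where
  "inversions n I = {(i, j). i \<in> I \<and> j \<in> {..<n} - I \<and> j < i}"

text \<open>The transposition reverses the order of the pair a, Suc a only, so it carries old
  inversions injectively to new ones; the pair itself, which was not inverted before, is the single
  addition.\<close>

lemma card_inversions_swap: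
  assumes I: "I \<subseteq> {..<n}" "Suc a < n" "a \<in> I" "Suc a \<notin> I"
  shows "card (inversions n {i. adj_swap a i \<in> I}) = Suc (card (inversions n I))"
proof -
  let ?\<tau> = "adj_swap a" and ?I' = "{i. adj_swap a i \<in> I}"
  let ?f = "\<lambda>(i, j). (?\<tau> i, ?\<tau> j)"
  have inj: "inj_on ?f (inversions n I)"
    by (rule inj_on_inverseI[of _ ?f]) auto
  have fin: "finite (inversions n I)"
    by (rule finite_subset[of _ "{..<n} \<times> {..<n}"]) (use I in \<open>auto simp: inversions_def\<close>)
  have "inversions n ?I' = insert (Suc a, a) (?f ` inversions n I)"
  proof (intro set_eqI iffI)
    fix x assume x: "x \<in> inversions n ?I'"
    obtain i j where ij: "x = (i, j)" by (cases x)
    have h: "?\<tau> i \<in> I" "j < n" "?\<tau> j \<notin> I" "j < i" using x unfolding ij inversions_def by auto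
    show "x \<in> insert (Suc a, a) (?f ` inversions n I)"
    proof (cases "x = (Suc a, a)")
      case False
      then have "?\<tau> j < ?\<tau> i" using h(4) unfolding ij adj_swap_def by auto
      then have "(?\<tau> i, ?\<tau> j) \<in> inversions n I"
        using h adj_swap_less[OF I(2)] by (simp add: inversions_def)
      then have "?f (?\<tau> i, ?\<tau> j) \<in> ?f ` inversions n I" by (rule imageI)
      then show ?thesis by (simp add: ij)
    qed simp
  next
    fix x assume x: "x \<in> insert (Suc a, a) (?f ` inversions n I)"
    show "x \<in> inversions n ?I'"
    proof (cases "x = (Suc a, a)")
      case True
      then show ?thesis using I by (simp add: inversions_def adj_swap_def)
    next
      case False
      then obtain i j where ij: "x = (?\<tau> i, ?\<tau> j)" "(i, j) \<in> inversions n I" using x by auto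
      have h: "i \<in> I" "j < n" "j \<notin> I" "j < i" using ij(2) unfolding inversions_def by auto
      have "j \<noteq> a" using h I by blast
      then have "?\<tau> j < ?\<tau> i" using h(4) unfolding adj_swap_def by auto
      then show ?thesis using h adj_swap_less[OF I(2)] by (simp add: inversions_def ij(1))
    qed
  qed
  moreover have "(Suc a, a) \<notin> ?f ` inversions n I"
  proof
    assume "(Suc a, a) \<in> ?f ` inversions n I"
    then obtain i j where ij: "Suc a = ?\<tau> i" "a = ?\<tau> j" "(i, j) \<in> inversions n I" by auto
    have "i = a" using ij(1) by (auto simp: adj_swap_def split: if_splits)
    moreover have "j = Suc a" using ij(2) by (auto simp: adj_swap_def split: if_splits)
    ultimately show False using ij(3) by (simp add: inversions_def)
  qed
  ultimately show ?thesis using fin card_image[OF inj] by simp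
qed

lemma wedge_inversions:
  "wedge \<omega> \<theta> Zs p = (\<Sum>I\<in>Pow {..<length Zs}. (-1) ^ card (inversions (length Zs) I) * \<omega> (nths Zs I) p * \<theta> (nths Zs (- I)) p)"
  by (simp add: wedge_def inversions_def)

lemma set_nths_Un: "set (nths Zs I) \<union> set (nths Zs (- I)) = set Zs"
proof -
  have "set Zs = {Zs ! i |i. i < length Zs}" by (rule set_conv_nth)
  then show ?thesis unfolding set_nths by blast
qed

lemma length_nths_add: "length (nths Zs I) + length (nths Zs (- I)) = length Zs"
proof -
  have "card {i. i < length Zs \<and> i \<in> I} + card {i. i < length Zs \<and> i \<in> - I} =
      card ({i. i < length Zs \<and> i \<in> I} \<union> {i. i < length Zs \<and> i \<in> - I})"
    by (rule card_Un_disjoint[symmetric]) auto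
  also have "{i. i < length Zs \<and> i \<in> I} \<union> {i. i < length Zs \<and> i \<in> - I} = {..<length Zs}" by auto
  finally show ?thesis by (simp add: length_nths)
qed

context vb
begin

text \<open>Shuffles are reindexed by the transposed subset of positions. If both swapped positions
  go to the same factor, the subset is unchanged and that factor changes sign. If they are
  separated, both factors keep their arguments and the number of inversions changes by one.\<close>

lemma alt_form_wedge:
  assumes \<omega>: "alt_form B \<omega>" and \<theta>: "alt_form B \<theta>"
  shows "alt_form B (wedge \<omega> \<theta>)"
proof -
  obtain q where q: "\<And>Zs. length Zs > q \<Longrightarrow> \<omega> Zs = (\<lambda>_. 0)" using alt_formD(1)[OF \<omega>] by blast
  obtain q' where q': "\<And>Zs. length Zs > q' \<Longrightarrow> \<theta> Zs = (\<lambda>_. 0)" using alt_formD(1)[OF \<theta>] by blast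
  have sub: "set (nths Zs I) \<subseteq> sections B" if "set Zs \<subseteq> sections B" for Zs I
    using that set_nths_subset[of Zs I] by blast
  show ?thesis
  proof (rule alt_formI[of "q + q'"])
    fix Zs :: "('m \<Rightarrow> 'f) list" assume L: "length Zs > q + q'"
    have z: "\<omega> (nths Zs I) p * \<theta> (nths Zs (- I)) p = 0" for I p
    proof (cases "length (nths Zs I) > q")
      case False
      then have "length (nths Zs (- I)) > q'" using L length_nths_add[of Zs I] by linarith
      then show ?thesis using q' by simp
    qed (simp add: q)
    show "wedge \<omega> \<theta> Zs = (\<lambda>_. 0)"
      unfolding wedge_inversions[abs_def] mult.assoc z by simp
  next
    fix Zs :: "('m \<Rightarrow> 'f) list" assume L: "\<not> set Zs \<subseteq> sections B"
    have z: "\<omega> (nths Zs I) p * \<theta> (nths Zs (- I)) p = 0" for I p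
    proof (cases "set (nths Zs I) \<subseteq> sections B")
      case True
      then have "\<not> set (nths Zs (- I)) \<subseteq> sections B" using L set_nths_Un[of Zs I] by blast
      then show ?thesis using alt_formD(2)[OF \<theta>] by simp
    qed (simp add: alt_formD(2)[OF \<omega>])
    show "wedge \<omega> \<theta> Zs = (\<lambda>_. 0)"
      unfolding wedge_inversions[abs_def] mult.assoc z by simp
  next
    fix Zs p assume "set Zs \<subseteq> sections B"
    then show "smooth_at (base B) p (wedge \<omega> \<theta> Zs)"
      unfolding wedge_def
      by (intro smooth_at_sum smooth_at_mult smooth_at_const base_manifold alt_formD(3)[OF \<omega>] alt_formD(3)[OF \<theta>] sub)
  next
    fix X Y Zs p assume *: "X \<in> sections B" "Y \<in> sections B" "set Zs \<subseteq> sections B"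
    note s = sub[OF *(3)]
    show "wedge \<omega> \<theta> (sec_add B X Y # Zs) p = wedge \<omega> \<theta> (X # Zs) p + wedge \<omega> \<theta> (Y # Zs) p"
      unfolding wedge_inversions length_Cons sum.distrib[symmetric]
    proof (rule sum.cong[OF refl])
      fix I :: "nat set"
      show "(-1) ^ card (inversions (Suc (length Zs)) I) * \<omega> (nths (sec_add B X Y # Zs) I) p * \<theta> (nths (sec_add B X Y # Zs) (- I)) p =
        (-1) ^ card (inversions (Suc (length Zs)) I) * \<omega> (nths (X # Zs) I) p * \<theta> (nths (X # Zs) (- I)) p +
        (-1) ^ card (inversions (Suc (length Zs)) I) * \<omega> (nths (Y # Zs) I) p * \<theta> (nths (Y # Zs) (- I)) p"
        by (cases "0 \<in> I") (simp_all add: nths_Cons alt_formD(4)[OF \<omega> *(1,2) s] alt_formD(4)[OF \<theta> *(1,2) s] algebra_simps)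
    qed
  next
    fix f :: "'m \<Rightarrow> real" and X Zs p assume *: "X \<in> sections B" "\<And>q. smooth_at (base B) q f" "set Zs \<subseteq> sections B"
    note s = sub[OF *(3)]
    show "wedge \<omega> \<theta> (sec_mult B f X # Zs) p = f p * wedge \<omega> \<theta> (X # Zs) p"
      unfolding wedge_inversions length_Cons sum_distrib_left
    proof (rule sum.cong[OF refl])
      fix I :: "nat set"
      show "(-1) ^ card (inversions (Suc (length Zs)) I) * \<omega> (nths (sec_mult B f X # Zs) I) p * \<theta> (nths (sec_mult B f X # Zs) (- I)) p =
        f p * ((-1) ^ card (inversions (Suc (length Zs)) I) * \<omega> (nths (X # Zs) I) p * \<theta> (nths (X # Zs) (- I)) p)"
        by (cases "0 \<in> I") (simp_all add: nths_Cons alt_formD(5)[OF \<omega> *(1,2) s] alt_formD(5)[OF \<theta> *(1,2) s] algebra_simps)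
    qed
  next
    fix X Y us vs p assume *: "X \<in> sections B" "Y \<in> sections B" "set us \<subseteq> sections B" "set vs \<subseteq> sections B"
    let ?a = "length us" and ?n = "Suc (Suc (length us + length vs))"
    let ?Z = "us @ X # Y # vs" and ?Z' = "us @ Y # X # vs"
    let ?T = "\<lambda>I. {i. adj_swap (length us) i \<in> I}"
    let ?t = "\<lambda>Z I. (-1) ^ card (inversions ?n I) * \<omega> (nths Z I) p * \<theta> (nths Z (- I)) p"
    have TT: "?T (?T I) = I" for I by simp
    have Tn: "?T I \<subseteq> {..<?n}" if "I \<subseteq> {..<?n}" for I
      using that adj_swap_less[of ?a ?n] by force
    have bij: "bij_betw ?T (Pow {..<?n}) (Pow {..<?n})"
      by (rule bij_betw_byWitness[of _ ?T]) (use Tn in auto)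
    have CT: "- ?T I = ?T (- I)" for I by auto
    have key: "?t ?Z' (?T I) = - ?t ?Z I" if I: "I \<subseteq> {..<?n}" for I
    proof -
      consider "?a \<in> I" "Suc ?a \<in> I" | "?a \<notin> I" "Suc ?a \<notin> I" | "?a \<in> I" "Suc ?a \<notin> I" | "?a \<notin> I" "Suc ?a \<in> I" by blast
      then show ?thesis
      proof cases
        case 1
        then have T: "?T I = I" by (auto simp: adj_swap_def split: if_splits)
        have n: "nths ?Z' (- I) = nths ?Z (- I)"
          using nths_swap[of us "- I" Y X vs] 1 unfolding CT[symmetric] T by simp
        obtain us' vs' where u: "nths ?Z I = us' @ X # Y # vs'" "nths ?Z' I = us' @ Y # X # vs'"
          "set us' \<subseteq> set us" "set vs' \<subseteq> set vs"
          by (rule nths_swap_both[OF 1, of X Y vs]) (rule that)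
        have "\<omega> (nths ?Z' I) p = - \<omega> (nths ?Z I) p"
          unfolding u(1,2) by (rule alt_formD(6)[OF \<omega> *(1,2)]) (use u * in auto)
        then show ?thesis unfolding T n by simp
      next
        case 2
        then have T: "?T I = I" by (auto simp: adj_swap_def split: if_splits)
        have n: "nths ?Z' I = nths ?Z I"
          using nths_swap[of us I Y X vs] 2 unfolding T by simp
        have 2: "?a \<in> - I" "Suc ?a \<in> - I" using 2 by auto
        obtain us' vs' where u: "nths ?Z (- I) = us' @ X # Y # vs'" "nths ?Z' (- I) = us' @ Y # X # vs'"
          "set us' \<subseteq> set us" "set vs' \<subseteq> set vs"
          by (rule nths_swap_both[OF 2, of X Y vs]) (rule that)
        have "\<theta> (nths ?Z' (- I)) p = - \<theta> (nths ?Z (- I)) p"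
          unfolding u(1,2) by (rule alt_formD(6)[OF \<theta> *(1,2)]) (use u * in auto)
        then show ?thesis unfolding T n by simp
      next
        case 3
        have n: "nths ?Z' (?T I) = nths ?Z I" "nths ?Z' (- ?T I) = nths ?Z (- I)"
          unfolding CT by (rule nths_swap, use 3 in simp)+
        show ?thesis unfolding n using card_inversions_swap[OF I _ 3] by simp
      next
        case 4
        have n: "nths ?Z' (?T I) = nths ?Z I" "nths ?Z' (- ?T I) = nths ?Z (- I)"
          unfolding CT by (rule nths_swap, use 4 in simp)+
        have "?a \<in> ?T I" "Suc ?a \<notin> ?T I" using 4 by (auto simp: adj_swap_def)
        from card_inversions_swap[OF Tn[OF I] _ this]
        show ?thesis unfolding n TT by simp
      qed
    qed
    have "wedge \<omega> \<theta> ?Z' p = (\<Sum>I\<in>Pow {..<?n}. ?t ?Z' I)" by (simp add: wedge_inversions)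
    also have "\<dots> = (\<Sum>I\<in>Pow {..<?n}. ?t ?Z' (?T I))"
      by (rule sum.reindex_bij_betw[OF bij, symmetric])
    also have "\<dots> = (\<Sum>I\<in>Pow {..<?n}. - ?t ?Z I)"
      by (rule sum.cong[OF refl]) (rule key, simp)
    also have "\<dots> = - wedge \<omega> \<theta> ?Z p" by (simp add: wedge_inversions sum_negf)
    finally show "wedge \<omega> \<theta> ?Z' p = - wedge \<omega> \<theta> ?Z p" .
  qed
qed

text \<open>The passage from function-linear maps, whose values off the sections are arbitrary, to
  the normalized elements of degree 1 of the exterior algebra.\<close>

definition one_form :: "(('m \<Rightarrow> 'f) \<Rightarrow> 'm \<Rightarrow> real) \<Rightarrow> ('m, 'f) form" where
  "one_form \<Omega> = (\<lambda>Zs. if length Zs = 1 \<and> set Zs \<subseteq> sections B then \<Omega> (hd Zs) else (\<lambda>_. 0))"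

lemma one_form_Lambda_deg:
  assumes \<Omega>: "\<Omega> \<in> lin_forms B" shows "one_form \<Omega> \<in> Lambda_deg B 1"
  unfolding Lambda_deg_def mem_Collect_eq
proof (intro conjI allI impI ballI)
  fix Zs :: "('m \<Rightarrow> 'f) list" assume Zs: "length Zs = 1 \<and> set Zs \<subseteq> sections B"
  then obtain Z where Z: "Zs = [Z]" "Z \<in> sections B" by (cases Zs) auto
  show "one_form \<Omega> Zs \<in> smooth_functions (base B)"
    using Z lin_formsD(1)[OF \<Omega>] by (simp add: one_form_def smooth_functions_iff[OF base_manifold])
  show "one_form \<Omega> (Zs[i := sec_add B X Y]) = (\<lambda>p. one_form \<Omega> (Zs[i := X]) p + one_form \<Omega> (Zs[i := Y]) p)"
    if "i < 1" "X \<in> sections B" "Y \<in> sections B" for i X Y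
    using that Z lin_formsD(2)[OF \<Omega> that(2,3)] sec_add_mem[OF that(2,3)] by (simp add: one_form_def fun_eq_iff)
  show "one_form \<Omega> (Zs[i := sec_mult B f X]) = (\<lambda>p. f p * one_form \<Omega> (Zs[i := X]) p)"
    if "i < 1" "X \<in> sections B" "f \<in> smooth_functions (base B)" for i f X
    using that Z lin_formsD(3)[OF \<Omega> that(2), of f] sec_mult_mem[OF that(2), of f]
    by (simp add: one_form_def fun_eq_iff smooth_functions_iff[OF base_manifold])
qed (auto simp: one_form_def)

lemma nths_minus_single: "i < length Zs \<Longrightarrow> nths Zs (- {i}) = take i Zs @ drop (Suc i) Zs"
proof (induction Zs arbitrary: i)
  case (Cons Z Zs)
  show ?case
  proof (cases i)
    case 0
    then show ?thesis by (simp add: nths_Cons nths_all)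
  next
    case (Suc j)
    have "{k. Suc k \<in> - {i}} = - {j}" using Suc by auto
    then show ?thesis using Cons Suc by (simp add: nths_Cons)
  qed
qed simp

lemma nths_single: "i < length Zs \<Longrightarrow> nths Zs {i} = [Zs ! i]"
proof (induction Zs arbitrary: i)
  case (Cons Z Zs)
  have "{k. Suc k \<in> {i}} = (case i of 0 \<Rightarrow> {} | Suc j \<Rightarrow> {j})" by (auto split: nat.splits)
  then show ?case using Cons by (auto simp: nths_Cons split: nat.splits)
qed simp

text \<open>Only singletons contribute to the shuffle sum, and position i is preceded by i positions
  that go to the other factor; this gives the sign.\<close>

lemma wedge_one_form:
  assumes Zs: "set Zs \<subseteq> sections B"
  shows "wedge (one_form \<Omega>) \<theta> Zs p = (\<Sum>i<length Zs. (-1) ^ i * \<Omega> (Zs ! i) p * \<theta> (nths Zs (- {i})) p)"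
proof -
  let ?n = "length Zs"
  let ?t = "\<lambda>I. (-1) ^ card (inversions ?n I) * one_form \<Omega> (nths Zs I) p * \<theta> (nths Zs (- I)) p"
  have "wedge (one_form \<Omega>) \<theta> Zs p = (\<Sum>I\<in>(\<lambda>i. {i}) ` {..<?n}. ?t I)"
    unfolding wedge_inversions
  proof (rule sum.mono_neutral_right)
    show "\<forall>I\<in>Pow {..<?n} - (\<lambda>i. {i}) ` {..<?n}. ?t I = 0"
    proof
      fix I assume I: "I \<in> Pow {..<?n} - (\<lambda>i. {i}) ` {..<?n}"
      have "length (nths Zs I) \<noteq> 1"
      proof
        assume "length (nths Zs I) = 1"
        moreover have "{i. i < ?n \<and> i \<in> I} = I" using I by auto
        ultimately have "card I = 1" by (simp add: length_nths)
        then obtain i where "I = {i}" by (auto simp: card_1_singleton_iff)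
        then show False using I by auto
      qed
      then show "?t I = 0" by (simp add: one_form_def)
    qed
  qed auto
  also have "\<dots> = (\<Sum>i<?n. ?t {i})" by (subst sum.reindex) auto
  also have "\<dots> = (\<Sum>i<?n. (-1) ^ i * \<Omega> (Zs ! i) p * \<theta> (nths Zs (- {i})) p)"
  proof (rule sum.cong[OF refl])
    fix i assume "i \<in> {..<?n}"
    then have i: "i < ?n" by simp
    have "inversions ?n {i} = Pair i ` {..<i}" using i by (auto simp: inversions_def)
    then have "card (inversions ?n {i}) = i" by (simp add: card_image inj_on_def)
    moreover have "Zs ! i \<in> sections B" using Zs nth_mem[OF i] by blast
    ultimately show "?t {i} = (-1) ^ i * \<Omega> (Zs ! i) p * \<theta> (nths Zs (- {i})) p"
      using nths_single[OF i] by (simp add: one_form_def)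
  qed
  finally show ?thesis .
qed

lemma ideal_alt_form: "is_ideal B I \<Longrightarrow> \<omega> \<in> I \<Longrightarrow> alt_form B \<omega>"
  using Lambda_alt_form unfolding is_ideal_def by blast

lemma ideal_sum:
  assumes I: "is_ideal B I" and "finite A" "\<And>a. a \<in> A \<Longrightarrow> \<omega> a \<in> I"
  shows "(\<lambda>Zs p. \<Sum>a\<in>A. \<omega> a Zs p) \<in> I"
  using assms(2,3)
proof (induction A)
  case empty
  then show ?case using I unfolding is_ideal_def by simp
next
  case (insert a A)
  have "\<forall>\<omega>\<in>I. \<forall>\<theta>\<in>I. form_add \<omega> \<theta> \<in> I" using I unfolding is_ideal_def by blast
  from bspec[OF bspec[OF this, of "\<omega> a"], of "\<lambda>Zs p. \<Sum>a\<in>A. \<omega> a Zs p"] insert show ?case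
    by (simp add: form_add_def)
qed

end

section \<open>The ideal generated by the annihilator\<close>

context subvb
begin

lemma one_form_ann: "\<Omega> \<in> ann \<Longrightarrow> one_form \<Omega> \<in> annihilator_sections B E"
  using one_form_Lambda_deg sections_E unfolding ann_def annihilator_sections_def
  by (auto simp: one_form_def fun_eq_iff)

lemma annihilator_ann:
  assumes "\<Omega> \<in> annihilator_sections B E" shows "alt_form B \<Omega>" "(\<lambda>Z. \<Omega> [Z]) \<in> ann"
proof -
  have L: "\<Omega> \<in> Lambda_deg B 1" and S: "\<forall>S\<in>sections E. \<Omega> [S] = (\<lambda>_. 0)"
    using assms unfolding annihilator_sections_def by auto
  have 0: "\<Omega> Zs = (\<lambda>_. 0)" if "length Zs \<noteq> 1" for Zs
    using L that unfolding Lambda_deg_def by simp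
  have d: "deg_component \<Omega> q = (if q = 1 then \<Omega> else (\<lambda>_ _. 0))" for q
    using 0 by (auto simp: deg_component_def fun_eq_iff)
  have "(\<lambda>_ _. 0) \<in> Lambda_deg B q" for q
    unfolding Lambda_deg_def by (simp add: smooth_functions_iff[OF base_manifold] smooth_at_const[OF base_manifold])
  then have "\<forall>q. deg_component \<Omega> q \<in> Lambda_deg B q" using L by (simp add: d)
  moreover have "finite {q. deg_component \<Omega> q \<noteq> (\<lambda>_ _. 0)}"
    by (rule finite_subset[of _ "{1}"]) (auto simp: d)
  ultimately show a: "alt_form B \<Omega>" by (intro Lambda_alt_form) (simp add: Lambda_def)
  show "(\<lambda>Z. \<Omega> [Z]) \<in> ann"
    using alt_form_slot[OF a, of "[]" "[]"] S unfolding ann_def by simp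
qed

text \<open>A form of degree \<open>q\<close> vanishing as soon as \<open>Suc m\<close> of its arguments are in \<open>E\<close> is, up to a form
  vanishing already for \<open>m\<close> such arguments, an eigenvector with eigenvalue \<open>q - m\<close> of the derivation
  \<open>\<Sum>a. \<Omega> a \<and> contract 1 (c a)\<close> extending the projection \<open>\<Sum>a. \<Omega> a \<otimes> c a\<close> along \<open>E\<close>.\<close>

lemma vanishing_in_ideal:
  assumes I: "is_ideal B I" "annihilator_sections B E \<subseteq> I"
    and \<omega>: "alt_form B \<omega>" "\<And>Zs. length Zs \<noteq> q \<Longrightarrow> \<omega> Zs = (\<lambda>_. 0)"
    and m: "m \<le> q" "\<And>Zs. set Zs \<subseteq> sections B \<Longrightarrow> length Zs = q \<Longrightarrow> m \<le> card {i. i < q \<and> Zs ! i \<in> sections E} \<Longrightarrow> \<omega> Zs = (\<lambda>_. 0)"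
  shows "\<omega> \<in> I"
  using \<omega> m
proof (induction m arbitrary: \<omega>)
  case 0
  have "\<omega> Zs = (\<lambda>_. 0)" for Zs
    using 0(2)[of Zs] 0(4)[of Zs] alt_formD(2)[OF 0(1), of Zs] by (cases "set Zs \<subseteq> sections B"; cases "length Zs = q") simp_all
  then have "\<omega> = (\<lambda>_ _. 0)" by blast
  then show ?case using I(1) unfolding is_ideal_def by simp
next
  case (Suc m)
  note alt = Suc.prems(1)
  obtain A :: "('e \<times> 'w \<times> real) set" and \<Omega> c where R: "finite A" "\<And>a. a \<in> A \<Longrightarrow> \<Omega> a \<in> ann" "\<And>a. a \<in> A \<Longrightarrow> c a \<in> sections B"
    "\<And>Z. Z \<in> sections B \<Longrightarrow> \<exists>R\<in>sections E. Z = sec_add B R (sec_sum B A (\<lambda>a. sec_mult B (\<Omega> a Z) (c a)))"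
    by (rule finite_resolution) (rule that)
  have \<Omega>L: "\<Omega> a \<in> lin_forms B" if "a \<in> A" for a using R(2)[OF that] unfolding ann_def by blast
  \<comment> \<open>The inverse of the eigenvalue q - m, which is not 0 because Suc m \<le>
    q.\<close>
  define r where "r = 1 / (real q - real m)"
  define \<Delta> where "\<Delta> Zs p = (\<Sum>a\<in>A. wedge (one_form (\<Omega> a)) (contract r (c a) \<omega>) Zs p)" for Zs p
  have \<Delta>I: "\<Delta> \<in> I"
    unfolding \<Delta>_def[abs_def]
  proof (rule ideal_sum[OF I(1) R(1)])
    fix a assume a: "a \<in> A"
    have "one_form (\<Omega> a) \<in> I" using one_form_ann[OF R(2)[OF a]] I(2) by blast
    moreover have "contract r (c a) \<omega> \<in> Lambda B"
      by (rule alt_form_Lambda[OF alt_form_contract[OF alt R(3)[OF a]]])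
    ultimately show "wedge (one_form (\<Omega> a)) (contract r (c a) \<omega>) \<in> I"
      using I(1) unfolding is_ideal_def by blast
  qed
  \<comment> \<open>Moving \<open>c a\<close> from the front into slot i cancels the sign of the
    product. What remains is the derivation that replaces one argument after another by its
    projection \<Sum>a \<Omega> a (Z) c a.\<close>
  have \<Delta>f: "\<Delta> Zs p = r * (\<Sum>i<length Zs. \<Sum>a\<in>A. \<Omega> a (Zs ! i) p * \<omega> (take i Zs @ c a # drop (Suc i) Zs) p)"
    if Zs: "set Zs \<subseteq> sections B" for Zs p
  proof -
    have "\<Delta> Zs p = (\<Sum>a\<in>A. \<Sum>i<length Zs. r * (\<Omega> a (Zs ! i) p * \<omega> (take i Zs @ c a # drop (Suc i) Zs) p))"
      unfolding \<Delta>_def wedge_one_form[OF Zs] contract_def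
    proof (intro sum.cong refl)
      fix a i assume a: "a \<in> A" and i: "i \<in> {..<length Zs}"
      have "set (take i Zs) \<subseteq> sections B" "set (drop (Suc i) Zs) \<subseteq> sections B"
        by (rule subset_trans[OF set_take_subset Zs], rule subset_trans[OF set_drop_subset Zs])
      from alt_form_move_front[OF alt R(3)[OF a] this, of p] i
      have "\<omega> (take i Zs @ c a # drop (Suc i) Zs) p = (-1) ^ i * \<omega> (c a # nths Zs (- {i})) p"
        by (simp add: nths_minus_single min_def)
      then show "(-1) ^ i * \<Omega> a (Zs ! i) p * (r * \<omega> (c a # nths Zs (- {i})) p) =
          r * (\<Omega> a (Zs ! i) p * \<omega> (take i Zs @ c a # drop (Suc i) Zs) p)" by simp
    qed
    also have "\<dots> = (\<Sum>i<length Zs. \<Sum>a\<in>A. r * (\<Omega> a (Zs ! i) p * \<omega> (take i Zs @ c a # drop (Suc i) Zs) p))"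
      by (rule sum.swap)
    finally show ?thesis by (simp add: sum_distrib_left)
  qed
  define \<omega>' where "\<omega>' Zs p = \<omega> Zs p + (-1) * \<Delta> Zs p" for Zs p
  have "\<omega>' \<in> I"
  proof (rule Suc.IH)
    show "m \<le> q" using Suc.prems(3) by simp
    show alt': "alt_form B \<omega>'"
      unfolding \<omega>'_def[abs_def] by (rule alt_form_comb[OF alt ideal_alt_form[OF I(1) \<Delta>I]])
    show "\<omega>' Zs = (\<lambda>_. 0)" if L: "length Zs \<noteq> q" for Zs
    proof (cases "set Zs \<subseteq> sections B")
      case True
      have "\<omega> (take i Zs @ x # drop (Suc i) Zs) = (\<lambda>_. 0)" if "i < length Zs" for i x
        by (rule Suc.prems(2)) (use L that in auto)
      then have "\<Delta> Zs p = 0" for p by (simp add: \<Delta>f[OF True])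
      then show ?thesis using Suc.prems(2)[OF L] by (simp add: \<omega>'_def fun_eq_iff)
    qed (simp add: alt_formD(2)[OF alt'])
    show "\<omega>' Zs = (\<lambda>_. 0)" if Zs: "set Zs \<subseteq> sections B" and L: "length Zs = q"
      and C: "m \<le> card {i. i < q \<and> Zs ! i \<in> sections E}" for Zs
    proof
      fix p
      let ?S = "{i. i < q \<and> Zs ! i \<in> sections E}"
      \<comment> \<open>The projection of an argument in E is 0. Any other argument differs from its
        projection by a section Y of E; with Y in slot i at least Suc m arguments lie in E and
        \<omega> vanishes, so passing to the projection does not change \<omega>.\<close>
      have summand: "(\<Sum>a\<in>A. \<Omega> a (Zs ! i) p * \<omega> (take i Zs @ c a # drop (Suc i) Zs) p) =
          (if i \<in> ?S then 0 else \<omega> Zs p)" if i: "i < q" for i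
      proof (cases "i \<in> ?S")
        case True
        have "\<Omega> a (Zs ! i) p = 0" if "a \<in> A" for a using R(2)[OF that] True unfolding ann_def by blast
        then show ?thesis using True by simp
      next
        case False
        let ?L = "\<lambda>X. \<omega> (take i Zs @ X # drop (Suc i) Zs)"
        have sub: "set (take i Zs) \<subseteq> sections B" "set (drop (Suc i) Zs) \<subseteq> sections B"
          by (rule subset_trans[OF set_take_subset Zs], rule subset_trans[OF set_drop_subset Zs])
        have L': "?L \<in> lin_forms B" by (rule alt_form_slot[OF alt sub])
        have Zi: "Zs ! i \<in> sections B" using Zs nth_mem[of i Zs] i L by auto
        obtain Y where Y: "Y \<in> sections E" "Zs ! i = sec_add B Y (sec_sum B A (\<lambda>a. sec_mult B (\<Omega> a (Zs ! i)) (c a)))"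
          using R(4)[OF Zi] by blast
        have sm: "sec_mult B (\<Omega> a (Zs ! i)) (c a) \<in> sections B" if "a \<in> A" for a
          by (rule sec_mult_mem[OF R(3)[OF that] lin_formsD(1)[OF \<Omega>L[OF that] Zi]])
        have "?L (Zs ! i) p = ?L Y p + ?L (sec_sum B A (\<lambda>a. sec_mult B (\<Omega> a (Zs ! i)) (c a))) p"
          by (subst Y(2)) (rule lin_formsD(2)[OF L' sections_E[OF Y(1)] sec_sum_mem[OF R(1) sm]])
        also have "?L (sec_sum B A (\<lambda>a. sec_mult B (\<Omega> a (Zs ! i)) (c a))) p = (\<Sum>a\<in>A. ?L (sec_mult B (\<Omega> a (Zs ! i)) (c a)) p)"
          by (rule lin_form_sum[OF L' R(1) sm])
        also have "\<dots> = (\<Sum>a\<in>A. \<Omega> a (Zs ! i) p * ?L (c a) p)"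
          by (rule sum.cong[OF refl]) (use lin_formsD(3)[OF L' R(3) lin_formsD(1)[OF \<Omega>L Zi]] in simp)
        also have "?L (Zs ! i) = \<omega> Zs" using i L by (simp add: id_take_nth_drop[symmetric])
        also have "?L Y = (\<lambda>_. 0)"
        proof (rule Suc.prems(4))
          let ?Ys = "take i Zs @ Y # drop (Suc i) Zs"
          have eq: "?Ys = Zs[i := Y]" using i L by (simp add: upd_conv_take_nth_drop)
          show "set ?Ys \<subseteq> sections B" using sub sections_E[OF Y(1)] by simp
          show "length ?Ys = q" using i L by simp
          have "insert i ?S \<subseteq> {j. j < q \<and> ?Ys ! j \<in> sections E}"
            unfolding eq using i L Y(1) by (auto simp: nth_list_update)
          then have "card (insert i ?S) \<le> card {j. j < q \<and> ?Ys ! j \<in> sections E}"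
            by (intro card_mono) auto
          moreover have "card (insert i ?S) = Suc (card ?S)" using False by simp
          ultimately show "Suc m \<le> card {j. j < q \<and> ?Ys ! j \<in> sections E}" using C by linarith
        qed
        finally show ?thesis unfolding if_not_P[OF False] by simp
      qed
      have "\<Delta> Zs p = r * (\<Sum>i<q. if i \<in> ?S then 0 else \<omega> Zs p)"
        unfolding \<Delta>f[OF Zs] L by (intro arg_cong2[where f = "(*)"] refl sum.cong) (use summand in auto)
      also have "(\<Sum>i<q. if i \<in> ?S then 0 else \<omega> Zs p) = (\<Sum>i\<in>{..<q} - ?S. \<omega> Zs p)"
        by (rule sum.mono_neutral_cong_right) auto
      also have "\<dots> = (real q - real (card ?S)) * \<omega> Zs p"
      proof -
        have "card ({..<q} - ?S) = q - card ?S" by (subst card_Diff_subset) auto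
        moreover have "card ?S \<le> q" using card_mono[of "{..<q}" ?S] by auto
        ultimately show ?thesis by (simp add: of_nat_diff)
      qed
      finally have d: "\<Delta> Zs p = r * ((real q - real (card ?S)) * \<omega> Zs p)" .
      show "\<omega>' Zs p = 0"
      \<comment> \<open>With exactly m arguments in E there remain q - m others, and \<Delta>
        reproduces \<omega>; with more of them in E, \<omega> vanishes, and \<Delta> with
        it.\<close>
      proof (cases "card ?S = m")
        case True
        have "real q - real m \<noteq> 0" using Suc.prems(3) by simp
        then show ?thesis unfolding \<omega>'_def d True r_def by simp
      next
        case False
        then have "\<omega> Zs = (\<lambda>_. 0)" using C L Zs by (intro Suc.prems(4)) auto
        then show ?thesis unfolding \<omega>'_def d by simp
      qed
    qed
  qed
  then have "form_add \<omega>' \<Delta> \<in> I" using \<Delta>I I(1) unfolding is_ideal_def by blast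
  moreover have "form_add \<omega>' \<Delta> = \<omega>" by (simp add: form_add_def \<omega>'_def[abs_def])
  ultimately show ?case by simp
qed

text \<open>The empty tuple counts as a tuple of sections of E, so these forms have no component of
  degree 0, in accordance with an ideal generated in degree 1.\<close>

definition vanishing_forms :: "('m, 'f) form set" where
  "vanishing_forms = {\<omega>. alt_form B \<omega> \<and> (\<forall>us. set us \<subseteq> sections E \<longrightarrow> \<omega> us = (\<lambda>_. 0))}"

lemma vanishing_forms_ideal: "is_ideal B vanishing_forms"
  unfolding is_ideal_def
proof (intro conjI ballI)
  show "vanishing_forms \<subseteq> Lambda B" unfolding vanishing_forms_def using alt_form_Lambda by blast
  show "(\<lambda>_ _. 0) \<in> vanishing_forms" unfolding vanishing_forms_def using alt_form_zero by simp
  fix \<omega> assume "\<omega> \<in> vanishing_forms"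
  then have \<omega>: "alt_form B \<omega>" "\<And>us. set us \<subseteq> sections E \<Longrightarrow> \<omega> us = (\<lambda>_. 0)" unfolding vanishing_forms_def by auto
  show "form_add \<omega> \<theta> \<in> vanishing_forms" if "\<theta> \<in> vanishing_forms" for \<theta>
    using that \<omega> alt_form_comb[OF \<omega>(1), of \<theta> 1] unfolding vanishing_forms_def by (simp add: form_add_def)
  have sub: "set (nths us I) \<subseteq> sections E" if "set us \<subseteq> sections E" for us I
    using that set_nths_subset[of us I] by blast
  show "wedge \<theta> \<omega> \<in> vanishing_forms" "wedge \<omega> \<theta> \<in> vanishing_forms" if "\<theta> \<in> Lambda B" for \<theta>
    using alt_form_wedge[OF \<omega>(1) Lambda_alt_form[OF that]] alt_form_wedge[OF Lambda_alt_form[OF that] \<omega>(1)]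
    unfolding vanishing_forms_def by (auto simp: wedge_def \<omega>(2)[OF sub])
qed

text \<open>The descent on the number of arguments in E treats one degree at a time, so a vanishing
  form is split into its finitely many components. The component of degree q vanishes once all q
  arguments are in E, and this is where the descent starts.\<close>

lemma ideal_generated_annihilator: "ideal_generated B (annihilator_sections B E) = vanishing_forms"
proof
  have "annihilator_sections B E \<subseteq> vanishing_forms"
  proof
    fix \<Omega> assume \<Omega>: "\<Omega> \<in> annihilator_sections B E"
    have "\<Omega> us = (\<lambda>_. 0)" if "set us \<subseteq> sections E" for us
    proof (cases "length us = 1")
      case True
      then obtain S where "us = [S]" by (cases us) auto
      then show ?thesis using \<Omega> that unfolding annihilator_sections_def by simp
    next
      case False
      then show ?thesis using \<Omega> unfolding annihilator_sections_def Lambda_deg_def by simp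
    qed
    then show "\<Omega> \<in> vanishing_forms" unfolding vanishing_forms_def using annihilator_ann(1)[OF \<Omega>] by blast
  qed
  then show "ideal_generated B (annihilator_sections B E) \<subseteq> vanishing_forms"
    unfolding ideal_generated_def using vanishing_forms_ideal by blast
  show "vanishing_forms \<subseteq> ideal_generated B (annihilator_sections B E)"
    unfolding ideal_generated_def
  proof (intro subsetI InterI)
    fix \<omega> I assume "\<omega> \<in> vanishing_forms" and "I \<in> {I. is_ideal B I \<and> annihilator_sections B E \<subseteq> I}"
    then have \<omega>: "alt_form B \<omega>" "\<And>us. set us \<subseteq> sections E \<Longrightarrow> \<omega> us = (\<lambda>_. 0)"
      and I: "is_ideal B I" "annihilator_sections B E \<subseteq> I"
      unfolding vanishing_forms_def by auto
    obtain n where n: "\<And>Zs. length Zs > n \<Longrightarrow> \<omega> Zs = (\<lambda>_. 0)" using alt_formD(1)[OF \<omega>(1)] by blast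
    have deg: "deg_component \<omega> q \<in> I" for q
    proof (rule vanishing_in_ideal[OF I alt_form_deg[OF \<omega>(1)], where q = q and m = q])
      show "deg_component \<omega> q Zs = (\<lambda>_. 0)" if "length Zs \<noteq> q" for Zs using that by (simp add: deg_component_def)
      fix Zs assume Zs: "length Zs = q" "q \<le> card {i. i < q \<and> Zs ! i \<in> sections E}"
      have eq: "{i. i < q \<and> Zs ! i \<in> sections E} = {..<q}"
        by (rule card_subset_eq) (use Zs card_mono[of "{..<q}" "{i. i < q \<and> Zs ! i \<in> sections E}"] in auto)
      have "set Zs \<subseteq> sections E"
      proof
        fix x assume "x \<in> set Zs"
        then obtain i where i: "i < length Zs" "Zs ! i = x" unfolding in_set_conv_nth by (elim exE conjE)
        then have "i \<in> {..<q}" using Zs(1) by simp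
        then show "x \<in> sections E" unfolding eq[symmetric] using i(2) by simp
      qed
      then show "deg_component \<omega> q Zs = (\<lambda>_. 0)" using \<omega>(2) by (simp add: deg_component_def)
    qed simp
    have "(\<lambda>Zs p. \<Sum>q\<in>{..n}. deg_component \<omega> q Zs p) \<in> I" by (rule ideal_sum[OF I(1)]) (use deg in auto)
    moreover have "(\<Sum>q\<in>{..n}. deg_component \<omega> q Zs p) = \<omega> Zs p" for Zs p
    proof (cases "length Zs \<le> n")
      case True
      have "(\<Sum>q\<in>{..n}. deg_component \<omega> q Zs p) = (\<Sum>q\<in>{..n}. if q = length Zs then \<omega> Zs p else 0)"
        by (rule sum.cong) (auto simp: deg_component_def)
      then show ?thesis using True by simp
    next
      case False
      then show ?thesis using n[of Zs] by (auto simp: deg_component_def intro!: sum.neutral)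
    qed
    ultimately show "\<omega> \<in> I" by simp
  qed
qed

end

section \<open>The exterior differential\<close>

text \<open>Anchor and bracket enter through identities for \<open>Der Z f\<close>, the derivative
  of f along the anchor of Z. The anchor of the pull-back at a point reads Z at a displaced point;
  \<sigma> records this displacement in the rule for multiples of sections.\<close>

locale algebroid = vb B for B :: "('m::{t2_space, second_countable_topology}, 'e::euclidean_space, 'f, 'w::euclidean_space) vbundle" +
  fixes Der :: "('m \<Rightarrow> 'f) \<Rightarrow> ('m \<Rightarrow> real) \<Rightarrow> 'm \<Rightarrow> real"
    and brk :: "('m \<Rightarrow> 'f) \<Rightarrow> ('m \<Rightarrow> 'f) \<Rightarrow> 'm \<Rightarrow> 'f"
    and \<sigma> :: "'m \<Rightarrow> 'm"
  assumes der_smooth: "Z \<in> sections B \<Longrightarrow> (\<And>q. smooth_at (base B) q f) \<Longrightarrow> smooth_at (base B) p (Der Z f)"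
    and der_add: "Z \<in> sections B \<Longrightarrow> (\<And>q. smooth_at (base B) q f) \<Longrightarrow> (\<And>q. smooth_at (base B) q g) \<Longrightarrow>
      Der Z (\<lambda>q. f q + g q) p = Der Z f p + Der Z g p"
    and der_mult: "Z \<in> sections B \<Longrightarrow> (\<And>q. smooth_at (base B) q f) \<Longrightarrow> (\<And>q. smooth_at (base B) q g) \<Longrightarrow>
      Der Z (\<lambda>q. f q * g q) p = f p * Der Z g p + Der Z f p * g p"
    and der_const: "Z \<in> sections B \<Longrightarrow> Der Z (\<lambda>_. a) p = 0"
    and der_field_add: "X \<in> sections B \<Longrightarrow> Y \<in> sections B \<Longrightarrow> (\<And>q. smooth_at (base B) q f) \<Longrightarrow>
      Der (sec_add B X Y) f p = Der X f p + Der Y f p"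
    and der_field_mult_twisted: "X \<in> sections B \<Longrightarrow> (\<And>q. smooth_at (base B) q g) \<Longrightarrow> (\<And>q. smooth_at (base B) q f) \<Longrightarrow>
      Der (sec_mult B g X) f p = g (\<sigma> p) * Der X f p"
    and brk_mem: "X \<in> sections B \<Longrightarrow> Y \<in> sections B \<Longrightarrow> brk X Y \<in> sections B"
    and brk_add: "X \<in> sections B \<Longrightarrow> Y \<in> sections B \<Longrightarrow> Z \<in> sections B \<Longrightarrow>
      brk X (sec_add B Y Z) = sec_add B (brk X Y) (brk X Z)"
    and brk_anti: "X \<in> sections B \<Longrightarrow> Y \<in> sections B \<Longrightarrow> brk Y X = sec_mult B (\<lambda>_. -1) (brk X Y)"
    and brk_leibniz: "X \<in> sections B \<Longrightarrow> Y \<in> sections B \<Longrightarrow> (\<And>q. smooth_at (base B) q f) \<Longrightarrow>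
      brk X (sec_mult B f Y) = sec_add B (sec_mult B f (brk X Y)) (sec_mult B (Der X f) Y)"
begin

lemma der_cmult: "Z \<in> sections B \<Longrightarrow> (\<And>q. smooth_at (base B) q f) \<Longrightarrow> Der Z (\<lambda>q. a * f q) p = a * Der Z f p"
  using der_mult[of Z "\<lambda>_. a" f p, OF _ smooth_at_const[OF base_manifold]] der_const[of Z a p] by simp

lemma der_minus: "Z \<in> sections B \<Longrightarrow> (\<And>q. smooth_at (base B) q f) \<Longrightarrow> Der Z (\<lambda>q. - f q) p = - Der Z f p"
  using der_cmult[of Z f "-1" p] by simp

text \<open>For a bump function \<kappa> supported in \<open>U\<close> the product \<kappa> f is
  identically 0. The product rule at \<open>p\<close>, where \<kappa> = 1 and f = 0, then leaves
  only the derivative of f.\<close>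

lemma der_local_zero:
  assumes Z: "Z \<in> sections B" and f: "\<And>q. smooth_at (base B) q f" and U: "open U" "p \<in> U" "\<And>q. q \<in> U \<Longrightarrow> f q = 0"
  shows "Der Z f p = 0"
proof -
  obtain \<kappa> :: "'m \<Rightarrow> real" and V K where \<kappa>: "\<And>q. smooth_at (base B) q \<kappa>" "open V" "p \<in> V"
    "\<And>q. q \<in> V \<Longrightarrow> \<kappa> q = 1" "V \<subseteq> K" "closed K" "K \<subseteq> U" "\<And>q. q \<notin> K \<Longrightarrow> \<kappa> q = 0"
    by (rule smooth_bump[OF base_manifold U(1,2)]) (rule that)
  have "\<kappa> q * f q = 0" for q using U(3)[of q] \<kappa>(7) \<kappa>(8)[of q] by (cases "q \<in> K") auto
  then have "(\<lambda>q. \<kappa> q * f q) = (\<lambda>_. 0)" by blast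
  then have "Der Z (\<lambda>q. \<kappa> q * f q) p = 0" using der_const[OF Z, of 0 p] by simp
  then show ?thesis
    using der_mult[OF Z \<kappa>(1) f, of p] \<kappa>(3,4) U(2,3) by simp
qed

text \<open>At a point with \<open>\<sigma> p \<noteq> p\<close> the anchor vanishes: take \<open>\<kappa>\<close> equal to \<open>1\<close> at \<open>\<sigma> p\<close> and to \<open>0\<close> near
  \<open>p\<close>, and expand \<open>[\<kappa> v, f u]\<close> at \<open>p\<close> by the Leibniz rule in either argument.\<close>

lemma der_eq_0_moved:
  assumes v: "v \<in> sections B" and f: "\<And>q. smooth_at (base B) q f" and p: "\<sigma> p \<noteq> p"
  shows "Der v f p = 0"
proof -
  have U: "open (- {p})" "\<sigma> p \<in> - {p}" using p by auto
  obtain \<kappa> :: "'m \<Rightarrow> real" and V K where \<kappa>: "\<And>q. smooth_at (base B) q \<kappa>" "open V" "\<sigma> p \<in> V"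
    "\<And>q. q \<in> V \<Longrightarrow> \<kappa> q = 1" "V \<subseteq> K" "closed K" "K \<subseteq> - {p}" "\<And>q. q \<notin> K \<Longrightarrow> \<kappa> q = 0"
    by (rule smooth_bump[OF base_manifold U]) (rule that)
  have K: "open (- K)" "p \<in> - K" using \<kappa>(6,7) by auto
  have \<kappa>0: "\<kappa> p = 0" using \<kappa>(8) K by simp
  have D\<kappa>: "Der Z \<kappa> p = 0" if "Z \<in> sections B" for Z
    by (rule der_local_zero[OF that \<kappa>(1) K]) (use \<kappa>(8) in simp)
  have \<kappa>v: "sec_mult B \<kappa> v \<in> sections B" by (rule sec_mult_mem[OF v \<kappa>(1)])
  \<comment> \<open>The twisted rule evaluates \<kappa> at \<open>\<sigma> p\<close>, where it is 1:
    the section \<kappa> v vanishes near \<open>p\<close>, yet its anchor at \<open>p\<close> is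
    that of v.\<close>
  have Dv: "Der (sec_mult B \<kappa> v) f p = Der v f p"
    using der_field_mult_twisted[OF v \<kappa>(1) f] \<kappa>(3,4) by simp
  have leib: "frep B p (brk X (sec_mult B g Y) p) = g p *\<^sub>R frep B p (brk X Y p) + Der X g p *\<^sub>R frep B p (Y p)"
    if "X \<in> sections B" "Y \<in> sections B" "\<And>q. smooth_at (base B) q g" for X Y g
    unfolding brk_leibniz[OF that]
    using that by (simp add: frep_sec_add frep_sec_mult sec_mult_mem brk_mem der_smooth)
  have anti: "frep B p (brk Y X p) = - frep B p (brk X Y p)" if "X \<in> sections B" "Y \<in> sections B" for X Y
    unfolding brk_anti[OF that] by (simp add: frep_sec_mult brk_mem that)
  \<comment> \<open>By antisymmetry \<kappa> v may stand in the second argument, where the Leibniz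
    rule involves only the value and the derivatives of \<kappa> at \<open>p\<close>, all 0.\<close>
  have van: "frep B p (brk (sec_mult B \<kappa> v) X p) = 0" if X: "X \<in> sections B" for X
    unfolding anti[OF X \<kappa>v] leib[OF X v \<kappa>(1)] by (simp add: \<kappa>0 D\<kappa>[OF X])
  have eq: "Der v f p *\<^sub>R frep B p (u p) = 0" if u: "u \<in> sections B" for u
    using leib[OF \<kappa>v u f] van[OF u] van[OF sec_mult_mem[OF u f]] Dv by simp
  show ?thesis
  proof (rule ccontr)
    assume nz: "Der v f p \<noteq> 0"
    have zero: "w = 0" if w: "w \<in> typical B" for w
    proof -
      obtain u where u: "u \<in> sections B" "u p = inv_into (fibre B p) (frep B p) w"
        using section_through[OF frep_inv(1)[OF w]] .
      then have "frep B p (u p) = w" using frep_inv(2)[OF w] by simp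
      then show ?thesis using eq[OF u(1)] nz by simp
    qed
    \<comment> \<open>Only the case of rank 0 is left, where no section u can bring about the
      contradiction. There v = 0 v, and the twisted rule with the constant function 0 removes the
      anchor of v.\<close>
    have "v = sec_mult B (\<lambda>_. 0) v"
    proof (rule section_eqI[OF v sec_mult_mem[OF v smooth_at_const[OF base_manifold]]])
      fix x show "frep B x (v x) = frep B x (sec_mult B (\<lambda>_. 0) v x)"
        using zero[OF frep_mem[OF section_fibre[OF v]]] by (simp add: frep_sec_mult v)
    qed
    then have "Der v f p = 0"
      using der_field_mult_twisted[OF v smooth_at_const[OF base_manifold] f, of 0 p] by simp
    then show False using nz by simp
  qed
qed

text \<open>At a fixed point of \<sigma> the twisted rule is the ordinary one; at all other points
  both sides are 0.\<close>

lemma der_field_mult: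
  assumes "X \<in> sections B" "\<And>q. smooth_at (base B) q g" "\<And>q. smooth_at (base B) q f"
  shows "Der (sec_mult B g X) f p = g p * Der X f p"
  using der_field_mult_twisted[OF assms, of p] der_eq_0_moved[OF assms(1,3), of p] by (cases "\<sigma> p = p") auto

definition ext_d :: "('m, 'f) form \<Rightarrow> ('m, 'f) form" where
  "ext_d \<omega> = (\<lambda>Zs p.
     if set Zs \<subseteq> sections B then
       (\<Sum>i<length Zs. (-1) ^ i * Der (Zs ! i) (\<omega> (nths Zs (- {i}))) p) +
       (\<Sum>j<length Zs. \<Sum>i<j. (-1) ^ (i + j) * \<omega> (brk (Zs ! i) (Zs ! j) # nths Zs (- {i, j})) p)
     else 0)"

lemma nths_Cons_minus:
  "nths (X # Ws) (- {0}) = Ws" "nths (X # Ws) (- {Suc l}) = X # nths Ws (- {l})"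
  "nths (X # Ws) (- {0, Suc m}) = nths Ws (- {m})" "nths (X # Ws) (- {Suc l, Suc m}) = X # nths Ws (- {l, m})"
proof -
  have "{j. Suc j \<in> - {Suc l}} = - {l}" "{j. Suc j \<in> - {0, Suc m}} = - {m}" "{j. Suc j \<in> - {Suc l, Suc m}} = - {l, m}"
    by auto
  then show "nths (X # Ws) (- {0}) = Ws" "nths (X # Ws) (- {Suc l}) = X # nths Ws (- {l})"
    "nths (X # Ws) (- {0, Suc m}) = nths Ws (- {m})" "nths (X # Ws) (- {Suc l, Suc m}) = X # nths Ws (- {l, m})"
    by (simp_all add: nths_Cons nths_all)
qed

text \<open>Linearity in the first slot is read off from this form. The derivative and the bracket
  with the same index are kept together because their non-tensorial parts cancel each other.\<close>

lemma ext_d_Cons: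
  assumes "X \<in> sections B" "set Ws \<subseteq> sections B"
  shows "ext_d \<omega> (X # Ws) p = Der X (\<omega> Ws) p +
    (\<Sum>l<length Ws. (-1) ^ Suc l * (Der (Ws ! l) (\<omega> (X # nths Ws (- {l}))) p + \<omega> (brk X (Ws ! l) # nths Ws (- {l})) p)) +
    (\<Sum>m<length Ws. \<Sum>l<m. (-1) ^ (l + m) * \<omega> (brk (Ws ! l) (Ws ! m) # X # nths Ws (- {l, m})) p)"
proof -
  have e: "ext_d \<omega> (X # Ws) p =
      (\<Sum>i<Suc (length Ws). (-1) ^ i * Der ((X # Ws) ! i) (\<omega> (nths (X # Ws) (- {i}))) p) +
      (\<Sum>j<Suc (length Ws). \<Sum>i<j. (-1) ^ (i + j) * \<omega> (brk ((X # Ws) ! i) ((X # Ws) ! j) # nths (X # Ws) (- {i, j})) p)"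
    unfolding ext_d_def length_Cons using assms by (simp only: set_simps insert_subset simp_thms if_True)
  have 1: "(\<Sum>i<Suc (length Ws). (-1) ^ i * Der ((X # Ws) ! i) (\<omega> (nths (X # Ws) (- {i}))) p) =
      Der X (\<omega> Ws) p + (\<Sum>l<length Ws. (-1) ^ Suc l * Der (Ws ! l) (\<omega> (X # nths Ws (- {l}))) p)"
    by (subst sum.lessThan_Suc_shift) (simp add: nths_Cons_minus)
  have 2: "(\<Sum>j<Suc (length Ws). \<Sum>i<j. (-1) ^ (i + j) * \<omega> (brk ((X # Ws) ! i) ((X # Ws) ! j) # nths (X # Ws) (- {i, j})) p) =
      (\<Sum>m<length Ws. (-1) ^ Suc m * \<omega> (brk X (Ws ! m) # nths Ws (- {m})) p +
        (\<Sum>l<m. (-1) ^ (l + m) * \<omega> (brk (Ws ! l) (Ws ! m) # X # nths Ws (- {l, m})) p))"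
    apply (subst sum.lessThan_Suc_shift)
    apply (subst sum.lessThan_Suc_shift)
    apply (simp add: nths_Cons_minus)
    done
  show ?thesis
    unfolding e 1 2 by (simp add: sum.distrib distrib_left sum_subtractf sum_negf)
qed

text \<open>Multiplying X by f, the derivative along W of \<omega>(f X, ...) contributes (W f)
  \<omega>(X, ...), and the bracket [f X, W] contributes the same with the opposite sign; the
  derivative along f X itself is covered by the untwisted rule. For antisymmetry both sums are
  reindexed by the adjacent transposition.\<close>

lemma alt_form_ext_d:
  assumes \<omega>: "alt_form B \<omega>" shows "alt_form B (ext_d \<omega>)"
proof -
  obtain q where q: "\<And>Zs. length Zs > q \<Longrightarrow> \<omega> Zs = (\<lambda>_. 0)" using alt_formD(1)[OF \<omega>] by blast
  have sub: "set (nths Zs I) \<subseteq> sections B" if "set Zs \<subseteq> sections B" for Zs I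
    using that set_nths_subset[of Zs I] by blast
  have mem: "Zs ! i \<in> sections B" if "set Zs \<subseteq> sections B" "i < length Zs" for Zs i
    using that nth_mem by blast
  have sm: "smooth_at (base B) p (\<omega> Zs)" if "set Zs \<subseteq> sections B" for Zs p
    by (rule alt_formD(3)[OF \<omega> that])
  have smC: "smooth_at (base B) p (\<omega> (X # nths Zs I))" if "X \<in> sections B" "set Zs \<subseteq> sections B" for X Zs I p
    by (rule sm) (use that sub in auto)
  have neg1: "\<omega> (brk Y X # Zs) p = - \<omega> (brk X Y # Zs) p"
    if "X \<in> sections B" "Y \<in> sections B" "set Zs \<subseteq> sections B" for X Y Zs p
    unfolding brk_anti[OF that(1,2)]
    using alt_formD(5)[OF \<omega> brk_mem[OF that(1,2)] smooth_at_const[OF base_manifold] that(3)] by simp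
  have sw: "\<omega> (b # X # Zs) p = - \<omega> (X # b # Zs) p" if "X \<in> sections B" "b \<in> sections B" "set Zs \<subseteq> sections B" for X b Zs p
    using alt_formD(6)[OF \<omega> that(1,2), of "[]" Zs p] that by simp
  show ?thesis
  proof (rule alt_formI[of "Suc q"])
    fix Zs :: "('m \<Rightarrow> 'f) list" assume L: "length Zs > Suc q"
    show "ext_d \<omega> Zs = (\<lambda>_. 0)"
    proof (cases "set Zs \<subseteq> sections B")
      case True
      have 1: "\<omega> (nths Zs (- {i})) = (\<lambda>_. 0)" if "i < length Zs" for i
        by (rule q) (use L that in \<open>simp add: nths_minus_single\<close>)
      have 2: "\<omega> (X # nths Zs (- {i, j})) = (\<lambda>_. 0)" for X i j
      proof (rule q)
        have "card {k. k < length Zs \<and> k \<in> {i, j}} \<le> card {i, j}" by (rule card_mono) auto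
        also have "\<dots> \<le> 2" by (simp add: card_insert_if)
        finally have "length (nths Zs {i, j}) \<le> 2" by (simp add: length_nths)
        then show "q < length (X # nths Zs (- {i, j}))"
          using length_nths_add[of Zs "{i, j}"] L by simp
      qed
      show ?thesis
      proof
        fix p
        have "(\<Sum>i<length Zs. (-1) ^ i * Der (Zs ! i) (\<omega> (nths Zs (- {i}))) p) = 0"
          by (rule sum.neutral) (use 1 der_const mem[OF True] in auto)
        then show "ext_d \<omega> Zs p = 0" using 2 by (simp add: ext_d_def)
      qed
    qed (simp add: ext_d_def)
  next
    show "ext_d \<omega> Zs = (\<lambda>_. 0)" if "\<not> set Zs \<subseteq> sections B" for Zs
      using that by (auto simp: ext_d_def)
  next
    fix Zs p assume Zs: "set Zs \<subseteq> sections B"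
    have "smooth_at (base B) p (\<lambda>p.
        (\<Sum>i<length Zs. (-1) ^ i * Der (Zs ! i) (\<omega> (nths Zs (- {i}))) p) +
        (\<Sum>j<length Zs. \<Sum>i<j. (-1) ^ (i + j) * \<omega> (brk (Zs ! i) (Zs ! j) # nths Zs (- {i, j})) p))"
    proof (intro smooth_at_add smooth_at_sum smooth_at_mult smooth_at_const base_manifold)
      show "smooth_at (base B) p (Der (Zs ! i) (\<omega> (nths Zs (- {i}))))" if "i \<in> {..<length Zs}" for i
        by (rule der_smooth[OF mem[OF Zs] sm[OF sub[OF Zs]]]) (use that in simp)
      show "smooth_at (base B) p (\<omega> (brk (Zs ! i) (Zs ! j) # nths Zs (- {i, j})))"
        if "j \<in> {..<length Zs}" "i \<in> {..<j}" for i j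
        by (rule smC[OF brk_mem[OF mem[OF Zs] mem[OF Zs]] Zs]) (use that in auto)
    qed
    then show "smooth_at (base B) p (ext_d \<omega> Zs)" using Zs by (simp add: ext_d_def)
  next
    fix X Y Ws p assume X: "X \<in> sections B" and Y: "Y \<in> sections B" and Ws: "set Ws \<subseteq> sections B"
    note XY = sec_add_mem[OF X Y]
    note m = mem[OF Ws] and s = sub[OF Ws]
    have 1: "Der (Ws ! l) (\<omega> (sec_add B X Y # nths Ws (- {l}))) p =
        Der (Ws ! l) (\<omega> (X # nths Ws (- {l}))) p + Der (Ws ! l) (\<omega> (Y # nths Ws (- {l}))) p" if "l < length Ws" for l
    proof -
      have "\<omega> (sec_add B X Y # nths Ws (- {l})) = (\<lambda>p. \<omega> (X # nths Ws (- {l})) p + \<omega> (Y # nths Ws (- {l})) p)"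
        using alt_formD(4)[OF \<omega> X Y s] by blast
      then show ?thesis using der_add[OF m[OF that] smC[OF X Ws] smC[OF Y Ws]] by simp
    qed
    have 2: "\<omega> (brk (sec_add B X Y) (Ws ! l) # nths Ws (- {l})) p =
        \<omega> (brk X (Ws ! l) # nths Ws (- {l})) p + \<omega> (brk Y (Ws ! l) # nths Ws (- {l})) p" if "l < length Ws" for l
      unfolding neg1[OF m[OF that] XY s] neg1[OF m[OF that] X s] neg1[OF m[OF that] Y s] brk_add[OF m[OF that] X Y]
      by (simp add: alt_formD(4)[OF \<omega> brk_mem[OF m[OF that] X] brk_mem[OF m[OF that] Y] s])
    have 3: "\<omega> (brk (Ws ! l) (Ws ! k) # sec_add B X Y # nths Ws (- {l, k})) p =
        \<omega> (brk (Ws ! l) (Ws ! k) # X # nths Ws (- {l, k})) p + \<omega> (brk (Ws ! l) (Ws ! k) # Y # nths Ws (- {l, k})) p"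
      if "k < length Ws" "l < k" for l k
    proof -
      have b: "brk (Ws ! l) (Ws ! k) \<in> sections B" by (intro brk_mem m) (use that in auto)
      have bs: "set (brk (Ws ! l) (Ws ! k) # nths Ws (- {l, k})) \<subseteq> sections B" using b s by simp
      show ?thesis
        unfolding sw[OF XY b s] sw[OF X b s] sw[OF Y b s] using alt_formD(4)[OF \<omega> X Y bs] by simp
    qed
    show "ext_d \<omega> (sec_add B X Y # Ws) p = ext_d \<omega> (X # Ws) p + ext_d \<omega> (Y # Ws) p"
      unfolding ext_d_Cons[OF XY Ws] ext_d_Cons[OF X Ws] ext_d_Cons[OF Y Ws]
      by (simp add: 1 2 3 der_field_add[OF X Y sm[OF Ws]] distrib_left sum.distrib sum_negf sum_subtractf)
  next
    fix f :: "'m \<Rightarrow> real" and X Ws p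
    assume X: "X \<in> sections B" and f: "\<And>q. smooth_at (base B) q f" and Ws: "set Ws \<subseteq> sections B"
    note fX = sec_mult_mem[OF X f]
    note m = mem[OF Ws] and s = sub[OF Ws]
    have 1: "Der (Ws ! l) (\<omega> (sec_mult B f X # nths Ws (- {l}))) p + \<omega> (brk (sec_mult B f X) (Ws ! l) # nths Ws (- {l})) p =
        f p * (Der (Ws ! l) (\<omega> (X # nths Ws (- {l}))) p + \<omega> (brk X (Ws ! l) # nths Ws (- {l})) p)" if "l < length Ws" for l
    proof -
      note W = m[OF that]
      have "\<omega> (sec_mult B f X # nths Ws (- {l})) = (\<lambda>p. f p * \<omega> (X # nths Ws (- {l})) p)"
        using alt_formD(5)[OF \<omega> X f s] by blast
      then have a: "Der (Ws ! l) (\<omega> (sec_mult B f X # nths Ws (- {l}))) p =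
          f p * Der (Ws ! l) (\<omega> (X # nths Ws (- {l}))) p + Der (Ws ! l) f p * \<omega> (X # nths Ws (- {l})) p"
        using der_mult[OF W f smC[OF X Ws]] by simp
      have "\<omega> (brk (Ws ! l) (sec_mult B f X) # nths Ws (- {l})) p =
          f p * \<omega> (brk (Ws ! l) X # nths Ws (- {l})) p + Der (Ws ! l) f p * \<omega> (X # nths Ws (- {l})) p"
        unfolding brk_leibniz[OF W X f]
        using alt_formD(4)[OF \<omega> sec_mult_mem[OF brk_mem[OF W X] f] sec_mult_mem[OF X der_smooth[OF W f]] s]
          alt_formD(5)[OF \<omega> brk_mem[OF W X] f s] alt_formD(5)[OF \<omega> X der_smooth[OF W f] s] by simp
      then show ?thesis
        unfolding a neg1[OF W fX s] neg1[OF W X s] by (simp add: algebra_simps)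
    qed
    have 3: "\<omega> (brk (Ws ! l) (Ws ! k) # sec_mult B f X # nths Ws (- {l, k})) p =
        f p * \<omega> (brk (Ws ! l) (Ws ! k) # X # nths Ws (- {l, k})) p"
      if "k < length Ws" "l < k" for l k
    proof -
      have b: "brk (Ws ! l) (Ws ! k) \<in> sections B" by (intro brk_mem m) (use that in auto)
      have bs: "set (brk (Ws ! l) (Ws ! k) # nths Ws (- {l, k})) \<subseteq> sections B" using b s by simp
      show ?thesis
        unfolding sw[OF fX b s] sw[OF X b s] using alt_formD(5)[OF \<omega> X f bs] by simp
    qed
    have S1: "(\<Sum>l<length Ws. (-1) ^ Suc l * (Der (Ws ! l) (\<omega> (sec_mult B f X # nths Ws (- {l}))) p +
          \<omega> (brk (sec_mult B f X) (Ws ! l) # nths Ws (- {l})) p)) =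
        f p * (\<Sum>l<length Ws. (-1) ^ Suc l * (Der (Ws ! l) (\<omega> (X # nths Ws (- {l}))) p + \<omega> (brk X (Ws ! l) # nths Ws (- {l})) p))"
      unfolding sum_distrib_left by (rule sum.cong[OF refl]) (subst 1, auto)
    have S2: "(\<Sum>k<length Ws. \<Sum>l<k. (-1) ^ (l + k) * \<omega> (brk (Ws ! l) (Ws ! k) # sec_mult B f X # nths Ws (- {l, k})) p) =
        f p * (\<Sum>k<length Ws. \<Sum>l<k. (-1) ^ (l + k) * \<omega> (brk (Ws ! l) (Ws ! k) # X # nths Ws (- {l, k})) p)"
      unfolding sum_distrib_left by (intro sum.cong refl) (subst 3, auto)
    show "ext_d \<omega> (sec_mult B f X # Ws) p = f p * ext_d \<omega> (X # Ws) p"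
      unfolding ext_d_Cons[OF fX Ws] ext_d_Cons[OF X Ws] S1 S2 der_field_mult[OF X f sm[OF Ws]]
      by (simp add: distrib_left)
  next
    fix X Y us vs p assume *: "X \<in> sections B" "Y \<in> sections B" "set us \<subseteq> sections B" "set vs \<subseteq> sections B"
    let ?a = "length us" and ?n = "Suc (Suc (length us + length vs))"
    let ?\<tau> = "adj_swap (length us)"
    let ?Z = "us @ X # Y # vs" and ?Z' = "us @ Y # X # vs"
    have Z: "set ?Z \<subseteq> sections B" "set ?Z' \<subseteq> sections B" using * by auto
    have nthZ: "?Z' ! ?\<tau> i = ?Z ! i" for i
      by (auto simp: adj_swap_def nth_append nth_Cons split: nat.splits)
    have \<tau>n: "?\<tau> i < ?n \<longleftrightarrow> i < ?n" for i by (rule adj_swap_less) simp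
    have \<tau>C: "- {?\<tau> i} = {k. ?\<tau> k \<in> - {i}}" "- {?\<tau> i, ?\<tau> j} = {k. ?\<tau> k \<in> - {i, j}}" for i j
      by (auto simp: adj_swap_def split: if_splits)
    have both: "\<omega> (ws @ nths ?Z' A) p = - \<omega> (ws @ nths ?Z A) p"
      if A: "?a \<in> A" "Suc ?a \<in> A" and ws: "set ws \<subseteq> sections B" for ws A p
    proof -
      obtain us' vs' where u: "nths ?Z A = us' @ X # Y # vs'" "nths ?Z' A = us' @ Y # X # vs'"
        "set us' \<subseteq> set us" "set vs' \<subseteq> set vs"
        by (rule nths_swap_both[OF A, of X Y vs]) (rule that)
      show ?thesis
        unfolding u(1,2) using alt_formD(6)[OF \<omega> *(1,2), of "ws @ us'" vs' p] u(3,4) *(3,4) ws by auto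
    qed
    have bij: "bij_betw ?\<tau> {..<?n} {..<?n}"
      by (rule bij_betw_byWitness[of _ ?\<tau>]) (use \<tau>n in auto)
    let ?g = "\<lambda>Z i. (-1) ^ i * Der (Z ! i) (\<omega> (nths Z (- {i}))) p"
    have g: "?g ?Z' (?\<tau> i) = - ?g ?Z i" if i: "i < ?n" for i
    proof (cases "i = ?a \<or> i = Suc ?a")
      case True
      have n: "nths ?Z' (- {?\<tau> i}) = nths ?Z (- {i})"
        unfolding \<tau>C by (rule nths_swap) (use True in auto)
      have "(-1 :: real) ^ ?\<tau> i = - ((-1) ^ i)" using True by (auto simp: adj_swap_def)
      then show ?thesis unfolding n nthZ by simp
    next
      case False
      then have \<tau>: "?\<tau> i = i" by (simp add: adj_swap_def)
      have "\<omega> (nths ?Z' (- {i})) = (\<lambda>p. - \<omega> (nths ?Z (- {i})) p)"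
        using both[of "- {i}" "[]"] False by auto
      then have "Der (?Z ! i) (\<omega> (nths ?Z' (- {i}))) p = - Der (?Z ! i) (\<omega> (nths ?Z (- {i}))) p"
        using der_minus[OF mem[OF Z(1)] sm[OF sub[OF Z(1)]], of i] i by simp
      then show ?thesis using nthZ[of i] unfolding \<tau> by simp
    qed
    have "(\<Sum>i<?n. ?g ?Z' i) = (\<Sum>i<?n. ?g ?Z' (?\<tau> i))"
      by (rule sum.reindex_bij_betw[OF bij, symmetric])
    also have "\<dots> = (\<Sum>i<?n. - ?g ?Z i)" by (rule sum.cong[OF refl]) (rule g, simp)
    finally have S1: "(\<Sum>i<?n. ?g ?Z' i) = - (\<Sum>i<?n. ?g ?Z i)" by (simp only: sum_negf)
    let ?P = "Sigma {..<?n} (\<lambda>j. {..<j})"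
    \<comment> \<open>Transposing the two swapped positions themselves would give a pair with i > j,
      so this pair is left fixed; its sign comes from the antisymmetry of the bracket.\<close>
    let ?T = "\<lambda>(j, i). if (j, i) = (Suc ?a, ?a) then (j, i) else (?\<tau> j, ?\<tau> i)"
    let ?h = "\<lambda>Z (j, i). (-1) ^ (i + j) * \<omega> (brk (Z ! i) (Z ! j) # nths Z (- {i, j})) p"
    have TP: "?T x \<in> ?P" and TT: "?T (?T x) = x" and h: "?h ?Z' (?T x) = - ?h ?Z x" if xP: "x \<in> ?P" for x
    proof -
      obtain j i where x: "x = (j, i)" "j < ?n" "i < j" using xP by (cases x) auto
      have i: "i < ?n" using x by simp
      have b: "brk (?Z ! i) (?Z ! j) \<in> sections B"
        by (intro brk_mem mem[OF Z(1)]) (use x i in auto)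
      have "?T x \<in> ?P \<and> ?T (?T x) = x \<and> ?h ?Z' (?T x) = - ?h ?Z x"
      proof (cases "x = (Suc ?a, ?a)")
        case True
        then have ij: "j = Suc ?a" "i = ?a" using x by auto
        have "{k. ?\<tau> k \<in> - {i, j}} = - {i, j}" unfolding ij by (auto simp: adj_swap_def split: if_splits)
        then have n: "nths ?Z' (- {i, j}) = nths ?Z (- {i, j})"
          using nths_swap[of us "- {i, j}" Y X vs] ij by simp
        have "?Z' ! i = ?Z ! j" "?Z' ! j = ?Z ! i" unfolding ij by (simp_all add: nth_append)
        moreover have "\<omega> (brk (?Z ! j) (?Z ! i) # nths ?Z (- {i, j})) p = - \<omega> (brk (?Z ! i) (?Z ! j) # nths ?Z (- {i, j})) p"
          by (rule neg1[OF mem[OF Z(1)] mem[OF Z(1)] sub[OF Z(1)]]) (use x i in auto)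
        ultimately have "?h ?Z' (j, i) = - ?h ?Z (j, i)" by (simp only: prod.case n)
        moreover have "?T x = x" using True by simp
        ultimately show ?thesis using xP x(1) by simp
      next
        case False
        then have Tx: "?T x = (?\<tau> j, ?\<tau> i)" by (auto simp: x(1))
        have ij: "\<not> (i = ?a \<and> j = Suc ?a)"
        proof
          assume "i = ?a \<and> j = Suc ?a"
          then have "x = (Suc ?a, ?a)" by (simp add: x(1))
          then show False using False by contradiction
        qed
        then have lt: "?\<tau> i < ?\<tau> j" using x(3) unfolding adj_swap_def by auto
        then have mem: "?T x \<in> ?P" unfolding Tx using x(2) \<tau>n by simp
        have "(?\<tau> j, ?\<tau> i) \<noteq> (Suc ?a, ?a)" using x(3) by (auto simp: adj_swap_def split: if_splits)
        then have inv: "?T (?T x) = x" unfolding Tx by (auto simp: x(1))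
        have "(-1) ^ (?\<tau> i + ?\<tau> j) * \<omega> (brk (?Z ! i) (?Z ! j) # nths ?Z' (- {?\<tau> i, ?\<tau> j})) p =
            - ((-1) ^ (i + j) * \<omega> (brk (?Z ! i) (?Z ! j) # nths ?Z (- {i, j})) p)"
        proof (cases "?a \<in> {i, j} \<or> Suc ?a \<in> {i, j}")
          case True
          have n: "nths ?Z' (- {?\<tau> i, ?\<tau> j}) = nths ?Z (- {i, j})"
            unfolding \<tau>C by (rule nths_swap) (use True in auto)
          have "(-1 :: real) ^ (?\<tau> i + ?\<tau> j) = - ((-1) ^ (i + j))"
            using True ij x(3) by (auto simp: adj_swap_def)
          then show ?thesis unfolding n by simp
        next
          case False
          then have "?\<tau> i = i" "?\<tau> j = j" by (auto simp: adj_swap_def)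
          moreover have "\<omega> ([brk (?Z ! i) (?Z ! j)] @ nths ?Z' (- {i, j})) p = - \<omega> ([brk (?Z ! i) (?Z ! j)] @ nths ?Z (- {i, j})) p"
            by (rule both) (use False b in auto)
          ultimately show ?thesis by simp
        qed
        then have "?h ?Z' (?T x) = - ?h ?Z x" unfolding Tx by (simp only: x(1) prod.case nthZ)
        then show ?thesis using mem inv by blast
      qed
      then show "?T x \<in> ?P" "?T (?T x) = x" "?h ?Z' (?T x) = - ?h ?Z x" by blast+
    qed
    have bijP: "bij_betw ?T ?P ?P"
      by (rule bij_betw_byWitness[of _ ?T]) (use TP TT in blast)+
    have "(\<Sum>x\<in>?P. ?h ?Z' x) = (\<Sum>x\<in>?P. ?h ?Z' (?T x))"
      by (rule sum.reindex_bij_betw[OF bijP, symmetric])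
    also have "\<dots> = (\<Sum>x\<in>?P. - ?h ?Z x)" by (rule sum.cong[OF refl]) (rule h)
    finally have S2: "(\<Sum>x\<in>?P. ?h ?Z' x) = - (\<Sum>x\<in>?P. ?h ?Z x)" by (simp only: sum_negf)
    have d: "ext_d \<omega> W p = (\<Sum>i<?n. ?g W i) + (\<Sum>x\<in>?P. ?h W x)" if "set W \<subseteq> sections B" "length W = ?n" for W
    proof -
      have "(\<Sum>x\<in>?P. ?h W x) = (\<Sum>j<?n. \<Sum>i<j. (-1) ^ (i + j) * \<omega> (brk (W ! i) (W ! j) # nths W (- {i, j})) p)"
        by (rule sum.Sigma[symmetric]) auto
      then show ?thesis unfolding ext_d_def that(2) using that(1) by (simp only: if_True)
    qed
    have "ext_d \<omega> ?Z' p = (\<Sum>i<?n. ?g ?Z' i) + (\<Sum>x\<in>?P. ?h ?Z' x)" by (rule d[OF Z(2)]) simp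
    also have "\<dots> = - ((\<Sum>i<?n. ?g ?Z i) + (\<Sum>x\<in>?P. ?h ?Z x))" unfolding S1 S2 by simp
    also have "(\<Sum>i<?n. ?g ?Z i) + (\<Sum>x\<in>?P. ?h ?Z x) = ext_d \<omega> ?Z p" by (rule d[OF Z(1), symmetric]) simp
    finally show "ext_d \<omega> ?Z' p = - ext_d \<omega> ?Z p" .
  qed
qed

end

section \<open>Involutivity and closure under the differential\<close>

locale sub_algebroid = subvb B E + algebroid B Der brk \<sigma>
  for B E :: "('m::{t2_space, second_countable_topology}, 'e::euclidean_space, 'f, 'w::euclidean_space) vbundle"
    and Der brk \<sigma>
begin

lemma involutive_iff_differential:
  "(\<forall>S\<in>sections E. \<forall>T\<in>sections E. brk S T \<in> sections E) \<longleftrightarrow> (\<forall>\<omega>\<in>vanishing_forms. ext_d \<omega> \<in> vanishing_forms)"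
proof
  assume inv: "\<forall>S\<in>sections E. \<forall>T\<in>sections E. brk S T \<in> sections E"
  show "\<forall>\<omega>\<in>vanishing_forms. ext_d \<omega> \<in> vanishing_forms"
  proof
    fix \<omega> assume "\<omega> \<in> vanishing_forms"
    then have \<omega>: "alt_form B \<omega>" "\<And>us. set us \<subseteq> sections E \<Longrightarrow> \<omega> us = (\<lambda>_. 0)" unfolding vanishing_forms_def by auto
    have "ext_d \<omega> us p = 0" if us: "set us \<subseteq> sections E" for us p
    proof -
      have mem: "us ! i \<in> sections E" if "i < length us" for i using us nth_mem[OF that] by blast
      have sub: "set (nths us I) \<subseteq> sections E" for I using us set_nths_subset[of us I] by blast
      have "(\<Sum>i<length us. (-1) ^ i * Der (us ! i) (\<omega> (nths us (- {i}))) p) = 0"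
        by (rule sum.neutral) (use \<omega>(2)[OF sub] der_const sections_E[OF mem] in auto)
      moreover have "\<omega> (brk (us ! i) (us ! j) # nths us (- {i, j})) = (\<lambda>_. 0)" if "i < j" "j < length us" for i j
        by (rule \<omega>(2)) (use inv mem[of i] mem[of j] that sub in auto)
      then have "(\<Sum>j<length us. \<Sum>i<j. (-1) ^ (i + j) * \<omega> (brk (us ! i) (us ! j) # nths us (- {i, j})) p) = 0"
        by (intro sum.neutral ballI) auto
      ultimately show ?thesis by (simp add: ext_d_def)
    qed
    then show "ext_d \<omega> \<in> vanishing_forms"
      unfolding vanishing_forms_def using alt_form_ext_d[OF \<omega>(1)] by auto
  qed
next
  assume dv: "\<forall>\<omega>\<in>vanishing_forms. ext_d \<omega> \<in> vanishing_forms"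
  show "\<forall>S\<in>sections E. \<forall>T\<in>sections E. brk S T \<in> sections E"
  proof (intro ballI section_E_I ann_separates)
    fix S T assume S: "S \<in> sections E" and T: "T \<in> sections E"
    note SB = sections_E[OF S] and TB = sections_E[OF T]
    show b: "brk S T \<in> sections B" "brk S T \<in> sections B" by (rule brk_mem[OF SB TB])+
    fix x \<Omega> assume \<Omega>: "\<Omega> \<in> ann"
    have "one_form \<Omega> \<in> vanishing_forms"
      unfolding vanishing_forms_def
      using annihilator_ann(1)[OF one_form_ann[OF \<Omega>]] \<Omega> unfolding ann_def
      by (auto simp: one_form_def fun_eq_iff length_Suc_conv)
    then have "ext_d (one_form \<Omega>) [S, T] x = 0"
      using dv S T unfolding vanishing_forms_def by simp
    moreover have "ext_d (one_form \<Omega>) [S, T] x = Der S (\<Omega> T) x - Der T (\<Omega> S) x - \<Omega> (brk S T) x"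
      using ext_d_Cons[OF SB, of "[T]" "one_form \<Omega>" x] SB TB b by (simp add: one_form_def nths_Cons)
    moreover have "\<Omega> S = (\<lambda>_. 0)" "\<Omega> T = (\<lambda>_. 0)" using \<Omega> S T unfolding ann_def by auto
    ultimately show "\<Omega> (brk S T) x = 0" using der_const[OF SB, of 0 x] der_const[OF TB, of 0 x] by simp
  qed
qed

end

section \<open>The pull-back Lie algebroid\<close>

text \<open>Transition maps of the pull-back bundle are those of F with the base variable composed
  with h, so this supplies the smoothness axiom of the pull-back.\<close>

lemma smooth_fam_map:
  fixes M :: "('m::{t2_space, second_countable_topology}, 'e::euclidean_space) manifold"
    and N :: "('n::{t2_space, second_countable_topology}, 'd::euclidean_space) manifold"
    and g :: "'n \<Rightarrow> 'w::euclidean_space \<Rightarrow> 'v::real_normed_vector"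
  assumes M: "smooth_manifold M" and N: "smooth_manifold N" and h: "smooth_map M N h"
    and g: "smooth_fam_on N A W g"
  shows "smooth_fam_on M (h -` A) W (\<lambda>p w. g (h p) w)"
  unfolding smooth_fam_on_def smooth_on_def
proof (intro ballI)
  fix c z assume c: "c \<in> atlas M" and "z \<in> snd c ` (fst c \<inter> h -` A) \<times> W"
  then obtain p w where p: "p \<in> fst c" "h p \<in> A" "w \<in> W" "z = (snd c p, w)" by auto
  obtain c' where c': "c' \<in> atlas N" "h p \<in> fst c'" using manifold_chart_ex[OF N] .
  obtain O1 T where T: "open O1" "snd c p \<in> O1" "\<And>k. Ck_on k O1 T"
    "\<And>q. q \<in> fst c \<Longrightarrow> snd c q \<in> O1 \<Longrightarrow> h q \<in> fst c' \<and> snd c' (h q) = T (snd c q)"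
    by (rule smooth_map_local[OF M h c p(1) c' manifold_chart(1)[OF N c'(1)]]) (rule that)
  let ?S = "(snd c' ` (fst c' \<inter> A)) \<times> W"
  have "smooth_on ?S (\<lambda>(x, w). g (chart_inv c' x) w)"
    using g c' unfolding smooth_fam_on_def by blast
  moreover have "(snd c' (h p), w) \<in> ?S" using c' p by blast
  ultimately obtain V G where G: "open V" "(snd c' (h p), w) \<in> V" "\<And>k. Ck_on k V G"
      "\<And>y. y \<in> ?S \<Longrightarrow> y \<in> V \<Longrightarrow> (case y of (x, w) \<Rightarrow> g (chart_inv c' x) w) = G y"
    by (rule smooth_onE) (rule that)
  have op: "open (O1 \<times> (UNIV :: 'w set))" using T(1) by (simp add: open_Times)
  let ?\<Psi> = "\<lambda>z :: 'e \<times> 'w. (T (fst z), snd z)"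
  have fst: "Ck_on k (O1 \<times> (UNIV :: 'w set)) (\<lambda>z. fst z)" and snd: "Ck_on k (O1 \<times> (UNIV :: 'w set)) (\<lambda>z. snd z)" for k
    by (rule Ck_on_bounded_linear[OF bounded_linear_fst op Ck_on_ident[OF op]],
        rule Ck_on_bounded_linear[OF bounded_linear_snd op Ck_on_ident[OF op]])
  have "(\<lambda>z. fst z) ` (O1 \<times> (UNIV :: 'w set)) \<subseteq> O1" by auto
  from Ck_on_Pair[OF op Ck_on_compose[OF op T(1) this fst T(3)] snd]
  have \<Psi>: "Ck_on k (O1 \<times> (UNIV :: 'w set)) ?\<Psi>" for k .
  have "continuous_on (O1 \<times> UNIV) ?\<Psi>" using \<Psi>[of 0] by simp
  then have op2: "open (O1 \<times> UNIV \<inter> ?\<Psi> -` V)"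
    using op G(1) by (intro continuous_open_preimage)
  have sm: "Ck_on k (O1 \<times> UNIV \<inter> ?\<Psi> -` V) (\<lambda>z. G (?\<Psi> z))" for k
    by (rule Ck_on_compose[OF op2 G(1) _ Ck_on_subset[OF \<Psi>] G(3)]) auto
  have zin: "z \<in> O1 \<times> UNIV \<inter> ?\<Psi> -` V"
    using T(2,4) p G(2) by auto
  have eq: "(case y of (x, w) \<Rightarrow> g (h (chart_inv c x)) w) = G (?\<Psi> y)"
    if y: "y \<in> snd c ` (fst c \<inter> h -` A) \<times> W \<inter> (O1 \<times> UNIV \<inter> ?\<Psi> -` V)" for y
  proof -
    obtain q w' where q: "q \<in> fst c" "h q \<in> A" "w' \<in> W" "y = (snd c q, w')" "snd c q \<in> O1" using y by auto
    note Tq = T(4)[OF q(1,5)]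
    have "(snd c' (h q), w') \<in> ?S" using q Tq by blast
    moreover have "(snd c' (h q), w') \<in> V" using y q Tq by auto
    ultimately have "g (chart_inv c' (snd c' (h q))) w' = G (snd c' (h q), w')" using G(4) by fastforce
    moreover have "chart_inv c' (T (snd c q)) = h q"
      using chart_inv_chart[OF N c'(1) conjunct1[OF Tq]] Tq by simp
    ultimately show ?thesis using q Tq chart_inv_chart[OF M c q(1)] by simp
  qed
  show "\<exists>U g'. open U \<and> z \<in> U \<and> (\<forall>k. Ck_on k U g') \<and>
      (\<forall>y\<in>snd c ` (fst c \<inter> h -` A) \<times> W \<inter> U. (case y of (x, w) \<Rightarrow> g (h (chart_inv c x)) w) = g' y)"
    using op2 zin sm eq
    by (intro exI[of _ "O1 \<times> UNIV \<inter> ?\<Psi> -` V"] exI[of _ "\<lambda>z. G (?\<Psi> z)"] conjI allI ballI)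
qed

lemma smooth_fam_cong:
  assumes M: "smooth_manifold M" and "smooth_fam_on M A W g" "\<And>p w. p \<in> A \<Longrightarrow> w \<in> W \<Longrightarrow> g p w = g' p w"
  shows "smooth_fam_on M A W g'"
  unfolding smooth_fam_on_def
proof
  fix c assume c: "c \<in> atlas M"
  have sm: "smooth_on ((snd c ` (fst c \<inter> A)) \<times> W) (\<lambda>(x, w). g (chart_inv c x) w)"
    using assms(2) c unfolding smooth_fam_on_def by blast
  have eq: "(case y of (x, w) \<Rightarrow> g (chart_inv c x) w) = (case y of (x, w) \<Rightarrow> g' (chart_inv c x) w)"
    if "y \<in> (snd c ` (fst c \<inter> A)) \<times> W" for y
    using that assms(3) chart_inv_chart[OF M c] by auto
  show "smooth_on ((snd c ` (fst c \<inter> A)) \<times> W) (\<lambda>(x, w). g' (chart_inv c x) w)"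
    unfolding smooth_on_def
  proof
    fix z assume "z \<in> (snd c ` (fst c \<inter> A)) \<times> W"
    with sm obtain U G where U: "open U" "z \<in> U" "\<And>k. Ck_on k U G"
      "\<And>y. y \<in> (snd c ` (fst c \<inter> A)) \<times> W \<Longrightarrow> y \<in> U \<Longrightarrow> (case y of (x, w) \<Rightarrow> g (chart_inv c x) w) = G y"
      by (rule smooth_onE) (rule that)
    show "\<exists>U G. open U \<and> z \<in> U \<and> (\<forall>k. Ck_on k U G) \<and>
        (\<forall>y\<in>(snd c ` (fst c \<inter> A)) \<times> W \<inter> U. (case y of (x, w) \<Rightarrow> g' (chart_inv c x) w) = G y)"
      using U eq by (intro exI[of _ U] exI[of _ G]) auto
  qed
qed

locale gla =
  fixes M :: "('m::{t2_space, second_countable_topology}, 'e::euclidean_space) manifold"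
    and h :: "'m \<Rightarrow> 'n::{t2_space, second_countable_topology}"
    and F :: "('n, 'd::euclidean_space, 'f, 'w::euclidean_space) vbundle"
    and br :: "('n \<Rightarrow> 'f) \<Rightarrow> ('n \<Rightarrow> 'f) \<Rightarrow> ('n \<Rightarrow> 'f)"
    and \<rho> :: "'f \<Rightarrow> ('m, 'e) tvec"
    and \<eta> :: "'n \<Rightarrow> 'm"
  assumes gla: "generalized_lie_algebroid M h F br \<rho> \<eta>"
begin

abbreviation "N \<equiv> base F"
abbreviation "a \<equiv> gla_anchor M h F \<rho> \<eta>"
abbreviation "PB \<equiv> pullback_bundle M h F"

lemmas gla_def = gla[unfolded generalized_lie_algebroid_def Let_def]

lemma M_manifold: "smooth_manifold M" and N_manifold: "smooth_manifold N"
  and h_diffeo: "diffeomorphism M N h" and \<eta>_diffeo: "diffeomorphism N M \<eta>"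
  and F_bundle: "vector_bundle F" and \<rho>_morphism: "vb_morphism F (tangent_bundle M) \<rho> \<eta>"
  using gla_def by simp_all

lemma h_bij: "bij h" and \<eta>_bij: "bij \<eta>" and h_smooth: "smooth_map M N h" and h_inv_smooth: "smooth_map N M (inv h)"
  using h_diffeo \<eta>_diffeo unfolding diffeomorphism_def by simp_all

lemma inv_h [simp]: "inv h (h x) = x" "h (inv h y) = y"
  using h_bij by (simp_all add: bij_is_inj bij_is_surj surj_f_inv_f)

lemma \<eta>_inv [simp]: "\<eta> (inv \<eta> x) = x"
  using \<eta>_bij by (simp add: bij_is_surj surj_f_inv_f)

sublocale F: vb F
  using F_bundle by unfold_locales

lemma base_PB [simp]: "base PB = M" and fadd_PB: "fadd PB (x, b) (y, c) = (x, fadd F b c)"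
  and fscale_PB: "fscale PB r (x, b) = (x, fscale F r b)" and typical_PB: "typical PB = typical F"
  by (simp_all add: pullback_bundle_def)

lemma trivs_PB: "t' \<in> trivs PB \<longleftrightarrow> (\<exists>t\<in>trivs F. t' = (h -` fst t, snd t \<circ> snd))"
  by (auto simp: pullback_bundle_def image_iff split_beta)

lemma fibre_PB: "z \<in> fibre PB x \<longleftrightarrow> fst z = x \<and> snd z \<in> fibre F (h x)"
  by (auto simp: pullback_bundle_def fibre_def[of "pullback_bundle _ _ _"] split_beta) (auto simp: fibre_def)

lemma PB_inv:
  assumes t: "t \<in> trivs F" "h x \<in> fst t" and w: "w \<in> typical F"
  shows "bij_betw (snd t \<circ> snd) (fibre PB x) (typical F)"
    and "inv_into (fibre PB x) (snd t \<circ> snd) w = (x, inv_into (fibre F (h x)) (snd t) w)"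
proof -
  have "bij_betw snd (fibre PB x) (fibre F (h x))"
    by (rule bij_betwI[of _ _ _ "Pair x"]) (auto simp: fibre_PB)
  then show bij: "bij_betw (snd t \<circ> snd) (fibre PB x) (typical F)"
    using F.triv(2)[OF t] by (rule bij_betw_trans)
  show "inv_into (fibre PB x) (snd t \<circ> snd) w = (x, inv_into (fibre F (h x)) (snd t) w)"
    by (rule inv_into_f_eq[OF bij_betw_imp_inj_on[OF bij]])
      (use F.triv_inv(1,2)[OF t w] in \<open>auto simp: fibre_PB\<close>)
qed

lemma PB_bundle: "vector_bundle PB"
  unfolding vector_bundle_def typical_PB base_PB
proof (intro conjI)
  show "smooth_manifold M" by (rule M_manifold)
  show "subspace (typical F)" by (rule F.typical_subspace)
  show "\<forall>p. \<forall>a\<in>fibre PB p. \<forall>b\<in>fibre PB p. fadd PB a b \<in> fibre PB p"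
    by (auto simp: fibre_PB fadd_PB intro: F.fadd_fibre)
  show "\<forall>p r. \<forall>a\<in>fibre PB p. fscale PB r a \<in> fibre PB p"
    by (auto simp: fibre_PB fscale_PB intro: F.fscale_fibre)
  show "\<forall>(U, \<Phi>)\<in>trivs PB. open U \<and>
        (\<forall>p\<in>U. bij_betw \<Phi> (fibre PB p) (typical F) \<and>
           (\<forall>a\<in>fibre PB p. \<forall>b\<in>fibre PB p. \<Phi> (fadd PB a b) = \<Phi> a + \<Phi> b) \<and>
           (\<forall>r. \<forall>a\<in>fibre PB p. \<Phi> (fscale PB r a) = r *\<^sub>R \<Phi> a))"
  proof (rule ballI)
    fix s assume "s \<in> trivs PB"
    then obtain t where t: "t \<in> trivs F" "s = (h -` fst t, snd t \<circ> snd)" using trivs_PB by blast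
    have "continuous_on UNIV h" using h_smooth unfolding smooth_map_def by blast
    then have "open (h -` fst t)" using F.triv(1)[OF t(1)] by (rule open_vimage[rotated])
    moreover have "bij_betw (snd t \<circ> snd) (fibre PB p) (typical F)" if "p \<in> h -` fst t" for p
      by (rule PB_inv(1)[OF t(1) _ subspace_0[OF F.typical_subspace]]) (use that in simp)
    ultimately show "case s of (U, \<Phi>) \<Rightarrow> open U \<and>
        (\<forall>p\<in>U. bij_betw \<Phi> (fibre PB p) (typical F) \<and>
           (\<forall>a\<in>fibre PB p. \<forall>b\<in>fibre PB p. \<Phi> (fadd PB a b) = \<Phi> a + \<Phi> b) \<and>
           (\<forall>r. \<forall>a\<in>fibre PB p. \<Phi> (fscale PB r a) = r *\<^sub>R \<Phi> a))"
      unfolding t(2) using F.triv(3,4)[OF t(1)] by (auto simp: fibre_PB fadd_PB fscale_PB)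
  qed
  show "\<forall>p. \<exists>(U, \<Phi>)\<in>trivs PB. p \<in> U"
  proof
    fix p
    obtain t where t: "t \<in> trivs F" "h p \<in> fst t" using F.triv_ex[of "h p"] .
    then show "\<exists>(U, \<Phi>)\<in>trivs PB. p \<in> U"
      by (intro bexI[of _ "(h -` fst t, snd t \<circ> snd)"]) (auto simp: trivs_PB)
  qed
  show "\<forall>(U, \<Phi>)\<in>trivs PB. \<forall>(U', \<Phi>')\<in>trivs PB.
        smooth_fam_on M (U \<inter> U') (typical F) (\<lambda>p w. \<Phi>' (inv_into (fibre PB p) \<Phi> w))"
  proof (rule ballI)
    fix s assume "s \<in> trivs PB"
    then obtain t where t: "t \<in> trivs F" "s = (h -` fst t, snd t \<circ> snd)" using trivs_PB by blast
    show "case s of (U, \<Phi>) \<Rightarrow> \<forall>(U', \<Phi>')\<in>trivs PB.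
        smooth_fam_on M (U \<inter> U') (typical F) (\<lambda>p w. \<Phi>' (inv_into (fibre PB p) \<Phi> w))"
      unfolding t(2) prod.case
    proof (rule ballI)
      fix s' assume "s' \<in> trivs PB"
      then obtain t' where t': "t' \<in> trivs F" "s' = (h -` fst t', snd t' \<circ> snd)" using trivs_PB by blast
      have "smooth_fam_on M (h -` (fst t \<inter> fst t')) (typical F) (\<lambda>p w. snd t' (inv_into (fibre F (h p)) (snd t) w))"
        by (rule smooth_fam_map[OF M_manifold N_manifold h_smooth F.triv_trans[OF t(1) t'(1)]])
      then have "smooth_fam_on M (h -` (fst t \<inter> fst t')) (typical F)
          (\<lambda>p w. (snd t' \<circ> snd) (inv_into (fibre PB p) (snd t \<circ> snd) w))"
        by (rule smooth_fam_cong[OF M_manifold]) (use PB_inv(2)[OF t(1)] in auto)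
      then show "case s' of (U', \<Phi>') \<Rightarrow>
          smooth_fam_on M (h -` fst t \<inter> U') (typical F) (\<lambda>p w. \<Phi>' (inv_into (fibre PB p) (snd t \<circ> snd) w))"
        unfolding t'(2) by (simp add: vimage_Int)
    qed
  qed
qed

sublocale B: vb PB
  using PB_bundle by unfold_locales

section \<open>Transport of sections, bracket and anchor along the base diffeomorphism\<close>

lemma pb_section_mem:
  assumes z: "z \<in> sections F" shows "pb_section h z \<in> sections PB"
proof (rule B.sectionI)
  show "pb_section h z q \<in> fibre PB q" for q
    using F.section_fibre[OF z] by (simp add: fibre_PB pb_section_def)
  fix p
  obtain t where t: "t \<in> trivs F" "h p \<in> fst t" using F.triv_ex[of "h p"] .
  have "smooth_at M p (\<lambda>q. snd t (z (h q)))"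
    by (rule smooth_at_map[OF M_manifold N_manifold h_smooth F.section_smooth[OF z t]])
  then show "\<exists>s\<in>trivs PB. p \<in> fst s \<and> smooth_at (base PB) p (\<lambda>q. snd s (pb_section h z q))"
    using t by (intro bexI[of _ "(h -` fst t, snd t \<circ> snd)"]) (auto simp: trivs_PB pb_section_def)
qed

lemma unpb_section_mem:
  assumes Z: "Z \<in> sections PB" shows "unpb_section h Z \<in> sections F"
proof (rule F.sectionI)
  show "unpb_section h Z q \<in> fibre F q" for q
    using B.section_fibre[OF Z, of "inv h q"] by (simp add: fibre_PB unpb_section_def)
  fix y
  obtain t where t: "t \<in> trivs F" "y \<in> fst t" using F.triv_ex[of y] .
  have "(h -` fst t, snd t \<circ> snd) \<in> trivs PB" using t by (auto simp: trivs_PB)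
  from B.section_smooth[OF Z this, of "inv h y"] t(2)
  have "smooth_at M (inv h y) (\<lambda>q. snd t (snd (Z q)))" by simp
  then have "smooth_at N y (\<lambda>q. snd t (snd (Z (inv h q))))"
    by (rule smooth_at_map[OF N_manifold M_manifold h_inv_smooth])
  then show "\<exists>s\<in>trivs F. y \<in> fst s \<and> smooth_at N y (\<lambda>q. snd s (unpb_section h Z q))"
    using t by (auto simp: unpb_section_def)
qed

lemma pb_unpb: "Z \<in> sections PB \<Longrightarrow> pb_section h (unpb_section h Z) = Z"
  using B.section_fibre by (auto simp: pb_section_def unpb_section_def fun_eq_iff fibre_PB prod_eq_iff)

lemma unpb_add: "unpb_section h (sec_add PB X Y) = sec_add F (unpb_section h X) (unpb_section h Y)"
  and unpb_mult: "unpb_section h (sec_mult PB f X) = sec_mult F (\<lambda>y. f (inv h y)) (unpb_section h X)"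
  by (simp_all add: unpb_section_def sec_add_def sec_mult_def pullback_bundle_def split_beta)

lemma pb_add: "pb_section h (sec_add F u v) = sec_add PB (pb_section h u) (pb_section h v)"
  and pb_mult: "pb_section h (sec_mult F g u) = sec_mult PB (\<lambda>x. g (h x)) (pb_section h u)"
  by (simp_all add: pb_section_def sec_add_def sec_mult_def pullback_bundle_def)

lemma \<rho>_fibre: "b \<in> fibre F y \<Longrightarrow> \<rho> b \<in> fibre (tangent_bundle M) (\<eta> y)"
  and \<rho>_add: "b \<in> fibre F y \<Longrightarrow> c \<in> fibre F y \<Longrightarrow> \<rho> (fadd F b c) = fadd (tangent_bundle M) (\<rho> b) (\<rho> c)"
  and \<rho>_scale: "b \<in> fibre F y \<Longrightarrow> \<rho> (fscale F r b) = fscale (tangent_bundle M) r (\<rho> b)"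
proof -
  note m = \<rho>_morphism[unfolded vb_morphism_def]
  have "\<forall>p. \<forall>a\<in>fibre F p. \<rho> a \<in> fibre (tangent_bundle M) (\<eta> p)" using m by (elim conjE)
  then show "b \<in> fibre F y \<Longrightarrow> \<rho> b \<in> fibre (tangent_bundle M) (\<eta> y)" by simp
  have "\<forall>p. \<forall>a\<in>fibre F p. \<forall>b\<in>fibre F p. \<rho> (fadd F a b) = fadd (tangent_bundle M) (\<rho> a) (\<rho> b)" using m by (elim conjE)
  then show "b \<in> fibre F y \<Longrightarrow> c \<in> fibre F y \<Longrightarrow> \<rho> (fadd F b c) = fadd (tangent_bundle M) (\<rho> b) (\<rho> c)" by blast
  have "\<forall>p. \<forall>r. \<forall>a\<in>fibre F p. \<rho> (fscale F r a) = fscale (tangent_bundle M) r (\<rho> a)" using m by (elim conjE)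
  then show "b \<in> fibre F y \<Longrightarrow> \<rho> (fscale F r b) = fscale (tangent_bundle M) r (\<rho> b)" by blast
qed

text \<open>Unfolding \<open>unpb_section\<close> shows that at x the section Z is read at the image
  of x under the inverses of \<eta> and then h. This is the origin of the displacement
  \<sigma>.\<close>

lemma pb_anchor_eq: "pb_anchor h \<rho> \<eta> Z x = \<rho> (unpb_section h Z (inv \<eta> x))"
  by (simp add: pb_anchor_def sec_map_def)

lemma pb_anchor_fibre:
  assumes "Z \<in> sections PB" shows "pb_anchor h \<rho> \<eta> Z x \<in> fibre (tangent_bundle M) x"
  using \<rho>_fibre[OF F.section_fibre[OF unpb_section_mem[OF assms]], of "inv \<eta> x"] by (simp add: pb_anchor_eq)

text \<open>The inverse of the composite of h and \<eta> sends h x to the \<eta>-preimage of x, so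
  both sides apply \<rho> to the same vector. The two anchors are therefore h-related.\<close>

lemma anchor_related: "a (unpb_section h Z) (h x) = tangent_map M N h (pb_anchor h \<rho> \<eta> Z x)"
proof -
  have "inv (h \<circ> \<eta>) = inv \<eta> \<circ> inv h" by (rule o_inv_distrib[OF h_bij \<eta>_bij])
  then show ?thesis by (simp add: gla_anchor_def sec_map_def pb_anchor_eq)
qed

lemma anchor_section: "u \<in> sections F \<Longrightarrow> a u \<in> sections (tangent_bundle N)"
  using gla_def by simp

lemma br_mem: "u \<in> sections F \<Longrightarrow> v \<in> sections F \<Longrightarrow> br u v \<in> sections F"
  and br_add_left: "u \<in> sections F \<Longrightarrow> v \<in> sections F \<Longrightarrow> w \<in> sections F \<Longrightarrow>
      br (sec_add F u v) w = sec_add F (br u w) (br v w)"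
  and br_add_right: "u \<in> sections F \<Longrightarrow> v \<in> sections F \<Longrightarrow> w \<in> sections F \<Longrightarrow>
      br w (sec_add F u v) = sec_add F (br w u) (br w v)"
  and br_self: "u \<in> sections F \<Longrightarrow> br u u = sec_zero F"
proof -
  have L: "lie_algebra_of_sections F br" using gla_def by simp
  note L' = L[unfolded lie_algebra_of_sections_def]
  show "u \<in> sections F \<Longrightarrow> v \<in> sections F \<Longrightarrow> br u v \<in> sections F"
    "u \<in> sections F \<Longrightarrow> v \<in> sections F \<Longrightarrow> w \<in> sections F \<Longrightarrow> br (sec_add F u v) w = sec_add F (br u w) (br v w)"
    "u \<in> sections F \<Longrightarrow> v \<in> sections F \<Longrightarrow> w \<in> sections F \<Longrightarrow> br w (sec_add F u v) = sec_add F (br w u) (br w v)"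
    "u \<in> sections F \<Longrightarrow> br u u = sec_zero F"
    using L' by (elim conjE, simp)+
qed

lemma br_leibniz:
  "u \<in> sections F \<Longrightarrow> v \<in> sections F \<Longrightarrow> (\<And>y. smooth_at N y f) \<Longrightarrow>
    br u (sec_mult F f v) = sec_add F (sec_mult F f (br u v)) (sec_mult F (vf_apply N (a u) f) v)"
proof -
  have "\<forall>u\<in>sections F. \<forall>v\<in>sections F. \<forall>f\<in>smooth_functions N.
      br u (sec_mult F f v) = sec_add F (sec_mult F f (br u v)) (sec_mult F (vf_apply N (a u) f) v)"
    using gla_def by (elim conjE)
  then show "u \<in> sections F \<Longrightarrow> v \<in> sections F \<Longrightarrow> (\<And>y. smooth_at N y f) \<Longrightarrow>
    br u (sec_mult F f v) = sec_add F (sec_mult F f (br u v)) (sec_mult F (vf_apply N (a u) f) v)"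
    by (simp add: smooth_functions_iff[OF N_manifold])
qed

text \<open>Polarization of [u + v, u + v] = 0, carried out in fibre coordinates.\<close>

lemma br_anti:
  assumes u: "u \<in> sections F" and v: "v \<in> sections F"
  shows "br v u = sec_mult F (\<lambda>_. -1) (br u v)"
proof (rule F.section_eqI[OF br_mem[OF v u] F.sec_mult_mem[OF br_mem[OF u v] smooth_at_const[OF N_manifold]]])
  fix p
  have uv: "sec_add F u v \<in> sections F" by (rule F.sec_add_mem[OF u v])
  have "sec_zero F = sec_add F (sec_add F (br u u) (br u v)) (sec_add F (br v u) (br v v))"
    using br_self[OF uv] by (simp add: br_add_left[OF u v uv] br_add_right[OF u v u] br_add_right[OF u v v])
  then have "frep F p (sec_zero F p) = frep F p (sec_add F (sec_add F (br u u) (br u v)) (sec_add F (br v u) (br v v)) p)"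
    by simp
  also have "\<dots> = frep F p (br u v p) + frep F p (br v u p)"
    using u v by (simp add: F.frep_sec_add F.sec_add_mem br_mem br_self F.sec_zero_mem F.frep_zero)
  finally have "frep F p (br u v p) + frep F p (br v u p) = 0" by (simp add: F.frep_zero)
  then show "frep F p (br v u p) = frep F p (sec_mult F (\<lambda>_. -1) (br u v) p)"
    using u v by (simp add: F.frep_sec_mult br_mem eq_neg_iff_add_eq_0 add.commute)
qed

lemma smooth_inv_h: "(\<And>q. smooth_at M q f) \<Longrightarrow> smooth_at N y (\<lambda>y. f (inv h y))"
  by (rule smooth_at_map[OF N_manifold M_manifold h_inv_smooth])

text \<open>The Leibniz rule of the generalized algebroid differentiates functions on N along vector
  fields on N; relatedness of the anchors converts this into derivatives on M along the pull-back
  anchor.\<close>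

lemma anchor_apply:
  assumes Z: "Z \<in> sections PB" and f: "\<And>q. smooth_at M q f"
  shows "vf_apply N (a (unpb_section h Z)) (\<lambda>y. f (inv h y)) (h x) = vf_apply M (pb_anchor h \<rho> \<eta> Z) f x"
proof -
  have "a (unpb_section h Z) (h x) \<in> fibre (tangent_bundle N) (h x)"
    using anchor_section[OF unpb_section_mem[OF Z]] unfolding sections_def by blast
  from vf_apply_map[where X = "pb_anchor h \<rho> \<eta> Z" and p = x and Y = "a (unpb_section h Z)" and g = "\<lambda>y. f (inv h y)",
      OF M_manifold N_manifold h_smooth pb_anchor_fibre[OF Z] this anchor_related smooth_inv_h[OF f]]
  show ?thesis by simp
qed

text \<open>Smoothness of derivatives and the Leibniz rule are pulled over from N. Sum and product
  rules hold pointwise, since anchor values are tangent vectors, and fibrewise linearity of \<rho>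
  gives additivity and the twisted rule in the section.\<close>

sublocale alg: algebroid PB "\<lambda>Z. vf_apply M (pb_anchor h \<rho> \<eta> Z)" "pb_bracket h br" "\<lambda>x. inv h (inv \<eta> x)"
proof
  note [simp] = base_PB
  fix X Y Z :: "'m \<Rightarrow> 'm \<times> 'f" and f g :: "'m \<Rightarrow> real" and p c
  {
    assume Z: "Z \<in> sections PB" and "\<And>q. smooth_at (base PB) q f"
    then have f: "\<And>q. smooth_at M q f" by simp
    have "smooth_at M p (\<lambda>x. vf_apply N (a (unpb_section h Z)) (\<lambda>y. f (inv h y)) (h x))"
      by (rule smooth_at_map[OF M_manifold N_manifold h_smooth
            vf_apply_smooth[OF N_manifold anchor_section[OF unpb_section_mem[OF Z]] smooth_inv_h[OF f]]])
    then show "smooth_at (base PB) p (vf_apply M (pb_anchor h \<rho> \<eta> Z) f)"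
      by (simp add: anchor_apply[OF Z f])
    assume "\<And>q. smooth_at (base PB) q g"
    then have g: "\<And>q. smooth_at M q g" by simp
    show "vf_apply M (pb_anchor h \<rho> \<eta> Z) (\<lambda>q. f q + g q) p =
        vf_apply M (pb_anchor h \<rho> \<eta> Z) f p + vf_apply M (pb_anchor h \<rho> \<eta> Z) g p"
      by (rule vf_apply_add(1)[where X = "pb_anchor h \<rho> \<eta> Z" and p = p, OF M_manifold pb_anchor_fibre[OF Z] f g])
    show "vf_apply M (pb_anchor h \<rho> \<eta> Z) (\<lambda>q. f q * g q) p =
        f p * vf_apply M (pb_anchor h \<rho> \<eta> Z) g p + vf_apply M (pb_anchor h \<rho> \<eta> Z) f p * g p"
      by (rule vf_apply_add(2)[where X = "pb_anchor h \<rho> \<eta> Z" and p = p, OF M_manifold pb_anchor_fibre[OF Z] f g])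
  }
  show "Z \<in> sections PB \<Longrightarrow> vf_apply M (pb_anchor h \<rho> \<eta> Z) (\<lambda>_. c) p = 0"
    by (rule vf_apply_const[where X = "pb_anchor h \<rho> \<eta> Z" and p = p, OF M_manifold pb_anchor_fibre])
  {
    assume X: "X \<in> sections PB" and "\<And>q. smooth_at (base PB) q f"
    then have f: "\<And>q. smooth_at M q f" by simp
    note uX = F.section_fibre[OF unpb_section_mem[OF X]]
    {
      assume Y: "Y \<in> sections PB"
      note uY = F.section_fibre[OF unpb_section_mem[OF Y]]
      have XY: "sec_add PB X Y \<in> sections PB" by (rule B.sec_add_mem[OF X Y])
      show "vf_apply M (pb_anchor h \<rho> \<eta> (sec_add PB X Y)) f p =
          vf_apply M (pb_anchor h \<rho> \<eta> X) f p + vf_apply M (pb_anchor h \<rho> \<eta> Y) f p"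
        by (rule vf_apply_field_add(1)[where X = "pb_anchor h \<rho> \<eta> X" and Y = "pb_anchor h \<rho> \<eta> Y"
              and Z = "pb_anchor h \<rho> \<eta> (sec_add PB X Y)" and p = p,
              OF M_manifold pb_anchor_fibre[OF X] pb_anchor_fibre[OF Y] pb_anchor_fibre[OF XY] f])
          (unfold pb_anchor_eq unpb_add, simp add: sec_add_def \<rho>_add[OF uX uY])
      have "pb_bracket h br X (sec_mult PB f Y) = pb_section h
          (sec_add F (sec_mult F (\<lambda>y. f (inv h y)) (br (unpb_section h X) (unpb_section h Y)))
            (sec_mult F (vf_apply N (a (unpb_section h X)) (\<lambda>y. f (inv h y))) (unpb_section h Y)))"
        unfolding pb_bracket_def unpb_mult
          br_leibniz[OF unpb_section_mem[OF X] unpb_section_mem[OF Y] smooth_inv_h[OF f]] ..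
      then show "pb_bracket h br X (sec_mult PB f Y) =
          sec_add PB (sec_mult PB f (pb_bracket h br X Y)) (sec_mult PB (vf_apply M (pb_anchor h \<rho> \<eta> X) f) Y)"
        by (simp add: pb_add pb_mult anchor_apply[OF X f] pb_unpb[OF Y] pb_bracket_def)
    }
    assume "\<And>q. smooth_at (base PB) q g"
    then have g: "\<And>q. smooth_at (base PB) q g" .
    have gX: "sec_mult PB g X \<in> sections PB" by (rule B.sec_mult_mem[OF X g])
    show "vf_apply M (pb_anchor h \<rho> \<eta> (sec_mult PB g X)) f p =
        g (inv h (inv \<eta> p)) * vf_apply M (pb_anchor h \<rho> \<eta> X) f p"
      by (rule vf_apply_field_add(2)[where X = "pb_anchor h \<rho> \<eta> X" and Y = "pb_anchor h \<rho> \<eta> X"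
            and Z = "pb_anchor h \<rho> \<eta> (sec_mult PB g X)" and p = p,
            OF M_manifold pb_anchor_fibre[OF X] pb_anchor_fibre[OF X] pb_anchor_fibre[OF gX] f])
        (unfold pb_anchor_eq unpb_mult, simp add: sec_mult_def \<rho>_scale[OF uX])
  }
  {
    assume X: "X \<in> sections PB" and Y: "Y \<in> sections PB"
    show "pb_bracket h br X Y \<in> sections PB"
      unfolding pb_bracket_def by (intro pb_section_mem br_mem unpb_section_mem X Y)
    show "pb_bracket h br Y X = sec_mult PB (\<lambda>_. -1) (pb_bracket h br X Y)"
      unfolding pb_bracket_def br_anti[OF unpb_section_mem[OF X] unpb_section_mem[OF Y]] pb_mult ..
    assume Z: "Z \<in> sections PB"
    show "pb_bracket h br X (sec_add PB Y Z) = sec_add PB (pb_bracket h br X Y) (pb_bracket h br X Z)"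
      unfolding pb_bracket_def unpb_add
        br_add_right[OF unpb_section_mem[OF Y] unpb_section_mem[OF Z] unpb_section_mem[OF X]] pb_add ..
  }
qed

lemma ext_diff_eq: "ext_diff M h F br \<rho> \<eta> \<omega> = alg.ext_d \<omega>"
  unfolding ext_diff_def alg.ext_d_def ..

end

theorem theorem5p1:
  fixes M :: "('m::{t2_space, second_countable_topology}, 'e::euclidean_space) manifold"
    and h :: "'m \<Rightarrow> 'n::{t2_space, second_countable_topology}"
    and F :: "('n, 'd::euclidean_space, 'f, 'w::euclidean_space) vbundle"
    and br :: "('n \<Rightarrow> 'f) \<Rightarrow> ('n \<Rightarrow> 'f) \<Rightarrow> ('n \<Rightarrow> 'f)"
    and \<rho> :: "'f \<Rightarrow> ('m, 'e) tvec"
    and \<eta> :: "'n \<Rightarrow> 'm"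
    and E :: "('m, 'e, 'm \<times> 'f, 'w) vbundle"
  assumes "generalized_lie_algebroid M h F br \<rho> \<eta>"
    and "interior_ds M h F E"
  shows "involutive h br E \<longleftrightarrow>
    exterior_ds M h F br \<rho> \<eta>
      (ideal_generated (pullback_bundle M h F)
        (annihilator_sections (pullback_bundle M h F) E))"
proof -
  interpret gla M h F br \<rho> \<eta> by unfold_locales (rule assms(1))
  interpret S: sub_algebroid "pullback_bundle M h F" E "\<lambda>Z. vf_apply M (pb_anchor h \<rho> \<eta> Z)" "pb_bracket h br"
    "\<lambda>x. inv h (inv \<eta> x)"
    by unfold_locales (use assms(2) in \<open>simp add: interior_ds_def\<close>)
  have I: "ideal_generated (pullback_bundle M h F) (annihilator_sections (pullback_bundle M h F) E) = S.vanishing_forms"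
    by (rule S.ideal_generated_annihilator)
  have "involutive h br E \<longleftrightarrow> (\<forall>\<omega>\<in>S.vanishing_forms. ext_diff M h F br \<rho> \<eta> \<omega> \<in> S.vanishing_forms)"
    unfolding involutive_def ext_diff_eq by (rule S.involutive_iff_differential)
  \<comment> \<open>E itself is the interior differential system required of an EDS, since the forms
    in question vanish on its sections by definition.\<close>
  also have "\<dots> \<longleftrightarrow> exterior_ds M h F br \<rho> \<eta> S.vanishing_forms"
    unfolding exterior_ds_def differential_ideal_def
    using S.vanishing_forms_ideal assms(2) unfolding S.vanishing_forms_def by auto
  finally show ?thesis unfolding I .
qed

end
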